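(* The reduced spherical scissors congruence $K$-theory groups $$\widetilde K_{2n}\big(\mathcal{P}^{S^{2k+1}}_{O(2k+2)}\big)$$ are nonzero for all nonnegative integers $n$ and $k$.
   Context: For a finite-dimensional real vector space $V$, $\Sigma\mathrm{ST}(V)=|\{0\subseteq U\subseteq V\}|/(|\{0\subseteq U\subsetneq V\}|\cup|\{0\subsetneq U\subseteq V\}|)$, where $|\cdot|$ is geometric realization of posets of linear subspaces of $V$. For an inner product space $V$, $\mathbb{S}^{-V}=F_VS^0$ is the free orthogonal spectrum on $S^0$ at level $V$, with $O(V)$ acting on the left by inverting and using the natural right action. Orthogonal groups are discrete. The reduced spherical scissors congruence $K$-theory spectrum is $$\widetilde K(\mathcal{P}^{S^{d-1}}_{O(d)})\simeq\big(\mathbb{S}^{-\mathbb{R}^d}\wedge\Sigma\mathrm{ST}(\mathbb{R}^d)\big)_{hO(d)}$$ (homotopy orbits; an equivalence due to Malkiewich, which may be taken as the definition), and $\widetilde K_m=\pi_m$ of this spectrum. *)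

theory Defs
  imports "HOL-Analysis.Analysis" "HOL-Algebra.Group" "HOL-Library.Function_Algebras"
begin

(* Conventions.

   A pointed space is a topology on an option type with base point None; the remaining points
   are Some x.  This matches Alexandroff_compactification, so one-point compactifications are
   pointed spaces.  Maps of pointed spaces that reflect the base point (all the group actions
   below) are given by functions on the underlying type and extended by map_option.

   R^n is the subspace topspace (Euclidean_space n) of nat => real, so that R^n is literally
   contained in R^(n+1).  Products and smash products are formed in k-spaces (kification). *)

section \<open>Linear algebra in Euclidean space\<close>

interpretation real_fun: vector_space "\<lambda>(c::real) (x::nat \<Rightarrow> real). (\<lambda>i. c * x i)"
  by unfold_locales (auto simp: algebra_simps fun_eq_iff)

abbreviation Rn :: "nat \<Rightarrow> (nat \<Rightarrow> real) set"
  where "Rn n \<equiv> topspace (Euclidean_space n)"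

definition dot :: "nat \<Rightarrow> (nat \<Rightarrow> real) \<Rightarrow> (nat \<Rightarrow> real) \<Rightarrow> real"
  where "dot n x y = (\<Sum>i<n. x i * y i)"

definition linear_isometries :: "nat \<Rightarrow> nat \<Rightarrow> ((nat \<Rightarrow> real) \<Rightarrow> (nat \<Rightarrow> real)) set"
  where "linear_isometries d n =
    {\<phi> \<in> Rn d \<rightarrow>\<^sub>E Rn n.
       (\<forall>x\<in>Rn d. \<forall>y\<in>Rn d. \<phi> (x + y) = \<phi> x + \<phi> y) \<and>
       (\<forall>x\<in>Rn d. \<forall>c. \<phi> (\<lambda>i. c * x i) = (\<lambda>i. c * \<phi> x i)) \<and>
       (\<forall>x\<in>Rn d. \<forall>y\<in>Rn d. dot n (\<phi> x) (\<phi> y) = dot d x y)}"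

definition orthogonal_group :: "nat \<Rightarrow> ((nat \<Rightarrow> real) \<Rightarrow> (nat \<Rightarrow> real)) monoid"
  where "orthogonal_group d =
    \<lparr>carrier = {g \<in> linear_isometries d d. bij_betw g (Rn d) (Rn d)},
     mult = compose (Rn d), one = restrict id (Rn d)\<rparr>"

lemma group_orthogonal_group: "group (orthogonal_group d)"
proof (rule groupI)
  have add_closed: "x + y \<in> Rn d" if "x \<in> Rn d" "y \<in> Rn d" for x y
    using that by (simp add: topspace_Euclidean_space)
  have scale_closed: "(\<lambda>i. c * x i) \<in> Rn d" if "x \<in> Rn d" for x and c :: real
    using that by (simp add: topspace_Euclidean_space)
  fix f g h
  assume f: "f \<in> carrier (orthogonal_group d)"
  note fD = f[unfolded orthogonal_group_def linear_isometries_def, simplified]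
  have fR: "f x \<in> Rn d" if "x \<in> Rn d" for x using fD that by (auto simp: PiE_def)
  show "\<one>\<^bsub>orthogonal_group d\<^esub> \<otimes>\<^bsub>orthogonal_group d\<^esub> f = f"
  proof
    fix x show "(\<one>\<^bsub>orthogonal_group d\<^esub> \<otimes>\<^bsub>orthogonal_group d\<^esub> f) x = f x"
      using fD fR by (cases "x \<in> Rn d")
        (auto simp: orthogonal_group_def compose_def PiE_def extensional_def)
  qed
  show "\<exists>k\<in>carrier (orthogonal_group d). k \<otimes>\<^bsub>orthogonal_group d\<^esub> f = \<one>\<^bsub>orthogonal_group d\<^esub>"
  proof (rule bexI)
    define k where "k = restrict (inv_into (Rn d) f) (Rn d)"
    have bij: "bij_betw f (Rn d) (Rn d)" using fD by blast
    have kf: "k (f x) = x" if "x \<in> Rn d" for x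
      using that fR bij by (simp add: k_def bij_betw_def)
    have kR: "k x \<in> Rn d" and fk: "f (k x) = x" if "x \<in> Rn d" for x
      using that bij by (auto simp: k_def bij_betw_def inv_into_into f_inv_into_f)
    show "k \<otimes>\<^bsub>orthogonal_group d\<^esub> f = \<one>\<^bsub>orthogonal_group d\<^esub>"
      using kf by (auto simp: orthogonal_group_def compose_def fun_eq_iff)
    have "k (x + y) = k x + k y" if "x \<in> Rn d" "y \<in> Rn d" for x y
    proof -
      have "f (k x + k y) = x + y" using fD kR fk that by simp
      then show ?thesis using kf add_closed kR that by metis
    qed
    moreover have "k (\<lambda>i. c * x i) = (\<lambda>i. c * k x i)" if "x \<in> Rn d" for x c
    proof -
      have "f (\<lambda>i. c * k x i) = (\<lambda>i. c * x i)" using fD kR fk that by simp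
      then show ?thesis using kf scale_closed kR that by metis
    qed
    moreover have "dot d (k x) (k y) = dot d x y" if "x \<in> Rn d" "y \<in> Rn d" for x y
      using fD kR fk that by metis
    moreover have "k \<in> Rn d \<rightarrow>\<^sub>E Rn d" using kR by (auto simp: k_def PiE_def)
    moreover have "bij_betw k (Rn d) (Rn d)"
      using bij_betw_inv_into[OF bij] by (simp add: k_def cong: bij_betw_cong)
    ultimately show "k \<in> carrier (orthogonal_group d)"
      unfolding orthogonal_group_def linear_isometries_def by simp
  qed
  assume g: "g \<in> carrier (orthogonal_group d)"
  note gD = g[unfolded orthogonal_group_def linear_isometries_def, simplified]
  have gR: "g x \<in> Rn d" if "x \<in> Rn d" for x using gD that by (auto simp: PiE_def)
  have "bij_betw (compose (Rn d) f g) (Rn d) (Rn d)"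
    using fD gD by (blast intro: bij_betw_compose)
  then show "f \<otimes>\<^bsub>orthogonal_group d\<^esub> g \<in> carrier (orthogonal_group d)"
    using fD gD gR fR
    by (simp add: orthogonal_group_def linear_isometries_def compose_def PiE_def
        add_closed scale_closed)
  assume h: "h \<in> carrier (orthogonal_group d)"
  have hR: "h x \<in> Rn d" if "x \<in> Rn d" for x
    using h that by (auto simp: orthogonal_group_def linear_isometries_def PiE_def)
  show "f \<otimes>\<^bsub>orthogonal_group d\<^esub> g \<otimes>\<^bsub>orthogonal_group d\<^esub> h
      = f \<otimes>\<^bsub>orthogonal_group d\<^esub> (g \<otimes>\<^bsub>orthogonal_group d\<^esub> h)"
    using hR by (auto simp: orthogonal_group_def compose_def fun_eq_iff)
next
  show "\<one>\<^bsub>orthogonal_group d\<^esub> \<in> carrier (orthogonal_group d)"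
    by (auto simp: orthogonal_group_def linear_isometries_def topspace_Euclidean_space bij_betw_def
        inj_on_def)
qed


section \<open>Point-set constructions\<close>

definition coinduced_topology :: "'b set \<Rightarrow> 'a topology \<Rightarrow> ('a \<Rightarrow> 'b) \<Rightarrow> 'b topology"
  where "coinduced_topology S X f =
    topology (\<lambda>U. U \<subseteq> S \<and> openin X {x \<in> topspace X. f x \<in> U})"

lemma openin_coinduced_topology:
  "openin (coinduced_topology S X f) U \<longleftrightarrow> U \<subseteq> S \<and> openin X {x \<in> topspace X. f x \<in> U}"
proof -
  have "istopology (\<lambda>U. U \<subseteq> S \<and> openin X {x \<in> topspace X. f x \<in> U})"
    unfolding istopology_def
  proof (intro conjI allI impI)
    fix A B assume "A \<subseteq> S \<and> openin X {x \<in> topspace X. f x \<in> A}"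
      and "B \<subseteq> S \<and> openin X {x \<in> topspace X. f x \<in> B}"
    moreover have "{x \<in> topspace X. f x \<in> A \<inter> B}
        = {x \<in> topspace X. f x \<in> A} \<inter> {x \<in> topspace X. f x \<in> B}" by auto
    ultimately show "A \<inter> B \<subseteq> S" "openin X {x \<in> topspace X. f x \<in> A \<inter> B}" by auto
  next
    fix K assume *: "\<forall>U\<in>K. U \<subseteq> S \<and> openin X {x \<in> topspace X. f x \<in> U}"
    then show "\<Union>K \<subseteq> S" by auto
    have "{x \<in> topspace X. f x \<in> \<Union>K} = (\<Union>U\<in>K. {x \<in> topspace X. f x \<in> U})" by auto
    then show "openin X {x \<in> topspace X. f x \<in> \<Union>K}" using * by auto
  qed
  then show ?thesis by (simp add: coinduced_topology_def topology_inverse')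
qed

lemma topspace_coinduced_topology:
  assumes "f ` topspace X \<subseteq> S"
  shows "topspace (coinduced_topology S X f) = S"
proof -
  have "{x \<in> topspace X. f x \<in> S} = topspace X" using assms by auto
  then have "openin (coinduced_topology S X f) S" by (simp add: openin_coinduced_topology)
  then show ?thesis
    by (metis openin_coinduced_topology openin_subset openin_topspace subset_antisym)
qed

(* The pointed quotient X/A; for A = {} it is X with a disjoint base point. *)
definition quotient_space :: "'a topology \<Rightarrow> 'a set \<Rightarrow> 'a option topology"
  where "quotient_space X A =
    coinduced_topology (insert None (Some ` (topspace X - A))) X
      (\<lambda>x. if x \<in> A then None else Some x)"

definition smash_pt :: "'a option \<Rightarrow> 'b option \<Rightarrow> ('a \<times> 'b) option"
  where "smash_pt a b =
    (case a of None \<Rightarrow> None | Some x \<Rightarrow> (case b of None \<Rightarrow> None | Some y \<Rightarrow> Some (x, y)))"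

definition smash :: "'a option topology \<Rightarrow> 'b option topology \<Rightarrow> ('a \<times> 'b) option topology"
  where "smash X Y =
    coinduced_topology ((\<lambda>(a, b). smash_pt a b) ` (topspace X \<times> topspace Y))
      (kification (prod_topology X Y)) (\<lambda>(a, b). smash_pt a b)"


section \<open>Geometric realization of posets\<close>

(* |P| is the order complex: barycentric coordinates supported on a finite chain, with the
   weak topology determined by the closed simplices. *)

definition order_simplices :: "'p set \<Rightarrow> ('p \<Rightarrow> 'p \<Rightarrow> bool) \<Rightarrow> 'p set set"
  where "order_simplices P prec =
    {C. finite C \<and> C \<noteq> {} \<and> C \<subseteq> P \<and> Complete_Partial_Order.chain prec C}"

definition closed_simplex :: "'p set \<Rightarrow> ('p \<Rightarrow> real) set"
  where "closed_simplex C =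
    {t. (\<forall>p. 0 \<le> t p) \<and> (\<forall>p. p \<notin> C \<longrightarrow> t p = 0) \<and> (\<Sum>p\<in>C. t p) = 1}"

definition realization_points :: "'p set \<Rightarrow> ('p \<Rightarrow> 'p \<Rightarrow> bool) \<Rightarrow> ('p \<Rightarrow> real) set"
  where "realization_points P prec = (\<Union>C\<in>order_simplices P prec. closed_simplex C)"

definition realization :: "'p set \<Rightarrow> ('p \<Rightarrow> 'p \<Rightarrow> bool) \<Rightarrow> ('p \<Rightarrow> real) topology"
  where "realization P prec = topology (\<lambda>U. U \<subseteq> realization_points P prec \<and>
    (\<forall>C\<in>order_simplices P prec.
       openin (subtopology (powertop_real UNIV) (closed_simplex C)) (closed_simplex C \<inter> U)))"

lemma openin_realization:
  "openin (realization P prec) U \<longleftrightarrow> U \<subseteq> realization_points P prec \<and>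
    (\<forall>C\<in>order_simplices P prec.
       openin (subtopology (powertop_real UNIV) (closed_simplex C)) (closed_simplex C \<inter> U))"
proof -
  have "istopology (\<lambda>U. U \<subseteq> realization_points P prec \<and>
    (\<forall>C\<in>order_simplices P prec.
       openin (subtopology (powertop_real UNIV) (closed_simplex C)) (closed_simplex C \<inter> U)))"
    (is "istopology ?L")
    unfolding istopology_def
  proof (intro conjI allI impI ballI)
    fix A B assume A: "?L A" and B: "?L B"
    then show "A \<inter> B \<subseteq> realization_points P prec" by auto
    fix C assume C: "C \<in> order_simplices P prec"
    have "closed_simplex C \<inter> (A \<inter> B) = (closed_simplex C \<inter> A) \<inter> (closed_simplex C \<inter> B)" by auto
    then show "openin (subtopology (powertop_real UNIV) (closed_simplex C)) (closed_simplex C \<inter> (A \<inter> B))"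
      using A B C by (metis (no_types, lifting) openin_Int)
  next
    fix K assume K: "\<forall>U\<in>K. ?L U"
    then show "\<Union>K \<subseteq> realization_points P prec" by blast
    fix C assume C: "C \<in> order_simplices P prec"
    have "closed_simplex C \<inter> \<Union>K = \<Union>((\<lambda>U. closed_simplex C \<inter> U) ` K)" by auto
    moreover have "openin (subtopology (powertop_real UNIV) (closed_simplex C))
        (\<Union>((\<lambda>U. closed_simplex C \<inter> U) ` K))"
      by (rule openin_Union) (use K C in blast)
    ultimately show "openin (subtopology (powertop_real UNIV) (closed_simplex C)) (closed_simplex C \<inter> \<Union>K)"
      by simp
  qed
  then show ?thesis unfolding realization_def by (simp add: topology_inverse')
qed

lemma topspace_realization: "topspace (realization P prec) = realization_points P prec"
proof -
  have "closed_simplex C \<inter> realization_points P prec = closed_simplex C"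
    if "C \<in> order_simplices P prec" for C
    using that by (auto simp: realization_points_def)
  then have "openin (realization P prec) (realization_points P prec)"
    by (simp add: openin_realization openin_subtopology_refl)
  then show ?thesis
    by (metis openin_realization openin_subset openin_topspace subset_antisym)
qed

definition realization_map :: "('p \<Rightarrow> 'q) \<Rightarrow> ('p \<Rightarrow> real) \<Rightarrow> ('q \<Rightarrow> real)"
  where "realization_map f t = (\<lambda>q. \<Sum>p | t p \<noteq> 0 \<and> f p = q. t p)"

definition Sigma_ST :: "(nat \<Rightarrow> real) set \<Rightarrow> ((nat \<Rightarrow> real) set \<Rightarrow> real) option topology"
  where "Sigma_ST V = (let P = {U. real_fun.subspace U \<and> U \<subseteq> V} in
    quotient_space (realization P (\<subseteq>))
      (realization_points (P - {V}) (\<subseteq>) \<union> realization_points (P - {{0}}) (\<subseteq>)))"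


section \<open>Orthogonal spectra and their homotopy groups\<close>

definition sphere_space :: "nat \<Rightarrow> (nat \<Rightarrow> real) option topology"
  where "sphere_space q = Alexandroff_compactification (Euclidean_space q)"

(* Coordinatized orthogonal spectra: the pointed space X(R^n) with its O(n)-action and the
   structure map X(R^n) \<and> S^1 \<rightarrow> X(R^(n+1)), where S^1 is the one-point compactification of
   the reals.  The structure maps below send (None, s) and (x, None) to None. *)
record 'a orth_spectrum =
  level :: "nat \<Rightarrow> 'a option topology"
  orth_act :: "nat \<Rightarrow> ((nat \<Rightarrow> real) \<Rightarrow> (nat \<Rightarrow> real)) \<Rightarrow> 'a \<Rightarrow> 'a"
  sigma :: "nat \<Rightarrow> 'a option \<Rightarrow> real option \<Rightarrow> 'a option"

(* S^q \<and> S^1 is identified with S^(q+1) by appending the last coordinate. *)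
definition suspend :: "'a orth_spectrum \<Rightarrow> nat \<Rightarrow> nat \<Rightarrow>
    ((nat \<Rightarrow> real) option \<Rightarrow> 'a option) \<Rightarrow> (nat \<Rightarrow> real) option \<Rightarrow> 'a option"
  where "suspend X q N f = (\<lambda>x. case x of None \<Rightarrow> None
    | Some v \<Rightarrow> sigma X N (f (Some (v(q := 0)))) (Some (v q)))"

primrec stabilize :: "'a orth_spectrum \<Rightarrow> nat \<Rightarrow> nat \<Rightarrow>
    ((nat \<Rightarrow> real) option \<Rightarrow> 'a option) \<Rightarrow> nat \<Rightarrow> (nat \<Rightarrow> real) option \<Rightarrow> 'a option"
  where
    "stabilize X m N f 0 = f"
  | "stabilize X m N f (Suc i) = suspend X (m + N + i) (N + i) (stabilize X m N f i)"

definition stable_maps :: "'a orth_spectrum \<Rightarrow> nat \<Rightarrow>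
    (nat \<times> ((nat \<Rightarrow> real) option \<Rightarrow> 'a option)) set"
  where "stable_maps X m =
    {(N, f). continuous_map (sphere_space (m + N)) (level X N) f \<and> f None = None}"

definition stable_homotopic :: "'a orth_spectrum \<Rightarrow> nat \<Rightarrow>
    ((nat \<times> ((nat \<Rightarrow> real) option \<Rightarrow> 'a option)) \<times>
     (nat \<times> ((nat \<Rightarrow> real) option \<Rightarrow> 'a option))) set"
  where "stable_homotopic X m =
    {((N, f), (M, g)). (N, f) \<in> stable_maps X m \<and> (M, g) \<in> stable_maps X m \<and>
       (\<exists>i j. N + i = M + j \<and>
          homotopic_with (\<lambda>h. h None = None) (sphere_space (m + (N + i))) (level X (N + i))
            (stabilize X m N f i) (stabilize X m M g j))}"

(* The sum of two maps on S^q, q \<ge> 1: the half-spaces where the coordinate 0 is negative,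
   respectively positive, are stretched to the whole of R^q in an orientation preserving way. *)
definition pinch_sum :: "((nat \<Rightarrow> real) option \<Rightarrow> 'a option) \<Rightarrow>
    ((nat \<Rightarrow> real) option \<Rightarrow> 'a option) \<Rightarrow> (nat \<Rightarrow> real) option \<Rightarrow> 'a option"
  where "pinch_sum f g = (\<lambda>x. case x of None \<Rightarrow> None
    | Some v \<Rightarrow> if v 0 < 0 then f (Some (v(0 := - ln (- v 0))))
                else if v 0 > 0 then g (Some (v(0 := ln (v 0))))
                else None)"

(* \<pi>_m(X) = colim_N \<pi>_(m+N) (X(R^N)) for m \<ge> 0. *)
definition stable_homotopy_group :: "nat \<Rightarrow> 'a orth_spectrum \<Rightarrow>
    (nat \<times> ((nat \<Rightarrow> real) option \<Rightarrow> 'a option)) set monoid"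
  where "stable_homotopy_group m X =
    \<lparr>carrier = stable_maps X m // stable_homotopic X m,
     mult = (\<lambda>A B. \<Union>{stable_homotopic X m `` {(N, pinch_sum f g)} | N f g.
                      1 \<le> N \<and> (N, f) \<in> A \<and> (N, g) \<in> B}),
     one = stable_homotopic X m `` {(0, \<lambda>_. None)}\<rparr>"

definition smash_spectrum :: "'a orth_spectrum \<Rightarrow> 'b option topology \<Rightarrow> ('a \<times> 'b) orth_spectrum"
  where "smash_spectrum X K =
    \<lparr>level = (\<lambda>N. smash (level X N) K),
     orth_act = (\<lambda>N A. map_prod (orth_act X N A) id),
     sigma = (\<lambda>N z s. case z of None \<Rightarrow> None
               | Some (x, k) \<Rightarrow> smash_pt (sigma X N (Some x) s) (Some k))\<rparr>"

(* The total space of the orthogonal complement bundle over the Stiefel manifold of linear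
   isometries R^d \<rightarrow> R^N, topologized by pointwise convergence.  Its Thom space J(R^d, R^N) is its
   one-point compactification, and F_V A = J(V, -) \<and> A, so that F_V S^0 = J(V, -). *)
definition complement_bundle ::
    "nat \<Rightarrow> nat \<Rightarrow> (((nat \<Rightarrow> real) \<Rightarrow> (nat \<Rightarrow> real)) \<times> (nat \<Rightarrow> real)) topology"
  where "complement_bundle d N =
    subtopology (prod_topology (product_topology (\<lambda>_. Euclidean_space N) (Rn d)) (Euclidean_space N))
      {(\<phi>, w). \<phi> \<in> linear_isometries d N \<and> (\<forall>v\<in>Rn d. dot N w (\<phi> v) = 0)}"

definition neg_sphere :: "nat \<Rightarrow> (((nat \<Rightarrow> real) \<Rightarrow> (nat \<Rightarrow> real)) \<times> (nat \<Rightarrow> real)) orth_spectrum"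
  where "neg_sphere d =
    \<lparr>level = (\<lambda>N. Alexandroff_compactification (complement_bundle d N)),
     orth_act = (\<lambda>N A (\<phi>, w). (compose (Rn d) A \<phi>, A w)),
     sigma = (\<lambda>N x s. case x of None \<Rightarrow> None
               | Some (\<phi>, w) \<Rightarrow> map_option (\<lambda>r. (\<phi>, w(N := r))) s)\<rparr>"

definition neg_sphere_act :: "nat \<Rightarrow> ((nat \<Rightarrow> real) \<Rightarrow> (nat \<Rightarrow> real)) \<Rightarrow>
    ((nat \<Rightarrow> real) \<Rightarrow> (nat \<Rightarrow> real)) \<times> (nat \<Rightarrow> real) \<Rightarrow> ((nat \<Rightarrow> real) \<Rightarrow> (nat \<Rightarrow> real)) \<times> (nat \<Rightarrow> real)"
  where "neg_sphere_act d g = (\<lambda>(\<phi>, w). (compose (Rn d) \<phi> (inv\<^bsub>orthogonal_group d\<^esub> g), w))"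


section \<open>Homotopy orbits for discrete groups\<close>

(* Milnor's model of EG, the infinite join G * G * ... with the weak topology: it is the
   realization of G \<times> nat, ordered by strict inequality of the nat-coordinates. *)
definition milnor_le :: "'g \<times> nat \<Rightarrow> 'g \<times> nat \<Rightarrow> bool"
  where "milnor_le p q \<longleftrightarrow> p = q \<or> snd p < snd q"

definition EG :: "('g, 'm) monoid_scheme \<Rightarrow> ('g \<times> nat \<Rightarrow> real) topology"
  where "EG G = realization (carrier G \<times> UNIV) milnor_le"

definition EG_act :: "('g, 'm) monoid_scheme \<Rightarrow> 'g \<Rightarrow> ('g \<times> nat \<Rightarrow> real) \<Rightarrow> ('g \<times> nat \<Rightarrow> real)"
  where "EG_act G g = realization_map (\<lambda>(h, i). (g \<otimes>\<^bsub>G\<^esub> h, i))"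

definition orbit_pt :: "('g, 'm) monoid_scheme \<Rightarrow> ('g \<Rightarrow> 'a \<Rightarrow> 'a) \<Rightarrow>
    ('g \<times> nat \<Rightarrow> real) \<Rightarrow> 'a option \<Rightarrow> (('g \<times> nat \<Rightarrow> real) \<times> 'a) set option"
  where "orbit_pt G act e z =
    map_option (\<lambda>x. (\<lambda>g. (EG_act G g e, act g x)) ` carrier G) z"

(* The quotient (EG_+ \<and> X)/G of a pointed left G-space X by the diagonal action. *)
definition homotopy_orbit_space :: "('g, 'm) monoid_scheme \<Rightarrow> ('g \<Rightarrow> 'a \<Rightarrow> 'a) \<Rightarrow>
    'a option topology \<Rightarrow> (('g \<times> nat \<Rightarrow> real) \<times> 'a) set option topology"
  where "homotopy_orbit_space G act X =
    coinduced_topology ((\<lambda>(e, z). orbit_pt G act e z) ` (topspace (EG G) \<times> topspace X))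
      (kification (prod_topology (EG G) X)) (\<lambda>(e, z). orbit_pt G act e z)"

(* Homotopy orbits are formed levelwise.  The structure map is computed on an arbitrary
   representative of the orbit. *)
definition homotopy_orbits :: "('g, 'm) monoid_scheme \<Rightarrow> ('g \<Rightarrow> 'a \<Rightarrow> 'a) \<Rightarrow>
    'a orth_spectrum \<Rightarrow> (('g \<times> nat \<Rightarrow> real) \<times> 'a) set orth_spectrum"
  where "homotopy_orbits G act X =
    \<lparr>level = (\<lambda>N. homotopy_orbit_space G act (level X N)),
     orth_act = (\<lambda>N A C. map_prod id (orth_act X N A) ` C),
     sigma = (\<lambda>N c s. case c of None \<Rightarrow> None
               | Some C \<Rightarrow> (case (SOME p. p \<in> C) of (e, x) \<Rightarrow>
                   orbit_pt G act e (sigma X N (Some x) s)))\<rparr>"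


section \<open>Reduced spherical scissors congruence K-theory\<close>

definition reduced_spherical_K_spectrum where
  "reduced_spherical_K_spectrum d =
    homotopy_orbits (orthogonal_group d)
      (\<lambda>g. map_prod (neg_sphere_act d g) (realization_map (image g)))
      (smash_spectrum (neg_sphere d) (Sigma_ST (Rn d)))"

definition reduced_spherical_K where
  "reduced_spherical_K d m = stable_homotopy_group m (reduced_spherical_K_spectrum d)"

end

theory Submission imports Defs "HOL-Probability.Infinite_Product_Measure" begin

text \<open>
The class is detected by a real Alexander-Spanier type cochain on finite tuples of points of a level
of the spectrum. Close points of a level have representatives \<open>(e, ((\<phi>, w), t))\<close> adapted to a common
flag of even-dimensional subspaces of \<open>\<real>\<^sup>2\<^sup>r\<close>, that is, to an ordered decomposition into oriented planes.
The cochain is the cup product of rational functionals of the directions which \<open>e\<close> and \<open>t\<close> determine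
in these planes (additive maps \<open>\<real> \<rightarrow> \<real>\<close> killing \<open>\<pi>\<close>, whose discontinuity does no harm because the
orthogonal group is discrete), of the step functions locating \<open>t\<close> relative to the flag, and of a Thom cochain of the
complement of the image of \<open>\<phi>\<close>. The Thom cochain is averaged over the rotations of the planes and
antisymmetrised over their reflections. Every plane carries an odd number of functionals (\<open>2n + 1\<close> the
first one, one each of the others), so a change of frame changes both parts by the same sign and the
product is well defined on orbits. It is a cocycle on small tuples; hence its evaluation on fine
subdivisions of a large cube is an invariant of stable homotopy.

The representative maps a sphere to the points in which \<open>e\<close> runs through a torus of \<open>2n + r\<close> commuting
rotations, by angles dual to the functionals, and \<open>t\<close> through a cube of coordinate flags. Near the
support of the pulled back cochain all factors become step functions of single coordinates, up to a
fixed rotation, so the evaluation is a nonzero constant.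
\<close>

text \<open>The levels are iterated quotients of kified products with weak topologies. A cochain on
  finite tuples asks little of them: every point needs one open neighbourhood on whose tuples the
  coboundary vanishes, and the cochain must vanish near the base point.

  The obstacle is vanishing near the base point when weight leaves a member of the flag. The
  thresholds then force much weight onto one subspace strictly between two consecutive members, and
  it traces a line in the corresponding plane. The direction is read from that line, and from the
  group coordinate only if there is no such line; so the direction factor is constant there.

  A null-homotopy may live at any level \<open>N\<close>. Hence the cochain is built for every
  \<open>N\<close>, whereas the map from the sphere depends only on \<open>n\<close>,
  \<open>r\<close>, the dual angles and an irrational offset. Iterated polar coordinates realise a
  thickened torus in a Euclidean space, and the map is the collapse onto it.\<close>

type_synonym vec = "nat => real"
type_synonym ivec = "nat => int"
type_synonym grid = "unit\<times>ivec"
type_synonym framed = "(nat => vec)\<times>vec"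

section \<open>Cochains on ordered tuples\<close>

text \<open>The alternating sum over the omitted entry. Degrees are not recorded: a cochain is a
  function on lists of all lengths, and a statement in degree m concerns lists of length m + 1 or m
  + 2.\<close>

fun coboundary :: "('a list => real) => 'a list => real"
 where
  "coboundary c [] = 0"
 | "coboundary c (x # xs) = c xs - coboundary (%ys. c (x # ys)) xs"

text \<open>The sum over i of (-1)^i times \<open>c\<close> at a x_0, ..., a x_i, b x_i, ..., b x_m:
  the staircase triangulation of the prism between the images under \<open>a\<close> and
  \<open>b\<close>.\<close>

fun prism :: "('a => 'b) => ('a => 'b) => ('b list => real) => 'a list => real"
 where
  "prism a b c [] = 0"
 | "prism a b c (x # xs) = c (a x # b x # map b xs) - prism a b (%ys. c (a x # ys)) xs"

text \<open>The product of the coboundary of the 0-cochain \<open>g\<close> with \<open>c\<close>.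
  Only differences of \<open>g\<close> enter, so \<open>g\<close> matters up to a constant and no
  regularity is asked of it.\<close>

fun cup :: "('a => real) => ('a list => real) => 'a list => real"
 where
  "cup g c (x # y # ys) = (g y - g x)*c (y # ys)"
 | "cup g c xs = 0"

lemma coboundary_map: "coboundary (%ys. c (map f ys)) xs = coboundary c (map f xs)"
 by (induction xs arbitrary: c) simp_all

lemma coboundary_diff:
 "coboundary (%ys. c ys - c' ys) xs = coboundary c xs - coboundary c' xs"
 by (induction xs arbitrary: c c') (simp_all add: algebra_simps)

lemma coboundary_scale: "coboundary (%ys. k*c ys) xs = k*coboundary c xs"
 by (induction xs arbitrary: c) (simp_all add: algebra_simps)

lemma coboundary_sum: "coboundary (%ys. \<Sum>t\<in>T. c t ys) xs = (\<Sum>t\<in>T. coboundary (c t) xs)"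
 by (induction xs arbitrary: c) (simp_all add: sum_subtractf)

lemma coboundary_cong:
 assumes "!!ys. set ys\<subseteq>set xs ==> Suc (length ys) = length xs ==> c ys = c' ys"
 shows "coboundary c xs = coboundary c' xs"
 using assms
proof (induction xs arbitrary: c c')
 case (Cons x xs)
 have "c xs = c' xs" using Cons.prems[of xs] by auto
 moreover have "coboundary (%ys. c (x # ys)) xs = coboundary (%ys. c' (x # ys)) xs"
  by (rule Cons.IH, rule Cons.prems) auto
 ultimately show ?case by simp
qed simp

lemma coboundary_const: "coboundary (%_. k) xs = (if even (length xs) then 0 else k)"
 by (induction xs) simp_all

lemma prism_diff: "prism a b (%ys. c ys - c' ys) xs = prism a b c xs - prism a b c' xs"
 by (induction xs arbitrary: c c') (simp_all add: algebra_simps)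

lemma prism_scale: "prism a b (%ys. k*c ys) xs = k*prism a b c xs"
 by (induction xs arbitrary: c) (simp_all add: algebra_simps)

lemma prism_cong:
 assumes "!!ys. set ys\<subseteq>a ` set xs\<union>b ` set xs ==> length ys = Suc (length xs) ==> c ys = c' ys"
 shows "prism a b c xs = prism a b c' xs"
 using assms
proof (induction xs arbitrary: c c')
 case (Cons x xs)
 have "c (a x # b x # map b xs) = c' (a x # b x # map b xs)" by (rule Cons.prems) auto
 moreover have "prism a b (%ys. c (a x # ys)) xs = prism a b (%ys. c' (a x # ys)) xs"
  by (rule Cons.IH, rule Cons.prems) auto
 ultimately show ?case by simp
qed simp

lemma prism_zero: "prism a b (%_. 0) xs = 0"
 by (induction xs) simp_all

lemma prism_map:
 assumes "!!x. a (f x) = f' (a' x)" "!!x. b (f x) = f' (b' x)"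
 shows "prism a b c (map f xs) = prism a' b' (%ys. c (map f' ys)) xs"
 by (induction xs arbitrary: c) (simp_all add: assms comp_def)

text \<open>The chain homotopy formula, by peeling off the first entry: \<open>c\<close> with
  \<open>a x\<close> put in front is again a cochain, to which the induction hypothesis
  applies.\<close>

lemma prism_coboundary:
 "prism a b (coboundary c) xs + coboundary (prism a b c) xs = c (map b xs) - c (map a xs)"
proof (induction xs arbitrary: c)
 case (Cons x xs)
 let ?c = "%ys. c (a x # ys)"
 have 1: "prism a b (%ys. coboundary c (a x # ys)) xs = prism a b c xs - prism a b (coboundary ?c) xs"
  by (simp add: prism_diff)
 have 2: "coboundary (%ys. prism a b c (x # ys)) xs
   = coboundary (%zs. ?c (b x # zs)) (map b xs) - coboundary (prism a b ?c) xs"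
  by (simp add: coboundary_diff coboundary_map[where c = "%zs. ?c (b x # zs)" and f = b])
 have 3: "coboundary c (a x # b x # map b xs)
   = c (b x # map b xs) - (?c (map b xs) - coboundary (%zs. ?c (b x # zs)) (map b xs))"
  by simp
 show ?case
  unfolding prism.simps(2)[of a b "coboundary c"] coboundary.simps(2)[of "prism a b c"] 1 2 3
  using Cons.IH[of ?c] by simp
qed simp

text \<open>The left factor is closed of degree one, so the product rule leaves one term with a
  sign. Two entries are too few: there the right side would involve \<open>c []\<close>.\<close>

lemma coboundary_cup:
 assumes "3<=length xs"
 shows "coboundary (cup g c) xs = - cup g (coboundary c) xs"
proof -
 obtain x y z zs where xs: "xs = x # y # z # zs"
  using assms by (cases xs; cases "tl xs"; cases "tl (tl xs)") auto
 have h: "coboundary (%ws. cup g c (x # y # ws)) (z # zs)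
   = (g y - g x)*coboundary (%ws. c (y # ws)) (z # zs)"
  by (simp add: coboundary_scale del: coboundary.simps)
 show ?thesis
  unfolding xs
  by (subst coboundary.simps(2), subst coboundary.simps(2), subst h) (simp add: algebra_simps)
qed

text \<open>\<open>g\<close> does not see the direction of the prism, so its difference vanishes on
  the doubled entry, and the prism slides past the factor at the cost of a sign.\<close>

lemma prism_cup:
 assumes "!!x. g (a x) = h x" "!!x. g (b x) = h x"
 shows "prism a b (cup g c) xs = - cup h (prism a b c) xs"
proof (cases xs rule: remdups_adj.cases)
 case (3 x y ys)
 thus ?thesis
  by (simp add: assms prism_scale) (simp add: algebra_simps)
qed (auto simp: assms)

lemma cup_cong:
 assumes "!!ys. set ys\<subseteq>set xs ==> Suc (length ys) = length xs ==> c ys = c' ys"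
  and "!!x. x\<in>set xs ==> g x = g' x"
 shows "cup g c xs = cup g' c' xs"
proof (cases xs rule: remdups_adj.cases)
 case (3 x y ys)
 thus ?thesis using assms(1)[of "y # ys"] assms(2) by auto
qed auto

definition cups :: "('a => real) list => ('a list => real) => 'a list => real"
 where "cups gs c = foldr cup gs c"

lemma cups_simps [simp]: "cups [] c = c" "cups (g # gs) c = cup g (cups gs c)"
 by (simp_all add: cups_def)

lemma cups_append: "cups (gs @ hs) c = cups gs (cups hs c)"
 by (simp add: cups_def)

lemma cups_cong:
 assumes "!!ys. set ys\<subseteq>set xs ==> length ys + length gs = length xs ==> c ys = c' ys"
 shows "cups gs c xs = cups gs c' xs"
 using assms
proof (induction gs arbitrary: xs)
 case (Cons g gs)
 show ?case unfolding cups_simps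
  by (rule cup_cong[OF Cons.IH refl], rule Cons.prems) auto
qed simp

lemma cups_cong_funs:
 assumes "length gs = length gs'" "!!i x. i < length gs ==> x\<in>set xs ==> (gs ! i) x = (gs' ! i) x"
 shows "cups gs c xs = cups gs' c xs"
 using assms
proof (induction gs gs' arbitrary: xs rule: list_induct2)
 case (Cons g gs g' gs')
 show ?case unfolding cups_simps
 proof (rule cup_cong)
  fix ys assume "set ys\<subseteq>set xs"
  thus "cups gs c ys = cups gs' c ys"
   using Cons.prems[of "Suc _"] by (intro Cons.IH) auto
 qed (use Cons.prems[of 0] in auto)
qed simp

lemma coboundary_cups:
 assumes "length gs + 2<=length xs"
 shows "coboundary (cups gs c) xs = (-1)^length gs*cups gs (coboundary c) xs"
 using assms
proof (induction gs arbitrary: xs)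
 case (Cons g gs)
 have "coboundary (cups (g # gs) c) xs = - cup g (coboundary (cups gs c)) xs"
  unfolding cups_simps by (rule coboundary_cup) (use Cons.prems in simp)
 also have "cup g (coboundary (cups gs c)) xs
   = cup g (%ys. (-1)^length gs*cups gs (coboundary c) ys) xs"
  by (rule cup_cong[OF _ refl], rule Cons.IH) (use Cons.prems in auto)
 also have "... = (-1)^length gs*cup g (cups gs (coboundary c)) xs"
  by (cases xs rule: remdups_adj.cases) auto
 finally show ?case by simp
qed simp

text \<open>Each factor is a difference of two entries, so a nonzero value forces every function to
  take two values on the tuple. This is how supports are located below.\<close>

lemma cups_nonzeroD:
 assumes "cups gs c xs~=0"
 shows "\<forall>g\<in>set gs. \<exists>x\<in>set xs. \<exists>y\<in>set xs. g x~=g y"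
  and "\<exists>ys. set ys\<subseteq>set xs & length ys + length gs = length xs & c ys~=0"
proof -
 have "(\<forall>g\<in>set gs. \<exists>x\<in>set xs. \<exists>y\<in>set xs. g x~=g y) &
   (\<exists>ys. set ys\<subseteq>set xs & length ys + length gs = length xs & c ys~=0)"
  using assms
 proof (induction gs arbitrary: xs)
  case (Cons g gs)
  then obtain x y ys where xs: "xs = x # y # ys"
   by (cases xs rule: remdups_adj.cases) auto
  hence "g y~=g x" "cups gs c (y # ys)~=0" using Cons.prems by auto
  from Cons.IH[OF this(2)] obtain zs where "\<forall>h\<in>set gs. \<exists>u\<in>set (y # ys). \<exists>v\<in>set (y # ys). h u~=h v"
   and zs: "set zs\<subseteq>set (y # ys)" "length zs + length gs = length (y # ys)" "c zs~=0" by blast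
  hence "\<forall>h\<in>set gs. \<exists>u\<in>set xs. \<exists>v\<in>set xs. h u~=h v" unfolding xs by (meson list.set_intros(2))
  moreover have "\<exists>u\<in>set xs. \<exists>v\<in>set xs. g u~=g v"
   using \<open>g y~=g x\<close> unfolding xs by (intro bexI[of _ y] bexI[of _ x]) auto
  moreover have "\<exists>zs. set zs\<subseteq>set xs & length zs + length (g # gs) = length xs & c zs~=0"
   using zs unfolding xs by (intro exI[of _ zs]) auto
  ultimately show ?case by simp
 qed auto
 thus "\<forall>g\<in>set gs. \<exists>x\<in>set xs. \<exists>y\<in>set xs. g x~=g y"
  and "\<exists>ys. set ys\<subseteq>set xs & length ys + length gs = length xs & c ys~=0" by auto
qed

lemma cups_map: "cups gs c (map f xs) = cups (map (%g x. g (f x)) gs) (%ys. c (map f ys)) xs"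
proof (induction gs arbitrary: xs)
 case (Cons g gs)
 show ?case
 proof (cases xs rule: remdups_adj.cases)
  case (3 x y ys)
  thus ?thesis using Cons[of "y # ys"] by simp
 qed auto
qed simp

section \<open>Summation over the subdivided box\<close>

definition put :: "nat => int => 'p\<times>ivec => 'p\<times>ivec"
 where "put l t x = (fst x, (snd x)(l := t))"

lemma put_simps [simp]: "fst (put l t x) = fst x" "snd (put l t x) = (snd x)(l := t)"
 by (simp_all add: put_def)

locale box =
 fixes lo hi :: "nat => int"
 assumes lo_less_hi: "!!l. lo l < hi l"
begin

text \<open>The cross product with the subdivided interval in direction \<open>l\<close>. Iterated,
  \<open>sweeps 0 q c [x]\<close> evaluates \<open>c\<close> on the fundamental chain of a
  triangulated box of dimension \<open>q\<close>.\<close>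

definition sweep :: "nat => (('p\<times>ivec) list => real) => ('p\<times>ivec) list => real"
 where "sweep l c xs = (\<Sum>t\<in>{lo l..<hi l}. prism (put l t) (put l (t + 1)) c xs)"

primrec sweeps :: "nat => nat => (('p\<times>ivec) list => real) => ('p\<times>ivec) list => real"
 where
  "sweeps l 0 c = c"
 | "sweeps l (Suc n) c = sweep l (sweeps (Suc l) n c)"

lemma sweeps_snoc: "sweeps l (Suc n) c = sweeps l n (sweep (l + n) c)"
proof (induction n arbitrary: l)
 case (Suc n)
 have "sweeps l (Suc (Suc n)) c = sweep l (sweeps (Suc l) (Suc n) c)" by simp
 also have "... = sweep l (sweeps (Suc l) n (sweep (Suc l + n) c))" by (simp only: Suc)
 also have "... = sweeps l (Suc n) (sweep (l + Suc n) c)" by simp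
 finally show ?case .
qed simp

text \<open>The kind of tuple that arises from a tuple over \<open>P\<close> by sweeping in the
  first \<open>q\<close> directions; identities of swept cochains need only be checked on
  these.\<close>

definition adm :: "'p set => nat => ('p\<times>ivec) list => bool"
 where "adm P q xs \<longleftrightarrow> fst ` set xs\<subseteq>P &
  (\<forall>l<q. \<exists>t. lo l<=t & t < hi l & (\<forall>x\<in>set xs. snd x l = t | snd x l = t + 1)) &
  (\<forall>l\<ge>q. \<forall>x\<in>set xs. snd x l = 0)"

lemma adm_put:
 assumes "adm P q xs" "set ys\<subseteq>put q t ` set xs\<union>put q (t + 1) ` set xs" "lo q<=t" "t < hi q"
 shows "adm P (Suc q) ys"
 unfolding adm_def
proof (intro conjI allI impI)
 have ys: "\<exists>x\<in>set xs. y = put q t x | y = put q (t+1) x" if "y\<in>set ys" for y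
  using assms(2) that by blast
 show "fst ` set ys\<subseteq>P"
 proof
  fix z assume "z\<in>fst ` set ys"
  then obtain y where "y\<in>set ys" "z = fst y" by auto
  with ys[of y] assms(1) show "z\<in>P" by (auto simp: adm_def)
 qed
 show "\<exists>s. lo l<=s & s < hi l & (\<forall>x\<in>set ys. snd x l = s | snd x l = s + 1)" if "l < Suc q" for l
 proof (cases "l = q")
  case True
  have "\<forall>x\<in>set ys. snd x l = t | snd x l = t + 1" using ys True by fastforce
  thus ?thesis using assms True by blast
 next
  case False
  then obtain s where s: "lo l<=s" "s < hi l" "\<forall>x\<in>set xs. snd x l = s | snd x l = s + 1"
   using assms(1) \<open>l < Suc q\<close> unfolding adm_def by (auto elim!: less_SucE)
  hence "\<forall>x\<in>set ys. snd x l = s | snd x l = s + 1" using ys False by fastforce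
  thus ?thesis using s by blast
 qed
 show "\<forall>x\<in>set ys. snd x l = 0" if "Suc q<=l" for l
 proof
  fix y assume "y\<in>set ys"
  then obtain x where "x\<in>set xs" "y = put q t x | y = put q (t+1) x" using ys by blast
  thus "snd y l = 0" using that assms(1) unfolding adm_def by auto
 qed
qed

lemma sweep_cong:
 assumes "adm P q xs"
  and "!!ys. adm P (Suc q) ys ==> length ys = Suc (length xs) ==> c ys = c' ys"
 shows "sweep q c xs = sweep q c' xs"
 unfolding sweep_def
proof (rule sum.cong[OF refl])
 fix t assume "t\<in>{lo q..<hi q}"
 thus "prism (put q t) (put q (t + 1)) c xs = prism (put q t) (put q (t + 1)) c' xs"
  by (intro prism_cong assms(2) adm_put[OF assms(1)]) auto
qed

lemma sweeps_cong:
 assumes "adm P q xs"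
  and "!!ys. adm P (q + n) ys ==> length ys = length xs + n ==> c ys = c' ys"
 shows "sweeps q n c xs = sweeps q n c' xs"
 using assms
proof (induction n arbitrary: q xs)
 case (Suc n)
 show ?case unfolding sweeps.simps
  by (rule sweep_cong[OF Suc.prems(1)], rule Suc.IH) (use Suc.prems(2) in auto)
qed auto

lemma sweep_diff: "sweep l (%ys. c ys - c' ys) xs = sweep l c xs - sweep l c' xs"
 by (simp add: sweep_def prism_diff sum_subtractf)

lemma sweep_scale: "sweep l (%ys. k*c ys) xs = k * sweep l c xs"
 by (simp add: sweep_def prism_scale sum_distrib_left)

lemma sweeps_diff: "sweeps l n (%ys. c ys - c' ys) xs = sweeps l n c xs - sweeps l n c' xs"
proof (induction n arbitrary: l xs)
 case (Suc n)
 have "sweeps (Suc l) n (%ys. c ys - c' ys) = (%ys. sweeps (Suc l) n c ys - sweeps (Suc l) n c' ys)"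
  using Suc by (intro ext)
 thus ?case by (simp add: sweep_diff)
qed simp

lemma sweeps_scale: "sweeps l n (%ys. k*c ys) xs = k * sweeps l n c xs"
proof (induction n arbitrary: l xs)
 case (Suc n)
 have "sweeps (Suc l) n (%ys. k*c ys) = (%ys. k * sweeps (Suc l) n c ys)"
  using Suc by (intro ext)
 thus ?case by (simp add: sweep_scale)
qed simp

lemma sweeps_zero: "sweeps l n (%_. 0) xs = 0"
 using sweeps_scale[of l n 0 "%_. 0" xs] by simp

lemma sweep_coboundary:
 "sweep l (coboundary c) xs + coboundary (sweep l c) xs
  = c (map (put l (hi l)) xs) - c (map (put l (lo l)) xs)"
proof -
 have "coboundary (sweep l c) xs
   = (\<Sum>t\<in>{lo l..<hi l}. coboundary (prism (put l t) (put l (t + 1)) c) xs)"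
  unfolding sweep_def[abs_def] by (rule coboundary_sum)
 hence "sweep l (coboundary c) xs + coboundary (sweep l c) xs
   = (\<Sum>t\<in>{lo l..<hi l}. c (map (put l (t + 1)) xs) - c (map (put l t) xs))"
  by (simp add: sweep_def prism_coboundary flip: sum.distrib)
 also have "... = c (map (put l (hi l)) xs) - c (map (put l (lo l)) xs)"
 proof -
  have tel: "(\<Sum>t\<in>{a..<a + int n}. f (t + 1) - f t) = f (a + int n) - f a" for a n and f :: "int => real"
  proof (induction n)
   case (Suc n)
   have "{a..<a + int (Suc n)} = insert (a + int n) {a..<a + int n}" by auto
   thus ?case using Suc by (simp add: ac_simps)
  qed simp
  from tel[of "%t. c (map (put l t) xs)" "lo l" "nat (hi l - lo l)"] lo_less_hi[of l]
  show ?thesis by simp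
 qed
 finally show ?thesis .
qed

definition face :: "nat => nat => ('p\<times>ivec) list => bool"
 where "face q n xs \<longleftrightarrow> (\<exists>l. q<=l & l < q + n &
  ((\<forall>x\<in>set xs. snd x l = lo l) | (\<forall>x\<in>set xs. snd x l = hi l)))"

lemma adm_map_put:
 assumes "adm P q xs" "t = lo q | t = hi q"
 shows "adm P (Suc q) (map (put q t) xs)"
proof (cases "t = lo q")
 case True
 thus ?thesis
  using lo_less_hi[of q] by (intro adm_put[OF assms(1), where t = t]) auto
next
 case False
 thus ?thesis
  using lo_less_hi[of q] assms(2) by (intro adm_put[OF assms(1), where t = "t - 1"]) auto
qed

text \<open>Sweeping in later directions leaves a coordinate frozen at \<open>s\<close>
  unchanged.\<close>

lemma sweeps_zero_if:
 assumes "adm P k xs" "\<forall>x\<in>set xs. snd x l = s" "l < k"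
  and "!!ys. adm P (k + n) ys ==> \<forall>x\<in>set ys. snd x l = s ==> length ys = length xs + n ==> c ys = 0"
 shows "sweeps k n c xs = 0"
 using assms
proof (induction n arbitrary: k xs)
 case (Suc n)
 have "prism (put k t) (put k (t + 1)) (sweeps (Suc k) n c) xs = 0" if t: "t\<in>{lo k..<hi k}" for t
 proof -
  have "prism (put k t) (put k (t + 1)) (sweeps (Suc k) n c) xs
    = prism (put k t) (put k (t + 1)) (%_. 0) xs"
  proof (rule prism_cong)
   fix vs assume vs: "set vs\<subseteq>put k t ` set xs\<union>put k (t + 1) ` set xs"
    "length vs = Suc (length xs)"
   show "sweeps (Suc k) n c vs = 0"
   proof (rule Suc.IH)
    show "adm P (Suc k) vs" using Suc.prems(1) vs(1) t by (intro adm_put) auto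
    show "\<forall>y\<in>set vs. snd y l = s"
    proof
     fix y assume "y\<in>set vs"
     then obtain x where "x\<in>set xs" "y = put k t x | y = put k (t+1) x"
      using vs(1) by blast
     thus "snd y l = s" using Suc.prems by auto
    qed
   qed (use Suc.prems vs in auto)
  qed
  thus ?thesis by (simp add: prism_zero)
 qed
 thus ?case by (simp add: sweep_def)
qed auto

text \<open>Stokes for the box: the boundary terms are sweeps over faces, and there \<open>c\<close>
  vanishes by assumption.\<close>

lemma sweeps_coboundary:
 assumes "adm P q xs"
  and "!!ys. adm P (q + n) ys ==> face q n ys ==> Suc (length ys) = length xs + n ==> c ys = 0"
 shows "sweeps q n (coboundary c) xs = (-1)^n*coboundary (sweeps q n c) xs"
 using assms
proof (induction n arbitrary: q xs)
 case (Suc n)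
 let ?c = "sweeps (Suc q) n c"
 have z: "?c (map (put q t) xs) = 0" if t: "t = lo q | t = hi q" for t
 proof (rule sweeps_zero_if)
  show "adm P (Suc q) (map (put q t) xs)" by (rule adm_map_put[OF Suc.prems(1) t])
  show "\<forall>x\<in>set (map (put q t) xs). snd x q = t" by auto
  fix ys assume ys: "adm P (Suc q + n) ys" "\<forall>x\<in>set ys. snd x q = t"
   "length ys = length (map (put q t) xs) + n"
  hence "face q (Suc n) ys" unfolding face_def using t by (intro exI[of _ q]) auto
  thus "c ys = 0" using ys by (intro Suc.prems(2)) auto
 qed simp
 have e: "sweeps (Suc q) n (coboundary c) ys = (-1)^n*coboundary ?c ys"
  if "adm P (Suc q) ys" "length ys = Suc (length xs)" for ys
 proof (rule Suc.IH[OF that(1)])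
  fix zs assume "adm P (Suc q + n) zs" "face (Suc q) n zs" "Suc (length zs) = length ys + n"
  moreover from this have "face q (Suc n) zs" unfolding face_def
   by (metis Suc_leD add_Suc add_Suc_right)
  ultimately show "c zs = 0" using that(2) by (intro Suc.prems(2)) auto
 qed
 have "sweeps q (Suc n) (coboundary c) xs = sweep q (%ys. (-1)^n*coboundary ?c ys) xs"
  unfolding sweeps.simps by (rule sweep_cong[OF Suc.prems(1)]) (use e in auto)
 also have "... = (-1)^n*(?c (map (put q (hi q)) xs) - ?c (map (put q (lo q)) xs)
   - coboundary (sweep q ?c) xs)"
 proof -
  have "sweep q (coboundary ?c) xs = ?c (map (put q (hi q)) xs) - ?c (map (put q (lo q)) xs)
    - coboundary (sweep q ?c) xs"
   using sweep_coboundary[of q ?c xs] by linarith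
  thus ?thesis by (simp only: sweep_scale)
 qed
 also have "?c (map (put q (hi q)) xs) = 0"
  by (rule z) simp
 also have "?c (map (put q (lo q)) xs) = 0"
  by (rule z) simp
 finally show ?case by simp
qed simp

lemma sweeps_cup:
 assumes "!!l t x. m<=l ==> l < m + n ==> g (put l t x) = g x"
 shows "sweeps m n (cup g c) xs = (-1)^n*cup g (sweeps m n c) xs"
 using assms
proof (induction n arbitrary: m xs)
 case (Suc n)
 let ?c = "sweeps (Suc m) n c"
 have "sweeps (Suc m) n (cup g c) = (%ys. (-1)^n*cup g ?c ys)"
  by (intro ext Suc.IH Suc.prems) auto
 hence "sweeps m (Suc n) (cup g c) xs = (-1)^n * sweep m (cup g ?c) xs"
  by (simp add: sweep_scale)
 also have "sweep m (cup g ?c) xs = (\<Sum>t\<in>{lo m..<hi m}. - cup g (prism (put m t) (put m (t+1)) ?c) xs)"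
  unfolding sweep_def by (intro sum.cong refl prism_cup Suc.prems) auto
 also have "... = - cup g (sweep m ?c) xs"
  by (cases xs rule: remdups_adj.cases) (auto simp: sweep_def sum_negf sum_distrib_left)
 finally show ?case by simp
qed simp

lemma sweep_cup_single:
 "sweep l (cup g c) [x] = (\<Sum>t\<in>{lo l..<hi l}. (g (put l (t + 1) x) - g (put l t x))*c [put l (t + 1) x])"
 by (simp add: sweep_def)

text \<open>Direction \<open>q\<close> serves as time. By the prism formula the sweep of the cocycle
  \<open>c\<close> in this direction is a primitive of the difference of the two ends, and Stokes
  applies to it in the other directions.\<close>

lemma sweeps_homotopy:
 assumes x: "fst x\<in>P" "snd x = (%_. 0)"
  and cocycle: "!!ys. adm P (Suc q) ys ==> length ys = q + 2 ==> coboundary c ys = 0"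
  and faces: "!!ys. adm P (Suc q) ys ==> length ys = q + 1 ==> face 0 q ys ==> c ys = 0"
 shows "sweeps 0 q (%ys. c (map (put q (hi q)) ys)) [x] = sweeps 0 q (%ys. c (map (put q (lo q)) ys)) [x]"
proof -
 have adm: "adm P 0 [x]" using x by (simp add: adm_def)
 have "sweeps 0 q (%ys. c (map (put q (hi q)) ys)) [x] - sweeps 0 q (%ys. c (map (put q (lo q)) ys)) [x]
   = sweeps 0 q (%ys. c (map (put q (hi q)) ys) - c (map (put q (lo q)) ys)) [x]"
  by (simp add: sweeps_diff)
 also have "... = sweeps 0 q (coboundary (sweep q c)) [x]"
 proof (rule sweeps_cong[OF adm])
  fix ys assume ys: "adm P (0 + q) ys" "length ys = length [x] + q"
  have "sweep q (coboundary c) ys = sweep q (%_. 0) ys"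
   by (rule sweep_cong[of P], use ys in simp, rule cocycle) (use ys in auto)
  thus "c (map (put q (hi q)) ys) - c (map (put q (lo q)) ys) = coboundary (sweep q c) ys"
   using sweep_coboundary[of q c ys] by (simp add: sweep_def prism_zero)
 qed
 also have "... = (-1)^q*coboundary (sweeps 0 q (sweep q c)) [x]"
 proof (rule sweeps_coboundary[OF adm])
  fix ys assume ys: "adm P (0 + q) ys" "face 0 q ys" "Suc (length ys) = length [x] + q"
  then obtain l s where l: "l < q" "\<forall>y\<in>set ys. snd y l = s" "s = lo l | s = hi l"
   unfolding face_def by auto
  have "sweeps q (Suc 0) c ys = 0"
  proof (rule sweeps_zero_if[of P q ys l s])
   fix zs assume zs: "adm P (q + Suc 0) zs" "\<forall>x\<in>set zs. snd x l = s" "length zs = length ys + Suc 0"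
   hence "face 0 q zs" using l by (auto simp: face_def)
   thus "c zs = 0" using zs ys by (intro faces) auto
  qed (use ys l in auto)
  thus "sweep q c ys = 0" by simp
 qed
 \<comment> \<open>The coboundary at a one-entry list is the value at the empty list, where a sweep
   in at least one direction is 0.\<close>
 also have "coboundary (sweeps 0 q (sweep q c)) [x] = 0"
  unfolding coboundary.simps sweeps_snoc[of 0 q c, simplified, symmetric] by (simp add: sweep_def)
 finally show ?thesis by simp
qed

text \<open>Only the slab between \<open>tt\<close> and \<open>tt + 1\<close> contributes. The
  factor keeps the tuple from its second entry on, and in a prism those entries already have
  coordinate \<open>tt + 1\<close>.\<close>

lemma sweeps_cup_aligned:
 assumes g: "!!x y. g x - g y = s*(of_bool (snd x k > tt) - of_bool (snd y k > tt))"
  and "lo k<=tt" "tt < hi k"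
 shows "sweeps k (Suc n) (cup g c) [x] = (-1)^n * s * sweeps (Suc k) n c [put k (tt + 1) x]"
proof -
 have "g (put l t x) = g x" if "l~=k" for l t x
  using g[of "put l t x" x] that by simp
 hence "sweeps (Suc k) n (cup g c) = (%ys. (-1)^n*cup g (sweeps (Suc k) n c) ys)"
  by (intro ext sweeps_cup) auto
 hence "sweeps k (Suc n) (cup g c) [x] = (-1)^n * sweep k (cup g (sweeps (Suc k) n c)) [x]"
  by (simp add: sweep_scale)
 also have "sweep k (cup g (sweeps (Suc k) n c)) [x]
   = (\<Sum>t\<in>{lo k..<hi k}. if t = tt then s * sweeps (Suc k) n c [put k (tt + 1) x] else 0)"
  unfolding sweep_cup_single g by (rule sum.cong) auto
 also have "... = s * sweeps (Suc k) n c [put k (tt + 1) x]"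
  using assms(2,3) by simp
 finally show ?thesis by simp
qed

text \<open>The sign collected when each of \<open>m\<close> factors of degree one is moved past the
  sweeps in the directions after its own; the first of \<open>Suc m\<close> factors passes
  \<open>m + n\<close> of them.\<close>

primrec aligned_sign :: "nat => nat => real"
 where
  "aligned_sign 0 n = 1"
 | "aligned_sign (Suc m) n = (-1)^(m + n)*aligned_sign m n"

lemma aligned_sign_nonzero: "aligned_sign m n~=0"
 by (induction m) auto

lemma sweeps_cups_aligned:
 assumes "!!i x y. i < length gs ==> (gs ! i) x - (gs ! i) y
   = s i*(of_bool (snd x (k + i) > tt (k + i)) - of_bool (snd y (k + i) > tt (k + i)))"
  and "!!i. i < length gs ==> lo (k + i)<=tt (k + i) & tt (k + i) < hi (k + i)"
 shows "sweeps k (length gs + n) (cups gs c) [x] = aligned_sign (length gs) n*(\<Prod>i<length gs. s i)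
  * sweeps (k + length gs) n c
    [(fst x, %l. if k<=l & l < k + length gs then tt l + 1 else snd x l)]"
 using assms
proof (induction gs arbitrary: k x s)
 case (Cons g gs)
 let ?x = "put k (tt k + 1) x"
 have "sweeps k (length (g # gs) + n) (cups (g # gs) c) [x]
   = (-1)^(length gs + n) * s 0 * sweeps (Suc k) (length gs + n) (cups gs c) [?x]"
  using sweeps_cup_aligned[where g = g and s = "s 0" and tt = "tt k" and c = "cups gs c"
    and x = x and k = k and n = "length gs + n"]
   Cons.prems(1)[of 0] Cons.prems(2)[of 0] by simp
 also have "sweeps (Suc k) (length gs + n) (cups gs c) [?x]
   = aligned_sign (length gs) n*(\<Prod>i<length gs. s (Suc i)) * sweeps (Suc k + length gs) n c
    [(fst ?x, %l. if Suc k<=l & l < Suc k + length gs then tt l + 1 else snd ?x l)]"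
  by (rule Cons.IH) (use Cons.prems[of "Suc _"] in auto)
 also have "(%l. if Suc k<=l & l < Suc k + length gs then tt l + 1 else snd ?x l)
   = (%l. if k<=l & l < k + length (g # gs) then tt l + 1 else snd x l)"
  by (auto simp: fun_eq_iff)
 finally show ?case
  by (simp add: prod.lessThan_Suc_shift del: prod.lessThan_Suc)
next
 case Nil
 have "(%l. if k<=l & l < k + length [] then tt l + 1 else snd x l) = snd x" by auto
 thus ?case by simp
qed

end

section \<open>Rational functionals of angles\<close>

interpretation rat_real: vector_space "%(q::rat) (x::real). of_rat q*x"
 by unfold_locales (simp_all add: algebra_simps of_rat_add of_rat_mult)

lemma countable_rat_span:
 assumes "finite S"
 shows "countable (rat_real.span S)"
 using assms
proof (induction S rule: finite_induct)
 case (insert a S)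
 have "rat_real.span (insert a S)\<subseteq>(%(q, x). of_rat q*a + x) ` (UNIV\<times>rat_real.span S)"
 proof
  fix x assume "x\<in>rat_real.span (insert a S)"
  then obtain k where "x - of_rat k*a\<in>rat_real.span S"
   unfolding rat_real.span_breakdown_eq by blast
  thus "x\<in>(%(q, x). of_rat q*a + x) ` (UNIV\<times>rat_real.span S)"
   by (intro image_eqI[of _ _ "(k, x - of_rat k*a)"]) auto
 qed
 thus ?case
  by (rule countable_subset) (intro countable_image countable_SIGMA insert.IH countableI_type)
qed simp

text \<open>A finite rational span is countable and the reals are not, so a further independent
  element always exists.\<close>

lemma ex_rat_independent:
 assumes "p~=0"
 shows "\<exists>S. finite S & card S = n & p\<notin>S & \<not> rat_real.dependent (insert p S)"
proof (induction n)
 case 0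
 show ?case using assms by (intro exI[of _ "{}"]) auto
next
 case (Suc n)
 then obtain S where S: "finite S" "card S = n" "p\<notin>S" "\<not> rat_real.dependent (insert p S)" by blast
 have "countable (rat_real.span (insert p S))" by (rule countable_rat_span) (use S in simp)
 hence "rat_real.span (insert p S)~=UNIV"
  using uncountable_UNIV_real by metis
 then obtain x where x: "x\<notin>rat_real.span (insert p S)" by blast
 hence "x\<notin>insert p S" using rat_real.span_base by blast
 moreover have "\<not> rat_real.dependent (insert x (insert p S))"
  using x S by (simp add: rat_real.independent_insert)
 ultimately show ?case
  using S by (intro exI[of _ "insert x S"]) (auto simp: insert_commute)
qed

text \<open>A real-linear map that kills pi is zero. The nonzero examples come from rationally
  independent families containing pi, and they are discontinuous.\<close>

definition angle_functional :: "(real => real) => bool"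
 where "angle_functional f \<longleftrightarrow> (\<forall>x y. f (x + y) = f x + f y) & f pi = 0"

lemma angle_functionalD:
 assumes "angle_functional f"
 shows "f (x + y) = f x + f y" "f pi = 0" "f 0 = 0" "f (- x) = - f x" "f (x - y) = f x - f y"
  and "f (2*pi * of_int n) = 0"
proof -
 show add: "f (x + y) = f x + f y" for x y using assms by (simp add: angle_functional_def)
 show pi0: "f pi = 0" using assms by (simp add: angle_functional_def)
 show zero: "f 0 = 0" using add[of 0 0] by simp
 show neg: "f (- x) = - f x" for x using add[of x "- x"] zero by simp
 show "f (x - y) = f x - f y" using add[of x "- y"] neg by simp
 have nat: "f (2*pi * of_nat m) = 0" for m
 proof (induction m)
  case (Suc m)
  have "2*pi * of_nat (Suc m) = 2*pi * of_nat m + (pi + pi)" by (simp add: algebra_simps)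
  thus ?case using Suc by (simp only: add pi0)
 qed (simp add: zero)
 show "f (2*pi * of_int n) = 0"
 proof (cases "n\<ge>0")
  case True
  thus ?thesis using nat[of "nat n"] by simp
 next
  case False
  hence "2*pi * of_int n = - (2*pi * of_nat (nat (- n)))" by simp
  thus ?thesis using nat[of "nat (- n)"] by (simp only: neg)
 qed
qed

text \<open>The independent family is taken together with pi, so that the dual functionals can be
  prescribed to kill pi.\<close>

lemma ex_dual_angles:
 "\<exists>(be::nat => real) La. (\<forall>j. angle_functional (La j)) &
  (\<forall>i<n. \<forall>j<n. La i (be j) = of_bool (i = j))"
proof -
 obtain S where S: "finite S" "card S = n" "pi\<notin>S" "\<not> rat_real.dependent (insert pi S)"
  using ex_rat_independent[of pi n] by auto
 obtain be where be: "bij_betw be {..<n} S"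
  using finite_same_card_bij[of "{..<n}" S] S by auto
 interpret P: vector_space_pair "%(q::rat) (x::real). of_rat q*x" "%(q::rat) (x::real). of_rat q*x" ..
 have "\<exists>g. angle_functional g & (i < n --> (\<forall>j<n. g (be j) = of_bool (i = j)))" for i
 proof -
  obtain g where g: "Vector_Spaces.linear (%(q::rat) (x::real). of_rat q*x) (%(q::rat) (x::real). of_rat q*x) g" "\<forall>x\<in>insert pi S. g x = (if i < n & x = be i then 1 else 0)"
   using P.linear_independent_extend[OF S(4), of "%x. if i < n & x = be i then 1 else 0"] by blast
  interpret G: Vector_Spaces.linear "%(q::rat) (x::real). of_rat q*x" "%(q::rat) (x::real). of_rat q*x" g
   by (rule g(1))
  have add: "g (x + y) = g x + g y" for x y by (rule G.add)
  have mem: "be j\<in>S" if "j < n" for j using be that by (auto simp: bij_betw_def)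
  have "g pi = 0" using g(2) S(3) mem[of i] by auto
  moreover have "g (be j) = of_bool (i = j)" if "i < n" "j < n" for j
   using g(2) mem[OF that(2)] be that by (auto simp: bij_betw_def inj_on_def)
  ultimately show ?thesis using add by (intro exI[of _ g]) (simp add: angle_functional_def)
 qed
 then obtain La where "\<forall>i. angle_functional (La i) & (i < n --> (\<forall>j<n. La i (be j) = of_bool (i = j)))"
  by metis
 thus ?thesis by blast
qed

lemma angle_functional_Arg_cis:
 assumes "angle_functional f"
 shows "f (Arg (cis t)) = f t"
proof -
 obtain n::int where "Arg (cis t) = t + 2*pi * of_int n"
 proof -
  have "cis (Arg (cis t)) = cis t" using cis_Arg[of "cis t"] by (simp add: sgn_eq)
  then obtain n::int where "Arg (cis t) - t = 2*pi * of_int n"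
  proof -
   assume a: "!!n. Arg (cis t) - t = 2*pi*real_of_int n ==> thesis" 
   assume "cis (Arg (cis t)) = cis t"
   hence "cos (Arg (cis t)) = cos t & sin (Arg (cis t)) = sin t"
    by (metis cis.sel)
   hence "cos t = cos (Arg (cis t)) & sin t = sin (Arg (cis t))" by simp
   then obtain m::int where "t = Arg (cis t) + 2*pi*m" using sin_cos_eq_iff by metis
   thus thesis using a[of "- m"] by simp
  qed
  thus ?thesis using that[of n] by simp
 qed
 thus ?thesis using angle_functionalD[OF assms] by simp
qed

lemma angle_functional_Arg_mult:
 assumes "angle_functional f" "z~=0"
 shows "f (Arg (cis t*z)) = f t + f (Arg z)"
proof -
 have "cis t*z = of_real (cmod z)*cis (t + Arg z)"
  using rcis_cmod_Arg[of z] unfolding rcis_def cis_mult[symmetric] by (metis mult.left_commute)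
 hence "Arg (cis t*z) = Arg (cis (t + Arg z))"
  using assms(2) by (simp add: Arg_times_of_real)
 thus ?thesis using assms angle_functional_Arg_cis angle_functionalD(1) by simp
qed

text \<open>A negative factor changes the argument by pi, which \<open>f\<close> ignores. Thus
  \<open>f\<close> of the argument is an invariant of the real line spanned by
  \<open>z\<close>.\<close>

lemma angle_functional_Arg_scale:
 assumes "angle_functional f" "z~=0" "c~=0"
 shows "f (Arg (of_real c*z)) = f (Arg z)"
proof (cases "c > 0")
 case True
 thus ?thesis by (simp add: Arg_times_of_real)
next
 case False
 hence "of_real c*z = of_real (- c)*(cis pi*z)" by simp
 hence "Arg (of_real c*z) = Arg (cis pi*z)"
  using False assms(3) Arg_times_of_real[of "- c" "cis pi*z"] by simp
 thus ?thesis using assms angle_functional_Arg_mult[of f z pi] angle_functionalD(2) by simp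
qed

lemma angle_functional_Arg_cnj:
 assumes "angle_functional f"
 shows "f (Arg (cnj z)) = - f (Arg z)"
proof (cases "z\<in>\<real>")
 case True
 hence "f (Arg z) = 0"
  using angle_functionalD[OF assms] by (auto elim!: Reals_cases simp: Arg_of_real)
 thus ?thesis using True by (simp add: Reals_cnj_iff)
next
 case False
 thus ?thesis
  using Arg_cnj[of z] angle_functionalD[OF assms] by auto
qed

section \<open>Averages over a torus of angles\<close>

definition circleM :: "real measure"
 where "circleM = uniform_measure lborel {0..<2*pi}"

definition wrap :: "real => real"
 where "wrap x = x - 2*pi * of_int \<lfloor>x/(2*pi)\<rfloor>"

lemma measurable_wrap [measurable]: "wrap\<in>borel_measurable borel"
 unfolding wrap_def by measurable

lemma wrap_shift: "wrap (x + 2*pi * of_int n) = wrap x"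
proof -
 have "(x + 2*pi * of_int n)/(2*pi) = x/(2*pi) + of_int n" by (simp add: field_simps)
 hence "\<lfloor>(x + 2*pi * of_int n)/(2*pi)\<rfloor> = \<lfloor>x/(2*pi)\<rfloor> + n" by simp
 thus ?thesis by (simp add: wrap_def algebra_simps)
qed

lemma wrap_id: "0<=x ==> x < 2*pi ==> wrap x = x"
 unfolding wrap_def by (simp add: floor_eq_iff field_simps)

lemma sets_circleM [simp, measurable_cong]: "sets circleM = sets borel"
 by (simp add: circleM_def)

lemma space_circleM [simp]: "space circleM = UNIV"
 by (simp add: circleM_def)

lemma prob_space_circleM: "prob_space circleM"
 unfolding circleM_def by (rule prob_space_uniform_measure) simp_all

abbreviation set_nn :: "(real => ennreal) => real set => ennreal"
 where "set_nn f A \<equiv> \<integral>\<^sup>+x. f x*indicator A x \<partial>lborel"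

lemma nn_integral_period:
 fixes f :: "real => ennreal"
 assumes [measurable]: "f\<in>borel_measurable borel"
  and per: "!!x n. f (x + 2*pi * of_int n) = f x"
 shows "set_nn f {a..<a + 2*pi} = set_nn f {0..<2*pi}"
proof -
 define n where "n = \<lfloor>a/(2*pi)\<rfloor>"
 define b where "b = 2*pi * of_int n"
 have "b<=a" "a < b + 2*pi"
 proof -
  have "of_int n<=a/(2*pi)" "a/(2*pi) < of_int n + 1"
   unfolding n_def by linarith+
  thus "b<=a" "a < b + 2*pi" unfolding b_def by (simp_all add: field_simps)
 qed
 have shift: "set_nn f {u + 2*pi * of_int m..<v + 2*pi * of_int m}
   = set_nn f {u..<v}" for u v m
 proof -
  have "set_nn f {u + 2*pi * of_int m..<v + 2*pi * of_int m}
    = (\<integral>\<^sup>+x. f (2*pi * of_int m + 1*x)*indicator {u + 2*pi * of_int m..<v + 2*pi * of_int m} (2*pi * of_int m + 1*x) \<partial>lborel)"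
   by (subst nn_integral_real_affine[where c = 1 and t = "2*pi * of_int m"]) auto
  also have "... = set_nn f {u..<v}"
  proof (rule nn_integral_cong)
   fix x::real
   have "f (2*pi * of_int m + 1*x) = f x" using per[of x m] by (simp add: add.commute)
   moreover have "indicator {u + 2*pi * of_int m..<v + 2*pi * of_int m} (2*pi * of_int m + 1*x) = (indicator {u..<v} x::ennreal)"
    by (auto simp: indicator_def)
   ultimately show "f (2*pi * of_int m + 1*x)*indicator {u + 2*pi * of_int m..<v + 2*pi * of_int m} (2*pi * of_int m + 1*x) = f x*indicator {u..<v} x" by simp
  qed
  finally show ?thesis .
 qed
 have split: "set_nn f {u..<w}
   = set_nn f {u..<v} + set_nn f {v..<w}"
  if "u<=v" "v<=w" for u v w
 proof -
  have "set_nn f {u..<w}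
    = (\<integral>\<^sup>+x. f x*indicator {u..<v} x + f x*indicator {v..<w} x \<partial>lborel)"
   by (rule nn_integral_cong) (use that in \<open>auto simp: indicator_def\<close>)
  also have "... = set_nn f {u..<v} + set_nn f {v..<w}"
   by (rule nn_integral_add) auto
  finally show ?thesis .
 qed
 have "set_nn f {a..<a + 2*pi}
   = set_nn f {a..<b + 2*pi} + set_nn f {b + 2*pi * of_int 1..<a + 2*pi * of_int 1}"
  using split[of a "b + 2*pi" "a + 2*pi"] \<open>b<=a\<close> \<open>a < b + 2*pi\<close> by simp
 also have "set_nn f {b + 2*pi * of_int 1..<a + 2*pi * of_int 1}
   = set_nn f {b..<a}" by (rule shift)
 also have "set_nn f {a..<b + 2*pi} + set_nn f {b..<a}
   = set_nn f {b..<b + 2*pi}"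
  using split[of b a "b + 2*pi"] \<open>b<=a\<close> \<open>a < b + 2*pi\<close> by (simp add: add.commute)
 also have "... = set_nn f {0..<2*pi}"
  using shift[of 0 n "2*pi"] by (simp add: b_def add.commute)
 finally show ?thesis .
qed

text \<open>By periodicity all half-open intervals of length 2 pi carry the same integral. A
  reflection yields an interval closed at the other end, which differs by null sets.\<close>

lemma distr_circleM:
 assumes "s = 1 | s = -1"
 shows "distr circleM circleM (%x. wrap (a + s*x)) = circleM"
proof (rule measure_eqI)
 let ?I = "{0..<2*pi}"
 let ?w = "%x. wrap (a + s*x)"
 fix A assume "A\<in>sets (distr circleM circleM ?w)"
 hence A [measurable]: "A\<in>sets borel" by simp
 define f :: "real => ennreal" where "f = (%x. indicator A (wrap x))"
 have f [measurable]: "f\<in>borel_measurable borel" unfolding f_def by measurable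
 have per: "f (x + 2*pi * of_int n) = f x" for x n by (simp add: f_def wrap_shift)
 have circ: "emeasure circleM B
   = set_nn (indicator B) ?I/emeasure lborel ?I"
  if [measurable]: "B\<in>sets borel" for B
 proof -
  have "emeasure circleM B = emeasure lborel (?I\<inter>B)/emeasure lborel ?I"
   unfolding circleM_def by (rule emeasure_uniform_measure) auto
  also have "emeasure lborel (?I\<inter>B) = (\<integral>\<^sup>+x. indicator (?I\<inter>B) x \<partial>lborel)"
   by (rule nn_integral_indicator[symmetric]) auto
  also have "... = set_nn (indicator B) ?I"
   by (rule nn_integral_cong) (auto simp: indicator_def)
  finally show ?thesis .
 qed
 have "emeasure (distr circleM circleM ?w) A
   = emeasure circleM (?w -` A)"
  by (subst emeasure_distr) (auto simp: A)
 also have "... = set_nn (%x. f (a + s*x)) ?I/emeasure lborel ?I"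
 proof -
  have "?w -` A\<in>sets borel"
   using measurable_sets[of "?w" borel borel A] by simp
  hence "emeasure circleM (?w -` A)
    = (\<integral>\<^sup>+x. indicator (?w -` A) x*indicator ?I x \<partial>lborel)/emeasure lborel ?I"
   by (rule circ)
  thus ?thesis by (simp add: f_def indicator_def)
 qed
 also have "set_nn (%x. f (a + s*x)) ?I
   = set_nn f ?I"
 proof (cases "s = 1")
  case True
  have "set_nn f ?I = set_nn f {a..<a + 2*pi}"
   by (rule nn_integral_period[symmetric]) (auto simp: per)
  also have "... = (\<integral>\<^sup>+x. f (a + 1*x)*indicator {a..<a + 2*pi} (a + 1*x) \<partial>lborel)"
   by (subst nn_integral_real_affine[where c = 1 and t = a]) auto
  also have "... = set_nn (%x. f (a + s*x)) ?I"
   by (rule nn_integral_cong) (auto simp: indicator_def True)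
  finally show ?thesis by simp
 next
  case False
  hence s: "s = -1" using assms by simp
  have "set_nn f ?I
    = set_nn f {a - 2*pi..<(a - 2*pi) + 2*pi}"
   by (rule nn_integral_period[symmetric]) (auto simp: per)
  also have "... = set_nn f {a - 2*pi<..a}"
  proof (rule nn_integral_cong_AE)
   have "AE x in lborel. x~=a" "AE x in lborel. x~=a - 2*pi"
    by (rule AE_lborel_singleton)+
   thus "AE x in lborel. f x*indicator {a - 2*pi..<a - 2*pi + 2*pi} x = f x*indicator {a - 2*pi<..a} x"
    by eventually_elim (auto simp: indicator_def)
  qed
  also have "... = (\<integral>\<^sup>+x. f (a + (-1)*x)*indicator {a - 2*pi<..a} (a + (-1)*x) \<partial>lborel)"
   by (subst nn_integral_real_affine[where c = "-1" and t = a]) auto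
  also have "... = set_nn (%x. f (a + s*x)) ?I"
   by (rule nn_integral_cong) (auto simp: indicator_def s)
  finally show ?thesis by simp
 qed
 also have "set_nn f ?I = set_nn (indicator A) ?I"
  by (rule nn_integral_cong) (auto simp: f_def indicator_def wrap_id)
 also have "... / emeasure lborel ?I = emeasure circleM A" by (rule circ[symmetric]) simp
 finally show "emeasure (distr circleM circleM ?w) A = emeasure circleM A" .
qed simp

definition torusM :: "nat => vec measure"
 where "torusM r = PiM {..<r} (%_. circleM)"

lemma prob_space_torusM: "prob_space (torusM r)"
 unfolding torusM_def by (intro prob_space_PiM prob_space_circleM)

lemma distr_torusM:
 assumes s: "!!i. s i = 1 | s i = (-1::real)"
 shows "distr (torusM r) (torusM r) (%tt. \<lambda>i\<in>{..<r}. wrap (aa i + s i * tt i)) = torusM r"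
  (is "distr _ _ ?T = _")
proof -
 let ?M = "PiM {..<r} (%_. circleM)"
 interpret C: prob_space circleM by (rule prob_space_circleM)
 interpret product_sigma_finite "%_::nat. circleM" ..
 have T [measurable]: "?T\<in>?M \<rightarrow>\<^sub>M ?M"
  by measurable
 show ?thesis unfolding torusM_def
 proof (rule PiM_eqI)
  fix A assume A: "!!i. i\<in>{..<r} ==> A i\<in>sets circleM"
  let ?B = "%i. (%x. wrap (aa i + s i*x)) -` A i"
  have B: "?B i\<in>sets circleM" if "i < r" for i
  proof -
   have "(%x. wrap (aa i + s i*x))\<in>circleM \<rightarrow>\<^sub>M circleM" by measurable
   from measurable_sets[OF this, of "A i"] A that show ?thesis by simp
  qed
  have "emeasure (distr ?M ?M ?T) (Pi\<^sub>E {..<r} A)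
    = emeasure ?M (?T -` Pi\<^sub>E {..<r} A\<inter>space ?M)"
   using A by (intro emeasure_distr T sets_PiM_I_finite) auto
  also have "?T -` Pi\<^sub>E {..<r} A\<inter>space ?M = Pi\<^sub>E {..<r} ?B"
   by (auto simp: space_PiM PiE_def Pi_def)
  also have "emeasure ?M (Pi\<^sub>E {..<r} ?B) = (\<Prod>i<r. emeasure circleM (?B i))"
   using B by (intro emeasure_PiM) auto
  also have "... = (\<Prod>i<r. emeasure circleM (A i))"
  proof (rule prod.cong[OF refl])
   fix i assume i: "i\<in>{..<r}"
   have "emeasure circleM (A i) = emeasure (distr circleM circleM (%x. wrap (aa i + s i*x))) (A i)"
    by (simp only: distr_circleM[OF s])
   also have "... = emeasure circleM (?B i)"
    using A[OF i] by (subst emeasure_distr) auto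
   finally show "emeasure circleM (?B i) = emeasure circleM (A i)" by simp
  qed
  finally show "emeasure (distr ?M ?M ?T) (Pi\<^sub>E {..<r} A)
    = (\<Prod>i\<in>{..<r}. emeasure circleM (A i))" .
 qed auto
qed

text \<open>Meant for the average in the Thom cochain: turning the frame translates or reflects the
  angles that are integrated over.\<close>

lemma integral_torus_shift:
 fixes F :: "vec => real"
 assumes s: "!!i. s i = 1 | s i = (-1::real)"
  and [measurable]: "F\<in>borel_measurable (torusM r)"
  and F: "!!tt tt'. (!!i. i < r ==> wrap (tt i) = wrap (tt' i)) ==> F tt = F tt'"
 shows "(\<integral>tt. F (%i. aa i + s i * tt i) \<partial>torusM r) = (\<integral>tt. F tt \<partial>torusM r)"
proof -
 let ?T = "%tt. \<lambda>i\<in>{..<r}. wrap (aa i + s i * tt i)"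
 have T [measurable]: "?T\<in>torusM r \<rightarrow>\<^sub>M torusM r"
  unfolding torusM_def by measurable
 have ww: "wrap (wrap x) = wrap x" for x
  using wrap_shift[of x "- \<lfloor>x/(2*pi)\<rfloor>"] by (simp add: wrap_def)
 have "(\<integral>tt. F tt \<partial>torusM r) = (\<integral>tt. F tt \<partial>distr (torusM r) (torusM r) ?T)"
  by (simp add: distr_torusM[OF s])
 also have "... = (\<integral>tt. F (?T tt) \<partial>torusM r)"
  by (rule integral_distr) measurable
 also have "... = (\<integral>tt. F (%i. aa i + s i * tt i) \<partial>torusM r)"
  by (intro Bochner_Integration.integral_cong refl F) (simp add: ww)
 finally show ?thesis by simp
qed

section \<open>Sweeps of pulled back, summed and averaged cochains\<close>

context box
begin

lemma sweeps_map:
 assumes "!!l t x. f (put l t x) = put l t (f x)"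
 shows "sweeps k n c (map f xs) = sweeps k n (%ys. c (map f ys)) xs"
proof (induction n arbitrary: k xs)
 case (Suc n)
 have "sweeps k (Suc n) c (map f xs)
   = (\<Sum>t\<in>{lo k..<hi k}. prism (put k t) (put k (t + 1)) (%ys. sweeps (Suc k) n c (map f ys)) xs)"
  unfolding sweeps.simps sweep_def
  by (rule sum.cong[OF refl], rule prism_map) (simp_all add: assms)
 thus ?case by (simp add: Suc sweep_def)
qed simp

lemma sweeps_sum: "sweeps k n (%ys. \<Sum>i\<in>I. c i ys) xs = (\<Sum>i\<in>I. sweeps k n (c i) xs)"
proof (induction I rule: infinite_finite_induct)
 case (insert i I)
 have "sweeps k n (%ys. \<Sum>j\<in>insert i I. c j ys) xs
   = sweeps k n (%ys. c i ys - - 1*(\<Sum>j\<in>I. c j ys)) xs"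
  using insert by (simp add: add.commute)
 also have "... = sweeps k n (c i) xs - - 1 * sweeps k n (%ys. \<Sum>j\<in>I. c j ys) xs"
  by (simp only: sweeps_diff sweeps_scale)
 finally show ?case using insert by simp
qed (simp_all add: sweeps_zero)

lemma sweeps_cups:
 assumes "!!g l t x. g\<in>set gs ==> m<=l ==> l < m + n ==> g (put l t x) = g x"
 shows "sweeps m n (cups gs c) xs = (-1)^(n*length gs)*cups gs (sweeps m n c) xs"
 using assms
proof (induction gs arbitrary: xs)
 case (Cons g gs)
 have "sweeps m n (cups (g # gs) c) xs = (-1)^n*cup g (sweeps m n (cups gs c)) xs"
  unfolding cups_simps by (rule sweeps_cup) (use Cons.prems in auto)
 also have "cup g (sweeps m n (cups gs c)) xs = cup g (%ys. (-1)^(n*length gs)*cups gs (sweeps m n c) ys) xs"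
  by (rule cup_cong[OF _ refl], rule Cons.IH) (use Cons.prems in auto)
 also have "... = (-1)^(n*length gs)*cup g (cups gs (sweeps m n c)) xs"
  by (cases xs rule: remdups_adj.cases) auto
 finally show ?case by (simp add: power_add)
qed simp

lemma prism_integral:
 assumes "!!ys. integrable M (%tt. c tt ys)"
 shows "integrable M (%tt. prism a b (c tt) xs)"
  and "(\<integral>tt. prism a b (c tt) xs \<partial>M) = prism a b (%ys. \<integral>tt. c tt ys \<partial>M) xs"
proof -
 have "integrable M (%tt. prism a b (c tt) xs) &
   (\<integral>tt. prism a b (c tt) xs \<partial>M) = prism a b (%ys. \<integral>tt. c tt ys \<partial>M) xs"
  using assms
 proof (induction xs arbitrary: c)
  case (Cons x xs)
  from Cons.IH[of "%tt ys. c tt (a x # ys)"] Cons.prems show ?case by auto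
 qed simp
 thus "integrable M (%tt. prism a b (c tt) xs)"
  and "(\<integral>tt. prism a b (c tt) xs \<partial>M) = prism a b (%ys. \<integral>tt. c tt ys \<partial>M) xs" by auto
qed

lemma sweeps_integral:
 assumes "!!ys. integrable M (%tt. c tt ys)"
 shows "integrable M (%tt. sweeps k n (c tt) xs)"
  and "(\<integral>tt. sweeps k n (c tt) xs \<partial>M) = sweeps k n (%ys. \<integral>tt. c tt ys \<partial>M) xs"
proof -
 have "(\<forall>xs. integrable M (%tt. sweeps k n (c tt) xs)) &
   (\<forall>xs. (\<integral>tt. sweeps k n (c tt) xs \<partial>M) = sweeps k n (%ys. \<integral>tt. c tt ys \<partial>M) xs)"
 proof (induction n arbitrary: k)
  case (Suc n)
  have I: "integrable M (%tt. sweeps (Suc k) n (c tt) ys)" for ys using Suc by blast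
  have E: "(%ys. \<integral>tt. sweeps (Suc k) n (c tt) ys \<partial>M) = sweeps (Suc k) n (%ys. \<integral>tt. c tt ys \<partial>M)"
   using Suc by blast
  have P: "integrable M (%tt. prism (put k t) (put k (t + 1)) (sweeps (Suc k) n (c tt)) xs)" for t xs
   by (rule prism_integral(1)[OF I])
  have "(\<integral>tt. sweeps k (Suc n) (c tt) xs \<partial>M) = sweeps k (Suc n) (%ys. \<integral>tt. c tt ys \<partial>M) xs" for xs
   unfolding sweeps.simps sweep_def
   by (subst Bochner_Integration.integral_sum[OF P])
    (simp only: prism_integral(2)[where c = "%tt. sweeps (Suc k) n (c tt)", OF I] E)
  moreover have "integrable M (%tt. sweeps k (Suc n) (c tt) xs)" for xs
   unfolding sweeps.simps sweep_def by (rule Bochner_Integration.integrable_sum[OF P])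
  ultimately show ?case by blast
 qed (use assms in auto)
 thus "integrable M (%tt. sweeps k n (c tt) xs)"
  and "(\<integral>tt. sweeps k n (c tt) xs \<partial>M) = sweeps k n (%ys. \<integral>tt. c tt ys \<partial>M) xs" by auto
qed

end

text \<open>Needed because a deformation adds a time direction to the box, which the sweeps over its
  two ends do not see.\<close>

lemma sweeps_box_cong:
 assumes "box lo hi" "box lo' hi'" "!!l. k<=l ==> l < k + n ==> lo l = lo' l & hi l = hi' l"
 shows "box.sweeps lo hi k n c = box.sweeps lo' hi' k n c"
 using assms(3)
proof (induction n arbitrary: k)
 case (Suc n)
 have e: "box.sweeps lo hi (Suc k) n c = box.sweeps lo' hi' (Suc k) n c"
  by (rule Suc.IH) (use Suc.prems in auto)
 have "lo k = lo' k" "hi k = hi' k" using Suc.prems[of k] by auto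
 thus ?case
  unfolding box.sweeps.simps[OF assms(1)] box.sweeps.simps[OF assms(2)] e
   box.sweep_def[OF assms(1), abs_def] box.sweep_def[OF assms(2), abs_def] by simp
qed (simp add: box.sweeps.simps[OF assms(1)] box.sweeps.simps[OF assms(2)])

section \<open>A Thom cochain for complements of flat bundles of planes\<close>

definition turn_cos :: "vec => nat set => nat => real"
 where "turn_cos tt E l = (if even l then cos (tt (l div 2))
  else if l div 2\<in>E then sin (tt (l div 2)) else - sin (tt (l div 2)))"

definition turn_sin :: "vec => nat set => nat => real"
 where "turn_sin tt E l = (if even l then sin (tt (l div 2))
  else if l div 2\<in>E then - cos (tt (l div 2)) else cos (tt (l div 2)))"

(* rotate the i-th pair of vectors by the angle tt i, and reflect it if i\<in>E *)
definition turn :: "vec => nat set => (nat => vec) => nat => nat => real"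
 where "turn tt E A = (%l j. turn_cos tt E l*A (2*(l div 2)) j + turn_sin tt E l*A (2*(l div 2) + 1) j)"

lemma turn_turn:
 "turn tt E (turn aa E' A) = turn (%i. aa i + (if i\<in>E' then -1 else 1) * tt i) ((E - E')\<union>(E' - E)) A"
proof (intro ext)
 fix l j::nat
 define i where "i = l div 2"
 have "l = 2*i | l = 2*i + 1" unfolding i_def by presburger
 thus "turn tt E (turn aa E' A) l j
   = turn (%i. aa i + (if i\<in>E' then -1 else 1) * tt i) ((E - E')\<union>(E' - E)) A l j"
  by (elim disjE; cases "i\<in>E"; cases "i\<in>E'")
   (simp_all add: turn_def turn_cos_def turn_sin_def cos_add sin_add cos_diff sin_diff algebra_simps)
qed

text \<open>A point of the complement bundle in coordinates: \<open>fst p\<close> lists the images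
  of an orthonormal frame, \<open>snd p\<close> is the vector in the orthogonal complement.\<close>

definition orthonormal_pt :: "nat => nat => framed => bool"
 where "orthonormal_pt N d p \<longleftrightarrow>
  (\<forall>l<d. \<forall>l'<d. (\<Sum>j<N. fst p l j*fst p l' j) = of_bool (l = l')) &
  (\<forall>l<d. (\<Sum>j<N. snd p j*fst p l j) = 0)"

lemma orthonormal_pt_turn:
 assumes "orthonormal_pt N (2*r) p"
 shows "orthonormal_pt N (2*r) (turn tt E (fst p), snd p)"
proof -
 let ?A = "fst p"
 have S: "(\<Sum>j<N. (a*?A l j + b*?A m j)*(c*?A l' j + d*?A m' j))
   = a*c * of_bool (l = l') + a*d * of_bool (l = m') + b*c * of_bool (m = l') + b*d * of_bool (m = m')"
  if "l < 2*r" "m < 2*r" "l' < 2*r" "m' < 2*r" for a b c d l m l' m'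
 proof -
  have "(\<Sum>j<N. (a*?A l j + b*?A m j)*(c*?A l' j + d*?A m' j))
   = a*c*(\<Sum>j<N. ?A l j*?A l' j) + a*d*(\<Sum>j<N. ?A l j*?A m' j)
    + b*c*(\<Sum>j<N. ?A m j*?A l' j) + b*d*(\<Sum>j<N. ?A m j*?A m' j)"
   by (simp add: sum_distrib_left sum.distrib[symmetric] algebra_simps)
  thus ?thesis using assms that by (simp add: orthonormal_pt_def)
 qed
 have b: "2*(l div 2) < 2*r" "2*(l div 2) + 1 < 2*r" if "l < 2*r" for l
  using that by presburger+
 have "(\<Sum>j<N. turn tt E ?A l j * turn tt E ?A l' j) = of_bool (l = l')" if l: "l < 2*r" "l' < 2*r" for l l'
 proof -
  define i i' where "i = l div 2" and "i' = l' div 2"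
  have ii: "l = 2*i | l = 2*i + 1" "l' = 2*i' | l' = 2*i' + 1"
   unfolding i_def i'_def by presburger+
  have "(\<Sum>j<N. turn tt E ?A l j * turn tt E ?A l' j)
   = turn_cos tt E l * turn_cos tt E l' * of_bool (2*i = 2*i')
   + turn_cos tt E l * turn_sin tt E l' * of_bool (2*i = 2*i' + 1)
   + turn_sin tt E l * turn_cos tt E l' * of_bool (2*i + 1 = 2*i')
   + turn_sin tt E l * turn_sin tt E l' * of_bool (2*i + 1 = 2*i' + 1)"
   unfolding turn_def i_def i'_def by (rule S) (use b l in auto)
  also have "... = (turn_cos tt E l * turn_cos tt E l' + turn_sin tt E l * turn_sin tt E l') * of_bool (i = i')"
  proof -
   have "2*i~=2*i' + 1" "2*i + 1~=2*i'" by presburger+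
   thus ?thesis by (simp add: algebra_simps)
  qed
  also have "... = of_bool (l = l')"
  proof -
   have *: "sin x * sin x + cos x*cos x = 1" "cos x*cos x + sin x * sin x = 1" for x::real
    using sin_cos_squared_add[of x] by (simp_all add: power2_eq_square algebra_simps)
   show ?thesis
    using ii by (elim disjE; cases "i = i'"; cases "i\<in>E")
     (auto simp: turn_cos_def turn_sin_def * )
  qed
  finally show ?thesis .
 qed
 moreover have "(\<Sum>j<N. snd p j * turn tt E ?A l j) = 0" if "l < 2*r" for l
 proof -
  have "(\<Sum>j<N. snd p j * turn tt E ?A l j) = turn_cos tt E l*(\<Sum>j<N. snd p j*?A (2*(l div 2)) j)
    + turn_sin tt E l*(\<Sum>j<N. snd p j*?A (2*(l div 2) + 1) j)"
   by (simp add: turn_def sum_distrib_left sum.distrib[symmetric] algebra_simps)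
  thus ?thesis using assms b[OF that] by (simp add: orthonormal_pt_def)
 qed
 ultimately show ?thesis by (simp add: orthonormal_pt_def)
qed

definition close_pts :: "nat => nat => real => framed set => bool"
 where "close_pts N d ka P \<longleftrightarrow> (\<forall>p\<in>P. orthonormal_pt N d p) &
  (\<forall>p\<in>P. \<forall>p'\<in>P. \<forall>j<N. \<bar>snd p j - snd p' j\<bar><=ka & (\<forall>l<d. \<bar>fst p l j - fst p' l j\<bar><=ka))"

text \<open>A turned vector combines two old ones with coefficients bounded by 1, whence the factor
  2.\<close>

lemma close_pts_turn:
 assumes "close_pts N (2*r) ka P" "0<=ka"
 shows "close_pts N (2*r) (2 * ka) ((%p. (turn tt E (fst p), snd p)) ` P)"
proof -
 have b: "2*(l div 2) < 2*r" "2*(l div 2) + 1 < 2*r" if "l < 2*r" for l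
  using that by presburger+
 have c: "\<bar>turn_cos tt E l\<bar><=1" "\<bar>turn_sin tt E l\<bar><=1" for l
  by (auto simp: turn_cos_def turn_sin_def)
 have "\<bar>turn tt E (fst p) l j - turn tt E (fst p') l j\<bar><=2 * ka"
  if "p\<in>P" "p'\<in>P" "l < 2*r" "j < N" for p p' l j
 proof -
  have "\<bar>turn tt E (fst p) l j - turn tt E (fst p') l j\<bar>
   = \<bar>turn_cos tt E l*(fst p (2*(l div 2)) j - fst p' (2*(l div 2)) j)
    + turn_sin tt E l*(fst p (2*(l div 2) + 1) j - fst p' (2*(l div 2) + 1) j)\<bar>"
   by (simp add: turn_def algebra_simps)
  also have "...<=\<bar>turn_cos tt E l\<bar>*\<bar>fst p (2*(l div 2)) j - fst p' (2*(l div 2)) j\<bar>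
    + \<bar>turn_sin tt E l\<bar>*\<bar>fst p (2*(l div 2) + 1) j - fst p' (2*(l div 2) + 1) j\<bar>"
   by (rule order_trans[OF abs_triangle_ineq]) (simp add: abs_mult)
  also have "...<=1 * ka + 1 * ka"
   using assms that b[OF \<open>l < 2*r\<close>] by (intro add_mono mult_mono c) (auto simp: close_pts_def)
  finally show ?thesis by simp
 qed
 moreover have "\<bar>snd p j - snd p' j\<bar><=2 * ka" if "p\<in>P" "p'\<in>P" "j < N" for p p' j
  using assms that unfolding close_pts_def by (smt (verit, best))
 moreover have "orthonormal_pt N (2*r) (turn tt E (fst p), snd p)" if "p\<in>P" for p
  using assms that by (intro orthonormal_pt_turn) (simp add: close_pts_def)
 ultimately show ?thesis unfolding close_pts_def ball_simps fst_conv snd_conv by blast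
qed

lemma coboundary_integral:
 assumes "!!ys. integrable M (%tt. c tt ys)"
 shows "integrable M (%tt. coboundary (c tt) xs)
  & coboundary (%ys. \<integral>tt. c tt ys \<partial>M) xs = (\<integral>tt. coboundary (c tt) xs \<partial>M)"
 using assms
proof (induction xs arbitrary: c)
 case (Cons x xs)
 from Cons.IH[of "%tt ys. c tt (x # ys)"] Cons.prems show ?case by auto
qed simp

lemma cups_zero: "cups gs (%_. 0) xs = 0"
 using cups_nonzeroD(2)[of gs "%_. 0" xs] by auto

lemma coboundary_cups_one:
 assumes "length xs = length gs + 2"
 shows "coboundary (cups gs (%_. 1)) xs = 0"
proof -
 have "coboundary (cups gs (%_. 1)) xs = (-1)^length gs*cups gs (coboundary (%_. 1)) xs"
  by (rule coboundary_cups) (use assms in simp)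
 also have "cups gs (coboundary (%_. 1)) xs = cups gs (%_. 0) xs"
  by (rule cups_cong) (use assms in \<open>simp add: coboundary_const\<close>)
 finally show ?thesis by (simp add: cups_zero)
qed

lemma sum_mult_self: "(\<Sum>l<n. f l)*(\<Sum>l<n. f l) = (\<Sum>l<n. \<Sum>l'<n. f l*(f l'::real))"
 by (simp add: sum_product)

lemma orthonormal_pt_norm:
 assumes "orthonormal_pt N d p"
 shows "(\<Sum>j<N. (snd p j + (\<Sum>l<d. v l*fst p l j))\<^sup>2) = (\<Sum>l<d. (v l)\<^sup>2) + (\<Sum>j<N. (snd p j)\<^sup>2)"
proof -
 have "(\<Sum>j<N. (snd p j + (\<Sum>l<d. v l*fst p l j))\<^sup>2)
   = (\<Sum>j<N. (snd p j)\<^sup>2) + 2*(\<Sum>j<N. \<Sum>l<d. v l*(snd p j*fst p l j))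
    + (\<Sum>j<N. \<Sum>l<d. \<Sum>l'<d. v l * v l'*(fst p l j*fst p l' j))"
  by (simp add: power2_sum sum.distrib sum_distrib_left sum_mult_self power2_eq_square[of "\<Sum>l<d. _ l"] algebra_simps)
 also have "(\<Sum>j<N. \<Sum>l<d. v l*(snd p j*fst p l j)) = (\<Sum>l<d. v l*(\<Sum>j<N. snd p j*fst p l j))"
  by (subst sum.swap) (simp add: sum_distrib_left)
 also have "... = 0" using assms by (simp add: orthonormal_pt_def)
 also have "(\<Sum>j<N. \<Sum>l<d. \<Sum>l'<d. v l * v l'*(fst p l j*fst p l' j))
   = (\<Sum>l<d. \<Sum>l'<d. v l * v l'*(\<Sum>j<N. fst p l j*fst p l' j))"
  by (subst sum.swap, rule sum.cong[OF refl], subst sum.swap) (simp add: sum_distrib_left)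
 also have "... = (\<Sum>l<d. \<Sum>l'<d. if l' = l then (v l)\<^sup>2 else 0)"
  using assms by (intro sum.cong refl) (auto simp: orthonormal_pt_def power2_eq_square)
 also have "... = (\<Sum>l<d. (v l)\<^sup>2)" by simp
 finally show ?thesis by simp
qed

text \<open>\<open>ka\<close> bounds the oscillation of frame and vector over a tuple,
  \<open>1/L\<close> is the mesh in the fibre. The squared bracket in \<open>fine\<close> bounds the
  oscillation of one ambient coordinate after a turn, which doubles \<open>ka\<close>; if all
  \<open>N\<close> coordinates are that small, the point is closer than 1/2 to the origin.\<close>

locale thom_data =
 fixes r N L::nat and ka::real
 assumes rN: "2*r<=N" and L_pos: "0 < L" and ka_pos: "0 < ka"
  and fine: "real N*(2 * ka*(1 + 2*real r) + 2*real r/real L)\<^sup>2 < 1/4"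
begin

abbreviation (input) dd :: nat
  where "dd \<equiv> 2*r"

sublocale grid: box "%_. - int L" "%_. int L"
 using L_pos by unfold_locales simp

text \<open>The ambient point with complement component \<open>w\<close> and coordinates n/L in
  [-1, 1] along the frame; complement and span of the frame together fill \<real>^N.\<close>

definition zcoord :: "nat => framed\<times>ivec => real"
 where "zcoord j x = snd (fst x) j + (\<Sum>l<dd. of_int (snd x l)/real L*fst (fst x) l j)"

definition positive :: "nat => framed\<times>ivec => real"
 where "positive j x = of_bool (zcoord j x > 0)"

text \<open>The complement axes come first: for a turned standard frame their factors do not involve
  the fibre coordinates and can be moved out of the fibre sweep.\<close>

definition axes :: "nat list"
 where "axes = [dd..<N] @ [0..<dd]"

lemma axes_simps [simp]: "length axes = N" "set axes = {..<N}"
 using rN by (auto simp: axes_def)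

text \<open>The product of the sign jumps of all ambient coordinates represents the generator of the
  cohomology of \<real>^N relative to the complement of the origin. Integration over the cube in the
  span of the frame leaves a cochain of degree N - 2 r.\<close>

definition raw_thom :: "framed list => real"
 where "raw_thom ps = grid.sweeps 0 dd (cups (map positive axes) (%_. 1)) (map (%p. (p, %_. 0)) ps)"

definition turn_pt :: "vec => nat set => framed => framed"
 where "turn_pt tt E p = (turn tt E (fst p), snd p)"

definition thom :: "framed list => real"
 where "thom ps = (\<Sum>E\<in>Pow {..<r}. (-1)^card E*(\<integral>tt. raw_thom (map (turn_pt tt E) ps) \<partial>torusM r))"

text \<open>Every ambient coordinate changes sign within the tuple and oscillates by at most
  \<open>D\<close>, so it is at most \<open>D\<close> in absolute value at every vertex.
  Orthonormality splits the resulting norm estimate into fibre and complement.\<close>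

lemma cups_positive_small:
 assumes close: "close_pts N dd (2 * ka) (fst ` set ys)"
  and bound: "!!x l. x\<in>set ys ==> l < dd ==> \<bar>snd x l\<bar><=int L"
  and near: "!!x y l. x\<in>set ys ==> y\<in>set ys ==> l < dd ==> \<bar>snd x l - snd y l\<bar><=1"
  and nz: "cups (map positive axes) c ys~=0"
  and u: "u\<in>set ys"
 shows "(\<Sum>l<dd. (of_int (snd u l)/real L)\<^sup>2) + (\<Sum>j<N. (snd (fst u) j)\<^sup>2) < 1/4"
proof -
 define D where "D = 2 * ka*(1 + 2*real r) + 2*real r/real L"
 have "0<=D" unfolding D_def using ka_pos by (intro add_nonneg_nonneg mult_nonneg_nonneg) auto
 have on: "orthonormal_pt N dd (fst x)" if "x\<in>set ys" for x
  using close that by (auto simp: close_pts_def)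
 have A1: "\<bar>fst (fst x) l j\<bar><=1" if "x\<in>set ys" "l < dd" "j < N" for x l j
 proof -
  have "(fst (fst x) l j)\<^sup>2<=(\<Sum>j<N. (fst (fst x) l j)\<^sup>2)"
   by (rule member_le_sum) (use that in auto)
  also have "... = 1" using on[OF that(1)] that(2) by (simp add: orthonormal_pt_def power2_eq_square)
  finally show ?thesis by (simp add: abs_square_le_1)
 qed
 have diff: "\<bar>zcoord j x - zcoord j y\<bar><=D" if x: "x\<in>set ys" and y: "y\<in>set ys" and j: "j < N" for x y j
 proof -
  let ?h = "%l. of_int (snd x l)/real L*(fst (fst x) l j - fst (fst y) l j)
      + of_int (snd x l - snd y l)/real L*fst (fst y) l j"
  have eq: "zcoord j x - zcoord j y = (snd (fst x) j - snd (fst y) j)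
    + (\<Sum>l<dd. ?h l)"
   by (simp add: zcoord_def sum_subtractf[symmetric] sum.distrib[symmetric] algebra_simps diff_divide_distrib)
  have "\<bar>zcoord j x - zcoord j y\<bar><=\<bar>snd (fst x) j - snd (fst y) j\<bar>
    + (\<Sum>l<dd. \<bar>?h l\<bar>)"
   unfolding eq by (rule order_trans[OF abs_triangle_ineq]) (rule add_left_mono[OF sum_abs])
  also have "...<=2 * ka + (\<Sum>l<dd. 2 * ka + 1/real L)"
  proof (rule add_mono[OF _ sum_mono])
   show "\<bar>snd (fst x) j - snd (fst y) j\<bar><=2 * ka"
    using close x y j by (auto simp: close_pts_def)
  next
   fix l assume l: "l\<in>{..<dd}"
   have 1: "\<bar>of_int (snd x l)/real L\<bar><=1"
    using bound x l of_int_le_iff lessThan_iff L_pos by fastforce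
   have 2: "\<bar>of_int (snd x l - snd y l)/real L\<bar><=1/real L"
    using near x y l of_int_le_iff lessThan_iff L_pos of_int_diff by (fastforce simp: abs_divide divide_right_mono)
   have 3: "\<bar>fst (fst x) l j - fst (fst y) l j\<bar><=2 * ka"
    using close x y j l by (auto simp: close_pts_def)
   have "\<bar>?h l\<bar>
    <=\<bar>of_int (snd x l)/real L\<bar>*\<bar>fst (fst x) l j - fst (fst y) l j\<bar>
      + \<bar>of_int (snd x l - snd y l)/real L\<bar>*\<bar>fst (fst y) l j\<bar>"
    by (rule order_trans[OF abs_triangle_ineq]) (simp add: abs_mult)
   also have "...<=1*(2 * ka) + 1/real L*1"
    using mult_mono[OF 1 3] mult_mono[OF 2 A1[OF y _ j, of l]] l L_pos by simp
   finally show "\<bar>?h l\<bar><=2 * ka + 1/real L" by simp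
  qed
  also have "... = D" by (simp add: D_def algebra_simps)
  finally show ?thesis .
 qed
 have small: "(zcoord j u)\<^sup>2<=D\<^sup>2" if j: "j < N" for j
 proof -
  obtain x y where x: "x\<in>set ys" and y: "y\<in>set ys" and xy: "positive j x~=positive j y"
   using cups_nonzeroD(1)[OF nz] j by force
  have "zcoord j x > 0 & \<not> zcoord j y > 0 | zcoord j y > 0 & \<not> zcoord j x > 0"
   using xy by (auto simp: positive_def)
  hence "\<bar>zcoord j u\<bar><=D" using diff[OF u x j] diff[OF u y j] by linarith
  thus ?thesis using \<open>0<=D\<close> by (simp add: abs_le_square_iff[symmetric])
 qed
 have "(\<Sum>l<dd. (of_int (snd u l)/real L)\<^sup>2) + (\<Sum>j<N. (snd (fst u) j)\<^sup>2) = (\<Sum>j<N. (zcoord j u)\<^sup>2)"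
  unfolding zcoord_def by (rule orthonormal_pt_norm[OF on[OF u], symmetric])
 also have "...<=(\<Sum>j<N. D\<^sup>2)" by (intro sum_mono small) simp
 also have "... < 1/4" using fine by (simp add: D_def)
 finally show ?thesis .
qed

lemma adm_near:
 assumes "grid.adm P dd ys" "x\<in>set ys" "y\<in>set ys" "l < dd"
 shows "\<bar>snd x l\<bar><=int L" "\<bar>snd x l - snd y l\<bar><=1"
proof -
 obtain t where "- int L<=t" "t < int L" "\<forall>x\<in>set ys. snd x l = t | snd x l = t + 1"
  using assms(1,4) unfolding grid.adm_def by blast
 thus "\<bar>snd x l\<bar><=int L" "\<bar>snd x l - snd y l\<bar><=1"
 proof -
  have "snd x l = t | snd x l = t + 1" "snd y l = t | snd y l = t + 1"
   using \<open>\<forall>x\<in>set ys. snd x l = t | snd x l = t + 1\<close> assms(2,3) by auto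
  thus "\<bar>snd x l\<bar><=int L" "\<bar>snd x l - snd y l\<bar><=1"
   using \<open>- int L<=t\<close> \<open>t < int L\<close> by linarith+
 qed
qed

lemma close_pts_subset: "close_pts N' d k P ==> Q\<subseteq>P ==> close_pts N' d k Q"
 unfolding close_pts_def by blast

text \<open>On a face one fibre coordinate is 1 or -1, so the vertex has norm at least 1 and is
  outside the support.\<close>

lemma raw_thom_faces:
 assumes "close_pts N dd (2 * ka) P" "grid.adm P dd ys" "grid.face 0 dd ys" "ys~=[]"
 shows "cups (map positive axes) (%_. 1) ys = 0"
proof (rule ccontr)
 assume nz: "cups (map positive axes) (%_. 1) ys~=0"
 obtain l where l: "l < dd" "(\<forall>x\<in>set ys. snd x l = - int L) | (\<forall>x\<in>set ys. snd x l = int L)"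
  using assms(3) unfolding grid.face_def by auto
 obtain u where u: "u\<in>set ys" using assms(4) by (cases ys) auto
 have cl: "close_pts N dd (2 * ka) (fst ` set ys)"
  using assms(1,2) close_pts_subset unfolding grid.adm_def by blast
 have "(\<Sum>l<dd. (of_int (snd u l)/real L)\<^sup>2) + (\<Sum>j<N. (snd (fst u) j)\<^sup>2) < 1/4"
  by (rule cups_positive_small[OF cl _ _ nz u]) (use adm_near[OF assms(2)] in blast)+
 moreover have "(of_int (snd u l)/real L)\<^sup>2<=(\<Sum>l<dd. (of_int (snd u l)/real L)\<^sup>2)"
  by (rule member_le_sum) (use l in auto)
 moreover have "(of_int (snd u l)/real L)\<^sup>2 = 1"
  using l(2) u L_pos by (auto simp: power_divide)
 moreover have "0<=(\<Sum>j<N. (snd (fst u) j)\<^sup>2)" by (simp add: sum_nonneg)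
 ultimately show False by simp
qed

lemma adm_start: "set ps\<subseteq>P ==> grid.adm P 0 (map (%p. (p, %_. 0)) ps)"
 by (auto simp: grid.adm_def)

lemma coboundary_raw_thom:
 assumes "close_pts N dd (2 * ka) (set ps)" "length ps = N - dd + 2"
 shows "coboundary raw_thom ps = 0"
proof -
 let ?c = "cups (map positive axes) (%_. 1)"
 let ?xs = "map (%p. (p, %_. 0)) ps"
 have "coboundary raw_thom ps = coboundary (grid.sweeps 0 dd ?c) ?xs"
  unfolding raw_thom_def[abs_def] by (rule coboundary_map)
 also have "... = (-1)^dd*((-1)^dd*coboundary (grid.sweeps 0 dd ?c) ?xs)" by simp
 also have "(-1)^dd*coboundary (grid.sweeps 0 dd ?c) ?xs = grid.sweeps 0 dd (coboundary ?c) ?xs"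
 proof (rule grid.sweeps_coboundary[symmetric, OF adm_start[OF order_refl]])
  fix ys assume "grid.adm (set ps) (0 + dd) ys" "grid.face 0 dd ys" "Suc (length ys) = length ?xs + dd"
  thus "?c ys = 0" using assms by (intro raw_thom_faces[of "set ps"]) auto
 qed
 also have "grid.sweeps 0 dd (coboundary ?c) ?xs = grid.sweeps 0 dd (%_. 0) ?xs"
 proof (rule grid.sweeps_cong[OF adm_start[OF order_refl]])
  fix ys :: "(framed\<times>ivec) list"
  assume "length ys = length ?xs + dd"
  thus "coboundary ?c ys = 0" using assms rN by (intro coboundary_cups_one) simp
 qed
 finally show ?thesis by (simp add: grid.sweeps_zero)
qed

lemma measurable_turn:
 assumes "l < dd"
 shows "(%tt. turn tt E A l j)\<in>borel_measurable (torusM r)"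
proof -
 have "(%tt. tt (l div 2))\<in>torusM r \<rightarrow>\<^sub>M circleM"
  unfolding torusM_def by (rule measurable_component_singleton) (use assms in auto)
 hence [measurable]: "(%tt. tt (l div 2))\<in>borel_measurable (torusM r)"
  by (simp add: measurable_cong_sets[OF refl sets_circleM])
 show ?thesis unfolding turn_def turn_cos_def turn_sin_def by measurable
qed

lemma measurable_positive_turn [measurable]:
 "(%tt. positive j (turn_pt tt E p, n))\<in>borel_measurable (torusM r)"
proof -
 have [measurable]: "(%tt. zcoord j (turn_pt tt E p, n))\<in>borel_measurable (torusM r)"
  unfolding zcoord_def turn_pt_def fst_conv snd_conv
  by (intro borel_measurable_add borel_measurable_const borel_measurable_sum borel_measurable_times measurable_turn) auto
 show ?thesis unfolding positive_def by measurable
qed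

lemma integrable_cups:
 fixes g :: "'i => 'a => 't => real"
 assumes "finite_measure M" "!!j x. (%tt. g j x tt)\<in>borel_measurable M" "!!j x tt. g j x tt\<in>{0..1}"
 shows "integrable M (%tt. cups (map (%j x. g j x tt) js) (%_. 1) xs)"
proof -
 interpret finite_measure M by fact
 have m: "(%tt. cups (map (%j x. g j x tt) js) (%_. 1) xs)\<in>borel_measurable M"
 proof (induction js arbitrary: xs)
  case (Cons j js)
  show ?case using Cons assms(2) by (cases xs rule: remdups_adj.cases) auto
 qed simp
 have "\<bar>cups (map (%j x. g j x tt) js) (%_. 1) xs\<bar><=1" for tt
 proof (induction js arbitrary: xs)
  case (Cons j js)
  show ?case
  proof (cases xs rule: remdups_adj.cases)
   case (3 x y ys)
   have "\<bar>g j y tt - g j x tt\<bar><=1" using assms(3)[of j y tt] assms(3)[of j x tt] by auto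
   hence "\<bar>g j y tt - g j x tt\<bar>*\<bar>cups (map (%j x. g j x tt) js) (%_. 1) (y # ys)\<bar><=1*1"
    using Cons[of "y # ys"] by (intro mult_mono) auto
   thus ?thesis using 3 by (simp add: abs_mult)
  qed auto
 qed simp
 thus ?thesis using m by (intro integrable_const_bound[where B = 1]) auto
qed

lemma raw_thom_turn:
 "raw_thom (map (turn_pt tt E) ps)
  = grid.sweeps 0 dd (cups (map (%j x. positive j (turn_pt tt E (fst x), snd x)) axes) (%_. 1))
    (map (%p. (p, %_. 0)) ps)"
proof -
 let ?f = "%x. (turn_pt tt E (fst x), snd x)"
 let ?xs = "map (%p. (p, %_. 0)) ps"
 have "map (%p. (p, %_. 0)) (map (turn_pt tt E) ps) = map ?f ?xs" by simp
 hence "raw_thom (map (turn_pt tt E) ps)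
   = grid.sweeps 0 dd (cups (map positive axes) (%_. 1)) (map ?f ?xs)"
  unfolding raw_thom_def by (rule arg_cong)
 also have "... = grid.sweeps 0 dd (%ys. cups (map positive axes) (%_. 1) (map ?f ys)) ?xs"
  by (rule grid.sweeps_map) (simp add: put_def)
 finally show ?thesis by (simp add: cups_map comp_def)
qed

lemma integrable_raw_thom: "integrable (torusM r) (%tt. raw_thom (map (turn_pt tt E) ps))"
proof -
 interpret T: prob_space "torusM r" by (rule prob_space_torusM)
 show ?thesis unfolding raw_thom_turn
  by (intro grid.sweeps_integral(1) integrable_cups[where g = "%j x tt. positive j (turn_pt tt E (fst x), snd x)"])
   (auto simp: T.finite_measure_axioms positive_def[abs_def] intro!: measurable_positive_turn[unfolded positive_def])
qed

lemma coboundary_thom: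
 assumes "close_pts N dd ka (set ps)" "length ps = N - dd + 2"
 shows "coboundary thom ps = 0"
proof -
 have z: "coboundary (%ps. raw_thom (map (turn_pt tt E) ps)) ps = 0" for tt E
 proof -
  have "coboundary raw_thom (map (turn_pt tt E) ps) = 0"
   using close_pts_turn[OF assms(1), of tt E] ka_pos assms(2)
   by (intro coboundary_raw_thom) (auto simp: turn_pt_def[abs_def])
  thus ?thesis by (simp add: coboundary_map)
 qed
 have i: "coboundary (%ps. \<integral>tt. raw_thom (map (turn_pt tt E) ps) \<partial>torusM r) ps = 0" for E
  using coboundary_integral[of "torusM r" "%tt ps. raw_thom (map (turn_pt tt E) ps)" ps, OF integrable_raw_thom]
  by (simp add: z)
 have "coboundary thom ps = (\<Sum>E\<in>Pow {..<r}. coboundary (%ps. (-1)^card E*(\<integral>tt. raw_thom (map (turn_pt tt E) ps) \<partial>torusM r)) ps)"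
  unfolding thom_def[abs_def] by (rule coboundary_sum)
 thus ?thesis by (simp add: coboundary_scale i)
qed

text \<open>Turning leaves \<open>snd p\<close> unchanged, so the support estimate holds for all
  terms of the average at once.\<close>

lemma thom_small:
 assumes "close_pts N dd ka (set ps)" "thom ps~=0" "ps~=[]"
 shows "\<exists>p\<in>set ps. (\<Sum>j<N. (snd p j)\<^sup>2) < 1/4"
proof (rule ccontr)
 assume neg: "\<not> ?thesis"
 have "raw_thom (map (turn_pt tt E) ps) = 0" for tt E
 proof -
  let ?P = "turn_pt tt E ` set ps"
  have cl: "close_pts N dd (2 * ka) ?P"
   using close_pts_turn[OF assms(1), of tt E] ka_pos by (simp add: turn_pt_def[abs_def])
  have ad: "grid.adm ?P 0 (map (%p. (p, %_. 0)) (map (turn_pt tt E) ps))"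
   by (rule adm_start) simp
  have "raw_thom (map (turn_pt tt E) ps)
    = grid.sweeps 0 dd (%_. 0) (map (%p. (p, %_. 0)) (map (turn_pt tt E) ps))"
   unfolding raw_thom_def
  proof (rule grid.sweeps_cong[OF ad])
   fix ys assume ys: "grid.adm ?P (0 + dd) ys"
    "length ys = length (map (%p. (p, %_. 0)) (map (turn_pt tt E) ps)) + dd"
   show "cups (map positive axes) (%_. 1) ys = 0"
   proof (rule ccontr)
    assume nz: "cups (map positive axes) (%_. 1) ys~=0"
    have "ys~=[]" using ys(2) assms(3) by auto
    then obtain u where u: "u\<in>set ys" by (cases ys) auto
    have cl': "close_pts N dd (2 * ka) (fst ` set ys)"
     using cl ys(1) close_pts_subset unfolding grid.adm_def by blast
    have "(\<Sum>l<dd. (of_int (snd u l)/real L)\<^sup>2) + (\<Sum>j<N. (snd (fst u) j)\<^sup>2) < 1/4"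
     by (rule cups_positive_small[OF cl' _ _ nz u]) (use adm_near[of ?P ys] ys(1) in auto)
    moreover have "0<=(\<Sum>l<dd. (of_int (snd u l)/real L)\<^sup>2)" by (simp add: sum_nonneg)
    moreover obtain p where "p\<in>set ps" "snd (fst u) = snd p"
     using ys(1) u unfolding grid.adm_def turn_pt_def by fastforce
    ultimately show False using neg by fastforce
   qed
  qed
  thus ?thesis by (simp add: grid.sweeps_zero)
 qed
 thus False using assms(2) by (simp add: thom_def)
qed

end

lemma cos_wrap: "cos (wrap x) = cos x" and sin_wrap: "sin (wrap x) = sin x"
 by (simp_all add: wrap_def cos_diff sin_diff mult.assoc cos_int_2pin[unfolded mult.assoc] sin_int_2pin[unfolded mult.assoc])

lemma minus_one_power_card_symdiff:
 assumes "finite A" "finite B"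
 shows "(-1::real)^card ((A - B)\<union>(B - A)) = (-1)^card A*(-1)^card B"
proof -
 have a: "card A = card (A - B) + card (A\<inter>B)"
  using assms by (metis Diff_Diff_Int card_Diff_subset_Int finite_Int card_Un_disjoint Int_Diff_Un Un_commute Diff_disjoint finite_Diff inf_commute Int_Diff_disjoint)
 have b: "card B = card (B - A) + card (A\<inter>B)"
  using assms by (metis Diff_disjoint Int_Diff_Un Un_commute card_Un_disjoint finite_Diff finite_Int inf_commute Int_Diff_disjoint)
 have c: "card ((A - B)\<union>(B - A)) = card (A - B) + card (B - A)"
  using assms by (intro card_Un_disjoint) auto
 show ?thesis unfolding a b c power_add by (simp add: power_mult_distrib[symmetric] mult.assoc mult.left_commute)
qed

definition stdf :: "nat => nat => real"
 where "stdf l j = of_bool (l = j)"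

lemma orthonormal_stdf:
 assumes "d<=N" "!!j. j < d ==> w j = 0"
 shows "orthonormal_pt N d (stdf, w)"
proof -
 have "(\<Sum>j<N. stdf l j * stdf l' j) = (\<Sum>j<N. if j = l then of_bool (l = l') else 0)" for l l'
  by (rule sum.cong) (auto simp: stdf_def)
 moreover have "(\<Sum>j<N. w j * stdf l j) = (\<Sum>j<N. if j = l then w l else 0)" for l
  by (rule sum.cong) (auto simp: stdf_def)
 ultimately show ?thesis using assms by (simp add: orthonormal_pt_def)
qed

section \<open>Symmetry and normalisation of the Thom cochain\<close>

context thom_data
begin

lemma raw_thom_map:
 "raw_thom (map h vs)
  = grid.sweeps 0 dd (cups (map (%j x. positive j (h (fst x), snd x)) axes) (%_. 1))
    (map (%p. (p, %_. 0)) vs)"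
proof -
 let ?f = "%x. (h (fst x), snd x)"
 let ?xs = "map (%p. (p, %_. 0)) vs"
 have "map (%p. (p, %_. 0)) (map h vs) = map ?f ?xs" by simp
 hence "raw_thom (map h vs) = grid.sweeps 0 dd (cups (map positive axes) (%_. 1)) (map ?f ?xs)"
  unfolding raw_thom_def by (rule arg_cong)
 also have "... = grid.sweeps 0 dd (%ys. cups (map positive axes) (%_. 1) (map ?f ys)) ?xs"
  by (rule grid.sweeps_map) (simp add: put_def)
 finally show ?thesis by (simp add: cups_map comp_def)
qed

lemma raw_thom_periodic:
 assumes "!!i. i < r ==> wrap (tt i) = wrap (tt' i)"
 shows "raw_thom (map (turn_pt tt E) ps) = raw_thom (map (turn_pt tt' E) ps)"
proof -
 have "turn tt E A l j = turn tt' E A l j" if "l < dd" for A l j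
 proof -
  have "wrap (tt (l div 2)) = wrap (tt' (l div 2))" using that by (intro assms) auto
  hence "cos (tt (l div 2)) = cos (tt' (l div 2))" "sin (tt (l div 2)) = sin (tt' (l div 2))"
   by (metis cos_wrap, metis sin_wrap)
  thus ?thesis by (simp add: turn_def turn_cos_def turn_sin_def)
 qed
 hence "(%j x. positive j (turn_pt tt E (fst x), snd x)) = (%j x. positive j (turn_pt tt' E (fst x), snd x))"
  by (auto simp: fun_eq_iff positive_def zcoord_def turn_pt_def cong: sum.cong_simp)
 thus ?thesis unfolding raw_thom_turn by simp
qed

text \<open>Composition of turns moves the angles of integration and replaces the set of reflected
  planes by a symmetric difference. The invariant measure absorbs the first change, reindexing the
  sum the second, at the cost of a sign.\<close>

lemma thom_turn:
 assumes E': "E'\<subseteq>{..<r}"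
 shows "thom (map (turn_pt aa E') ps) = (-1)^card E' * thom ps"
proof -
 let ?S = "%E. (E - E')\<union>(E' - E)"
 let ?s = "%i. if i\<in>E' then -1 else 1::real"
 let ?F = "%E tt. raw_thom (map (turn_pt tt E) ps)"
 have "(\<integral>tt. raw_thom (map (turn_pt tt E) (map (turn_pt aa E') ps)) \<partial>torusM r) = (\<integral>tt. ?F (?S E) tt \<partial>torusM r)" for E
 proof -
  have "(\<integral>tt. raw_thom (map (turn_pt tt E) (map (turn_pt aa E') ps)) \<partial>torusM r)
    = (\<integral>tt. ?F (?S E) (%i. aa i + ?s i * tt i) \<partial>torusM r)"
   by (simp add: turn_pt_def[abs_def] turn_turn comp_def)
  also have "... = (\<integral>tt. ?F (?S E) tt \<partial>torusM r)"
   by (rule integral_torus_shift) (auto intro: raw_thom_periodic borel_measurable_integrable integrable_raw_thom)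
  finally show ?thesis .
 qed
 hence "thom (map (turn_pt aa E') ps) = (\<Sum>E\<in>Pow {..<r}. (-1)^card E*(\<integral>tt. ?F (?S E) tt \<partial>torusM r))"
  by (simp add: thom_def)
 also have "... = (\<Sum>E\<in>Pow {..<r}. (-1)^card (?S E)*(\<integral>tt. ?F E tt \<partial>torusM r))"
 proof (rule sum.reindex_bij_witness[where i = ?S and j = ?S])
  fix E assume "E\<in>Pow {..<r}"
  show e: "?S (?S E) = E" by auto
  show "?S E\<in>Pow {..<r}" using \<open>E\<in>Pow {..<r}\<close> E' by auto
  show "(-1)^card (?S (?S E))*(\<integral>tt. ?F (?S E) tt \<partial>torusM r) = (-1)^card E*(\<integral>tt. ?F (?S E) tt \<partial>torusM r)"
   unfolding e ..
 qed (use E' in auto)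
 also have "... = (\<Sum>E\<in>Pow {..<r}. (-1)^card E'*((-1)^card E*(\<integral>tt. ?F E tt \<partial>torusM r)))"
 proof (rule sum.cong[OF refl])
  fix E assume "E\<in>Pow {..<r}"
  hence "finite E" "finite E'" using E' finite_subset by auto
  thus "(-1)^card (?S E)*(\<integral>tt. ?F E tt \<partial>torusM r)
    = (-1)^card E'*((-1)^card E*(\<integral>tt. ?F E tt \<partial>torusM r))"
   by (simp add: minus_one_power_card_symdiff)
 qed
 finally show ?thesis by (simp add: thom_def sum_distrib_left)
qed

definition rotated :: "vec => nat set => nat => ivec => real"
 where "rotated tt E j n = of_bool ((\<Sum>l<dd. of_int (n l)/real L * turn tt E stdf l j) > 0)"

text \<open>The degree over the origin of the linear map from the fibre cube to the span of the
  turned standard frame.\<close>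

definition rotated_degree :: "vec => nat set => real"
 where "rotated_degree tt E = grid.sweeps 0 dd
  (cups (map (%j x. rotated tt E j (snd x)) [0..<dd]) (%_. 1)) [((), %_. 0)]"

lemma turn_zero_stdf:
 "turn (%_. 0) E stdf l j = (if odd j & j div 2\<in>E then -1 else 1) * of_bool (l = j)"
proof -
 have "l = 2*(l div 2) | l = 2*(l div 2) + 1" by presburger
 thus ?thesis
  by (auto simp: turn_def turn_cos_def turn_sin_def stdf_def)
qed

lemma prod_signs: 
 "(\<Prod>j<dd. if odd j & j div 2\<in>E then -1 else 1) = (-1::real)^card (E\<inter>{..<r})"
proof (induction r)
 case (Suc r)
 have "E\<inter>{..<Suc r} = (if r\<in>E then insert r (E\<inter>{..<r}) else E\<inter>{..<r})"
  by (auto simp: less_Suc_eq)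
 thus ?case using Suc by simp
qed simp

lemma rotated_degree_zero:
 assumes "E\<subseteq>{..<r}"
 shows "rotated_degree (%_. 0) E = (-1)^card E*grid.aligned_sign dd 0"
proof -
 let ?gs = "map (%j (x::grid). rotated (%_. 0) E j (snd x)) [0..<dd]"
 let ?x = "((), %_::nat. 0::int)"
 let ?s = "%j. if odd j & j div 2\<in>E then -1 else 1::real"
 \<comment> \<open>For a reflected axis the factor is the indicator of n < 0, which jumps between -1
   and 0.\<close>
 let ?t = "%j. if odd j & j div 2\<in>E then -1 else 0::int"
 have "rotated (%_. 0) E j n = of_bool (?s j * of_int (n j) > 0)" if "j < dd" for j n
 proof -
  have "(\<Sum>l<dd. of_int (n l)/real L * turn (%_. 0) E stdf l j)
    = (\<Sum>l<dd. if l = j then ?s j * of_int (n j)/real L else 0)"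
   unfolding turn_zero_stdf by (intro sum.cong) auto
  also have "... = ?s j * of_int (n j)/real L" using that by simp
  finally show ?thesis using L_pos by (simp add: rotated_def zero_less_divide_iff del: of_bool_eq_iff)
 qed
 hence al: "(?gs ! i) x - (?gs ! i) y = ?s i*(of_bool (snd x (0 + i) > ?t (0 + i)) - of_bool (snd y (0 + i) > ?t (0 + i)))"
  if "i < length ?gs" for i and x y :: "grid"
  using that by auto
 have "rotated_degree (%_. 0) E = grid.sweeps 0 (length ?gs + 0) (cups ?gs (%_. 1)) [?x]"
  by (simp add: rotated_degree_def)
 also have "... = grid.aligned_sign (length ?gs) 0*(\<Prod>i<length ?gs. ?s i)*grid.sweeps (0 + length ?gs) 0 (%_. 1)
   [(fst ?x, %l. if 0<=l & l < 0 + length ?gs then ?t l + 1 else snd ?x l)]"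
  by (rule grid.sweeps_cups_aligned[where s = ?s and tt = ?t and k = 0 and n = 0], rule al)
   (use L_pos in auto)
 also have "... = (-1)^card E*grid.aligned_sign dd 0"
  using prod_signs[of E] assms by (simp add: Int_absorb2)
 finally show ?thesis .
qed

text \<open>The angles are contracted to 0 in \<open>T\<close> steps of size at most
  \<open>ka\<close>. Frames within one cell then stay close, and the cochain stays zero on the
  lateral faces.\<close>

lemma rotated_degree_homotopy: "rotated_degree tt E = rotated_degree (%_. 0) E"
proof -
 obtain T::nat where T: "0 < T" "!!i. i < r ==> \<bar>tt i\<bar><=ka*real T"
 proof -
  obtain n::nat where n: "(\<Sum>i<r. \<bar>tt i\<bar>)/ka<=real n" using real_arch_simple by blast
  have "\<bar>tt i\<bar><=ka*real (Suc n)" if "i < r" for i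
  proof -
   have "\<bar>tt i\<bar><=(\<Sum>i<r. \<bar>tt i\<bar>)" by (rule member_le_sum) (use that in auto)
   also have "...<=ka*real n" using n ka_pos by (simp add: field_simps)
   also have "...<=ka*real (Suc n)" using ka_pos by simp
   finally show ?thesis .
  qed
  thus thesis using that[of "Suc n"] by simp
 qed
 define lo' where "lo' = (%l::nat. if l < dd then - int L else 0)"
 define hi' where "hi' = (%l::nat. if l < dd then int L else int T)"
 interpret B: box lo' hi'
  by unfold_locales (use L_pos T(1) in \<open>auto simp: lo'_def hi'_def\<close>)
 have N': "real dd*(2 * ka*(1 + 2*real r) + 2*real r/real L)\<^sup>2 < 1/4"
  using mult_right_mono[of "real dd" "real N" "(2 * ka*(1 + 2*real r) + 2*real r/real L)\<^sup>2"] rN fine by simp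
 \<comment> \<open>The ambient space is now the span itself, with zero complement, so the support
   estimate is available with \<open>2*r\<close> in place of \<open>N\<close>.\<close>
 interpret D: thom_data r "dd" L ka
  by unfold_locales (use L_pos ka_pos N' in auto)
 define ph where "ph n = (%i. of_int (n dd)/real T * tt i)" for n :: "nat => int"
 let ?H = "%j x. rotated (ph (snd x)) E j (snd x)"
 let ?c = "cups (map ?H [0..<dd]) (%_. 1)::grid list => real"
 have "B.sweeps 0 dd (%ys. ?c (map (put dd (hi' dd)) ys)) [((), %_. 0)]
   = B.sweeps 0 dd (%ys. ?c (map (put dd (lo' dd)) ys)) [((), %_. 0)]"
 proof (rule B.sweeps_homotopy[of _ UNIV])
  fix ys :: "grid list" assume "length ys = dd + 2"
  thus "coboundary ?c ys = 0" by (intro coboundary_cups_one) simp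
 next
  fix ys :: "grid list"
  assume ys: "B.adm UNIV (Suc dd) ys" "length ys = dd + 1" "B.face 0 dd ys"
  show "?c ys = 0"
  proof (rule ccontr)
   assume nz: "?c ys~=0"
   define f where "f x = ((turn (ph (snd x)) E stdf, %_::nat. 0::real), snd x)" for x :: "grid"
   have Hf: "?H j x = D.positive j (f x)" for j and x :: "grid"
    by (simp add: rotated_def D.positive_def D.zcoord_def f_def)
   have "D.axes = [0..<dd]" by (simp add: D.axes_def)
   hence nz': "cups (map D.positive D.axes) (%_. 1) (map f ys)~=0"
    using nz unfolding Hf by (simp add: cups_map comp_def)
   have near: "\<bar>snd x l\<bar><=int L" "\<bar>snd x l - snd y l\<bar><=1"
    if h: "x\<in>set ys" "y\<in>set ys" "l < dd" for x y l
   proof -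
    obtain t where t: "lo' l<=t" "t < hi' l" "\<forall>x\<in>set ys. snd x l = t | snd x l = t + 1"
     using ys(1) h(3) unfolding B.adm_def by (meson less_Suc_eq)
    hence "snd x l = t | snd x l = t + 1" "snd y l = t | snd y l = t + 1" using h by auto
    thus "\<bar>snd x l\<bar><=int L" "\<bar>snd x l - snd y l\<bar><=1"
     using t h(3) unfolding lo'_def hi'_def by (auto split: if_splits)
   qed
   have time: "\<bar>ph (snd x) i - ph (snd y) i\<bar><=ka" if h: "x\<in>set ys" "y\<in>set ys" "i < r" for x y i
   proof -
    obtain t where t: "\<forall>x\<in>set ys. snd x dd = t | snd x dd = t + 1"
     using ys(1) unfolding B.adm_def by blast
    hence "snd x dd = t | snd x dd = t + 1" "snd y dd = t | snd y dd = t + 1"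
     using h by auto
    hence d: "\<bar>real_of_int (snd x dd) - real_of_int (snd y dd)\<bar><=1" by auto
    have "ph (snd x) i - ph (snd y) i = (real_of_int (snd x dd) - real_of_int (snd y dd))*(tt i/real T)"
     by (simp add: ph_def algebra_simps diff_divide_distrib)
    also have "\<bar>...\<bar><=1 * ka"
     unfolding abs_mult using T h(3) d by (intro mult_mono) (auto simp: field_simps abs_divide)
    finally show ?thesis by simp
   qed
   have lip: "\<bar>turn_cos aa E l - turn_cos be E l\<bar><=\<bar>aa (l div 2) - be (l div 2)\<bar>"
    "\<bar>turn_sin aa E l - turn_sin be E l\<bar><=\<bar>aa (l div 2) - be (l div 2)\<bar>" for aa be l
   proof -
    have c: "\<bar>cos x - cos y\<bar><=\<bar>x - y\<bar>" and s: "\<bar>sin x - sin y\<bar><=\<bar>x - y\<bar>" for x y::real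
    proof -
     have "\<bar>sin z\<bar><=\<bar>z\<bar>" for z::real using abs_sin_x_le_abs_x .
     note this[of "(x - y)/2"]
     have h: "\<bar>sin ((x - y)/2)\<bar><=\<bar>x - y\<bar>/2" using abs_sin_x_le_abs_x[of "(x - y)/2"] by simp
     have "\<bar>cos x - cos y\<bar> = 2*(\<bar>sin ((x + y)/2)\<bar>*\<bar>sin ((x - y)/2)\<bar>)"
      unfolding cos_diff_cos[of x y] using abs_minus_commute[of x y]
      by (simp add: abs_mult) (metis abs_minus_cancel minus_diff_eq minus_divide_left sin_minus)
     also have "...<=2*(1*(\<bar>x - y\<bar>/2))" by (intro mult_left_mono mult_mono h) auto
     finally show "\<bar>cos x - cos y\<bar><=\<bar>x - y\<bar>" by simp
     have "\<bar>sin x - sin y\<bar> = 2*(\<bar>sin ((x - y)/2)\<bar>*\<bar>cos ((x + y)/2)\<bar>)"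
      unfolding sin_diff_sin[of x y] by (simp add: abs_mult)
     also have "...<=2*((\<bar>x - y\<bar>/2)*1)" by (intro mult_left_mono mult_mono h) auto
     finally show "\<bar>sin x - sin y\<bar><=\<bar>x - y\<bar>" by simp
    qed
    show "\<bar>turn_cos aa E l - turn_cos be E l\<bar><=\<bar>aa (l div 2) - be (l div 2)\<bar>"
     using c[of "aa (l div 2)" "be (l div 2)"] s[of "aa (l div 2)" "be (l div 2)"]
     by (auto simp: turn_cos_def abs_minus_commute)
    show "\<bar>turn_sin aa E l - turn_sin be E l\<bar><=\<bar>aa (l div 2) - be (l div 2)\<bar>"
     using c[of "aa (l div 2)" "be (l div 2)"] s[of "aa (l div 2)" "be (l div 2)"]
     by (auto simp: turn_sin_def abs_minus_commute)
   qed
   have cl: "close_pts dd dd (2 * ka) (fst ` set (map f ys))"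
   proof -
    have "orthonormal_pt dd dd (fst (f x))" for x
     using orthonormal_pt_turn[OF orthonormal_stdf[of "dd" "dd" "%_. 0"], of "ph (snd x)" E]
     by (simp add: f_def)
    moreover have "\<bar>turn (ph (snd x)) E stdf l j - turn (ph (snd y)) E stdf l j\<bar><=2 * ka"
     if "x\<in>set ys" "y\<in>set ys" "l < dd" for x y l j
    proof -
     have i: "l div 2 < r" using that(3) by auto
     have "turn (ph (snd x)) E stdf l j - turn (ph (snd y)) E stdf l j
      = (turn_cos (ph (snd x)) E l - turn_cos (ph (snd y)) E l) * stdf (2*(l div 2)) j
      + (turn_sin (ph (snd x)) E l - turn_sin (ph (snd y)) E l) * stdf (2*(l div 2) + 1) j"
      by (simp add: turn_def algebra_simps)
     hence "\<bar>turn (ph (snd x)) E stdf l j - turn (ph (snd y)) E stdf l j\<bar>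
      <=\<bar>turn_cos (ph (snd x)) E l - turn_cos (ph (snd y)) E l\<bar> + \<bar>turn_sin (ph (snd x)) E l - turn_sin (ph (snd y)) E l\<bar>"
      by (auto simp: stdf_def)
     thus ?thesis
      using lip(1)[of "ph (snd x)" l "ph (snd y)"] lip(2)[of "ph (snd x)" l "ph (snd y)"] time[OF that(1,2) i]
      by linarith
    qed
    ultimately show ?thesis using ka_pos by (auto simp: close_pts_def f_def)
   qed
   obtain l where l: "l < dd" "(\<forall>x\<in>set ys. snd x l = - int L) | (\<forall>x\<in>set ys. snd x l = int L)"
   proof -
    obtain l where "l < dd" "(\<forall>x\<in>set ys. snd x l = lo' l) | (\<forall>x\<in>set ys. snd x l = hi' l)"
     using ys(3) unfolding B.face_def by auto
    thus thesis using that[of l] by (simp add: lo'_def hi'_def)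
   qed
   obtain u where u: "u\<in>set ys" using ys(2) by (cases ys) auto
   have "(\<Sum>l<dd. (of_int (snd (f u) l)/real L)\<^sup>2) + (\<Sum>j<dd. (snd (fst (f u)) j)\<^sup>2) < 1/4"
    by (rule D.cups_positive_small[OF cl _ _ nz']) (use near u in \<open>auto simp: f_def\<close>)
   moreover have "(of_int (snd u l)/real L)\<^sup>2<=(\<Sum>l<dd. (of_int (snd u l)/real L)\<^sup>2)"
    by (rule member_le_sum) (use l in auto)
   moreover have "(of_int (snd u l)/real L)\<^sup>2 = 1"
    using l(2) u L_pos by (auto simp: power_divide)
   ultimately show False by (simp add: f_def)
  qed
 qed auto
 moreover have "(%ys. ?c (map (put dd t) ys))
   = cups (map (%j x. rotated (%i. of_int t/real T * tt i) E j (snd x)) [0..<dd]) (%_. 1)" for t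
 proof -
  have "?H j (put dd t x) = rotated (%i. of_int t/real T * tt i) E j (snd x)" for j and x :: "grid"
   by (simp add: rotated_def ph_def)
  thus ?thesis by (simp add: cups_map comp_def fun_eq_iff)
 qed
 moreover have "B.sweeps 0 dd c = grid.sweeps 0 dd c" for c :: "grid list => real"
  by (rule sweeps_box_cong[OF B.box_axioms grid.box_axioms]) (auto simp: lo'_def hi'_def)
 ultimately show ?thesis
  using T(1) by (simp add: rotated_degree_def lo'_def hi'_def)
qed

text \<open>The 2^r sets of reflected planes contribute equally, since the sign of the
  antisymmetrisation cancels the degree of the reflections.\<close>

definition thom_const::real
 where "thom_const = 2^r*grid.aligned_sign (N - dd) 0*grid.aligned_sign dd 0"

lemma thom_const_nonzero: "thom_const~=0"
 by (simp add: thom_const_def grid.aligned_sign_nonzero)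

text \<open>For a turned standard frame, complement and fibre separate: the complement factors are
  aligned with the swept directions, and the fibre sweep is a rotated degree. So the cochain is
  normalised on each complement.\<close>

lemma sweeps_thom:
 fixes x0 :: "'p\<times>ivec"
 assumes B: "box lo hi" and E': "E'\<subseteq>{..<r}"
  and w: "!!x i. i < N - dd ==> w x (dd + i) > 0 \<longleftrightarrow> snd x (c + i) > 0"
  and w0: "!!x j. j < dd ==> w x j = 0"
  and lohi: "!!i. i < N - dd ==> lo (c + i)<=0 & 0 < hi (c + i)"
 shows "box.sweeps lo hi c (N - dd) (%vs. thom (map (%x. (turn aa E' stdf, w x)) vs)) [x0]
   = (-1)^card E' * thom_const"
proof -
 interpret B: box lo hi by fact
 interpret T: prob_space "torusM r" by (rule prob_space_torusM)
 let ?m = "N - dd"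
 let ?g = "%x. (stdf, w x)"
 let ?B = "%tt E. B.sweeps c ?m (%vs. raw_thom (map (turn_pt tt E) (map ?g vs))) [x0]"
 have raw: "?B tt E
   = B.aligned_sign ?m 0*rotated_degree tt E" for tt E
 proof -
  let ?P = "%j (x::'p\<times>ivec). of_bool (w x j > 0)::real"
  let ?rs = "map (%j x. rotated tt E j (snd x)) [0..<dd]"
  let ?V = "%xs. grid.sweeps 0 dd (cups ?rs (%_. 1)) xs"
  let ?W = "%vs. ?V (map (%x. (x, %_. 0)) vs)"
  have raw1: "raw_thom (map (turn_pt tt E) (map ?g vs))
    = cups (map ?P [dd..<N]) ?W vs" for vs
  proof -
   let ?h = "%x. (turn tt E stdf, w x)"
   have std: "turn tt E stdf l j = 0" if "l < dd" "dd<=j" for l j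
   proof -
    have "2*(l div 2) < j" "2*(l div 2) + 1 < j" using that by presburger+
    thus ?thesis by (simp add: turn_def stdf_def)
   qed
   have "raw_thom (map (turn_pt tt E) (map ?g vs)) = raw_thom (map ?h vs)"
    by (simp add: comp_def turn_pt_def)
   also have "... = grid.sweeps 0 dd (cups (map (%j x. positive j (?h (fst x), snd x)) axes) (%_. 1))
     (map (%p. (p, %_. 0)) vs)" by (rule raw_thom_map)
   also have "cups (map (%j x. positive j (?h (fst x), snd x)) axes) (%_. 1)
     = cups (map (%j x. ?P j (fst x)) [dd..<N]) (cups ?rs (%_. 1))"
   proof -
    have p: "positive j (?h (fst x), snd x) = ?P j (fst x)" if "dd<=j"
     for j and x :: "('p\<times>ivec)\<times>ivec"
     using that by (simp add: positive_def zcoord_def std)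
    have q: "positive j (?h (fst x), snd x) = rotated tt E j (snd x)" if "j < dd"
     for j and x :: "('p\<times>ivec)\<times>ivec"
     using that by (simp add: positive_def zcoord_def rotated_def w0)
    have e: "map (%j (x::('p\<times>ivec)\<times>ivec). positive j (?h (fst x), snd x)) [dd..<N] = map (%j x. ?P j (fst x)) [dd..<N]"
     "map (%j (x::('p\<times>ivec)\<times>ivec). positive j (?h (fst x), snd x)) [0..<dd] = ?rs"
     by (intro map_cong refl ext p q; simp)+
    show ?thesis unfolding axes_def map_append cups_append e ..
   qed
   \<comment> \<open>Passing an even number of fibre sweeps produces no sign.\<close>
   also have "grid.sweeps 0 dd ... (map (%p. (p, %_. 0)) vs)
     = cups (map (%j x. ?P j (fst x)) [dd..<N]) ?V (map (%p. (p, %_. 0)) vs)"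
    by (subst grid.sweeps_cups) (auto simp: power_mult)
   also have "... = cups (map ?P [dd..<N]) ?W vs"
    by (simp add: cups_map comp_def)
   finally show ?thesis .
  qed
  let ?gs = "map ?P [dd..<N]"
  have len: "length ?gs = ?m" by simp
  have "?B tt E
    = B.sweeps c (length ?gs + 0) (cups ?gs ?W) [x0]"
   by (simp only: raw1 add_0_right len)
  also have "... = B.aligned_sign (length ?gs) 0*(\<Prod>i<length ?gs. 1)
    * B.sweeps (c + length ?gs) 0 ?W
     [(fst x0, %l. if c<=l & l < c + length ?gs then 0 + 1 else snd x0 l)]"
   by (rule B.sweeps_cups_aligned[where s = "%_. 1" and tt = "%_. 0"]) (use w lohi in auto)
  also have "... = B.aligned_sign ?m 0
    * ?V [((fst x0, %l. if c<=l & l < c + length ?gs then 0 + 1 else snd x0 l), %_. 0)]"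
   by simp
  also have "?V [(y, %_. 0)] = rotated_degree tt E" for y :: "'p\<times>ivec"
  proof -
   let ?c = "cups ?rs (%_. 1)"
   have "rotated_degree tt E = grid.sweeps 0 dd ?c (map (%x. ((), snd x)) [(y, %_. 0)])"
    by (simp add: rotated_degree_def)
   also have "... = grid.sweeps 0 dd (%ys. ?c (map (%x. ((), snd x)) ys)) [(y, %_. 0)]"
    by (rule grid.sweeps_map) (simp add: put_def)
   finally show ?thesis by (simp add: cups_map comp_def)
  qed
  finally show ?thesis .
 qed
 have "thom (map (%x. (turn aa E' stdf, w x)) vs) = (-1)^card E' * thom (map ?g vs)" for vs
  using thom_turn[OF E', of aa "map ?g vs"] by (simp add: comp_def turn_pt_def)
 hence "B.sweeps c ?m (%vs. thom (map (%x. (turn aa E' stdf, w x)) vs)) [x0]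
   = (-1)^card E'*B.sweeps c ?m (%vs. thom (map ?g vs)) [x0]"
  by (simp add: B.sweeps_scale)
 also have "B.sweeps c ?m (%vs. thom (map ?g vs)) [x0]
   = (\<Sum>E\<in>Pow {..<r}. (-1)^card E*(\<integral>tt. ?B tt E \<partial>torusM r))"
  unfolding thom_def
  by (subst B.sweeps_sum, subst B.sweeps_scale, subst B.sweeps_integral(2)) (auto intro: integrable_raw_thom simp del: map_map)
 also have "... = (\<Sum>E\<in>Pow {..<r}. (-1)^card E*(B.aligned_sign ?m 0*((-1)^card E*grid.aligned_sign dd 0)))"
 proof (intro sum.cong refl arg_cong[of _ _ "%x. (-1)^card _*x"])
  fix E assume "E\<in>Pow {..<r}"
  hence "rotated_degree tt E = (-1)^card E*grid.aligned_sign dd 0" for tt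
   unfolding rotated_degree_homotopy[of tt] by (intro rotated_degree_zero) simp
  thus "(\<integral>tt. ?B tt E \<partial>torusM r)
    = B.aligned_sign ?m 0*((-1)^card E*grid.aligned_sign dd 0)"
   by (simp add: raw T.prob_space del: map_map)
 qed
 also have "... = (\<Sum>E\<in>Pow {..<r}. B.aligned_sign ?m 0*grid.aligned_sign dd 0)"
  by (intro sum.cong refl) (simp add: mult.left_commute[of "(-1)^card _"] power_mult_distrib[symmetric])
 also have "... = thom_const" by (simp add: thom_const_def card_Pow)
 finally show ?thesis .
qed

end

section \<open>Orthonormal frames and flags of planes\<close>

lemma Rn_iff: "x\<in>Rn d \<longleftrightarrow> (\<forall>i\<ge>d. x i = 0)"
 by (simp add: topspace_Euclidean_space)

lemma Rn_comb: "(!!k. k\<in>K ==> b k\<in>Rn d) ==> (%j. \<Sum>k\<in>K. c k*b k j)\<in>Rn d"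
 by (auto simp: Rn_iff intro!: sum.neutral)

lemma Rn_mono: "d<=n ==> Rn d\<subseteq>Rn n"
 by (auto simp: Rn_iff)

lemma dot_comb_left: "dot d (%j. \<Sum>k\<in>K. c k*b k j) y = (\<Sum>k\<in>K. c k*dot d (b k) y)"
proof -
 have "dot d (%j. \<Sum>k\<in>K. c k*b k j) y = (\<Sum>i<d. \<Sum>k\<in>K. c k*(b k i*y i))"
  by (simp add: dot_def sum_distrib_right mult.assoc)
 also have "... = (\<Sum>k\<in>K. c k*dot d (b k) y)"
  by (subst sum.swap) (simp add: dot_def sum_distrib_left)
 finally show ?thesis .
qed

lemma dot_commute: "dot d x y = dot d y x"
 by (simp add: dot_def mult.commute)

lemma dot_simps [simp]:
 "dot d (x + y) z = dot d x z + dot d y z" "dot d z (x + y) = dot d z x + dot d z y"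
 "dot d (%i. c*x i) z = c*dot d x z" "dot d z (%i. c*x i) = c*dot d z x"
 "dot d 0 z = 0" "dot d z 0 = 0"
 by (simp_all add: dot_def algebra_simps sum.distrib sum_distrib_left)

lemma stdf_Rn: "k < d ==> stdf k\<in>Rn d"
 by (auto simp: Rn_iff stdf_def)

lemma dot_stdf: "k < d ==> dot d x (stdf k) = x k"
proof -
 assume "k < d"
 have "dot d x (stdf k) = (\<Sum>i<d. if i = k then x k else 0)"
  unfolding dot_def stdf_def by (rule sum.cong) auto
 thus ?thesis using \<open>k < d\<close> by simp
qed

lemma Rn_expansion:
 assumes "x\<in>Rn d"
 shows "x = (%j. \<Sum>k<d. x k * stdf k j)"
proof
 fix j
 have "(\<Sum>k<d. x k * stdf k j) = (\<Sum>k<d. if k = j then x j else 0)"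
  by (rule sum.cong) (auto simp: stdf_def)
 thus "x j = (\<Sum>k<d. x k * stdf k j)" using assms by (auto simp: Rn_iff)
qed

lemma linear_isometriesD:
 assumes "ph\<in>linear_isometries d n"
 shows "x\<in>Rn d ==> ph x\<in>Rn n"
  and "x\<in>Rn d ==> y\<in>Rn d ==> ph (x + y) = ph x + ph y"
  and "x\<in>Rn d ==> ph (%i. c*x i) = (%i. c*ph x i)"
  and "x\<in>Rn d ==> y\<in>Rn d ==> dot n (ph x) (ph y) = dot d x y"
  and "x\<notin>Rn d ==> ph x = undefined"
 using assms unfolding linear_isometries_def by (auto simp: PiE_def extensional_def)

lemma linear_isometries_comb:
 assumes ph: "ph\<in>linear_isometries d n" and "finite K" "!!k. k\<in>K ==> b k\<in>Rn d"
 shows "ph (%j. \<Sum>k\<in>K. c k*b k j) = (%j. \<Sum>k\<in>K. c k*ph (b k) j)"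
 using assms(2,3)
proof (induction K rule: finite_induct)
 case empty
 have "ph (%i. 0*(0::nat => real) i) = (%i. 0*ph 0 i)"
  by (rule linear_isometriesD(3)[OF ph]) (simp add: Rn_iff)
 thus ?case by simp
next
 case (insert k K)
 have e: "(%j. \<Sum>k\<in>insert k K. c k*f k j) = (%j. c k*f k j) + (%j. \<Sum>k\<in>K. c k*f k j)"
  for f :: "_ => nat => real" using insert by (simp add: fun_eq_iff)
 have "ph ((%j. c k*b k j) + (%j. \<Sum>k\<in>K. c k*b k j))
   = ph (%j. c k*b k j) + ph (%j. \<Sum>k\<in>K. c k*b k j)"
  by (rule linear_isometriesD(2)[OF ph]) (use insert Rn_comb[of K b d c] in \<open>auto simp: Rn_iff\<close>)
 also have "ph (%j. c k*b k j) = (%j. c k*ph (b k) j)"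
  by (rule linear_isometriesD(3)[OF ph]) (use insert in simp)
 also have "ph (%j. \<Sum>k\<in>K. c k*b k j) = (%j. \<Sum>k\<in>K. c k*ph (b k) j)"
  by (rule insert.IH) (use insert in simp)
 finally show ?case unfolding e[of b] e[of "%k. ph (b k)"] .
qed

lemma orthogonalD:
 assumes "g\<in>carrier (orthogonal_group d)"
 shows "g\<in>linear_isometries d d" "bij_betw g (Rn d) (Rn d)"
 using assms by (auto simp: orthogonal_group_def)

definition frame :: "nat => (nat => vec) => bool"
 where "frame d b \<longleftrightarrow> (\<forall>k<d. b k\<in>Rn d) & (\<forall>k<d. \<forall>l<d. dot d (b k) (b l) = of_bool (k = l))"

lemma frameD:
 assumes "frame d b"
 shows "k < d ==> b k\<in>Rn d" "k < d ==> l < d ==> dot d (b k) (b l) = of_bool (k = l)"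
 using assms by (auto simp: frame_def)

(* the member of dimension 2 i of the flag of even-dimensional subspaces of a frame *)
definition flag :: "(nat => vec) => nat => vec set"
 where "flag b i = real_fun.span (b ` {..<2*i})"

lemma flag_0 [simp]: "flag b 0 = {0}"
 by (simp add: flag_def)

lemma flag_mono: "i<=i' ==> flag b i\<subseteq>flag b i'"
 unfolding flag_def by (intro real_fun.span_mono image_mono) auto

lemma subspace_flag: "real_fun.subspace (flag b i)"
 unfolding flag_def by (rule real_fun.subspace_span)

lemma mem_flag: "k < 2*i ==> b k\<in>flag b i"
 unfolding flag_def by (intro real_fun.span_base) auto

lemma subspace_Rn: "real_fun.subspace (Rn d)"
 by (auto simp: real_fun.subspace_def Rn_iff)

lemma flag_subset_subspace:
 assumes "real_fun.subspace U" "!!k. k < 2*i ==> b k\<in>U"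
 shows "flag b i\<subseteq>U"
 unfolding flag_def by (rule real_fun.span_minimal) (use assms in auto)

lemma flag_subset_Rn: "frame d b ==> 2*i<=d ==> flag b i\<subseteq>Rn d"
 by (rule flag_subset_subspace[OF subspace_Rn], rule frameD(1)) auto

lemma flag_orthogonal:
 assumes "!!k. k < 2*i ==> dot d u (b k) = 0" "v\<in>flag b i"
 shows "dot d u v = 0"
proof -
 have "flag b i\<subseteq>{v. dot d u v = 0}"
  by (rule flag_subset_subspace) (use assms(1) in \<open>auto simp: real_fun.subspace_def\<close>)
 thus ?thesis using assms(2) by blast
qed

lemma subspace_comb:
 assumes "real_fun.subspace U" "finite K" "!!k. k\<in>K ==> b k\<in>U"
 shows "(%j. \<Sum>k\<in>K. c k*b k j)\<in>U"
 using assms(2,3)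
proof (induction K rule: finite_induct)
 case empty
 thus ?case using real_fun.subspace_0[OF assms(1)] by (simp add: zero_fun_def)
next
 case (insert k K)
 have "(%j. \<Sum>k\<in>insert k K. c k*b k j) = (%j. c k*b k j) + (%j. \<Sum>k\<in>K. c k*b k j)"
  using insert by (simp add: fun_eq_iff)
 also have "...\<in>U"
  using insert by (intro real_fun.subspace_add[OF assms(1)] real_fun.subspace_scale[OF assms(1)]) auto
 finally show ?case .
qed

lemma flag_expansion:
 assumes b: "frame d b" and i: "2*i<=d" and u: "u\<in>flag b i"
 shows "u = (%j. \<Sum>k<2*i. dot d u (b k)*b k j)"
proof -
 let ?P = "%u. (%j. \<Sum>k<2*i. dot d u (b k)*b k j)"
 have "flag b i\<subseteq>{u. u = ?P u}"
 proof (rule flag_subset_subspace)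
  have add: "?P (u + v) = ?P u + ?P v" for u v
   by (simp add: fun_eq_iff algebra_simps sum.distrib)
  have scale: "?P (%i. c*u i) = (%i. c*?P u i)" for u c
   by (simp add: fun_eq_iff algebra_simps sum_distrib_left)
  show "real_fun.subspace {u. u = ?P u}"
  proof (rule real_fun.subspaceI)
   show "0\<in>{u. u = ?P u}" by (simp add: fun_eq_iff)
   show "u + v\<in>{u. u = ?P u}" if "u\<in>{u. u = ?P u}" "v\<in>{u. u = ?P u}" for u v
    unfolding mem_Collect_eq add by (rule arg_cong2[of _ _ _ _ "(+)"]) (use that in simp_all)
   show "(%i. c*u i)\<in>{u. u = ?P u}" if "u\<in>{u. u = ?P u}" for u c
    unfolding mem_Collect_eq scale by (rule arg_cong[of _ _ "%u i. c*u i"]) (use that in simp)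
  qed
  fix k assume k: "k < 2*i"
  have "?P (b k) = (%j. \<Sum>l<2*i. if l = k then b k j else 0)"
   using frameD(2)[OF b] k i by (intro ext sum.cong) auto
  thus "b k\<in>{u. u = ?P u}" using k by auto
 qed
 thus ?thesis using u by blast
qed

lemma frame_independent:
 assumes b: "frame d b" and i: "n<=d"
 shows "\<not> real_fun.dependent (b ` {..<n})" "inj_on b {..<n}"
proof -
 show inj: "inj_on b {..<n}"
 proof (rule inj_onI)
  fix k l assume "k\<in>{..<n}" "l\<in>{..<n}" "b k = b l"
  thus "k = l" using frameD(2)[OF b, of k l] frameD(2)[OF b, of k k] i by (auto split: if_splits)
 qed
 show "\<not> real_fun.dependent (b ` {..<n})"
 proof
  assume "real_fun.dependent (b ` {..<n})"
  then obtain k where k: "k < n" "b k\<in>real_fun.span (b ` {..<n} - {b k})"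
   unfolding real_fun.dependent_def by auto
  have "real_fun.span (b ` {..<n} - {b k})\<subseteq>{v. dot d (b k) v = 0}"
  proof (rule real_fun.span_minimal)
   show "real_fun.subspace {v. dot d (b k) v = 0}" by (auto simp: real_fun.subspace_def)
   show "b ` {..<n} - {b k}\<subseteq>{v. dot d (b k) v = 0}"
    using frameD(2)[OF b] k(1) i by (auto simp: of_bool_def split: if_splits)
  qed
  thus False using k frameD(2)[OF b, of k k] i by auto
 qed
qed

lemma span_eq_of_card:
 assumes "\<not> real_fun.dependent S" "finite S" "finite T" "S\<subseteq>real_fun.span T" "card T<=card S"
 shows "real_fun.span S = real_fun.span T"
proof -
 have "T\<subseteq>real_fun.span S"
 proof
  fix t assume t: "t\<in>T"
  show "t\<in>real_fun.span S"
  proof (rule ccontr)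
   assume n: "t\<notin>real_fun.span S"
   hence "\<not> real_fun.dependent (insert t S)" using assms(1) by (simp add: real_fun.independent_insert)
   moreover have "insert t S\<subseteq>real_fun.span T" using assms(4) t real_fun.span_base by blast
   ultimately have "card (insert t S)<=card T"
    using real_fun.independent_span_bound[OF assms(3)] by blast
   moreover have "t\<notin>S" using n real_fun.span_base by blast
   ultimately show False using assms(2,5) by simp
  qed
 qed
 thus ?thesis using assms(4) by (metis real_fun.span_eq)
qed

lemma flag_eq_of_subset:
 assumes "frame d b" "frame d b'" "2*i<=d" "flag b i\<subseteq>flag b' i"
 shows "flag b i = flag b' i"
 unfolding flag_def
proof (rule span_eq_of_card)
 show "card (b' ` {..<2*i})<=card (b ` {..<2*i})"
  using frame_independent(2)[OF assms(1,3)] frame_independent(2)[OF assms(2,3)]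
  by (simp add: card_image)
 show "b ` {..<2*i}\<subseteq>real_fun.span (b' ` {..<2*i})"
  using assms(4) mem_flag[of _ i b] unfolding flag_def[of b'] by auto
qed (use frame_independent(1)[OF assms(1,3)] in auto)

lemma frame_stdf: "frame d stdf"
 by (auto simp: frame_def stdf_Rn dot_stdf) (auto simp: stdf_def)

lemma flag_top:
 assumes "frame (2*r) b"
 shows "flag b r = Rn (2*r)"
proof -
 have std: "flag stdf r = Rn (2*r)"
 proof
  show "flag stdf r\<subseteq>Rn (2*r)" by (rule flag_subset_Rn[OF frame_stdf]) simp
  show "Rn (2*r)\<subseteq>flag stdf r"
  proof
   fix x assume "x\<in>Rn (2*r)"
   from Rn_expansion[OF this] subspace_comb[OF subspace_flag[of stdf r], of "{..<2*r}" stdf x] mem_flag[of _ r stdf]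
   show "x\<in>flag stdf r" by auto
  qed
 qed
 have "flag b r = flag stdf r"
  by (rule flag_eq_of_subset[OF assms frame_stdf]) (use flag_subset_Rn[OF assms] std in auto)
 thus ?thesis using std by simp
qed

lemma flag_strict:
 assumes b: "frame d b" and i: "2*Suc i<=d"
 shows "flag b i \<subset> flag b (Suc i)"
proof -
 have "b (2*i)\<notin>flag b i"
 proof
  assume "b (2*i)\<in>flag b i"
  hence "dot d (b (2*i)) (b (2*i)) = 0"
   using flag_orthogonal[of i d "b (2*i)" b "b (2*i)"] frameD(2)[OF b] i by auto
  thus False using frameD(2)[OF b, of "2*i" "2*i"] i by auto
 qed
 moreover have "b (2*i)\<in>flag b (Suc i)" by (rule mem_flag) simp
 ultimately show ?thesis using flag_mono[of i "Suc i" b] by auto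
qed

definition pcoord :: "nat => (nat => vec) => nat => vec => complex"
 where "pcoord d b i u = Complex (dot d u (b (2*i))) (dot d u (b (2*i + 1)))"

lemma pcoord_simps:
 "pcoord d b i (x + y) = pcoord d b i x + pcoord d b i y"
 "pcoord d b i (%j. c*x j) = of_real c*pcoord d b i x"
 by (simp_all add: pcoord_def complex_eq_iff)

lemma pcoord_turn:
 "pcoord d (turn aa E b) i u
  = (if i\<in>E then cnj (cis (- aa i)*pcoord d b i u) else cis (- aa i)*pcoord d b i u)"
proof -
 have lin: "dot d u (%j. p*x j + q*y j) = p*dot d u x + q*dot d u y" for p q x y
  by (simp add: dot_def algebra_simps sum.distrib sum_distrib_left)
 have "dot d u (turn aa E b l) = turn_cos aa E l*dot d u (b (2*(l div 2))) + turn_sin aa E l*dot d u (b (2*(l div 2) + 1))" for l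
  unfolding turn_def by (rule lin)
 thus ?thesis
  by (auto simp: pcoord_def turn_cos_def turn_sin_def complex_eq_iff algebra_simps)
qed

lemma flag_of_pcoord_0:
 assumes b: "frame d b" and i: "2*Suc i<=d" and u: "u\<in>flag b (Suc i)" "pcoord d b i u = 0"
 shows "u\<in>flag b i"
proof -
 have "u = (%j. \<Sum>k<2*Suc i. dot d u (b k)*b k j)" by (rule flag_expansion[OF b i u(1)])
 also have "... = (%j. \<Sum>k<2*i. dot d u (b k)*b k j)"
  using u(2) by (simp add: pcoord_def complex_eq_iff)
 also have "...\<in>flag b i"
  by (rule subspace_comb[OF subspace_flag]) (auto intro: mem_flag)
 finally show ?thesis .
qed

text \<open>Vectors of \<open>flag b (Suc i)\<close> are determined modulo \<open>flag b i\<close>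
  by their plane coordinate.\<close>

lemma flag_mod:
 assumes b: "frame d b" and i: "2*Suc i<=d" and U: "real_fun.subspace U" "flag b i\<subseteq>U"
  and u: "u\<in>U" "u\<in>flag b (Suc i)" "v\<in>flag b (Suc i)" "pcoord d b i u = pcoord d b i v"
 shows "v\<in>U"
proof -
 have "v - u\<in>flag b (Suc i)" using u subspace_flag real_fun.subspace_diff by blast
 moreover have "pcoord d b i (v - u) = 0"
  using u(4) pcoord_simps(1)[of d b i "v - u" u] by simp
 ultimately have "v - u\<in>U" using flag_of_pcoord_0[OF b i] U(2) by blast
 hence "(v - u) + u\<in>U" using u(1) U(1) real_fun.subspace_add by blast
 thus ?thesis by simp
qed

text \<open>Two independent plane coordinates would span the plane, and then \<open>U\<close> would
  contain all of \<open>flag b (Suc i)\<close>.\<close>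

lemma pcoord_proportional:
 assumes b: "frame d b" and i: "2*Suc i<=d"
  and U: "real_fun.subspace U" "flag b i\<subseteq>U" "U \<subset> flag b (Suc i)"
  and u: "u\<in>U" "v\<in>U" "pcoord d b i u~=0" "pcoord d b i v~=0"
 shows "\<exists>c. c~=0 & pcoord d b i v = of_real c*pcoord d b i u"
proof -
 let ?z = "pcoord d b i u" and ?w = "pcoord d b i v"
 let ?D = "Re ?z*Im ?w - Im ?z * Re ?w"
 have "?D = 0"
 proof (rule ccontr)
  assume D: "?D~=0"
  have "b k\<in>U" if k: "k < 2*Suc i" for k
  proof -
   have bk: "b k\<in>flag b (Suc i)" by (rule mem_flag[OF k])
   let ?p = "pcoord d b i (b k)"
   \<comment> \<open>Cramer's rule for the coefficients of \<open>?p\<close> in the basis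
     \<open>?z\<close>, \<open>?w\<close>.\<close>
   define x y where "x = (Re ?p*Im ?w - Im ?p * Re ?w)/?D" and "y = (Re ?z*Im ?p - Im ?z * Re ?p)/?D"
   let ?s = "(%j. x*u j) + (%j. y * v j)"
   have s: "?s\<in>U" using u(1,2) by (intro real_fun.subspace_add[OF U(1)] real_fun.subspace_scale[OF U(1)])
   have "pcoord d b i ?s = of_real x*?z + of_real y*?w"
    by (simp only: pcoord_simps)
   also have "... = ?p"
   proof (rule complex_eqI)
    have cramer: "A/?D*a + B/?D*c = P" if "A*a + B*c = P*?D" for A B a c P::real
     using D that by (simp add: add_divide_distrib[symmetric] nonzero_eq_divide_eq)
    have "x * Re ?z + y * Re ?w = Re ?p" "x*Im ?z + y*Im ?w = Im ?p"
     unfolding x_def y_def by (rule cramer, simp add: algebra_simps)+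
    thus "Re (of_real x*?z + of_real y*?w) = Re ?p" "Im (of_real x*?z + of_real y*?w) = Im ?p"
     by simp_all
   qed
   finally show ?thesis using flag_mod[OF b i U(1,2) s _ bk] U(3) s by blast
  qed
  hence "flag b (Suc i)\<subseteq>U" by (rule flag_subset_subspace[OF U(1)])
  thus False using U(3) by auto
 qed
 hence "?w*cnj ?z\<in>\<real>" by (simp add: complex_is_Real_iff algebra_simps)
 then obtain t where t: "?w*cnj ?z = of_real t" by (auto elim: Reals_cases)
 have "?w*(of_real ((cmod ?z)\<^sup>2)) = of_real t*?z"
  using t complex_norm_square[of ?z] by (metis mult.assoc mult.commute)
 hence "?w = of_real (t/(cmod ?z)\<^sup>2)*?z"
  using u(3) by (simp add: field_simps)
 moreover have "t/(cmod ?z)\<^sup>2~=0" using calculation u(4) by auto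
 ultimately show ?thesis by blast
qed

text \<open>Equal flags make the transition matrix block diagonal, with one orthogonal 2 by 2 block
  per plane: a rotation, possibly followed by a reflection.\<close>

lemma frame_change:
 assumes b: "frame (2*r) b" and b': "frame (2*r) b'" and fl: "!!i. i<=r ==> flag b' i = flag b i"
 shows "\<exists>aa E. E\<subseteq>{..<r} & (\<forall>l<2*r. b' l = turn aa E b l)"
proof -
 have ex: "\<exists>a e. b' (2*i) = (%j. cos a*b (2*i) j + sin a*b (2*i + 1) j) & (e = 1 | e = (-1::real)) &
   b' (2*i + 1) = (%j. e*(- sin a*b (2*i) j + cos a*b (2*i + 1) j))" if i: "i < r" for i
 proof -
  have exp: "b' k = (%j. dot (2*r) (b' k) (b (2*i))*b (2*i) j + dot (2*r) (b' k) (b (2*i + 1))*b (2*i + 1) j)"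
   if k: "k = 2*i | k = 2*i + 1" for k
  proof -
   have "b' k\<in>flag b' (Suc i)" by (rule mem_flag) (use k in auto)
   hence "b' k\<in>flag b (Suc i)" using fl[of "Suc i"] i by simp
   hence "b' k = (%j. \<Sum>l<2*Suc i. dot (2*r) (b' k) (b l)*b l j)"
    by (intro flag_expansion[OF b]) (use i in auto)
   moreover have "dot (2*r) (b' k) (b l) = 0" if "l < 2*i" for l
   proof -
    have "b l\<in>flag b' i" using fl[of i] i mem_flag[OF that, of b] by simp
    thus ?thesis by (rule flag_orthogonal[rotated]) (use frameD(2)[OF b'] k i in auto)
   qed
   ultimately show ?thesis by simp
  qed
  define p q p' q' where "p = dot (2*r) (b' (2*i)) (b (2*i))" and "q = dot (2*r) (b' (2*i)) (b (2*i + 1))"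
   and "p' = dot (2*r) (b' (2*i + 1)) (b (2*i))" and "q' = dot (2*r) (b' (2*i + 1)) (b (2*i + 1))"
  have e1: "b' (2*i) = (%j. p*b (2*i) j + q*b (2*i + 1) j)"
   and e2: "b' (2*i + 1) = (%j. p'*b (2*i) j + q'*b (2*i + 1) j)"
   using exp[of "2*i"] exp[of "2*i + 1"] by (simp_all add: p_def q_def p'_def q'_def)
  have lin: "dot (2*r) (%j. s*b (2*i) j + t*b (2*i + 1) j) (%j. s'*b (2*i) j + t'*b (2*i + 1) j)
    = s * s' + t * t'" for s t s' t'
  proof -
   have "dot (2*r) (%j. s*b (2*i) j + t*b (2*i + 1) j) (%j. s'*b (2*i) j + t'*b (2*i + 1) j)
    = s * s'*dot (2*r) (b (2*i)) (b (2*i)) + s * t'*dot (2*r) (b (2*i)) (b (2*i + 1))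
    + t * s'*dot (2*r) (b (2*i + 1)) (b (2*i)) + t * t'*dot (2*r) (b (2*i + 1)) (b (2*i + 1))"
    by (simp add: dot_def algebra_simps sum.distrib sum_distrib_left)
   thus ?thesis using frameD(2)[OF b] i by simp
  qed
  have n1: "p*p + q*q = 1" and n2: "p'*p' + q'*q' = 1" and o: "p*p' + q*q' = 0"
   using frameD(2)[OF b', of "2*i" "2*i"] frameD(2)[OF b', of "2*i + 1" "2*i + 1"]
    frameD(2)[OF b', of "2*i" "2*i + 1"] i unfolding e1 e2 lin by auto
  obtain a where a: "p = cos a" "q = sin a"
   using sincos_total_2pi[of p q] n1 by (auto simp: power2_eq_square)
  \<comment> \<open>The determinant of the block; its sign decides whether the plane belongs to
    \<open>E\<close>.\<close>
  define e where "e = p*q' - q*p'"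
  have "e*e = (p*p + q*q)*(p'*p' + q'*q') - (p*p' + q*q')*(p*p' + q*q')"
   by (simp add: e_def algebra_simps)
  hence "e*e = 1" using n1 n2 o by simp
  hence e: "e = 1 | e = -1" by (simp add: square_eq_1_iff)
  have "p' = (p*p + q*q)*p'" using n1 by simp
  also have "... = p*(p*p' + q*q') - q*e" by (simp add: e_def algebra_simps)
  finally have p': "p' = - q*e" using o by simp
  have "q' = (p*p + q*q)*q'" using n1 by simp
  also have "... = q*(p*p' + q*q') + p*e" by (simp add: e_def algebra_simps)
  finally have q': "q' = p*e" using o by simp
  thus ?thesis using e1 e2 e a p' q' by (intro exI[of _ a] exI[of _ e]) (auto simp: fun_eq_iff algebra_simps)
 qed
 let ?R = "%i a e. b' (2*i) = (%j. cos a*b (2*i) j + sin a*b (2*i + 1) j)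
   & (e = 1 | e = (-1::real)) & b' (2*i + 1) = (%j. e*(- sin a*b (2*i) j + cos a*b (2*i + 1) j))"
 have "\<forall>i. \<exists>p. i < r --> ?R i (fst p) (snd p)"
 proof
  fix i
  show "\<exists>p. i < r --> ?R i (fst p) (snd p)"
  proof (cases "i < r")
   case True
   from ex[OF this] obtain a e where "?R i a e" by blast
   thus ?thesis by (intro exI[of _ "(a, e)"]) simp
  qed simp
 qed
 from choice[OF this] obtain p where p: "\<forall>i. i < r --> ?R i (fst (p i)) (snd (p i))" by blast
 define aa where "aa = (%i. fst (p i))"
 define e where "e = (%i. snd (p i))"
 have ae: "?R i (aa i) (e i)" if "i < r" for i
  using p that unfolding aa_def e_def by blast
 define E where "E = {i. i < r & e i = -1}"
 have "b' l = turn aa E b l" if l: "l < 2*r" for l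
 proof -
  have i: "l div 2 < r" using l by auto
  show ?thesis
  proof (cases "even l")
   case True
   hence l2: "l = 2*(l div 2)" by simp
   have "b' l = (%j. cos (aa (l div 2))*b (2*(l div 2)) j + sin (aa (l div 2))*b (2*(l div 2) + 1) j)"
    using ae[OF i] l2 by simp
   thus ?thesis using True by (simp add: turn_def turn_cos_def turn_sin_def)
  next
   case False
   hence l2: "l = 2*(l div 2) + 1" by presburger
   have "b' l = (%j. e (l div 2)*(- sin (aa (l div 2))*b (2*(l div 2)) j + cos (aa (l div 2))*b (2*(l div 2) + 1) j))"
    using conjunct2[OF conjunct2[OF ae[OF i]]] l2[symmetric] by simp
   thus ?thesis
    using ae[OF i] False i by (auto simp: turn_def turn_cos_def turn_sin_def E_def fun_eq_iff)
  qed
 qed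
 thus ?thesis by (intro exI[of _ aa] exI[of _ E]) (auto simp: E_def)
qed

section \<open>Points of order complexes\<close>

text \<open>On weights, 1 minus the overlap is half of the l1-distance, so it bounds the change of
  every mass and of every single weight.\<close>

definition overlap :: "('p => real) => ('p => real) => real"
 where "overlap t t' = (\<Sum>p | t p~=0. min (t p) (t' p))"

definition mass :: "('p => real) => 'p set => real"
 where "mass t S = (\<Sum>p | t p~=0 & p\<in>S. t p)"

lemma realization_pointsD:
 assumes "t\<in>realization_points P prec"
 shows "finite {p. t p~=0}" "{p. t p~=0}\<subseteq>P" "0<=t p" "(\<Sum>p | t p~=0. t p) = 1"
  and "t p~=0 ==> t q~=0 ==> prec p q | prec q p"
proof -
 obtain C where C: "C\<in>order_simplices P prec" "t\<in>closed_simplex C"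
  using assms by (auto simp: realization_points_def)
 hence fin: "finite C" "C\<subseteq>P" and t: "!!p. 0<=t p" "!!p. p\<notin>C ==> t p = 0" "(\<Sum>p\<in>C. t p) = 1"
  by (auto simp: order_simplices_def closed_simplex_def)
 have sub: "{p. t p~=0}\<subseteq>C" using t(2) by auto
 show "finite {p. t p~=0}" "{p. t p~=0}\<subseteq>P" "0<=t p"
  using sub fin t(1) finite_subset by auto
 have "(\<Sum>p | t p~=0. t p) = (\<Sum>p\<in>C. t p)"
  by (rule sum.mono_neutral_left) (use fin sub in auto)
 thus "(\<Sum>p | t p~=0. t p) = 1" using t(3) by simp
 assume "t p~=0" "t q~=0"
 thus "prec p q | prec q p"
  using sub C(1) by (auto simp: order_simplices_def Complete_Partial_Order.chain_def)
qed

lemma realization_pointsI: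
 assumes "finite {p. t p~=0}" "{p. t p~=0}\<subseteq>P" "!!p. 0<=t p" "(\<Sum>p | t p~=0. t p) = 1"
  and "!!p q. t p~=0 ==> t q~=0 ==> prec p q | prec q p"
 shows "{p. t p~=0}\<in>order_simplices P prec" "t\<in>closed_simplex {p. t p~=0}"
  and "t\<in>realization_points P prec"
proof -
 have "{p. t p~=0}~={}" using assms(4) by (metis sum.empty zero_neq_one)
 thus 1: "{p. t p~=0}\<in>order_simplices P prec"
  using assms by (auto simp: order_simplices_def Complete_Partial_Order.chain_def)
 show 2: "t\<in>closed_simplex {p. t p~=0}"
  using assms by (auto simp: closed_simplex_def)
 show "t\<in>realization_points P prec" using 1 2 by (auto simp: realization_points_def)
qed

definition weights :: "('p => real) => bool"
 where "weights t \<longleftrightarrow> finite {p. t p~=0} & (\<forall>p. 0<=t p) & (\<Sum>p | t p~=0. t p) = 1"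

lemma weights_realization: "t\<in>realization_points P prec ==> weights t"
 using realization_pointsD[of t P prec] by (auto simp: weights_def)

lemma weightsD:
 assumes "weights t"
 shows "finite {p. t p~=0}" "0<=t p" "(\<Sum>p | t p~=0. t p) = 1" "t p<=1"
proof -
 show f: "finite {p. t p~=0}" and p: "0<=t p" for p
  using assms by (auto simp: weights_def)
 show s: "(\<Sum>p | t p~=0. t p) = 1" using assms by (auto simp: weights_def)
 show "t p<=1"
 proof (cases "t p = 0")
  case False
  thus ?thesis using member_le_sum[of p "{p. t p~=0}" t] f p s by auto
 qed simp
qed

lemma weights_sum_superset:
 assumes "weights t" "finite W" "{p. t p~=0}\<subseteq>W"
 shows "(\<Sum>p\<in>W. t p) = 1"
proof -
 have "(\<Sum>p | t p~=0. t p) = (\<Sum>p\<in>W. t p)"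
  by (rule sum.mono_neutral_left) (use assms in auto)
 thus ?thesis using weightsD(3)[OF assms(1)] by simp
qed

lemma overlap_superset:
 assumes "weights t" "weights t'" "finite W" "{p. t p~=0}\<subseteq>W"
 shows "overlap t t' = (\<Sum>p\<in>W. min (t p) (t' p))"
 unfolding overlap_def
 by (rule sum.mono_neutral_left) (use assms weightsD(2)[OF assms(2)] in auto)

lemma overlap_commute:
 assumes "weights t" "weights t'"
 shows "overlap t t' = overlap t' t"
proof -
 let ?W = "{p. t p~=0}\<union>{p. t' p~=0}"
 have "finite ?W" using weightsD(1) assms by auto
 hence "overlap t t' = (\<Sum>p\<in>?W. min (t p) (t' p))" "overlap t' t = (\<Sum>p\<in>?W. min (t' p) (t p))"
  using overlap_superset[OF assms, of ?W] overlap_superset[OF assms(2,1), of ?W] by auto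
 thus ?thesis by (simp add: min.commute)
qed

text \<open>The triangle inequality for 1 minus the overlap.\<close>

lemma overlap_triangle:
 assumes "weights s" "weights t" "weights t'"
 shows "overlap s t + overlap s t' - 1<=overlap t t'"
proof -
 let ?W = "{p. s p~=0}\<union>{p. t p~=0}"
 have fin: "finite ?W" using weightsD(1) assms by auto
 have "(\<Sum>p\<in>?W. s p) = 1" by (rule weights_sum_superset[OF assms(1) fin]) auto
 hence "overlap s t + overlap s t' - 1 = (\<Sum>p\<in>?W. min (s p) (t p) + min (s p) (t' p) - s p)"
  using overlap_superset[OF assms(1,2) fin] overlap_superset[OF assms(1,3) fin]
  by (simp add: sum.distrib sum_subtractf)
 also have "...<=(\<Sum>p\<in>?W. min (t p) (t' p))" by (rule sum_mono) auto
 also have "... = overlap t t'" using overlap_superset[OF assms(2,3) fin] by auto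
 finally show ?thesis .
qed

lemma overlap_self: "weights t ==> overlap t t = 1"
 by (simp add: overlap_def weightsD(3))

lemma mass_diff:
 assumes "weights t" "weights t'"
 shows "mass t S - mass t' S<=1 - overlap t t'"
proof -
 let ?W = "{p. t p~=0}\<union>{p. t' p~=0}"
 have fin: "finite ?W" using weightsD(1) assms by auto
 have m: "mass u S = (\<Sum>p\<in>?W\<inter>S. u p)" if "u = t | u = t'" for u
  unfolding mass_def by (rule sum.mono_neutral_left) (use fin that in auto)
 have "mass t S = (\<Sum>p\<in>?W\<inter>S. min (t p) (t' p)) + (\<Sum>p\<in>?W\<inter>S. t p - min (t p) (t' p))"
  using m[of t] by (simp add: sum_subtractf)
 also have "(\<Sum>p\<in>?W\<inter>S. min (t p) (t' p))<=mass t' S"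
  using m[of t'] by (auto intro: sum_mono)
 also have "(\<Sum>p\<in>?W\<inter>S. t p - min (t p) (t' p))<=(\<Sum>p\<in>?W. t p - min (t p) (t' p))"
  by (rule sum_mono2) (use fin in auto)
 also have "... = 1 - overlap t t'"
 proof -
  have "(\<Sum>p\<in>?W. t p) = 1"
   by (rule weights_sum_superset[OF assms(1) fin]) auto
  thus ?thesis using overlap_superset[OF assms fin] by (simp add: sum_subtractf)
 qed
 finally show ?thesis by simp
qed

lemma mass_abs_diff:
 assumes "weights t" "weights t'"
 shows "\<bar>mass t S - mass t' S\<bar><=1 - overlap t t'"
 using mass_diff[OF assms, of S] mass_diff[OF assms(2,1), of S] overlap_commute[OF assms] by linarith

lemma mass_singleton: "mass t {p} = t p"
proof -
 have "{q. t q~=0 & q\<in>{p}} = (if t p = 0 then {} else {p})" by auto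
 thus ?thesis by (simp add: mass_def)
qed

lemma weight_abs_diff:
 assumes "weights t" "weights t'"
 shows "\<bar>t p - t' p\<bar><=1 - overlap t t'"
 using mass_abs_diff[OF assms, of "{p}"] by (simp add: mass_singleton)

lemma realization_map_apply:
 assumes "inj_on f S" "{p. t p~=0}\<subseteq>S" "p\<in>S"
 shows "realization_map f t (f p) = t p"
proof -
 have "{p'. t p'~=0 & f p' = f p} = (if t p = 0 then {} else {p})"
  using assms by (auto simp: inj_on_def)
 thus ?thesis by (simp add: realization_map_def)
qed

lemma realization_map_nonzeroD:
 assumes "realization_map f t q~=0"
 shows "\<exists>p. t p~=0 & f p = q"
proof (rule ccontr)
 assume "\<not> ?thesis"
 hence "{p. t p~=0 & f p = q} = {}" by auto
 hence "realization_map f t q = sum t {}" unfolding realization_map_def by (rule arg_cong)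
 thus False using assms by simp
qed

lemma realization_map_support:
 assumes "inj_on f S" "{p. t p~=0}\<subseteq>S"
 shows "{q. realization_map f t q~=0} = f ` {p. t p~=0}"
 using realization_map_nonzeroD[of f t] realization_map_apply[OF assms] assms(2) by fastforce

lemma realization_map_comp:
 assumes "inj_on f S" "inj_on f' (f ` S)" "{p. t p~=0}\<subseteq>S"
 shows "realization_map f' (realization_map f t) = realization_map (%p. f' (f p)) t"
proof
 fix q
 have inj: "inj_on (%p. f' (f p)) S" using comp_inj_on[OF assms(1,2)] by (simp add: comp_def)
 have sup: "{q. realization_map f t q~=0}\<subseteq>f ` S" using realization_map_support[OF assms(1,3)] assms(3) by auto
 show "realization_map f' (realization_map f t) q = realization_map (%p. f' (f p)) t q"
 proof (cases "\<exists>p\<in>S. q = f' (f p)")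
  case True
  then obtain p where p: "p\<in>S" "q = f' (f p)" by blast
  have "realization_map f' (realization_map f t) q = realization_map f t (f p)"
   unfolding p(2) by (rule realization_map_apply[OF assms(2) sup]) (use p in auto)
  thus ?thesis
   using realization_map_apply[OF assms(1,3) p(1)] realization_map_apply[OF inj assms(3) p(1)] p(2) by simp
 next
  case False
  hence "realization_map f' (realization_map f t) q = 0" "realization_map (%p. f' (f p)) t q = 0"
   using realization_map_nonzeroD[of f' "realization_map f t" q] sup
    realization_map_nonzeroD[of "%p. f' (f p)" t q] assms(3) by blast+
  thus ?thesis by simp
 qed
qed

lemma realization_map_cong:
 assumes "!!p. t p~=0 ==> f p = f' p"
 shows "realization_map f t = realization_map f' t"
proof
 fix q
 have "{p. t p~=0 & f p = q} = {p. t p~=0 & f' p = q}" using assms by auto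
 thus "realization_map f t q = realization_map f' t q" by (simp add: realization_map_def)
qed

lemma realization_map_id: "realization_map (%p. p) t = t"
proof
 fix q
 have "{p. t p~=0 & p = q} = (if t q = 0 then {} else {q})" by auto
 thus "realization_map (%p. p) t q = t q" by (simp add: realization_map_def)
qed

lemma realization_map_points:
 assumes t: "t\<in>realization_points P prec" and f: "inj_on f P" "f ` P\<subseteq>P'"
  and mono: "!!p q. p\<in>P ==> q\<in>P ==> prec p q ==> prec' (f p) (f q)"
 shows "realization_map f t\<in>realization_points P' prec'"
proof (rule realization_pointsI(3))
 let ?f = "realization_map f t"
 note tD = realization_pointsD[OF t]
 have s: "{q. ?f q~=0} = f ` {p. t p~=0}" by (rule realization_map_support[OF f(1) tD(2)])
 show "finite {p. ?f p~=0}" "{p. ?f p~=0}\<subseteq>P'"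
  unfolding s using tD(1,2) f(2) by auto
 show "0<=?f q" for q
  unfolding realization_map_def by (intro sum_nonneg tD(3))
 have "(\<Sum>p | ?f p~=0. ?f p) = (\<Sum>p | t p~=0. ?f (f p))"
  unfolding s by (rule sum.reindex[unfolded comp_def]) (rule inj_on_subset[OF f(1) tD(2)])
 also have "... = (\<Sum>p | t p~=0. t p)"
  by (intro sum.cong refl realization_map_apply[OF f(1) tD(2)]) (use tD(2) in auto)
 finally show "(\<Sum>p | ?f p~=0. ?f p) = 1" using tD(4) by simp
 fix p q assume "?f p~=0" "?f q~=0"
 then obtain p' q' where "t p'~=0" "p = f p'" "t q'~=0" "q = f q'"
  using realization_map_nonzeroD by metis
 thus "prec' p q | prec' q p" using tD(2) tD(5)[of p' q'] mono by blast
qed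

lemma overlap_realization_map:
 assumes "inj_on f S" "{p. t p~=0}\<subseteq>S" "{p. t' p~=0}\<subseteq>S"
 shows "overlap (realization_map f t) (realization_map f t') = overlap t t'"
proof -
 have "overlap (realization_map f t) (realization_map f t')
   = (\<Sum>p | t p~=0. min (realization_map f t (f p)) (realization_map f t' (f p)))"
  unfolding overlap_def realization_map_support[OF assms(1,2)]
  by (rule sum.reindex[unfolded comp_def]) (rule inj_on_subset[OF assms(1,2)])
 also have "... = overlap t t'"
  unfolding overlap_def
  using realization_map_apply[OF assms(1,2)] realization_map_apply[OF assms(1,3)] assms(2)
  by (intro sum.cong refl) auto
 finally show ?thesis .
qed

text \<open>Only the finitely many vertices in the support of \<open>t\<close> enter, so the overlap
  with \<open>t\<close> is continuous already for pointwise convergence.\<close>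

lemma openin_overlap:
 assumes t: "t\<in>realization_points P prec"
 shows "openin (realization P prec) {t'\<in>realization_points P prec. c < overlap t t'}"
proof -
 have cont: "continuous_map (powertop_real UNIV) euclideanreal (%t'. overlap t t')"
  unfolding overlap_def
  by (intro continuous_map_sum continuous_map_real_min continuous_map_product_projection)
   (use realization_pointsD(1)[OF t] in \<open>auto intro: continuous_map_product_projection\<close>)
 have "openin (powertop_real UNIV) {t'\<in>topspace (powertop_real UNIV). overlap t t'\<in>{c<..}}"
  using cont by (rule openin_continuous_map_preimage) simp
 hence o: "openin (powertop_real UNIV) {t'. c < overlap t t'}" by simp
 show ?thesis
  unfolding openin_realization
 proof (intro conjI ballI)
  fix C assume "C\<in>order_simplices P prec"
  hence "closed_simplex C\<inter>{t'\<in>realization_points P prec. c < overlap t t'} = closed_simplex C\<inter>{t'. c < overlap t t'}"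
   by (auto simp: realization_points_def)
  thus "openin (subtopology (powertop_real UNIV) (closed_simplex C))
    (closed_simplex C\<inter>{t'\<in>realization_points P prec. c < overlap t t'})"
   using o by (simp add: openin_subtopology_Int2)
 qed auto
qed

section \<open>The group action on points\<close>

type_synonym point = "((vec => vec)\<times>nat => real)\<times>(((vec => vec)\<times>vec)\<times>(vec set => real))"

abbreviation OG :: "nat => (vec => vec) monoid"
 where "OG \<equiv> orthogonal_group"

abbreviation "OC d \<equiv> carrier (OG d)"

lemma OG_simps:
 "x\<in>Rn d ==> (g \<otimes>\<^bsub>OG d\<^esub> h) x = g (h x)" "x\<in>Rn d ==> \<one>\<^bsub>OG d\<^esub> x = x"
 by (simp_all add: orthogonal_group_def compose_def)

lemma OG_Rn: "g\<in>OC d ==> x\<in>Rn d ==> g x\<in>Rn d"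
 using linear_isometriesD(1)[OF orthogonalD(1)] .

lemma OG_inv:
 assumes g: "g\<in>OC d" and x: "x\<in>Rn d"
 shows "(inv\<^bsub>OG d\<^esub> g) (g x) = x" "g ((inv\<^bsub>OG d\<^esub> g) x) = x"
proof -
 interpret G: group "OG d" by (rule group_orthogonal_group)
 show "(inv\<^bsub>OG d\<^esub> g) (g x) = x" using G.l_inv[OF g] OG_simps[OF x] by metis
 show "g ((inv\<^bsub>OG d\<^esub> g) x) = x" using G.r_inv[OF g] OG_simps[OF x] by metis
qed

lemma OG_inj: "g\<in>OC d ==> inj_on g (Rn d)" and OG_image: "g\<in>OC d ==> g ` Rn d = Rn d"
 using orthogonalD(2) by (auto simp: bij_betw_def)

definition EG_points :: "nat => ((vec => vec)\<times>nat => real) set"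
 where "EG_points d = realization_points (OC d\<times>UNIV) milnor_le"

definition ST_points :: "nat => (vec set => real) set"
 where "ST_points d = realization_points {U. real_fun.subspace U & U\<subseteq>Rn d} (\<subseteq>)"

lemma EG_points_unique:
 assumes "e\<in>EG_points d" "e (g, i)~=0" "e (h, i)~=0"
 shows "g = h"
 using realization_pointsD(5)[OF assms(1)[unfolded EG_points_def] assms(2,3)] by (auto simp: milnor_le_def)

lemma EG_points_carrier: "e\<in>EG_points d ==> e (g, i)~=0 ==> g\<in>OC d"
 using realization_pointsD(2)[of e "OC d\<times>UNIV" milnor_le] by (auto simp: EG_points_def)

lemma inj_on_mult: "g\<in>OC d ==> inj_on (%(h, i). (g \<otimes>\<^bsub>OG d\<^esub> h, i::nat)) (OC d\<times>UNIV)"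
proof (rule inj_onI)
 interpret G: group "OG d" by (rule group_orthogonal_group)
 fix p q :: "(vec => vec)\<times>nat"
 assume "g\<in>OC d" "p\<in>OC d\<times>UNIV" "q\<in>OC d\<times>UNIV"
  and "(case p of (h, i) => (g \<otimes>\<^bsub>OG d\<^esub> h, i)) = (case q of (h, i) => (g \<otimes>\<^bsub>OG d\<^esub> h, i))"
 thus "p = q" by (cases p, cases q) auto
qed

lemma EG_support: "e\<in>EG_points d ==> {p. e p~=0}\<subseteq>OC d\<times>UNIV"
 using realization_pointsD(2) by (auto simp: EG_points_def)

lemma EG_act_apply:
 assumes "e\<in>EG_points d" "g\<in>OC d" "h\<in>OC d"
 shows "EG_act (OG d) g e (g \<otimes>\<^bsub>OG d\<^esub> h, i) = e (h, i)"
 using realization_map_apply[OF inj_on_mult[OF assms(2)] EG_support[OF assms(1)], of "(h, i)"] assms(3)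
 by (simp add: EG_act_def)

lemma EG_act_points:
 assumes "e\<in>EG_points d" "g\<in>OC d"
 shows "EG_act (OG d) g e\<in>EG_points d"
 unfolding EG_act_def EG_points_def
 by (rule realization_map_points[OF assms(1)[unfolded EG_points_def] inj_on_mult[OF assms(2)]])
  (use assms(2) group.is_monoid[OF group_orthogonal_group] in \<open>auto simp: milnor_le_def monoid.m_closed\<close>)

lemma EG_act_act:
 assumes "e\<in>EG_points d" "g\<in>OC d" "h\<in>OC d"
 shows "EG_act (OG d) g (EG_act (OG d) h e) = EG_act (OG d) (g \<otimes>\<^bsub>OG d\<^esub> h) e"
proof -
 interpret G: group "OG d" by (rule group_orthogonal_group)
 have "(%(k, i::nat). (h \<otimes>\<^bsub>OG d\<^esub> k, i)) ` (OC d\<times>UNIV)\<subseteq>OC d\<times>UNIV"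
  using assms by auto
 hence "EG_act (OG d) g (EG_act (OG d) h e)
   = realization_map (%p. (%(k, i). (g \<otimes>\<^bsub>OG d\<^esub> k, i)) ((%(k, i). (h \<otimes>\<^bsub>OG d\<^esub> k, i)) p)) e"
  unfolding EG_act_def
  by (intro realization_map_comp[OF inj_on_mult[OF assms(3)] _ EG_support[OF assms(1)]]
    inj_on_subset[OF inj_on_mult[OF assms(2)]])
 also have "... = EG_act (OG d) (g \<otimes>\<^bsub>OG d\<^esub> h) e"
  unfolding EG_act_def
  by (rule realization_map_cong) (use EG_support[OF assms(1)] assms in \<open>auto simp: G.m_assoc\<close>)
 finally show ?thesis .
qed

lemma EG_act_one:
 assumes "e\<in>EG_points d"
 shows "EG_act (OG d) \<one>\<^bsub>OG d\<^esub> e = e"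
proof -
 interpret G: group "OG d" by (rule group_orthogonal_group)
 have "EG_act (OG d) \<one>\<^bsub>OG d\<^esub> e = realization_map (%p. p) e"
  unfolding EG_act_def by (rule realization_map_cong) (use EG_support[OF assms] in auto)
 thus ?thesis by (simp add: realization_map_id)
qed

lemma inj_on_image_subspaces: "g\<in>OC d ==> inj_on (image g) {U. real_fun.subspace U & U\<subseteq>Rn d}"
 using inj_on_image_eq_iff[OF OG_inj] by (auto simp: inj_on_def)

lemma ST_support: "t\<in>ST_points d ==> {U. t U~=0}\<subseteq>{U. real_fun.subspace U & U\<subseteq>Rn d}"
 using realization_pointsD(2)[of t _ "(\<subseteq>)"] by (auto simp: ST_points_def)

lemma subspace_image:
 assumes g: "ph\<in>linear_isometries d n" and U: "real_fun.subspace U" "U\<subseteq>Rn d"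
 shows "real_fun.subspace (ph ` U)"
proof (rule real_fun.subspaceI)
 have "ph (%i. 0*(0::vec) i) = (%i. 0*ph 0 i)"
  by (rule linear_isometriesD(3)[OF g]) (simp add: Rn_iff)
 hence "ph 0 = 0" by (simp add: zero_fun_def)
 thus "0\<in>ph ` U" using real_fun.subspace_0[OF U(1)] by (metis image_eqI)
 show "x + y\<in>ph ` U" if xy: "x\<in>ph ` U" "y\<in>ph ` U" for x y
 proof -
  obtain u v where uv: "u\<in>U" "v\<in>U" "x = ph u" "y = ph v" using xy by auto
  hence "x + y = ph (u + v)" using linear_isometriesD(2)[OF g, of u v] U(2) by (simp add: subsetD)
  thus ?thesis using uv real_fun.subspace_add[OF U(1)] by blast
 qed
 show "(%i. c*x i)\<in>ph ` U" if x: "x\<in>ph ` U" for c x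
 proof -
  obtain u where u: "u\<in>U" "x = ph u" using x by auto
  hence "(%i. c*x i) = ph (%i. c*u i)" using linear_isometriesD(3)[OF g, of u c] U(2) by (simp add: subsetD)
  thus ?thesis using u real_fun.subspace_scale[OF U(1)] by blast
 qed
qed

lemma ST_act_points:
 assumes t: "t\<in>ST_points d" and g: "g\<in>OC d"
 shows "realization_map (image g) t\<in>ST_points d"
 unfolding ST_points_def
proof (rule realization_map_points[OF t[unfolded ST_points_def] inj_on_image_subspaces[OF g]])
 show "(`) g ` {U. real_fun.subspace U & U\<subseteq>Rn d}\<subseteq>{U. real_fun.subspace U & U\<subseteq>Rn d}"
  using subspace_image[OF orthogonalD(1)[OF g]] OG_Rn[OF g] by auto
qed auto

lemma ST_act_apply:
 assumes "t\<in>ST_points d" "g\<in>OC d" "real_fun.subspace U" "U\<subseteq>Rn d"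
 shows "realization_map (image g) t (g ` U) = t U"
 by (rule realization_map_apply[OF inj_on_image_subspaces[OF assms(2)] ST_support[OF assms(1)]]) (use assms in auto)

lemma ST_act_act:
 assumes "t\<in>ST_points d" "g\<in>OC d" "h\<in>OC d"
 shows "realization_map (image g) (realization_map (image h) t) = realization_map (image (g \<otimes>\<^bsub>OG d\<^esub> h)) t"
proof -
 have "(`) h ` {U. real_fun.subspace U & U\<subseteq>Rn d}\<subseteq>{U. real_fun.subspace U & U\<subseteq>Rn d}"
  using subspace_image[OF orthogonalD(1)[OF assms(3)]] OG_Rn[OF assms(3)] by auto
 hence "realization_map (image g) (realization_map (image h) t) = realization_map (%U. g ` (h ` U)) t"
  by (intro realization_map_comp[OF inj_on_image_subspaces[OF assms(3)] _ ST_support[OF assms(1)]]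
    inj_on_subset[OF inj_on_image_subspaces[OF assms(2)]])
 also have "... = realization_map (image (g \<otimes>\<^bsub>OG d\<^esub> h)) t"
 proof (rule realization_map_cong)
  fix U assume "t U~=0"
  hence "U\<subseteq>Rn d" using ST_support[OF assms(1)] by auto
  thus "g ` h ` U = (g \<otimes>\<^bsub>OG d\<^esub> h) ` U"
   unfolding image_image by (intro image_cong refl) (auto simp: OG_simps(1) subsetD)
 qed
 finally show ?thesis .
qed

lemma ST_act_one:
 assumes "t\<in>ST_points d"
 shows "realization_map (image \<one>\<^bsub>OG d\<^esub>) t = t"
proof -
 have "realization_map (image \<one>\<^bsub>OG d\<^esub>) t = realization_map (%U. U) t"
 proof (rule realization_map_cong)
  fix U assume "t U~=0"
  hence "U\<subseteq>Rn d" using ST_support[OF assms] by auto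
  hence "\<one>\<^bsub>OG d\<^esub> ` U = (%x. x) ` U" by (intro image_cong refl) (auto simp: OG_simps(2) subsetD)
  thus "\<one>\<^bsub>OG d\<^esub> ` U = U" by simp
 qed
 thus ?thesis by (simp add: realization_map_id)
qed

definition bundle_points :: "nat => nat => ((vec => vec)\<times>vec) set"
 where "bundle_points d N = {(ph, w). ph\<in>linear_isometries d N & w\<in>Rn N & (\<forall>v\<in>Rn d. dot N w (ph v) = 0)}"

lemma neg_sphere_act_points:
 assumes "x\<in>bundle_points d N" "g\<in>OC d"
 shows "neg_sphere_act d g x\<in>bundle_points d N"
proof -
 interpret G: group "OG d" by (rule group_orthogonal_group)
 have i: "inv\<^bsub>OG d\<^esub> g\<in>OC d" using assms by simp
 note gR = OG_Rn[OF i] and lin = linear_isometriesD[OF orthogonalD(1)[OF i]]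
 obtain ph w where x: "x = (ph, w)" by force
 hence ph: "ph\<in>linear_isometries d N" using assms by (auto simp: bundle_points_def)
 let ?c = "compose (Rn d) ph (inv\<^bsub>OG d\<^esub> g)"
 have Radd: "u + v\<in>Rn d" "(%i. c*u i)\<in>Rn d" if "u\<in>Rn d" "v\<in>Rn d" for u v c
  using that by (auto simp: Rn_iff)
 have "?c\<in>linear_isometries d N"
  unfolding linear_isometries_def mem_Collect_eq
 proof (intro conjI ballI allI)
  show "?c\<in>Rn d \<rightarrow>\<^sub>E Rn N"
   using linear_isometriesD(1)[OF ph] gR by (auto simp: compose_def)
  fix u v c assume u: "u\<in>Rn d"
  show "?c (%i. c*u i) = (%i. c*?c u i)"
   using u Radd(2)[OF u u] by (simp add: compose_def lin(3) linear_isometriesD(3)[OF ph] gR)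
  assume v: "v\<in>Rn d"
  show "?c (u + v) = ?c u + ?c v"
   using u v Radd(1)[OF u v] by (simp add: compose_def lin(2) linear_isometriesD(2)[OF ph] gR)
  show "dot N (?c u) (?c v) = dot d u v"
   using u v by (simp add: compose_def lin(4) linear_isometriesD(4)[OF ph] gR)
 qed
 thus ?thesis using assms(1) gR unfolding x by (auto simp: bundle_points_def neg_sphere_act_def compose_def)
qed

lemma neg_sphere_act_act:
 assumes "x\<in>bundle_points d N" "g\<in>OC d" "h\<in>OC d"
 shows "neg_sphere_act d g (neg_sphere_act d h x) = neg_sphere_act d (g \<otimes>\<^bsub>OG d\<^esub> h) x"
proof -
 interpret G: group "OG d" by (rule group_orthogonal_group)
 have "compose (Rn d) (compose (Rn d) ph (inv\<^bsub>OG d\<^esub> h)) (inv\<^bsub>OG d\<^esub> g) = compose (Rn d) ph (inv\<^bsub>OG d\<^esub> (g \<otimes>\<^bsub>OG d\<^esub> h))" for ph :: "vec => vec"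
  using assms OG_Rn[of "inv\<^bsub>OG d\<^esub> g" d] by (auto simp: fun_eq_iff compose_def G.inv_mult_group OG_simps(1))
 thus ?thesis by (cases x) (simp add: neg_sphere_act_def)
qed

lemma neg_sphere_act_one:
 assumes "x\<in>bundle_points d N"
 shows "neg_sphere_act d \<one>\<^bsub>OG d\<^esub> x = x"
proof -
 interpret G: group "OG d" by (rule group_orthogonal_group)
 obtain ph w where x: "x = (ph, w)" by force
 hence "ph\<in>linear_isometries d N" using assms by (auto simp: bundle_points_def)
 hence "ph x = undefined" if "x\<notin>Rn d" for x using linear_isometriesD(5) that by blast
 hence "compose (Rn d) ph (inv\<^bsub>OG d\<^esub> \<one>\<^bsub>OG d\<^esub>) = ph"
  by (auto simp: fun_eq_iff compose_def OG_simps(2))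
 thus ?thesis by (simp add: x neg_sphere_act_def)
qed

definition points :: "nat => nat => point set"
 where "points d N = EG_points d\<times>(bundle_points d N\<times>ST_points d)"

definition act_fibre :: "nat => (vec => vec) => ((vec => vec)\<times>vec)\<times>(vec set => real) => ((vec => vec)\<times>vec)\<times>(vec set => real)"
 where "act_fibre d g = map_prod (neg_sphere_act d g) (realization_map (image g))"

definition act_point :: "nat => (vec => vec) => point => point"
 where "act_point d g p = (EG_act (OG d) g (fst p), act_fibre d g (snd p))"

lemma act_point_points: "p\<in>points d N ==> g\<in>OC d ==> act_point d g p\<in>points d N"
 using EG_act_points neg_sphere_act_points ST_act_points
 by (auto simp: points_def act_point_def act_fibre_def)

lemma act_point_act:
 "p\<in>points d N ==> g\<in>OC d ==> h\<in>OC d ==>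
  act_point d g (act_point d h p) = act_point d (g \<otimes>\<^bsub>OG d\<^esub> h) p"
 using EG_act_act neg_sphere_act_act ST_act_act
 by (auto simp: points_def act_point_def act_fibre_def)

lemma act_point_one: "p\<in>points d N ==> act_point d \<one>\<^bsub>OG d\<^esub> p = p"
 using EG_act_one neg_sphere_act_one ST_act_one
 by (auto simp: points_def act_point_def act_fibre_def)

lemma overlap_EG_act:
 assumes "e\<in>EG_points d" "e'\<in>EG_points d" "g\<in>OC d"
 shows "overlap (EG_act (OG d) g e) (EG_act (OG d) g e') = overlap e e'"
 unfolding EG_act_def
 by (rule overlap_realization_map[OF inj_on_mult[OF assms(3)] EG_support[OF assms(1)] EG_support[OF assms(2)]])

lemma weights_EG: "e\<in>EG_points d ==> weights e"
 unfolding EG_points_def by (rule weights_realization)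

lemma weights_ST: "t\<in>ST_points d ==> weights t"
 unfolding ST_points_def by (rule weights_realization)

text \<open>The two overlaps with \<open>e\<close> add up to more than 1, so some vertex supports
  both \<open>e'\<close> and its translate. In Milnor's model the index of a support vertex
  determines its group coordinate, which left multiplication by \<open>g\<close> therefore
  fixes.\<close>

lemma EG_act_free:
 assumes e: "e\<in>EG_points d" "e'\<in>EG_points d" and g: "g\<in>OC d"
  and ov: "overlap e e' > 1/2" "overlap e (EG_act (OG d) g e') > 1/2"
 shows "g = \<one>\<^bsub>OG d\<^esub>"
proof -
 interpret G: group "OG d" by (rule group_orthogonal_group)
 note ge' = EG_act_points[OF e(2) g]
 have "\<exists>p. e p~=0 & e p < min (e p) (e' p) + min (e p) (EG_act (OG d) g e' p)"
 proof (rule ccontr)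
  assume "\<not> ?thesis"
  hence "(\<Sum>p | e p~=0. min (e p) (e' p) + min (e p) (EG_act (OG d) g e' p))<=(\<Sum>p | e p~=0. e p)"
   by (intro sum_mono) (auto simp: not_less)
  thus False
   using ov weightsD(3)[OF weights_EG[OF e(1)]] by (simp add: overlap_def sum.distrib)
 qed
 then obtain p where p: "e p < min (e p) (e' p) + min (e p) (EG_act (OG d) g e' p)" by blast
 have nn: "0<=e' p" "0<=EG_act (OG d) g e' p"
  using weightsD(2)[OF weights_EG[OF e(2)]] weightsD(2)[OF weights_EG[OF ge']] by auto
 have n1: "e' p~=0" "EG_act (OG d) g e' p~=0" using p nn by (auto simp: min_def split: if_splits)
 obtain h i where hi: "p = (h, i)" by force
 obtain k where k: "e' (k, i)~=0" "h = g \<otimes>\<^bsub>OG d\<^esub> k"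
  using realization_map_nonzeroD[OF n1(2)[unfolded EG_act_def]] hi by auto
 have "k = h" using EG_points_unique[OF e(2) k(1)] n1(1) hi by simp
 thus ?thesis using k(2) EG_points_carrier[OF e(2) k(1)] g by simp
qed

text \<open>The group coordinate at the least index in the support: an equivariant but discontinuous
  choice of a group element.\<close>

definition label :: "((vec => vec)\<times>nat => real) => vec => vec"
 where "label e = (THE g. e (g, LEAST i. \<exists>g. e (g, i)~=0)~=0)"

lemma label_eqI:
 assumes "e\<in>EG_points d" "e (g, i)~=0" "!!h j. e (h, j)~=0 ==> i<=j"
 shows "label e = g"
proof -
 have "(LEAST i. \<exists>g. e (g, i)~=0) = i"
  by (rule Least_equality) (use assms in auto)
 thus ?thesis unfolding label_def
  using assms(2) EG_points_unique[OF assms(1)] by (intro the_equality) auto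
qed

lemma label_ex:
 assumes "e\<in>EG_points d"
 obtains i where "e (label e, i)~=0" "!!h j. e (h, j)~=0 ==> i<=j" "label e\<in>OC d"
proof -
 have "\<exists>p. e p~=0" using realization_pointsD(4)[OF assms[unfolded EG_points_def]]
  by (metis (mono_tags, lifting) Collect_empty_eq sum.empty zero_neq_one)
 hence ex: "\<exists>i g. e (g, i)~=0" by auto
 define i where "i = (LEAST i. \<exists>g. e (g, i)~=0)"
 obtain g where g: "e (g, i)~=0" using LeastI_ex[OF ex] unfolding i_def by blast
 have le: "i<=j" if "e (h, j)~=0" for h j unfolding i_def by (rule Least_le) (use that in blast)
 have "label e = g" by (rule label_eqI[OF assms g le])
 thus thesis using that[of i] g le EG_points_carrier[OF assms g] by blast
qed

lemma label_EG_act: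
 assumes e: "e\<in>EG_points d" and g: "g\<in>OC d"
 shows "label (EG_act (OG d) g e) = g \<otimes>\<^bsub>OG d\<^esub> label e"
proof -
 obtain i where i: "e (label e, i)~=0" "!!h j. e (h, j)~=0 ==> i<=j" "label e\<in>OC d"
  using label_ex[OF e] by blast
 show ?thesis
 proof (rule label_eqI[OF EG_act_points[OF e g]])
  show "EG_act (OG d) g e (g \<otimes>\<^bsub>OG d\<^esub> label e, i)~=0"
   using EG_act_apply[OF e g i(3)] i(1) by simp
  fix h j assume "EG_act (OG d) g e (h, j)~=0"
  then obtain k where "e (k, j)~=0" unfolding EG_act_def using realization_map_nonzeroD by fastforce
  thus "i<=j" by (rule i(2))
 qed
qed

section \<open>Directions in the planes of a flag\<close>

lemma frame_act:
 assumes "frame d b" "g\<in>OC d"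
 shows "frame d (%k. g (b k))"
 using assms frameD[OF assms(1)] OG_Rn[OF assms(2)] linear_isometriesD(4)[OF orthogonalD(1)[OF assms(2)]]
 unfolding frame_def by auto

lemma flag_act:
 assumes b: "frame d b" and g: "g\<in>OC d" and i: "2*i<=d"
 shows "flag (%k. g (b k)) i = g ` flag b i"
proof
 note gi = orthogonalD(1)[OF g]
 have sub: "flag b i\<subseteq>Rn d" by (rule flag_subset_Rn[OF b i])
 show "flag (%k. g (b k)) i\<subseteq>g ` flag b i"
  by (rule flag_subset_subspace[OF subspace_image[OF gi subspace_flag sub]]) (auto intro: mem_flag)
 show "g ` flag b i\<subseteq>flag (%k. g (b k)) i"
 proof
  fix x assume "x\<in>g ` flag b i"
  then obtain u where u: "u\<in>flag b i" "x = g u" by auto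
  have "x = g (%j. \<Sum>k<2*i. dot d u (b k)*b k j)"
   using flag_expansion[OF b i u(1)] u(2) by simp
  also have "... = (%j. \<Sum>k<2*i. dot d u (b k)*g (b k) j)"
   by (rule linear_isometries_comb[OF gi]) (use i frameD(1)[OF b] in auto)
  also have "...\<in>flag (%k. g (b k)) i"
   by (rule subspace_comb[OF subspace_flag]) (auto intro: mem_flag[of _ i "%k. g (b k)"])
  finally show "x\<in>flag (%k. g (b k)) i" .
 qed
qed

lemma pcoord_act:
 assumes "frame d b" "g\<in>OC d" "2*Suc i<=d" "u\<in>Rn d"
 shows "pcoord d (%k. g (b k)) i (g u) = pcoord d b i u"
 using assms linear_isometriesD(4)[OF orthogonalD(1)[OF assms(2)] assms(4)] frameD(1)[OF assms(1)]
 by (simp add: pcoord_def)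

definition dir_set :: "nat => real => (nat => vec) => nat => (vec set => real) => complex set"
 where "dir_set d de b i t = {m. \<exists>U u. de<=t U & flag b i \<subset> U & U \<subset> flag b (Suc i) & u\<in>U &
  m = pcoord d b i u & m~=0}"

text \<open>A group element is onto, so some standard basis vector has an image with nonzero plane
  coordinate. Taking the first one is compatible with the action.\<close>

definition label_dir :: "nat => (nat => vec) => nat => (vec => vec) => complex"
 where "label_dir d b i g
  = pcoord d b i (g (stdf (LEAST k. k < d & pcoord d b i (g (stdf k))~=0)))"

text \<open>A heavy intermediate subspace takes precedence over the label. Where weight moves from a
  member of the flag to such a subspace, the line is shared by nearby points and the direction
  factor vanishes.\<close>

definition direction :: "nat => real => (nat => vec) => nat => point => complex"
 where "direction d de b i p = (if dir_set d de b i (snd (snd p)) = {} then label_dir d b i (label (fst p))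
  else SOME m. m\<in>dir_set d de b i (snd (snd p)))"

lemma ST_subspace: "t\<in>ST_points d ==> t U~=0 ==> real_fun.subspace U & U\<subseteq>Rn d"
 using ST_support by blast

lemma dir_set_act:
 assumes b: "frame d b" and g: "g\<in>OC d" and i: "2*Suc i<=d"
  and t: "t\<in>ST_points d" and de: "0 < de"
 shows "dir_set d de (%k. g (b k)) i (realization_map (image g) t) = dir_set d de b i t"
proof -
 have fl: "flag (%k. g (b k)) i = g ` flag b i" "flag (%k. g (b k)) (Suc i) = g ` flag b (Suc i)"
  using i by (intro flag_act[OF b g]; simp)+
 have fR: "flag b i\<subseteq>Rn d" "flag b (Suc i)\<subseteq>Rn d" using i by (intro flag_subset_Rn[OF b]; simp)+
 have iff: "g ` A \<subset> g ` B \<longleftrightarrow> A \<subset> B" if "A\<subseteq>Rn d" "B\<subseteq>Rn d" for A B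
  unfolding psubset_eq inj_on_image_subset_iff[OF OG_inj[OF g] that] inj_on_image_eq_iff[OF OG_inj[OF g] that] ..
 show ?thesis
 proof (intro equalityI subsetI)
  fix m assume "m\<in>dir_set d de b i t"
  then obtain U u where U: "de<=t U" "flag b i \<subset> U" "U \<subset> flag b (Suc i)" "u\<in>U"
   "m = pcoord d b i u" "m~=0" unfolding dir_set_def mem_Collect_eq by blast
  have US: "real_fun.subspace U" "U\<subseteq>Rn d" using ST_subspace[OF t, of U] U(1) de by auto
  have "realization_map (image g) t (g ` U) = t U" by (rule ST_act_apply[OF t g US])
  thus "m\<in>dir_set d de (%k. g (b k)) i (realization_map (image g) t)"
   unfolding dir_set_def mem_Collect_eq
   using U US fR pcoord_act[OF b g i, of u] iff
   by (intro exI[of _ "g ` U"] exI[of _ "g u"]) (auto simp: fl subsetD)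
 next
  fix m assume "m\<in>dir_set d de (%k. g (b k)) i (realization_map (image g) t)"
  then obtain U' u' where U': "de<=realization_map (image g) t U'" "g ` flag b i \<subset> U'" "U' \<subset> g ` flag b (Suc i)" "u'\<in>U'"
   "m = pcoord d (%k. g (b k)) i u'" "m~=0" unfolding dir_set_def mem_Collect_eq fl by blast
  obtain U where U: "t U~=0" "g ` U = U'"
   using realization_map_nonzeroD[of "image g" t U'] U'(1) de by auto
  have US: "real_fun.subspace U" "U\<subseteq>Rn d" using ST_subspace[OF t U(1)] by auto
  obtain u where u: "u\<in>U" "u' = g u" using U' U by auto
  have "realization_map (image g) t (g ` U) = t U" by (rule ST_act_apply[OF t g US])
  hence "de<=t U" using U'(1) U(2) by simp
  moreover have "flag b i \<subset> U" "U \<subset> flag b (Suc i)"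
   using U'(2,3) unfolding U(2)[symmetric] iff[OF fR(1) US(2)] iff[OF US(2) fR(2)] by auto
  moreover have "m = pcoord d b i u"
   using U'(5) pcoord_act[OF b g i, of u] u US(2) by (auto simp: subsetD)
  ultimately show "m\<in>dir_set d de b i t"
   unfolding dir_set_def mem_Collect_eq using u(1) U'(6) by blast
 qed
qed

lemma label_dir_ex:
 assumes b: "frame d b" and h: "h\<in>OC d" and i: "2*Suc i<=d"
 shows "\<exists>k<d. pcoord d b i (h (stdf k))~=0"
proof (rule ccontr)
 assume n: "\<not> ?thesis"
 have bi: "b (2*i)\<in>Rn d" using frameD(1)[OF b, of "2*i"] i by simp
 let ?y = "(inv\<^bsub>OG d\<^esub> h) (b (2*i))"
 have yR: "?y\<in>Rn d" using OG_Rn[OF group.inv_closed[OF group_orthogonal_group h] bi] .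
 have "b (2*i) = h (%j. \<Sum>k<d. ?y k * stdf k j)"
  using OG_inv(2)[OF h bi] Rn_expansion[OF yR] by simp
 also have "... = (%j. \<Sum>k<d. ?y k*h (stdf k) j)"
  by (rule linear_isometries_comb[OF orthogonalD(1)[OF h]]) (auto intro: stdf_Rn)
 finally have "dot d (b (2*i)) (b (2*i)) = (\<Sum>k<d. ?y k*dot d (h (stdf k)) (b (2*i)))"
  using dot_comb_left[of d ?y "%k. h (stdf k)" "{..<d}" "b (2*i)"] by simp
 also have "... = 0" using n by (intro sum.neutral) (auto simp: pcoord_def complex_eq_iff)
 finally show False using frameD(2)[OF b, of "2*i" "2*i"] i by simp
qed

lemma label_dir_act:
 assumes b: "frame d b" and g: "g\<in>OC d" and h: "h\<in>OC d" and i: "2*Suc i<=d"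
 shows "label_dir d (%k. g (b k)) i (g \<otimes>\<^bsub>OG d\<^esub> h) = label_dir d b i h"
proof -
 have e: "pcoord d (%k. g (b k)) i ((g \<otimes>\<^bsub>OG d\<^esub> h) (stdf k)) = pcoord d b i (h (stdf k))"
  if "k < d" for k
  using pcoord_act[OF b g i, of "h (stdf k)"] OG_Rn[OF h stdf_Rn[OF that]]
   OG_simps(1)[OF stdf_Rn[OF that]] by simp
 have L: "(LEAST k. k < d & pcoord d (%k. g (b k)) i ((g \<otimes>\<^bsub>OG d\<^esub> h) (stdf k))~=0)
   = (LEAST k. k < d & pcoord d b i (h (stdf k))~=0)"
  using e by (intro arg_cong[of _ _ Least]) (auto simp: fun_eq_iff)
 have "\<exists>k<d. pcoord d b i (h (stdf k))~=0" by (rule label_dir_ex[OF b h i])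
 hence "(LEAST k. k < d & pcoord d b i (h (stdf k))~=0) < d"
  by (metis (mono_tags, lifting) LeastI)
 from e[OF this] show ?thesis unfolding label_dir_def L .
qed

lemma label_dir_nonzero:
 assumes b: "frame d b" and h: "h\<in>OC d" and i: "2*Suc i<=d"
 shows "label_dir d b i h~=0"
 using label_dir_ex[OF assms] unfolding label_dir_def by (metis (mono_tags, lifting) LeastI)

lemma direction_act:
 assumes "frame d b" "g\<in>OC d" "2*Suc i<=d" "p\<in>points d N" "0 < de"
 shows "direction d de (%k. g (b k)) i (act_point d g p) = direction d de b i p"
proof -
 obtain e x t where p: "p = (e, x, t)" by (cases p) auto
 have e: "e\<in>EG_points d" and t: "t\<in>ST_points d" using assms(4) by (auto simp: p points_def)
 obtain j where "label e\<in>OC d" using label_ex[OF e] by blast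
 thus ?thesis
  using dir_set_act[OF assms(1,2,3) t assms(5)] label_EG_act[OF e assms(2)] label_dir_act[OF assms(1,2) _ assms(3)]
  by (simp add: p direction_def act_point_def act_fibre_def)
qed

text \<open>The two subspaces belong to one chain, so the larger contains both vectors, and it
  traces only a line in the plane.\<close>

lemma dir_set_proportional:
 assumes b: "frame d b" and i: "2*Suc i<=d" and t: "t\<in>ST_points d" and de: "0 < de"
  and m: "m\<in>dir_set d de b i t" "m'\<in>dir_set d de b i t"
 shows "\<exists>c. c~=0 & m' = of_real c*m"
proof -
 obtain U u where U: "de<=t U" "flag b i \<subset> U" "U \<subset> flag b (Suc i)" "u\<in>U"
   "m = pcoord d b i u" "m~=0" using m(1) unfolding dir_set_def mem_Collect_eq by blast
 obtain U' u' where U': "de<=t U'" "flag b i \<subset> U'" "U' \<subset> flag b (Suc i)" "u'\<in>U'"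
   "m' = pcoord d b i u'" "m'~=0" using m(2) unfolding dir_set_def mem_Collect_eq by blast
 have n: "t U~=0" "t U'~=0" using U(1) U'(1) de by auto
 note S = ST_subspace[OF t n(1)] ST_subspace[OF t n(2)]
 have "U\<subseteq>U' | U'\<subseteq>U" using realization_pointsD(5)[OF t[unfolded ST_points_def] n] .
 then obtain W where W: "real_fun.subspace W" "flag b i\<subseteq>W" "W \<subset> flag b (Suc i)" "u\<in>W" "u'\<in>W"
  using U U' S by blast
 show ?thesis
  using pcoord_proportional[OF b i W] U U' by auto
qed

lemma dir_set_nonempty:
 assumes b: "frame d b" and i: "2*Suc i<=d" and U: "de<=t U" "flag b i \<subset> U" "U \<subset> flag b (Suc i)"
 shows "\<exists>u\<in>U. pcoord d b i u\<in>dir_set d de b i t & pcoord d b i u~=0"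
proof -
 obtain u where u: "u\<in>U" "u\<notin>flag b i" using U(2) by blast
 hence "pcoord d b i u~=0" using flag_of_pcoord_0[OF b i] U(3) by blast
 moreover from this have "pcoord d b i u\<in>dir_set d de b i t"
  unfolding dir_set_def mem_Collect_eq using u(1) U by blast
 ultimately show ?thesis using u(1) by blast
qed

text \<open>One vector of the common \<open>U\<close> gives an admissible direction at both points.
  Other choices differ from it by real factors, which \<open>f\<close> ignores.\<close>

lemma direction_const:
 assumes b: "frame d b" and i: "2*Suc i<=d" and f: "angle_functional f" and de: "0 < de"
  and p: "p\<in>points d N" "p'\<in>points d N"
  and U: "de<=snd (snd p) U" "de<=snd (snd p') U" "flag b i \<subset> U" "U \<subset> flag b (Suc i)"
 shows "f (Arg (direction d de b i p)) = f (Arg (direction d de b i p'))"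
proof -
 obtain u where u: "u\<in>U" "pcoord d b i u~=0"
  using dir_set_nonempty[where t = "snd (snd p)", OF b i U(1,3,4)] by blast
 have *: "f (Arg (direction d de b i q)) = f (Arg (pcoord d b i u))"
  if q: "q\<in>points d N" "de<=snd (snd q) U" for q
 proof -
  have t: "snd (snd q)\<in>ST_points d" using q(1) by (auto simp: points_def)
  have m: "pcoord d b i u\<in>dir_set d de b i (snd (snd q))"
   unfolding dir_set_def mem_Collect_eq using u U(3,4) q(2) by blast
  hence s: "(SOME m. m\<in>dir_set d de b i (snd (snd q)))\<in>dir_set d de b i (snd (snd q))" by (rule someI)
  have "direction d de b i q = (SOME m. m\<in>dir_set d de b i (snd (snd q)))" using m by (auto simp: direction_def)
  then obtain c where "c~=0" "direction d de b i q = of_real c*pcoord d b i u"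
   using dir_set_proportional[OF b i t de m s] by auto
  thus ?thesis using angle_functional_Arg_scale[OF f u(2)] by simp
 qed
 show ?thesis using *[OF p(1) U(1)] *[OF p(2) U(2)] by simp
qed

definition turn_dir :: "vec => nat set => nat => complex => complex"
 where "turn_dir aa E i m = (if i\<in>E then cnj (cis (- aa i)*m) else cis (- aa i)*m)"

lemma turn_dir_eq_0 [simp]: "turn_dir aa E i m = 0 \<longleftrightarrow> m = 0"
 by (auto simp: turn_dir_def)

lemma turn_dir_functional:
 assumes "angle_functional f" "m~=0"
 shows "f (Arg (turn_dir aa E i m)) = (if i\<in>E then -1 else 1)*(f (Arg m) - f (aa i))"
 using angle_functional_Arg_mult[OF assms, of "- aa i"] angle_functional_Arg_cnj[OF assms(1)] angle_functionalD(4)[OF assms(1)]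
 by (simp add: turn_dir_def del: complex_cnj_mult)

lemma direction_turn:
 assumes b: "frame d b" and b': "!!l. l < d ==> b' l = turn aa E b l"
  and fl: "!!i. 2*i<=d ==> flag b' i = flag b i"
  and i: "2*Suc i<=d" and f: "angle_functional f" and de: "0 < de" and p: "p\<in>points d N"
 shows "f (Arg (direction d de b' i p)) = (if i\<in>E then -1 else 1)*(f (Arg (direction d de b i p)) - f (aa i))"
proof -
 let ?d = "dir_set d de b i (snd (snd p))"
 have pc: "pcoord d b' i u = turn_dir aa E i (pcoord d b i u)" for u
 proof -
  have "pcoord d b' i u = pcoord d (turn aa E b) i u"
   using b'[of "2*i"] b'[of "2*i + 1"] i by (simp add: pcoord_def)
  thus ?thesis by (simp add: pcoord_turn turn_dir_def)
 qed
 have t: "snd (snd p)\<in>ST_points d" and e: "fst p\<in>EG_points d" using p by (auto simp: points_def)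
 have ds: "dir_set d de b' i (snd (snd p)) = turn_dir aa E i ` ?d"
 proof -
  have e: "flag b' i = flag b i" "flag b' (Suc i) = flag b (Suc i)" using i by (intro fl; simp)+
  show ?thesis
  proof (intro equalityI subsetI)
   fix m assume "m\<in>dir_set d de b' i (snd (snd p))"
   then obtain U u where U: "de<=snd (snd p) U" "flag b i \<subset> U" "U \<subset> flag b (Suc i)" "u\<in>U"
    "m = turn_dir aa E i (pcoord d b i u)" "m~=0" unfolding dir_set_def mem_Collect_eq e pc by blast
   hence "pcoord d b i u~=0" by auto
   hence "pcoord d b i u\<in>?d"
    unfolding dir_set_def mem_Collect_eq using U by blast
   thus "m\<in>turn_dir aa E i ` ?d" using U(5) by blast
  next
   fix m assume "m\<in>turn_dir aa E i ` ?d"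
   then obtain m' where m': "m'\<in>?d" "m = turn_dir aa E i m'" by blast
   then obtain U u where U: "de<=snd (snd p) U" "flag b i \<subset> U" "U \<subset> flag b (Suc i)" "u\<in>U"
    "m' = pcoord d b i u" "m'~=0" unfolding dir_set_def mem_Collect_eq by blast
   hence "m~=0" using m'(2) by simp
   thus "m\<in>dir_set d de b' i (snd (snd p))"
    unfolding dir_set_def mem_Collect_eq e pc using U m'(2) by blast
  qed
 qed
 show ?thesis
 proof (cases "?d = {}")
  case True
  obtain j where "label (fst p)\<in>OC d" using label_ex[OF e] by blast
  hence nz: "label_dir d b i (label (fst p))~=0" by (rule label_dir_nonzero[OF b _ i])
  have "label_dir d b' i (label (fst p)) = turn_dir aa E i (label_dir d b i (label (fst p)))"
   by (simp add: label_dir_def pc)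
  thus ?thesis using True ds turn_dir_functional[OF f nz] by (simp add: direction_def)
 next
  case False
  hence s: "direction d de b i p\<in>?d"
   "direction d de b' i p\<in>turn_dir aa E i ` ?d"
   using some_in_eq[of "?d"] some_in_eq[of "dir_set d de b' i (snd (snd p))"]
   by (auto simp: direction_def ds)
  then obtain m where m: "m\<in>?d" "direction d de b' i p = turn_dir aa E i m" by auto
  obtain c where c: "c~=0" "m = of_real c*direction d de b i p"
   using dir_set_proportional[OF b i t de s(1) m(1)] by auto
  have "m~=0" "direction d de b i p~=0" using m(1) s(1) unfolding dir_set_def by blast+
  thus ?thesis
   using m(2) turn_dir_functional[OF f] angle_functional_Arg_scale[OF f _ c(1)] c(2) by simp
 qed
qed

section \<open>The scissors congruence cochain\<close>

lemma cups_affine: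
 assumes "length gs' = length gs"
  and "!!i x. i < length gs ==> x\<in>set xs ==> (gs' ! i) x = s i*(gs ! i) x + k i"
 shows "cups gs' c xs = (\<Prod>i<length gs. s i)*cups gs c xs"
 using assms
proof (induction gs' gs arbitrary: xs s k rule: list_induct2)
 case (Cons g' gs' g gs)
 show ?case
 proof (cases xs rule: remdups_adj.cases)
  case (3 x y ys)
  have "cups gs' c (y # ys) = (\<Prod>i<length gs. s (Suc i))*cups gs c (y # ys)"
   by (rule Cons.IH[where k = "%i. k (Suc i)"]) (use Cons.prems[of "Suc _"] 3 in auto)
  moreover have "g' y - g' x = s 0*(g y - g x)"
   using Cons.prems[of 0 x] Cons.prems[of 0 y] 3 by (simp add: algebra_simps)
  ultimately show ?thesis
   using 3 by (simp add: prod.lessThan_Suc_shift del: prod.lessThan_Suc)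
 qed auto
qed simp

text \<open>Frames are functions on all indices, but only the first \<open>2*r\<close> vectors
  matter; both sides are compared after truncation.\<close>

lemma (in thom_data) thom_map_cong:
 assumes "!!p. p\<in>set ps ==> snd (h p) = snd (h' p)"
  and "!!p l. p\<in>set ps ==> l < 2*r ==> fst (h p) l = fst (h' p) l"
 shows "thom (map h ps) = thom (map h' ps)"
proof -
 define trunc :: "framed => framed"
  where "trunc q = (%l. if l < 2*r then fst q l else (%_. 0), snd q)" for q
 have "thom (map trunc qs) = thom qs" for qs
 proof -
  have "turn tt E (fst (trunc q)) l j = turn tt E (fst q) l j" if "l < 2*r" for tt E q l j
  proof -
   have "2*(l div 2) < 2*r" "2*(l div 2) + 1 < 2*r" using that by presburger+
   thus ?thesis by (simp add: turn_def trunc_def)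
  qed
  hence "zcoord j (turn_pt tt E (trunc q), n) = zcoord j (turn_pt tt E q, n)" for tt E j q n
   by (simp add: zcoord_def turn_pt_def) (simp add: trunc_def)
  hence "(%j x. positive j (turn_pt tt E (trunc (fst x)), snd x)) = (%j x. positive j (turn_pt tt E (fst x), snd x))" for tt E
   by (simp add: positive_def fun_eq_iff)
  hence "raw_thom (map (turn_pt tt E) (map trunc qs)) = raw_thom (map (turn_pt tt E) qs)" for tt E
   unfolding map_map raw_thom_map comp_def by simp
  thus ?thesis by (simp add: thom_def del: map_map)
 qed
 hence "thom (map h ps) = thom (map trunc (map h ps))" "thom (map h' ps) = thom (map trunc (map h' ps))" by (simp_all del: map_map)
 moreover have "map trunc (map h ps) = map trunc (map h' ps)"
  using assms by (auto simp: trunc_def fun_eq_iff)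
 ultimately show ?thesis by (simp only:)
qed

locale flag_cochain = thom_data r N L ka for r N L ka +
 fixes n::nat and f :: "nat => real => real"
 assumes r_pos: "0 < r" and f: "angle_functional (f j)"
begin

text \<open>Thresholds are \<open>8 * tau\<close> apart, which leaves room for an error of
  \<open>tau\<close> in each comparison of nearby points.\<close>

definition tau::real
 where "tau = 1/(8*(real r + 1))"

lemma tau_pos: "0 < tau"
 by (simp add: tau_def)

definition plane :: "nat => nat"
 where "plane j = (if j<=2*n then 0 else j - 2*n)"

lemma plane_less: "j < 2*n + r ==> plane j < r"
 using r_pos by (auto simp: plane_def)

lemma plane_surj: "i < r ==> \<exists>j < 2*n + r. plane j = i"
 by (intro exI[of _ "2*n + i"]) (auto simp: plane_def)

definition dir_fun :: "(nat => vec) => nat => point => real"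
 where "dir_fun b j p = f j (Arg (direction dd (2 * tau) b (plane j) p))"

definition threshold :: "nat => real"
 where "threshold i = (real r + 1 - real i)/(real r + 1)"

text \<open>The masses above the members of the flag are cumulative barycentric coordinates. On the
  chain of the flag itself, the equally spaced thresholds mark the barycentre.\<close>

definition level_fun :: "(nat => vec) => nat => point => real"
 where "level_fun b i p = of_bool (threshold i < mass (snd (snd p)) {U. flag b i\<subseteq>U})"

definition bundle_pt :: "(nat => vec) => point => framed"
 where "bundle_pt b p = (%l. fst (fst (snd p)) (b l), snd (fst (snd p)))"

definition coords :: "(nat => vec) => (point => real) list"
 where "coords b = map (dir_fun b) [0..<2*n + r] @ map (level_fun b) [1..<Suc r]"

lemma length_coords [simp]: "length (coords b) = 2*n + dd"
 by (simp add: coords_def)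

definition cochain :: "(nat => vec) => point list => real"
 where "cochain b ps = cups (coords b) (%qs. thom (map (bundle_pt b) qs)) ps"

definition adapted :: "(nat => vec) => point => bool"
 where "adapted b p \<longleftrightarrow> frame dd b & (\<forall>i\<le>r. snd (snd p) (flag b i)~=0)"

text \<open>Overlap above 1/2 in the first component makes lifts of a tuple unique up to one common
  group element; the other bounds serve the level and Thom factors.\<close>

definition near :: "point => point => bool"
 where "near p q \<longleftrightarrow> 1/2 < overlap (fst p) (fst q) & 1 - tau<=overlap (snd (snd p)) (snd (snd q)) &
  (\<forall>j<N. \<bar>snd (fst (snd p)) j - snd (fst (snd q)) j\<bar><=ka &
   (\<forall>v\<in>Rn dd. dot dd v v = 1 --> \<bar>fst (fst (snd p)) v j - fst (fst (snd q)) v j\<bar><=ka))"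

definition cluster :: "point set => bool"
 where "cluster P \<longleftrightarrow> P\<subseteq>points dd N & (\<forall>p\<in>P. \<forall>q\<in>P. near p q)"

lemma cluster_near: "cluster P ==> p\<in>P ==> q\<in>P ==> near p q"
 unfolding cluster_def by blast

lemma nearD:
 assumes "near p q"
 shows "1 - overlap (snd (snd p)) (snd (snd q))<=tau"
  and "j < N ==> \<bar>snd (fst (snd p)) j - snd (fst (snd q)) j\<bar><=ka"
  and "j < N ==> v\<in>Rn dd ==> dot dd v v = 1 ==>
   \<bar>fst (fst (snd p)) v j - fst (fst (snd q)) v j\<bar><=ka"
 using assms unfolding near_def by auto

lemma cluster_subset: "cluster P ==> Q\<subseteq>P ==> cluster Q"
 unfolding cluster_def by blast

lemma close_pts_bundle:
 assumes P: "cluster P" and b: "frame dd b"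
 shows "close_pts N dd ka (bundle_pt b ` P)"
 unfolding close_pts_def
proof (intro conjI ballI allI impI)
 fix x assume "x\<in>bundle_pt b ` P"
 then obtain p where p: "p\<in>P" "x = bundle_pt b p" by auto
 hence "fst (snd p)\<in>bundle_points dd N" using P by (auto simp: cluster_def points_def)
 hence ph: "fst (fst (snd p))\<in>linear_isometries dd N"
  and w: "!!v. v\<in>Rn dd ==> dot N (snd (fst (snd p))) (fst (fst (snd p)) v) = 0"
  by (auto simp: bundle_points_def)
 show "orthonormal_pt N dd x"
  unfolding orthonormal_pt_def p(2) bundle_pt_def fst_conv snd_conv dot_def[symmetric]
  using linear_isometriesD(4)[OF ph] w frameD[OF b] by auto
next
 fix x y j assume "x\<in>bundle_pt b ` P" "y\<in>bundle_pt b ` P" "j < N"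
 thus "\<bar>snd x j - snd y j\<bar><=ka" using nearD(2)[OF cluster_near[OF P]] by (auto simp: bundle_pt_def)
next
 fix x y j l assume "x\<in>bundle_pt b ` P" "y\<in>bundle_pt b ` P" "j < N" "l < dd"
 thus "\<bar>fst x l j - fst y l j\<bar><=ka"
  using nearD(3)[OF cluster_near[OF P]] frameD[OF b, of l] by (auto simp: bundle_pt_def)
qed

text \<open>The direction and level factors are coboundaries, so closedness reduces to that of
  \<open>thom\<close> on the remaining entries.\<close>

lemma coboundary_cochain:
 assumes "cluster (set ps)" "frame dd b" "length ps = 2*n + N + 2"
 shows "coboundary (cochain b) ps = 0"
proof -
 let ?T = "%qs. thom (map (bundle_pt b) qs)"
 have len: "length ps = length (coords b) + (N - dd) + 2" using assms(3) rN by simp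
 have "coboundary (cochain b) ps = (-1)^length (coords b)*cups (coords b) (coboundary ?T) ps"
  unfolding cochain_def[abs_def] by (rule coboundary_cups) (use len in simp)
 also have "cups (coords b) (coboundary ?T) ps = cups (coords b) (%_. 0) ps"
 proof (rule cups_cong)
  fix ys assume ys: "set ys\<subseteq>set ps" "length ys + length (coords b) = length ps"
  have "coboundary ?T ys = coboundary thom (map (bundle_pt b) ys)" by (rule coboundary_map)
  also have "... = 0"
   by (rule coboundary_thom)
    (use close_pts_bundle[OF cluster_subset[OF assms(1) ys(1)] assms(2)] ys(2) len in auto)
  finally show "coboundary ?T ys = 0" .
 qed
 finally show ?thesis by (simp add: cups_zero)
qed

lemma cochain_nonzeroD:
 assumes "cochain b ps~=0" "2*n + dd < length ps"
 shows "j < 2*n + r ==> \<exists>x\<in>set ps. \<exists>y\<in>set ps. dir_fun b j x~=dir_fun b j y"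
  and "1<=i ==> i<=r ==> \<exists>x\<in>set ps. \<exists>y\<in>set ps. level_fun b i x~=level_fun b i y"
  and "\<exists>qs. set qs\<subseteq>set ps & qs~=[] & thom (map (bundle_pt b) qs)~=0"
proof -
 note nz = assms(1)[unfolded cochain_def]
 show "j < 2*n + r ==> \<exists>x\<in>set ps. \<exists>y\<in>set ps. dir_fun b j x~=dir_fun b j y"
  using cups_nonzeroD(1)[OF nz] by (simp add: coords_def)
 show "\<exists>x\<in>set ps. \<exists>y\<in>set ps. level_fun b i x~=level_fun b i y" if "1<=i" "i<=r"
 proof -
  have "level_fun b i\<in>set (coords b)" using that by (auto simp: coords_def simp del: upt_Suc)
  thus ?thesis using cups_nonzeroD(1)[OF nz] by blast
 qed
 obtain qs where "set qs\<subseteq>set ps" "length qs + length (coords b) = length ps" "thom (map (bundle_pt b) qs)~=0"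
  using cups_nonzeroD(2)[OF nz] by blast
 thus "\<exists>qs. set qs\<subseteq>set ps & qs~=[] & thom (map (bundle_pt b) qs)~=0"
  using assms(2) by (intro exI[of _ qs]) auto
qed

text \<open>Some entry has squared norm below 1/4, and \<open>fine\<close> gives N ka^2 < 1/16. So
  every entry has squared norm below 2/4 + 2/16 < 1.\<close>

lemma cochain_far:
 assumes P: "cluster (set ps)" and b: "frame dd b" and len: "2*n + dd < length ps"
  and p: "p\<in>set ps" "1<=dot N (snd (fst (snd p))) (snd (fst (snd p)))"
 shows "cochain b ps = 0"
proof (rule ccontr)
 assume "cochain b ps~=0"
 from cochain_nonzeroD(3)[OF this len] obtain qs where
  qs: "set qs\<subseteq>set ps" "qs~=[]" "thom (map (bundle_pt b) qs)~=0" by blast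
 have cl: "close_pts N dd ka (set (map (bundle_pt b) qs))"
  using close_pts_bundle[OF cluster_subset[OF P qs(1)] b] by simp
 obtain q where q: "q\<in>set qs" "(\<Sum>j<N. (snd (fst (snd q)) j)\<^sup>2) < 1/4"
  using thom_small[OF cl qs(3)] qs(2) by (auto simp: bundle_pt_def)
 have "real N*(2 * ka)\<^sup>2 < 1/4"
 proof -
  have "2 * ka<=2 * ka*(1 + 2*real r) + 2*real r/real L"
   using ka_pos by (simp add: algebra_simps)
  hence "real N*(2 * ka)\<^sup>2<=real N*(2 * ka*(1 + 2*real r) + 2*real r/real L)\<^sup>2"
   using ka_pos by (intro mult_left_mono power_mono) auto
  thus ?thesis using fine by linarith
 qed
 hence ka: "real N * ka\<^sup>2 < 1/16" by (simp add: power_mult_distrib)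
 have "(snd (fst (snd p)) j)\<^sup>2<=2*(snd (fst (snd q)) j)\<^sup>2 + 2 * ka\<^sup>2" if "j < N" for j
 proof -
  let ?x = "snd (fst (snd p)) j" and ?y = "snd (fst (snd q)) j"
  have "\<bar>?x - ?y\<bar><=ka" by (rule nearD(2)[OF cluster_near[OF P p(1)] that]) (use q(1) qs(1) in auto)
  hence "(?x - ?y)\<^sup>2<=ka\<^sup>2" using ka_pos by (simp add: abs_le_square_iff[symmetric])
  moreover have "?x\<^sup>2<=2*?y\<^sup>2 + 2*(?x - ?y)\<^sup>2"
   using zero_le_power2[of "?x - 2*?y"] by (simp add: power2_eq_square algebra_simps)
  ultimately show ?thesis by linarith
 qed
 hence "(\<Sum>j<N. (snd (fst (snd p)) j)\<^sup>2)<=(\<Sum>j<N. 2*(snd (fst (snd q)) j)\<^sup>2 + 2 * ka\<^sup>2)"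
  by (intro sum_mono) simp
 also have "... = 2*(\<Sum>j<N. (snd (fst (snd q)) j)\<^sup>2) + 2*(real N * ka\<^sup>2)"
  by (simp add: sum.distrib sum_distrib_left)
 finally show False using q(2) ka p(2) by (simp add: dot_def power2_eq_square)
qed

lemma threshold_diff: "threshold i - threshold (Suc i) = 8 * tau"
 by (simp add: threshold_def tau_def field_simps)

text \<open>The level factors pin the mass above each member of the flag near its threshold. Little
  weight on \<open>flag b i\<close> therefore means much weight strictly between it and
  \<open>flag b (Suc i)\<close>, where by dimension the chain has only one subspace. It is heavy at
  all entries, so a direction factor is constant. For i = r the mass is the weight of the whole
  space, which contradicts its threshold.\<close>

lemma cochain_degenerate:
 assumes P: "cluster (set ps)" and b: "!!p. p\<in>set ps ==> adapted b p" and len: "2*n + dd < length ps"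
  and p: "p\<in>set ps" "i<=r" "snd (snd p) (flag b i) < tau"
 shows "cochain b ps = 0"
proof (rule ccontr)
 assume nz: "cochain b ps~=0"
 let ?t = "%q. snd (snd q)"
 let ?m = "%q i. mass (?t q) {U. flag b i\<subseteq>U}"
 have fr: "frame dd b" using b[OF p(1)] by (simp add: adapted_def)
 have ST: "?t q\<in>ST_points dd" if "q\<in>set ps" for q
  using P that by (auto simp: cluster_def points_def)
 have wt: "weights (?t q)" if "q\<in>set ps" for q by (rule weights_ST[OF ST[OF that]])
 have ov: "1 - overlap (?t q) (?t q')<=tau" if "q\<in>set ps" "q'\<in>set ps" for q q'
  by (rule nearD(1)[OF cluster_near[OF P that]])
 have m: "threshold i - tau<=?m p i & ?m p i<=threshold i + tau" if i: "i<=r" for i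
 proof (cases "i = 0")
  case True
  have "mass (?t p) {U. flag b 0\<subseteq>U} = (\<Sum>U | ?t p U~=0. ?t p U)"
   unfolding mass_def using ST_subspace[OF ST[OF p(1)]] real_fun.subspace_0
   by (intro sum.cong) (auto)
  thus ?thesis using True weightsD(3)[OF wt[OF p(1)]] tau_pos by (simp add: threshold_def)
 next
  case False
  then obtain x y where x: "x\<in>set ps" and y: "y\<in>set ps" and xy: "level_fun b i x~=level_fun b i y"
   using cochain_nonzeroD(2)[OF nz len, of i] i by auto
  have "(threshold i < ?m x i)~=(threshold i < ?m y i)"
   using xy by (auto simp: level_fun_def)
  moreover have "\<bar>?m p i - ?m x i\<bar><=tau" "\<bar>?m p i - ?m y i\<bar><=tau"
   using mass_abs_diff[OF wt[OF p(1)] wt[OF x], of "{U. flag b i\<subseteq>U}"] ov[OF p(1) x]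
    mass_abs_diff[OF wt[OF p(1)] wt[OF y], of "{U. flag b i\<subseteq>U}"] ov[OF p(1) y] by linarith+
  ultimately show ?thesis by linarith
 qed
 show False
 proof (cases "i = r")
  case True
  have "{U. ?t p U~=0 & U\<in>{U. flag b r\<subseteq>U}} = {U. ?t p U~=0 & U\<in>{flag b r}}"
   using ST_subspace[OF ST[OF p(1)]] flag_top[OF fr] by auto
  hence "?m p r = mass (?t p) {flag b r}" by (simp add: mass_def)
  hence "?m p r < tau" using p(3) True by (simp add: mass_singleton)
  moreover have "threshold r = 8 * tau" by (simp add: threshold_def tau_def field_simps)
  ultimately show False using m[of r] tau_pos by simp
 next
  case False
  hence i: "i < r" using p(2) by simp
  have ifr: "2*Suc i<=dd" using i by simp
  define B where "B = {U. ?t p U~=0 & flag b i \<subset> U & U \<subset> flag b (Suc i)}"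
  have finB: "finite B"
   by (rule finite_subset[OF _ weightsD(1)[OF wt[OF p(1)]]]) (auto simp: B_def)
  have split: "{U. ?t p U~=0 & U\<in>{U. flag b i\<subseteq>U}}
    = insert (flag b i) B\<union>{U. ?t p U~=0 & U\<in>{U. flag b (Suc i)\<subseteq>U}}"
  proof -
   have ad: "?t p (flag b i)~=0" "?t p (flag b (Suc i))~=0" using b[OF p(1)] i by (auto simp: adapted_def)
   have three: "U = flag b i | U\<in>B | flag b (Suc i)\<subseteq>U" if "?t p U~=0" "flag b i\<subseteq>U" for U
    using realization_pointsD(5)[OF ST[OF p(1), unfolded ST_points_def] that(1) ad(2)] that unfolding B_def by blast
   have mono: "flag b i\<subseteq>flag b (Suc i)" by (rule flag_mono) simp
   show ?thesis
   proof (intro equalityI subsetI)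
    fix U assume "U\<in>{U. ?t p U~=0 & U\<in>{U. flag b i\<subseteq>U}}"
    thus "U\<in>insert (flag b i) B\<union>{U. ?t p U~=0 & U\<in>{U. flag b (Suc i)\<subseteq>U}}"
     using three[of U] by auto
   next
    fix U assume "U\<in>insert (flag b i) B\<union>{U. ?t p U~=0 & U\<in>{U. flag b (Suc i)\<subseteq>U}}"
    then consider "U = flag b i" | "U\<in>B" | "?t p U~=0" "flag b (Suc i)\<subseteq>U" by auto
    thus "U\<in>{U. ?t p U~=0 & U\<in>{U. flag b i\<subseteq>U}}"
     using ad mono by cases (auto simp: B_def)
   qed
  qed
  have fin: "finite {U. ?t p U~=0 & U\<in>{U. flag b (Suc i)\<subseteq>U}}"
   by (rule finite_subset[OF _ weightsD(1)[OF wt[OF p(1)]]]) auto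
  have "?m p i = (\<Sum>U\<in>insert (flag b i) B. ?t p U) + ?m p (Suc i)"
   unfolding mass_def split
   by (rule sum.union_disjoint) (use finB fin flag_strict[OF fr ifr] in \<open>auto simp: B_def\<close>)
  also have "(\<Sum>U\<in>insert (flag b i) B. ?t p U) = ?t p (flag b i) + (\<Sum>U\<in>B. ?t p U)"
   using finB by (intro sum.insert) (auto simp: B_def)
  finally have "?m p i - ?m p (Suc i) = ?t p (flag b i) + (\<Sum>U\<in>B. ?t p U)" by simp
  \<comment> \<open>Two masses err by \<open>tau\<close> each from values \<open>8 * tau\<close>
    apart, and \<open>flag b i\<close> itself holds less than \<open>tau\<close>.\<close>
  hence big: "5 * tau < (\<Sum>U\<in>B. ?t p U)"
   using m[of i] m[of "Suc i"] i threshold_diff[of i] p(3) by simp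
  have uniq: "U = U'" if U: "U\<in>B" and U': "U'\<in>B" for U U'
  proof -
   have sub: False if A: "A\<in>B" "A'\<in>B" "A \<subset> A'" for A A'
   proof -
    have A1: "real_fun.subspace A" "real_fun.subspace A'" "flag b i \<subset> A" "flag b i \<subset> A'" "A' \<subset> flag b (Suc i)"
     using A ST_subspace[OF ST[OF p(1)]] by (auto simp: B_def)
    obtain u where u: "u\<in>A" "u\<notin>flag b i" using A1(3) by blast
    obtain u' where u': "u'\<in>A'" "u'\<notin>A" using A(3) by blast
    have nz: "pcoord dd b i u~=0" "pcoord dd b i u'~=0"
     using flag_of_pcoord_0[OF fr ifr] u u' A A1 by blast+
    obtain c where "pcoord dd b i u' = of_real c*pcoord dd b i u"
     using pcoord_proportional[OF fr ifr A1(2) _ A1(5) _ u'(1) nz] u(1) A(3) A1(4) by blast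
    hence "pcoord dd b i (%j. c*u j) = pcoord dd b i u'"
     by (simp only: pcoord_simps)
    moreover have "(%j. c*u j)\<in>A" by (rule real_fun.subspace_scale[OF A1(1) u(1)])
    ultimately have "u'\<in>A"
     using flag_mod[OF fr ifr A1(1) _ _ _ _, of "%j. c*u j" u'] A1 A(3) u'(1) by blast
    thus False using u'(2) by simp
   qed
   have "?t p U~=0" "?t p U'~=0" using U U' by (auto simp: B_def)
   hence "U\<subseteq>U' | U'\<subseteq>U"
    using realization_pointsD(5)[OF ST[OF p(1), unfolded ST_points_def]] by blast
   thus ?thesis using sub[OF U U'] sub[OF U' U] by blast
  qed
  have "B~={}" using big tau_pos by auto
  then obtain U where U: "U\<in>B" by blast
  hence "B = {U}" using uniq by blast
  hence "5 * tau < ?t p U" using big by simp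
  hence UU: "2 * tau<=?t q U" if "q\<in>set ps" for q
   using weight_abs_diff[OF wt[OF p(1)] wt[OF that], of U] ov[OF p(1) that] tau_pos by linarith
  obtain j where j: "j < 2*n + r" "plane j = i" using plane_surj[OF i] by blast
  obtain x y where x: "x\<in>set ps" and y: "y\<in>set ps" and xy: "dir_fun b j x~=dir_fun b j y"
   using cochain_nonzeroD(1)[OF nz len j(1)] by blast
  have "dir_fun b j x = dir_fun b j y"
   unfolding dir_fun_def j(2)
   by (rule direction_const[OF fr ifr f _ _ _ UU[OF x] UU[OF y]])
    (use U P x y tau_pos in \<open>auto simp: B_def cluster_def\<close>)
  thus False using xy by simp
 qed
qed

text \<open>Directions, masses and images under the isometry are all taken relative to the frame, so
  moving point and frame together changes nothing.\<close>

lemma cochain_act: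
 assumes b: "frame dd b" and g: "g\<in>OC dd" and ps: "set ps\<subseteq>points dd N"
 shows "cochain (%k. g (b k)) (map (act_point dd g) ps) = cochain b ps"
proof -
 let ?b = "%k. g (b k)" and ?a = "act_point dd g"
 have dir: "dir_fun ?b j (?a p) = dir_fun b j p" if "p\<in>set ps" "j < 2*n + r" for p j
  using direction_act[OF b g, of "plane j" p N "2 * tau"] plane_less[OF that(2)] that ps tau_pos
  by (auto simp: dir_fun_def)
 have lev: "level_fun ?b i (?a p) = level_fun b i p" if p: "p\<in>set ps" and i: "i<=r" for p i
 proof -
  let ?t = "snd (snd p)"
  have t: "?t\<in>ST_points dd" using p ps by (auto simp: points_def)
  have inj: "inj_on (image g) {U. ?t U~=0}"
   by (rule inj_on_subset[OF inj_on_image_subspaces[OF g] ST_support[OF t]])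
  have fl: "flag ?b i = g ` flag b i" by (rule flag_act[OF b g]) (use i in simp)
  have fR: "flag b i\<subseteq>Rn dd" by (rule flag_subset_Rn[OF b]) (use i in simp)
  have "mass (realization_map (image g) ?t) {U. flag ?b i\<subseteq>U}
    = (\<Sum>U\<in>image g ` {U. ?t U~=0 & flag b i\<subseteq>U}. realization_map (image g) ?t U)"
   unfolding mass_def
  proof (rule sum.cong)
   have s: "{U. realization_map (image g) ?t U~=0} = image g ` {U. ?t U~=0}"
    by (rule realization_map_support[OF inj_on_image_subspaces[OF g] ST_support[OF t]])
   have sub: "g ` flag b i\<subseteq>g ` U \<longleftrightarrow> flag b i\<subseteq>U" if "?t U~=0" for U
    using inj_on_image_subset_iff[OF OG_inj[OF g] fR, of U] ST_subspace[OF t that] by simp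
   show "{U. realization_map (image g) ?t U~=0 & U\<in>{U. flag ?b i\<subseteq>U}} = image g ` {U. ?t U~=0 & flag b i\<subseteq>U}"
   proof (intro equalityI subsetI)
    fix V assume V: "V\<in>{U. realization_map (image g) ?t U~=0 & U\<in>{U. flag ?b i\<subseteq>U}}"
    hence "V\<in>image g ` {U. ?t U~=0}" using s by blast
    then obtain U where "?t U~=0" "V = g ` U" by blast
    thus "V\<in>image g ` {U. ?t U~=0 & flag b i\<subseteq>U}" using V sub[of U] unfolding fl by simp
   next
    fix V assume "V\<in>image g ` {U. ?t U~=0 & flag b i\<subseteq>U}"
    then obtain U where U: "?t U~=0" "flag b i\<subseteq>U" "V = g ` U" by blast
    hence "realization_map (image g) ?t V~=0" using s by blast
    thus "V\<in>{U. realization_map (image g) ?t U~=0 & U\<in>{U. flag ?b i\<subseteq>U}}"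
     using U sub[of U] unfolding fl by simp
   qed
  qed simp
  also have "... = (\<Sum>U | ?t U~=0 & flag b i\<subseteq>U. realization_map (image g) ?t (g ` U))"
   by (rule sum.reindex[unfolded comp_def]) (rule inj_on_subset[OF inj], auto)
  also have "... = (\<Sum>U | ?t U~=0 & flag b i\<subseteq>U. ?t U)"
   by (intro sum.cong refl ST_act_apply[OF t g]) (use ST_subspace[OF t] in auto)
  finally have "mass (realization_map (image g) ?t) {U. flag ?b i\<subseteq>U} = mass ?t {U. flag b i\<subseteq>U}"
   by (simp add: mass_def)
  thus ?thesis by (simp add: level_fun_def act_point_def act_fibre_def)
 qed
 have "cochain ?b (map ?a ps) = cups (map (%h p. h (?a p)) (coords ?b)) (%qs. thom (map (bundle_pt ?b) (map ?a qs))) ps"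
  unfolding cochain_def by (rule cups_map)
 also have "... = cups (coords b) (%qs. thom (map (bundle_pt ?b) (map ?a qs))) ps"
 proof (rule cups_cong_funs)
  fix i p assume i: "i < length (map (%h p. h (?a p)) (coords ?b))" and p: "p\<in>set ps"
  show "(map (%h p. h (?a p)) (coords ?b) ! i) p = (coords b ! i) p"
   using i dir[OF p, of i] lev[OF p, of "i - (2*n + r) + 1"]
   by (auto simp: coords_def nth_append simp del: upt_Suc)
 qed simp
 also have "... = cups (coords b) (%qs. thom (map (bundle_pt b) qs)) ps"
 proof (rule cups_cong)
  fix qs assume qs: "set qs\<subseteq>set ps"
  have "thom (map (%p. bundle_pt ?b (?a p)) qs) = thom (map (bundle_pt b) qs)"
  proof (rule thom_map_cong)
   fix p assume "p\<in>set qs"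
   show "snd (bundle_pt ?b (?a p)) = snd (bundle_pt b p)"
    by (cases p) (auto simp: bundle_pt_def act_point_def act_fibre_def neg_sphere_act_def split: prod.splits)
   fix l assume "l < dd"
   hence "b l\<in>Rn dd" by (rule frameD(1)[OF b])
   thus "fst (bundle_pt ?b (?a p)) l = fst (bundle_pt b p) l"
    using OG_Rn[OF g] OG_inv(1)[OF g]
    by (cases p) (auto simp: bundle_pt_def act_point_def act_fibre_def neg_sphere_act_def compose_def split: prod.splits)
  qed
  thus "thom (map (bundle_pt ?b) (map ?a qs)) = thom (map (bundle_pt b) qs)" by (simp add: comp_def)
 qed
 finally show ?thesis by (simp add: cochain_def)
qed

text \<open>Plane 0 occurs 2 n + 1 times, and an even power of its sign is 1.\<close>

lemma prod_plane_signs: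
 assumes "!!i. s i = 1 | s i = (-1::real)"
 shows "(\<Prod>j<2*n + Suc m. s (plane j)) = (\<Prod>i<Suc m. s i)"
proof (induction m)
 case 0
 have "(\<Prod>j<2*n + Suc 0. s (plane j)) = (\<Prod>j<2*n + Suc 0. s 0)"
  by (rule prod.cong) (auto simp: plane_def)
 also have "... = s 0^(2*n) * s 0" by simp
 also have "s 0^(2*n) = 1" using assms[of 0] by (auto simp: power_mult)
 finally show ?case by simp
next
 case (Suc m)
 have "plane (2*n + Suc m) = Suc m" by (simp add: plane_def)
 thus ?case using Suc by simp
qed

text \<open>Both flags lie in the chain of one point, and nested subspaces of equal dimension
  coincide. So the frames differ by a turn with reflections in \<open>E\<close>, and the direction
  factors and the Thom factor each contribute (-1)^card E.\<close>

lemma cochain_frame_independent: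
 assumes ps: "set ps\<subseteq>points dd N" "ps~=[]"
  and b: "!!p. p\<in>set ps ==> adapted b p" and b': "!!p. p\<in>set ps ==> adapted b' p"
 shows "cochain b' ps = cochain b ps"
proof -
 obtain p0 where p0: "p0\<in>set ps" using ps(2) by (cases ps) auto
 have fr: "frame dd b" "frame dd b'" using b[OF p0] b'[OF p0] by (auto simp: adapted_def)
 have t0: "snd (snd p0)\<in>ST_points dd" using ps(1) p0 by (auto simp: points_def)
 have fl: "flag b' i = flag b i" if "i<=r" for i
 proof -
  have "snd (snd p0) (flag b i)~=0" "snd (snd p0) (flag b' i)~=0"
   using b[OF p0] b'[OF p0] that by (auto simp: adapted_def)
  hence "flag b i\<subseteq>flag b' i | flag b' i\<subseteq>flag b i"
   using realization_pointsD(5)[OF t0[unfolded ST_points_def]] by blast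
  thus ?thesis
   using flag_eq_of_subset[OF fr(1) fr(2), of i] flag_eq_of_subset[OF fr(2) fr(1), of i] that by auto
 qed
 obtain aa E where E: "E\<subseteq>{..<r}" and turn: "!!l. l < dd ==> b' l = turn aa E b l"
  using frame_change[OF fr fl] by blast
 let ?s = "%i. if i\<in>E then -1 else 1::real"
 have T: "thom (map (bundle_pt b') qs) = (-1)^card E * thom (map (bundle_pt b) qs)" if qs: "set qs\<subseteq>set ps" for qs
 proof -
  have "thom (map (bundle_pt b') qs) = thom (map (%p. turn_pt aa E (bundle_pt b p)) qs)"
  proof (rule thom_map_cong)
   fix p assume p: "p\<in>set qs"
   show "snd (bundle_pt b' p) = snd (turn_pt aa E (bundle_pt b p))" by (simp add: bundle_pt_def turn_pt_def)
   fix l assume l: "l < dd"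
   have ph: "fst (fst (snd p))\<in>linear_isometries dd N"
    using p qs ps(1) by (auto simp: points_def bundle_points_def)
   let ?m = "2*(l div 2)"
   have lb: "?m < dd" "Suc ?m < dd" using l by presburger+
   have comb: "(%j. \<Sum>k\<in>{?m, Suc ?m}. (if k = ?m then turn_cos aa E l else turn_sin aa E l) * v k j)
     = turn aa E v l" for v :: "nat => vec"
    by (simp add: turn_def)
   have "fst (fst (snd p)) (turn aa E b l) = turn aa E (%k. fst (fst (snd p)) (b k)) l"
    unfolding comb[symmetric]
    by (rule linear_isometries_comb[OF ph]) (use frameD(1)[OF fr(1)] lb in auto)
   thus "fst (bundle_pt b' p) l = fst (turn_pt aa E (bundle_pt b p)) l"
    by (simp add: bundle_pt_def turn_pt_def turn[OF l])
  qed
  also have "... = thom (map (turn_pt aa E) (map (bundle_pt b) qs))" by (simp add: comp_def)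
  also have "... = (-1)^card E * thom (map (bundle_pt b) qs)" by (rule thom_turn[OF E])
  finally show ?thesis .
 qed
 let ?S = "%i. if i < 2*n + r then ?s (plane i) else 1"
 have "cochain b' ps = (\<Prod>i<length (coords b). ?S i)*cups (coords b) (%qs. thom (map (bundle_pt b') qs)) ps"
  unfolding cochain_def
 proof (rule cups_affine[where k = "%i. if i < 2*n + r then - ?s (plane i)*f i (aa (plane i)) else 0"])
  fix i p assume i: "i < length (coords b)" and p: "p\<in>set ps"
  show "(coords b' ! i) p = ?S i*(coords b ! i) p + (if i < 2*n + r then - ?s (plane i)*f i (aa (plane i)) else 0)"
  proof (cases "i < 2*n + r")
   case True
   have "dir_fun b' i p = ?s (plane i)*(dir_fun b i p - f i (aa (plane i)))"
    unfolding dir_fun_def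
    by (rule direction_turn[OF fr(1) turn]) (use fl plane_less[OF True] f tau_pos p ps(1) in auto)
   thus ?thesis using True by (auto simp: coords_def nth_append algebra_simps)
  next
   case False
   thus ?thesis using i fl[of "i - (2*n + r) + 1"] by (simp add: coords_def nth_append level_fun_def del: upt_Suc)
  qed
 qed simp
 also have "(\<Prod>i<length (coords b). ?S i) = (\<Prod>i<2*n + r. ?s (plane i))"
 proof -
  have "(\<Prod>i<2*n + dd. ?S i) = (\<Prod>i<2*n + r. ?S i)"
   by (rule prod.mono_neutral_right) auto
  thus ?thesis by simp
 qed
 also have "... = (\<Prod>i<r. ?s i)"
  using prod_plane_signs[of ?s "r - 1"] r_pos by simp
 also have "... = (-1)^card E"
 proof -
  have "(\<Prod>i<r. ?s i) = (\<Prod>i\<in>E. -1)*(\<Prod>i\<in>{..<r} - E. 1)"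
   using E by (subst prod.subset_diff[OF E]) (auto intro!: arg_cong2[of _ _ _ _ "(*)"] prod.cong)
  thus ?thesis by simp
 qed
 also have "cups (coords b) (%qs. thom (map (bundle_pt b') qs)) ps = cups (coords b) (%qs. (-1)^card E * thom (map (bundle_pt b) qs)) ps"
  by (rule cups_cong) (use T in auto)
 also have "... = (-1)^card E*cups (coords b) (%qs. thom (map (bundle_pt b) qs)) ps"
 proof -
  have "cups gs (%qs. k*c qs) xs = k*cups gs c xs" for gs k xs and c :: "point list => real"
  proof (induction gs arbitrary: xs)
   case (Cons g gs)
   thus ?case by (cases xs rule: remdups_adj.cases) auto
  qed simp
  thus ?thesis .
 qed
 finally show ?thesis by (simp add: cochain_def power_add[symmetric] mult.assoc[symmetric])
qed

end

section \<open>Open sets of the levels of the spectrum\<close>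

lemma continuous_map_Euclidean_coord: "continuous_map (Euclidean_space n) euclideanreal (%x. x i)"
 unfolding Euclidean_space_def
 by (rule continuous_map_from_subtopology) (rule continuous_map_product_projection, simp)

lemma topspace_complement_bundle: "topspace (complement_bundle d N) = bundle_points d N"
proof -
 have "Rn d \<rightarrow>\<^sub>E Rn N = (Rn d \<rightarrow>\<^sub>E topspace (Euclidean_space N))" by simp
 thus ?thesis
  by (auto simp: complement_bundle_def bundle_points_def linear_isometries_def)
qed

lemma continuous_map_complement_bundle:
 "v\<in>Rn d ==> continuous_map (complement_bundle d N) euclideanreal (%x. fst x v j)"
 "continuous_map (complement_bundle d N) euclideanreal (%x. snd x j)"
proof -
 show "continuous_map (complement_bundle d N) euclideanreal (%x. fst x v j)" if "v\<in>Rn d"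
 proof -
  have "continuous_map (product_topology (%_. Euclidean_space N) (Rn d)) euclideanreal (%ph. ph v j)"
   using continuous_map_compose[OF continuous_map_product_projection[OF that, of "%_. Euclidean_space N"]
    continuous_map_Euclidean_coord[of N j]] by (simp add: comp_def)
  from continuous_map_compose[OF continuous_map_fst this] show ?thesis
   unfolding complement_bundle_def comp_def by (rule continuous_map_from_subtopology)
 qed
 show "continuous_map (complement_bundle d N) euclideanreal (%x. snd x j)"
  using continuous_map_compose[OF continuous_map_snd continuous_map_Euclidean_coord]
  unfolding complement_bundle_def comp_def by (rule continuous_map_from_subtopology)
qed

lemma compactin_Rn_box: "compactin (Euclidean_space n) {x\<in>Rn n. \<forall>i<n. \<bar>x i\<bar><=m}"
proof -
 have "compactin (powertop_real UNIV) (PiE UNIV (%i. if i < n then {-m..m} else {0}))"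
  by (auto simp: compactin_PiE)
 moreover have "PiE UNIV (%i. if i < n then {-m..m} else {0}) = {x\<in>Rn n. \<forall>i<n. \<bar>x i\<bar><=m}"
  by (auto simp: PiE_def Pi_iff Rn_iff abs_le_iff split: if_splits) (use linorder_not_le minus_le_iff in blast)+
 ultimately show ?thesis
  unfolding Euclidean_space_def compactin_subtopology by (auto simp: Rn_iff[unfolded topspace_Euclidean_space])
qed

lemma closedin_eq_real:
 assumes "continuous_map X euclideanreal f" "continuous_map X euclideanreal g"
 shows "closedin X {x\<in>topspace X. f x = g x}"
proof -
 have "closedin X {x\<in>topspace X. f x - g x\<in>{0}}"
  by (rule closedin_continuous_map_preimage[OF continuous_map_diff[OF assms]]) simp
 thus ?thesis by simp
qed

lemma continuous_map_dot:
 assumes "!!i. i < n ==> continuous_map X euclideanreal (%x. f x i)"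
  "!!i. i < n ==> continuous_map X euclideanreal (%x. g x i)"
 shows "continuous_map X euclideanreal (%x. dot n (f x) (g x))"
 unfolding dot_def using assms by (intro continuous_map_sum continuous_map_real_mult) auto

lemma coord_le_dot:
 assumes "dot n x x<=m\<^sup>2" "i < n" "0<=m"
 shows "\<bar>x i\<bar><=m"
proof -
 have "(x i)\<^sup>2<=(\<Sum>j<n. (x j)\<^sup>2)" by (rule member_le_sum) (use assms in auto)
 hence "(x i)\<^sup>2<=m\<^sup>2" using assms(1) by (simp add: dot_def power2_eq_square)
 thus ?thesis using assms(3) by (simp add: abs_le_square_iff[symmetric])
qed

text \<open>Isometries are functions on all of \<real>^d with pointwise convergence, so compactness
  comes from Tychonoff: the value at \<open>v\<close> lies in a cube of size |v|, and linearity,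
  isometry and orthogonality are closed conditions.\<close>

lemma compactin_bounded_bundle:
 "compactin (complement_bundle d N) {x\<in>bundle_points d N. dot N (snd x) (snd x)<=1}"
proof -
 let ?P = "product_topology (%_. Euclidean_space N) (Rn d)"
 let ?X = "prod_topology ?P (Euclidean_space N)"
 let ?G = "{x\<in>bundle_points d N. dot N (snd x) (snd x)<=1}"
 let ?T = "topspace ?X"
 let ?B = "%m. {x\<in>Rn N. \<forall>i<N. \<bar>x i\<bar><=m}"
 let ?K = "PiE (Rn d) (%v. ?B (sqrt (dot d v v)))\<times>?B 1"
 let ?F1 = "{x. \<forall>(v, v', j)\<in>(Rn d\<times>Rn d\<times>(UNIV::nat set)). fst x (v + v') j = fst x v j + fst x v' j}"
 let ?F2 = "{x. \<forall>(v, c, j)\<in>(Rn d\<times>UNIV\<times>(UNIV::nat set)). fst x (%i. c * v i) j = c*fst x v j}"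
 let ?F3 = "{x. \<forall>(v, v')\<in>Rn d\<times>Rn d. dot N (fst x v) (fst x v') = dot d v v'}"
 let ?F4 = "{x. \<forall>v\<in>Rn d. dot N (snd x) (fst x v) = 0}"
 have K: "compactin ?X ?K"
  unfolding compactin_Times by (auto simp: compactin_PiE compactin_Rn_box)
 have c1: "continuous_map ?X euclideanreal (%x. fst x v j)" if "v\<in>Rn d" for v j
  using continuous_map_compose[OF continuous_map_fst continuous_map_compose[OF
    continuous_map_product_projection[OF that, of "%_. Euclidean_space N"] continuous_map_Euclidean_coord[of N j]]]
  by (simp add: comp_def)
 have c2: "continuous_map ?X euclideanreal (%x. snd x j)" for j
  using continuous_map_compose[OF continuous_map_snd continuous_map_Euclidean_coord] by (simp add: comp_def)
 have add: "x + y\<in>Rn d" "(%i. c*x i)\<in>Rn d" if "x\<in>Rn d" "y\<in>Rn d" for x y c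
  using that by (auto simp: Rn_iff)
 define F where "F = ?T\<inter>?F1
 \<inter>?F2
 \<inter>?F3
 \<inter>?F4\<inter>{x. dot N (snd x) (snd x)<=1}"
 have cl_all: "closedin ?X (?T\<inter>{x. \<forall>s\<in>S. P s x})"
  if "!!s. s\<in>S ==> closedin ?X {x\<in>?T. P s x}" for S and P :: "'s => _ => bool"
 proof (cases "S = {}")
  case False
  have "closedin ?X (\<Inter>s\<in>S. {x\<in>?T. P s x})" using that False by (intro closedin_INT) auto
  moreover have "(\<Inter>s\<in>S. {x\<in>?T. P s x}) = ?T\<inter>{x. \<forall>s\<in>S. P s x}" using False by auto
  ultimately show ?thesis by simp
 qed (use closedin_topspace[of ?X] in simp)
 have clF: "closedin ?X F"
 proof -
  have 1: "closedin ?X (?T\<inter>?F1)"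
   by (rule cl_all) (auto simp del: topspace_prod_topology topspace_product_topology intro!: closedin_eq_real continuous_map_add c1 add)
  have 2: "closedin ?X (?T\<inter>?F2)"
   by (rule cl_all) (auto simp del: topspace_prod_topology topspace_product_topology intro!: closedin_eq_real continuous_map_real_mult c1 add)
  have 3: "closedin ?X (?T\<inter>?F3)"
   by (rule cl_all) (auto simp del: topspace_prod_topology topspace_product_topology intro!: closedin_eq_real continuous_map_dot c1)
  have 4: "closedin ?X (?T\<inter>?F4)"
   by (rule cl_all) (auto simp del: topspace_prod_topology topspace_product_topology intro!: closedin_eq_real continuous_map_dot c1 c2)
  have "closedin ?X {x\<in>?T. dot N (snd x) (snd x)\<in>{..1}}"
   by (rule closedin_continuous_map_preimage[OF continuous_map_dot]) (auto intro: c2)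
  hence 5: "closedin ?X (?T\<inter>{x. dot N (snd x) (snd x)<=1})"
   by (simp add: Collect_conj_eq)
  have "F = (?T\<inter>?F1)
  \<inter>(?T\<inter>?F2)
  \<inter>(?T\<inter>?F3)
  \<inter>(?T\<inter>?F4)
  \<inter>(?T\<inter>{x. dot N (snd x) (snd x)<=1})"
   unfolding F_def by blast
  thus ?thesis using 1 2 3 4 5 by (simp only: closedin_Int)
 qed
 have F: "F = ?G"
 proof (intro equalityI subsetI)
  fix x assume x: "x\<in>F"
  hence "fst x\<in>Rn d \<rightarrow>\<^sub>E Rn N" "snd x\<in>Rn N" by (auto simp: F_def)
  thus "x\<in>?G"
   using x by (auto simp: F_def bundle_points_def linear_isometries_def fun_eq_iff)
 next
  fix x assume x: "x\<in>?G"
  hence "fst x\<in>Rn d \<rightarrow>\<^sub>E Rn N" "snd x\<in>Rn N" by (auto simp: bundle_points_def linear_isometries_def)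
  hence "x\<in>?T" by (cases x) auto
  thus "x\<in>F" using x by (auto simp: F_def bundle_points_def linear_isometries_def fun_eq_iff)
 qed
 have FK: "F\<subseteq>?K"
 proof
  fix x assume x: "x\<in>F"
  hence f: "fst x\<in>Rn d \<rightarrow>\<^sub>E Rn N" "snd x\<in>Rn N" by (auto simp: F_def)
  have "\<bar>fst x v i\<bar><=sqrt (dot d v v)" if "v\<in>Rn d" "i < N" for v i
  proof (rule coord_le_dot)
   have "dot N (fst x v) (fst x v) = dot d v v" using x that by (auto simp: F_def)
   thus "dot N (fst x v) (fst x v)<=(sqrt (dot d v v))\<^sup>2" by (simp add: dot_def sum_nonneg)
  qed (use that in \<open>auto simp: dot_def sum_nonneg\<close>)
  moreover have "\<bar>snd x i\<bar><=1" if "i < N" for i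
   by (rule coord_le_dot[OF _ that]) (use x in \<open>auto simp: F_def\<close>)
  ultimately show "x\<in>?K" using f by (cases x) (auto simp: PiE_iff)
 qed
 have "compactin ?X F" by (rule closed_compactin[OF K FK clF])
 moreover have "F\<subseteq>{(ph, w). ph\<in>linear_isometries d N & (\<forall>v\<in>Rn d. dot N w (ph v) = 0)}"
  unfolding F by (auto simp: bundle_points_def)
 ultimately show ?thesis
  unfolding F complement_bundle_def compactin_subtopology by blast
qed

definition K_level :: "nat => nat => point set option topology"
 where "K_level d N = homotopy_orbit_space (OG d) (act_fibre d)
  (smash (Alexandroff_compactification (complement_bundle d N)) (Sigma_ST (Rn d)))"

lemma level_reduced_spherical_K_spectrum: "level (reduced_spherical_K_spectrum d) N = K_level d N"
 by (simp add: reduced_spherical_K_spectrum_def homotopy_orbits_def smash_spectrum_def neg_sphere_def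
   K_level_def act_fibre_def[abs_def])

definition orbit :: "nat => point => point set"
 where "orbit d p = (%g. act_point d g p) ` OC d"

lemma orbit_pt_eq: "orbit_pt (OG d) (act_fibre d) e z = map_option (%x. orbit d (e, x)) z"
 by (simp add: orbit_pt_def orbit_def act_point_def)

definition ST_boundary :: "nat => (vec set => real) set"
 where "ST_boundary d = {t\<in>ST_points d. t (Rn d) = 0 | t {0} = 0}"

definition flag_realization :: "nat => (vec set => real) topology"
 where "flag_realization d = realization {U. real_fun.subspace U & U\<subseteq>Rn d} (\<subseteq>)"

lemma topspace_flag_realization [simp]: "topspace (flag_realization d) = ST_points d"
 by (simp add: flag_realization_def ST_points_def topspace_realization)

text \<open>The realization of the poset without \<open>A\<close> consists of the points of weight 0
  at \<open>A\<close>, so both subcomplexes are vanishing loci of one coordinate.\<close>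

lemma Sigma_ST_Rn: "Sigma_ST (Rn d) = quotient_space (flag_realization d) (ST_boundary d)"
proof -
 let ?P = "{U. real_fun.subspace U & U\<subseteq>Rn d}"
 have del: "realization_points (?P - {A}) (\<subseteq>) = {t\<in>ST_points d. t A = 0}" for A :: "vec set"
 proof (intro equalityI subsetI)
  fix t assume t: "t\<in>realization_points (?P - {A}) (\<subseteq>)"
  note D = realization_pointsD[OF t]
  have "t\<in>ST_points d" unfolding ST_points_def
   by (rule realization_pointsI) (use D in auto)
  thus "t\<in>{t\<in>ST_points d. t A = 0}" using D(2) by auto
 next
  fix t assume t: "t\<in>{t\<in>ST_points d. t A = 0}"
  hence "t\<in>realization_points ?P (\<subseteq>)" by (simp add: ST_points_def)
  note D = realization_pointsD[OF this]
  show "t\<in>realization_points (?P - {A}) (\<subseteq>)"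
   by (rule realization_pointsI) (use D t in auto)
 qed
 show ?thesis
  unfolding Sigma_ST_def Let_def flag_realization_def[symmetric] del
  by (rule arg_cong2[of _ _ _ _ quotient_space]) (auto simp: ST_boundary_def)
qed

definition K_points :: "nat => nat => point set"
 where "K_points d N = {p\<in>points d N. snd (snd p)\<notin>ST_boundary d}"

lemma openin_Sigma_ST:
 "openin (Sigma_ST (Rn d)) U \<longleftrightarrow> U\<subseteq>insert None (Some ` (ST_points d - ST_boundary d)) &
  openin (flag_realization d) {t\<in>ST_points d. (if t\<in>ST_boundary d then None else Some t)\<in>U}"
 unfolding Sigma_ST_Rn quotient_space_def openin_coinduced_topology by simp

lemma topspace_Sigma_ST: "topspace (Sigma_ST (Rn d)) = insert None (Some ` (ST_points d - ST_boundary d))"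
 unfolding Sigma_ST_Rn quotient_space_def by (subst topspace_coinduced_topology) auto

lemma topspace_EG: "topspace (EG (OG d)) = EG_points d"
 by (simp add: EG_def EG_points_def topspace_realization)

lemma smash_pt_image:
 "(%(a, b). smash_pt a b) ` (insert None (Some ` A)\<times>insert None (Some ` B)) = insert None (Some ` (A\<times>B))"
proof (intro equalityI subsetI)
 fix x assume "x\<in>insert None (Some ` (A\<times>B))"
 then consider "x = smash_pt None None" | a b where "x = smash_pt (Some a) (Some b)" "a\<in>A" "b\<in>B"
  by (auto simp: smash_pt_def)
 thus "x\<in>(%(a, b). smash_pt a b) ` (insert None (Some ` A)\<times>insert None (Some ` B))"
  by cases (auto intro!: rev_image_eqI[of "(None, None)"] rev_image_eqI[of "(Some _, Some _)"])
qed (auto simp: smash_pt_def split: option.splits)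

lemma smash_level_image:
 "(%(a, b). smash_pt a b) ` (topspace (Alexandroff_compactification (complement_bundle d N))\<times>topspace (Sigma_ST (Rn d)))
  = insert None (Some ` (bundle_points d N\<times>(ST_points d - ST_boundary d)))"
 unfolding topspace_Sigma_ST topspace_Alexandroff_compactification topspace_complement_bundle by (rule smash_pt_image)

lemma topspace_smash_level:
 "topspace (smash (Alexandroff_compactification (complement_bundle d N)) (Sigma_ST (Rn d)))
  = insert None (Some ` (bundle_points d N\<times>(ST_points d - ST_boundary d)))"
 unfolding smash_def by (subst topspace_coinduced_topology) (use smash_level_image in auto)

text \<open>Kification refines the product topology, so openness of the preimage in the plain
  product is sufficient; the same holds for the levels.\<close>

lemma openin_smash_level:
 assumes "U\<subseteq>insert None (Some ` (bundle_points d N\<times>(ST_points d - ST_boundary d)))"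
  "openin (prod_topology (Alexandroff_compactification (complement_bundle d N)) (Sigma_ST (Rn d)))
   {x\<in>topspace (Alexandroff_compactification (complement_bundle d N))\<times>topspace (Sigma_ST (Rn d)). smash_pt (fst x) (snd x)\<in>U}"
 shows "openin (smash (Alexandroff_compactification (complement_bundle d N)) (Sigma_ST (Rn d))) U"
 unfolding smash_def openin_coinduced_topology smash_level_image
 using assms openin_kification_finer by (simp add: case_prod_beta)

lemma openin_K_level:
 assumes "U\<subseteq>topspace (K_level d N)"
  "openin (prod_topology (EG (OG d)) (smash (Alexandroff_compactification (complement_bundle d N)) (Sigma_ST (Rn d))))
   {x\<in>EG_points d\<times>insert None (Some ` (bundle_points d N\<times>(ST_points d - ST_boundary d))).
    map_option (%y. orbit d (fst x, y)) (snd x)\<in>U}"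
 shows "openin (K_level d N) U"
proof -
 have "topspace (K_level d N) = (%(e, z). orbit_pt (OG d) (act_fibre d) e z) `
  (topspace (EG (OG d))\<times>topspace (smash (Alexandroff_compactification (complement_bundle d N)) (Sigma_ST (Rn d))))"
  unfolding K_level_def homotopy_orbit_space_def by (subst topspace_coinduced_topology) auto
 thus ?thesis
  using assms unfolding K_level_def homotopy_orbit_space_def openin_coinduced_topology
  by (auto simp: case_prod_beta orbit_pt_eq topspace_smash_level topspace_EG intro!: openin_kification_finer)
qed

lemma topspace_K_levelD:
 assumes "y\<in>topspace (K_level d N)"
 shows "y = None | (\<exists>p\<in>K_points d N. y = Some (orbit d p))"
proof -
 have "topspace (K_level d N) = (%(e, z). orbit_pt (OG d) (act_fibre d) e z) `
  (topspace (EG (OG d))\<times>topspace (smash (Alexandroff_compactification (complement_bundle d N)) (Sigma_ST (Rn d))))"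
  unfolding K_level_def homotopy_orbit_space_def by (subst topspace_coinduced_topology) auto
 then obtain e z where "e\<in>EG_points d" "z\<in>insert None (Some ` (bundle_points d N\<times>(ST_points d - ST_boundary d)))"
  "y = map_option (%x. orbit d (e, x)) z"
  using assms by (auto simp: topspace_smash_level topspace_EG orbit_pt_eq)
 thus ?thesis by (cases z) (auto simp: K_points_def points_def intro!: bexI[of _ "(e, _)"])
qed

lemma EG_points_nonempty: "(%p. of_bool (p = (\<one>\<^bsub>OG d\<^esub>, 0)))\<in>EG_points d"
proof -
 have "\<one>\<^bsub>OG d\<^esub>\<in>OC d" by (simp add: group.is_monoid[OF group_orthogonal_group] monoid.one_closed)
 thus ?thesis unfolding EG_points_def
  by (intro realization_pointsI) (auto simp: milnor_le_def)
qed

lemma topspace_K_level: "topspace (K_level d N) = insert None (Some ` orbit d ` K_points d N)"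
proof -
 have "topspace (K_level d N) = (%(e, z). orbit_pt (OG d) (act_fibre d) e z) `
  (topspace (EG (OG d))\<times>topspace (smash (Alexandroff_compactification (complement_bundle d N)) (Sigma_ST (Rn d))))"
  unfolding K_level_def homotopy_orbit_space_def by (subst topspace_coinduced_topology) auto
 also have "... = insert None (Some ` orbit d ` K_points d N)"
 proof (intro equalityI subsetI)
  fix y assume y: "y\<in>insert None (Some ` orbit d ` K_points d N)"
  show "y\<in>(%(e, z). orbit_pt (OG d) (act_fibre d) e z) `
   (topspace (EG (OG d))\<times>topspace (smash (Alexandroff_compactification (complement_bundle d N)) (Sigma_ST (Rn d))))"
  proof (cases y)
   case None
   thus ?thesis using EG_points_nonempty[of d]
    by (auto simp: topspace_smash_level topspace_EG orbit_pt_eq intro!: rev_image_eqI[of "(_, None)"])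
  next
   case (Some Y)
   then obtain p where p: "p\<in>K_points d N" "y = Some (orbit d p)" using y by auto
   thus ?thesis
    by (intro rev_image_eqI[of "(fst p, Some (snd p))"])
     (auto simp: topspace_smash_level topspace_EG orbit_pt_eq K_points_def points_def)
  qed
 qed (auto simp: topspace_smash_level topspace_EG orbit_pt_eq K_points_def points_def image_iff)
 finally show ?thesis .
qed

lemma mem_orbit: "p\<in>points d N ==> p\<in>orbit d p"
 unfolding orbit_def
 by (rule image_eqI[of _ _ "\<one>\<^bsub>OG d\<^esub>"])
  (simp_all add: act_point_one group.is_monoid[OF group_orthogonal_group] monoid.one_closed)

lemma orbit_act:
 assumes p: "p\<in>points d N" and g: "g\<in>OC d"
 shows "orbit d (act_point d g p) = orbit d p"
proof -
 interpret G: group "OG d" by (rule group_orthogonal_group)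
 have "orbit d (act_point d g p) = (%h. act_point d (h \<otimes>\<^bsub>OG d\<^esub> g) p) ` OC d"
  unfolding orbit_def by (rule image_cong) (auto simp: act_point_act[OF p _ g])
 also have "... = (%h. act_point d h p) ` (%h. h \<otimes>\<^bsub>OG d\<^esub> g) ` OC d" by (simp add: image_image)
 also have "(%h. h \<otimes>\<^bsub>OG d\<^esub> g) ` OC d = OC d"
  using g by (auto simp: image_iff) (metis G.inv_closed G.inv_solve_right G.m_closed)
 finally show ?thesis by (simp add: orbit_def)
qed

lemma orbit_eqD:
 assumes "orbit d p = orbit d q" "p\<in>points d N"
 shows "\<exists>g\<in>OC d. p = act_point d g q"
 using mem_orbit[OF assms(2)] assms(1) by (auto simp: orbit_def)

lemma ST_boundary_act:
 assumes t: "t\<in>ST_points d" and g: "g\<in>OC d"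
 shows "realization_map (image g) t\<in>ST_boundary d \<longleftrightarrow> t\<in>ST_boundary d"
proof -
 have "realization_map (image g) t (Rn d) = t (Rn d)"
  using ST_act_apply[OF t g subspace_Rn, of d] OG_image[OF g] by simp
 moreover have "g ` {0} = {0}"
  using linear_isometriesD(3)[OF orthogonalD(1)[OF g], of 0 0] by (simp add: Rn_iff zero_fun_def)
 hence "realization_map (image g) t {0} = t {0}"
  using ST_act_apply[OF t g real_fun.subspace_single_0] by (simp add: Rn_iff)
 ultimately show ?thesis using t ST_act_points[OF t g] by (simp add: ST_boundary_def)
qed

lemma act_K_points:
 assumes "p\<in>K_points d N" "g\<in>OC d"
 shows "act_point d g p\<in>K_points d N"
 using assms act_point_points[of p d N g] ST_boundary_act[of "snd (snd p)" d g]
 by (auto simp: K_points_def points_def act_point_def act_fibre_def)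

lemma act_point_fst_snd: "fst (act_point d g p) = EG_act (OG d) g (fst p)"
 "fst (snd (act_point d g p)) = neg_sphere_act d g (fst (snd p))"
 "snd (snd (act_point d g p)) = realization_map (image g) (snd (snd p))"
 by (simp_all add: act_point_def act_fibre_def)

lemma snd_neg_sphere_act [simp]: "snd (neg_sphere_act d g x) = snd x"
 by (simp add: neg_sphere_act_def split: prod.splits)

text \<open>Near the base point of a smash product it suffices that one of the two components is
  near its own base point. The preimage is a union of two open strips, the first around infinity of
  the bundle.\<close>

lemma openin_K_level_base:
 assumes opn: "openin (flag_realization d) {t\<in>ST_points d. Q t}"
  and bd: "!!t. t\<in>ST_boundary d ==> Q t"
  and act: "!!t g. t\<in>ST_points d ==> g\<in>OC d ==> Q (realization_map (image g) t) \<longleftrightarrow> Q t"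
 shows "openin (K_level d N) (insert None (Some ` orbit d `
  {p\<in>K_points d N. 1 < dot N (snd (fst (snd p))) (snd (fst (snd p))) | Q (snd (snd p))}))"
  (is "openin _ (insert None (Some ` orbit d ` ?B))")
proof (rule openin_K_level)
 let ?A = "Alexandroff_compactification (complement_bundle d N)"
 let ?T = "Sigma_ST (Rn d)"
 let ?S = "insert None (Some ` (bundle_points d N\<times>(ST_points d - ST_boundary d)))"
 let ?E = "{x\<in>EG_points d\<times>?S. map_option (%y. orbit d (fst x, y)) (snd x)\<in>insert None (Some ` orbit d ` ?B)}"
 let ?C = "%y. 1 < dot N (snd (fst y)) (snd (fst y)) | Q (snd y)"
 let ?U = "insert None (Some ` {y\<in>bundle_points d N\<times>(ST_points d - ST_boundary d). ?C y})"
 show "insert None (Some ` orbit d ` ?B)\<subseteq>topspace (K_level d N)"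
  by (auto simp: topspace_K_level)
 have "openin (smash ?A ?T) ?U"
 proof (rule openin_smash_level)
  let ?A1 = "insert None (Some ` (bundle_points d N - {x\<in>bundle_points d N. dot N (snd x) (snd x)<=1}))"
  let ?A2 = "insert None (Some ` {t\<in>ST_points d - ST_boundary d. Q t})"
  have "closedin (complement_bundle d N) {x\<in>topspace (complement_bundle d N). dot N (snd x) (snd x)\<in>{..1}}"
   by (rule closedin_continuous_map_preimage[OF continuous_map_dot]) (auto intro: continuous_map_complement_bundle)
  hence A1: "openin ?A ?A1"
   unfolding openin_Alexandroff_compactification
   using compactin_bounded_bundle[of d N] by (intro disjI2 exI conjI) (auto simp: topspace_complement_bundle)
  have e: "{t\<in>ST_points d. (if t\<in>ST_boundary d then None else Some t)\<in>?A2} = {t\<in>ST_points d. Q t}"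
   using bd by (auto simp: ST_boundary_def)
  have A2: "openin ?T ?A2"
   unfolding openin_Sigma_ST e using opn by auto
  have "{x\<in>topspace ?A\<times>topspace ?T. smash_pt (fst x) (snd x)\<in>?U}
    = ?A1\<times>topspace ?T\<union>topspace ?A\<times>?A2"
   unfolding topspace_Sigma_ST topspace_Alexandroff_compactification topspace_complement_bundle
   by (auto simp: smash_pt_def split: option.splits)
  thus "openin (prod_topology ?A ?T)
   {x\<in>topspace ?A\<times>topspace ?T. smash_pt (fst x) (snd x)\<in>?U}"
   using A1 A2 by (auto simp: openin_prod_Times_iff simp del: topspace_Alexandroff_compactification intro!: openin_Un)
 qed auto
 hence "openin (prod_topology (EG (OG d)) (smash ?A ?T)) (EG_points d\<times>?U)"
  by (auto simp: openin_prod_Times_iff topspace_EG[symmetric])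
 moreover have "?E
   = EG_points d\<times>?U"
 proof (intro equalityI subsetI)
  fix x assume x: "x\<in>?E"
  show "x\<in>EG_points d\<times>?U"
  proof (cases "snd x")
   case None
   thus ?thesis using x by (cases x) auto
  next
   case (Some y)
   have y: "y\<in>bundle_points d N\<times>(ST_points d - ST_boundary d)" "fst x\<in>EG_points d" using x Some by auto
   obtain p where p: "p\<in>?B" "orbit d (fst x, y) = orbit d p" using x Some by auto
   have "(fst x, y)\<in>points d N" using y by (auto simp: points_def)
   from orbit_eqD[OF p(2) this] obtain g where g: "g\<in>OC d" "(fst x, y) = act_point d g p" by blast
   have t: "snd (snd p)\<in>ST_points d" using p(1) by (auto simp: K_points_def points_def)
   have "y = snd (act_point d g p)" using g(2) by (metis snd_conv)
   hence "?C y" using p(1) act[OF t g(1)] by (auto simp: act_point_fst_snd)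
   thus ?thesis using Some y by (cases x) auto
  qed
 next
  fix x assume x: "x\<in>EG_points d\<times>?U"
  show "x\<in>?E"
  proof (cases "snd x")
   case None
   thus ?thesis using x by (cases x) auto
  next
   case (Some y)
   hence "(fst x, y)\<in>?B" using x by (auto simp: K_points_def points_def)
   hence "Some (orbit d (fst x, y))\<in>insert None (Some ` orbit d ` ?B)" by blast
   thus ?thesis using x Some by (cases x) auto
  qed
 qed
 ultimately show "openin (prod_topology (EG (OG d)) (smash ?A ?T))
  ?E"
  by simp
qed

text \<open>The saturation of \<open>W\<close> is the union of its translates, each a product of
  open sets away from the base points.\<close>

lemma openin_K_level_orbits:
 assumes W: "W\<subseteq>K_points d N"
  and opn: "!!g. g\<in>OC d ==> \<exists>E A T. openin (EG (OG d)) E & openin (complement_bundle d N) A &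
   openin (flag_realization d) T & T\<inter>ST_boundary d = {} & act_point d g ` W = E\<times>(A\<times>T)"
 shows "openin (K_level d N) (Some ` orbit d ` W)"
proof (rule openin_K_level)
 let ?A = "Alexandroff_compactification (complement_bundle d N)"
 let ?T = "Sigma_ST (Rn d)"
 let ?S = "insert None (Some ` (bundle_points d N\<times>(ST_points d - ST_boundary d)))"
 let ?V = "\<Union>g\<in>OC d. map_prod id Some ` act_point d g ` W"
 let ?E = "{x\<in>EG_points d\<times>?S. map_option (%y. orbit d (fst x, y)) (snd x)\<in>Some ` orbit d ` W}"
 let ?X = "prod_topology (EG (OG d)) (smash ?A ?T)"
 show "Some ` orbit d ` W\<subseteq>topspace (K_level d N)"
  using W by (auto simp: topspace_K_level)
 have "openin ?X (map_prod id Some ` act_point d g ` W)" if g: "g\<in>OC d" for g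
 proof -
  obtain E A T where O: "openin (EG (OG d)) E" "openin (complement_bundle d N) A"
   "openin (flag_realization d) T" "T\<inter>ST_boundary d = {}" "act_point d g ` W = E\<times>(A\<times>T)"
   using opn[OF g] by blast
  have sub: "A\<subseteq>bundle_points d N" "T\<subseteq>ST_points d"
   using openin_subset[OF O(2)] openin_subset[OF O(3)] by (auto simp: topspace_complement_bundle)
  have "openin (smash ?A ?T) (Some ` (A\<times>T))"
  proof (rule openin_smash_level)
   show "Some ` (A\<times>T)\<subseteq>?S" using sub O(4) by auto
   have 1: "openin ?A (Some ` A)" unfolding openin_Alexandroff_compactification using O(2) by blast
   have e: "{t\<in>ST_points d. (if t\<in>ST_boundary d then None else Some t)\<in>Some ` T} = T"
    using O(4) sub by auto
   have 2: "openin ?T (Some ` T)"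
    unfolding openin_Sigma_ST e using O(3,4) sub by auto
   have "{x\<in>topspace ?A\<times>topspace ?T. smash_pt (fst x) (snd x)\<in>Some ` (A\<times>T)} = Some ` A\<times>Some ` T"
    unfolding topspace_Sigma_ST topspace_Alexandroff_compactification topspace_complement_bundle
    using sub O(4) by (intro equalityI subsetI) (auto simp: smash_pt_def disjoint_iff split: option.splits prod.splits)
   thus "openin (prod_topology ?A ?T)
    {x\<in>topspace ?A\<times>topspace ?T. smash_pt (fst x) (snd x)\<in>Some ` (A\<times>T)}"
    using 1 2 by (simp add: openin_prod_Times_iff)
  qed
  hence "openin ?X (E\<times>Some ` (A\<times>T))" using O(1) by (simp add: openin_prod_Times_iff)
  moreover have "map_prod id Some ` act_point d g ` W = E\<times>Some ` (A\<times>T)"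
   unfolding O(5) by (rule map_prod_surj_on) simp_all
  ultimately show ?thesis by simp
 qed
 hence "openin ?X ?V" by blast
 moreover have "?E
   = ?V"
 proof (intro equalityI subsetI)
  fix x assume x: "x\<in>?E"
  then obtain y where y: "snd x = Some y" by (cases "snd x") auto
  hence "(fst x, y)\<in>points d N" using x by (auto simp: points_def)
  moreover obtain p where p: "p\<in>W" "orbit d (fst x, y) = orbit d p" using x y by auto
  ultimately obtain g where g: "g\<in>OC d" "(fst x, y) = act_point d g p" using orbit_eqD by blast
  have "x = map_prod id Some (act_point d g p)" unfolding g(2)[symmetric] using y by (cases x) auto
  thus "x\<in>?V" using g(1) p(1) by blast
 next
  fix x assume "x\<in>?V"
  then obtain g p where g: "g\<in>OC d" "p\<in>W" "x = map_prod id Some (act_point d g p)"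
   by (elim UN_E imageE) simp
  have p: "act_point d g p\<in>K_points d N" "p\<in>points d N"
   using act_K_points[OF subsetD[OF W g(2)] g(1)] subsetD[OF W g(2)] by (simp_all add: K_points_def)
  have "orbit d (fst (act_point d g p), snd (act_point d g p))\<in>orbit d ` W"
   using orbit_act[OF p(2) g(1)] g(2) by simp
  thus "x\<in>?E"
   using p(1) unfolding g(3) by (cases "act_point d g p") (auto simp: K_points_def points_def)
 qed
 ultimately show "openin ?X ?E"
  by simp
qed

section \<open>The cochain on the levels of the spectrum\<close>

lemma unit_dot_le_1:
 assumes "dot d v v = 1" "dot d b b = 1"
 shows "\<bar>dot d v b\<bar><=1"
proof -
 let ?c = "dot d v b"
 have "0<=dot d (v + (%i. - ?c*b i)) (v + (%i. - ?c*b i))" by (simp add: dot_def sum_nonneg)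
 also have "... = 1 - ?c\<^sup>2"
  unfolding dot_simps using assms dot_commute[of d b v] by (simp add: power2_eq_square algebra_simps)
 finally show ?thesis by (simp add: abs_square_le_1[symmetric])
qed

section \<open>Descent of the cochain to orbits and its vanishing near the base point\<close>

context flag_cochain
begin

definition flagged :: "(vec set => real) => bool"
 where "flagged t \<longleftrightarrow> (\<exists>b. frame dd b & (\<forall>i\<le>r. tau<=t (flag b i)))"

lemma flag_weight_act:
 assumes "t\<in>ST_points dd" "g\<in>OC dd" "frame dd b" "i<=r"
 shows "realization_map (image g) t (flag (%k. g (b k)) i) = t (flag b i)"
 using flag_act[OF assms(3,2), of i] assms(4)
  ST_act_apply[OF assms(1,2) subspace_flag flag_subset_Rn[OF assms(3)], of i] by simp

lemma flagged_act:
 assumes t: "t\<in>ST_points dd" and g: "g\<in>OC dd"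
 shows "flagged (realization_map (image g) t) \<longleftrightarrow> flagged t"
proof -
 interpret G: group "OG dd" by (rule group_orthogonal_group)
 have imp: "flagged (realization_map (image h) s)"
  if s: "s\<in>ST_points dd" "flagged s" and h: "h\<in>OC dd" for s h
 proof -
  obtain b where b: "frame dd b" "!!i. i<=r ==> tau<=s (flag b i)" using s(2) by (auto simp: flagged_def)
  hence "frame dd (%k. h (b k)) & (\<forall>i\<le>r. tau<=realization_map (image h) s (flag (%k. h (b k)) i))"
   using frame_act[OF b(1) h] flag_weight_act[OF s(1) h b(1)] by simp
  thus ?thesis unfolding flagged_def by (rule exI[of _ "%k. h (b k)"])
 qed
 have "realization_map (image (inv\<^bsub>OG dd\<^esub> g)) (realization_map (image g) t) = t"
  using ST_act_act[OF t G.inv_closed[OF g] g] ST_act_one[OF t] g by simp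
 thus ?thesis using imp[OF t _ g] imp[OF ST_act_points[OF t g] _ G.inv_closed[OF g]] by auto
qed

lemma flagged_not_boundary: "flagged t ==> t\<notin>ST_boundary dd"
proof
 assume "flagged t" "t\<in>ST_boundary dd"
 then obtain b where b: "frame dd b" "!!i. i<=r ==> tau<=t (flag b i)" by (auto simp: flagged_def)
 thus False using b(2)[of 0] b(2)[of r] flag_top[OF b(1)] tau_pos \<open>t\<in>ST_boundary dd\<close>
  by (auto simp: ST_boundary_def)
qed

text \<open>In the weak topology one simplex at a time suffices. It has finitely many vertices, so
  only finitely many sets of vertices can be a flag, although frames form a continuum; being flagged
  is a finite union of closed conditions.\<close>

lemma openin_unflagged: "openin (flag_realization dd) {t\<in>ST_points dd. \<not> flagged t}"
 unfolding flag_realization_def openin_realization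
proof (intro conjI ballI)
 let ?P = "{U. real_fun.subspace U & U\<subseteq>Rn dd}"
 show "{t\<in>ST_points dd. \<not> flagged t}\<subseteq>realization_points ?P (\<subseteq>)" by (auto simp: ST_points_def)
 fix C assume C: "C\<in>order_simplices ?P (\<subseteq>)"
 hence fin: "finite C" by (simp add: order_simplices_def)
 let ?X = "subtopology (powertop_real UNIV) (closed_simplex C)"
 let ?G = "{t\<in>closed_simplex C. flagged t}"
 let ?F = "%S. {t\<in>topspace ?X. \<forall>U\<in>S. tau<=t U}"
 let ?S = "{S. S\<subseteq>C & (\<exists>b. frame dd b & S = flag b ` {..r})}"
 have cl: "closedin ?X (?F S)" if "finite S" for S
 proof -
  have "closedin ?X {t\<in>topspace ?X. t U\<in>{tau..}}" for U
   by (rule closedin_continuous_map_preimage[of _ euclideanreal])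
    (auto intro!: continuous_map_from_subtopology continuous_map_product_projection)
  hence "closedin ?X (topspace ?X\<inter>(\<Inter>U\<in>S. {t\<in>topspace ?X. t U\<in>{tau..}}))"
   by (cases "S = {}") (auto intro!: closedin_Int closedin_INT simp del: topspace_subtopology)
  moreover have "topspace ?X\<inter>(\<Inter>U\<in>S. {t\<in>topspace ?X. t U\<in>{tau..}}) = (?F S)"
   by auto
  ultimately show ?thesis by simp
 qed
 have "closedin ?X (\<Union>S\<in>?S. (?F S))"
  by (rule closedin_Union) (use fin in \<open>auto intro!: cl finite_subset[of _ C] simp del: topspace_subtopology\<close>)
 moreover have "(\<Union>S\<in>?S. (?F S)) = ?G"
 proof (intro equalityI subsetI)
  fix t assume t: "t\<in>?G"
  then obtain b where b: "frame dd b" "!!i. i<=r ==> tau<=t (flag b i)" by (auto simp: flagged_def)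
  have "flag b i\<in>C" if "i<=r" for i
  proof (rule ccontr)
   assume "flag b i\<notin>C"
   hence "t (flag b i) = 0" using t by (simp add: closed_simplex_def)
   thus False using b(2)[OF that] tau_pos by simp
  qed
  hence "flag b ` {..r}\<in>?S" using b(1) by blast
  moreover have "t\<in>(?F (flag b ` {..r}))" using t b(2) by auto
  ultimately show "t\<in>(\<Union>S\<in>?S. (?F S))" by blast
 next
  fix t assume "t\<in>(\<Union>S\<in>?S. (?F S))"
  thus "t\<in>?G" unfolding flagged_def by auto
 qed
 ultimately have "closedin ?X ?G" by simp
 hence "openin ?X (topspace ?X - ?G)" by (rule openin_diff[OF openin_topspace])
 moreover have "topspace ?X - ?G = closed_simplex C\<inter>{t\<in>ST_points dd. \<not> flagged t}"
  using C by (auto simp: ST_points_def realization_points_def)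
 ultimately show "openin ?X (closed_simplex C\<inter>{t\<in>ST_points dd. \<not> flagged t})" by simp
qed

definition remote :: "point => bool"
 where "remote p \<longleftrightarrow> 1 < dot N (snd (fst (snd p))) (snd (fst (snd p))) | \<not> flagged (snd (snd p))"

lemma remote_act: "p\<in>points dd N ==> g\<in>OC dd ==> remote (act_point dd g p) \<longleftrightarrow> remote p"
 unfolding remote_def act_point_fst_snd snd_neg_sphere_act
 by (auto simp: points_def flagged_act)

text \<open>To be an open neighbourhood of the base point on which the cochain vanishes.\<close>

definition bad :: "point set option set"
 where "bad = insert None (Some ` orbit dd ` {p\<in>K_points dd N. remote p})"

lemma openin_bad: "openin (K_level dd N) bad"
 unfolding bad_def remote_def
 by (rule openin_K_level_base) (use openin_unflagged flagged_not_boundary flagged_act in auto)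

definition lift :: "point set option list => point list => (nat => vec) => bool"
 where "lift ys ps b \<longleftrightarrow> ys = map (%p. Some (orbit dd p)) ps & cluster (set ps) & (\<forall>p\<in>set ps. adapted b p)"

text \<open>For nonempty tuples the choice of the lift is immaterial by \<open>lift_unique\<close>;
  tuples without a lift get the value 0.\<close>

definition orbit_cochain :: "point set option list => real"
 where "orbit_cochain ys = (if \<exists>z. lift ys (fst z) (snd z)
  then (%z. cochain (snd z) (fst z)) (SOME z. lift ys (fst z) (snd z)) else 0)"

text \<open>Entry by entry the lifts differ by group elements. Overlaps above 1/2 in both lifts and
  freeness of the action force one common element; then equivariance and independence of the frame
  apply.\<close>

lemma lift_unique:
 assumes "lift ys ps b" "lift ys ps' b'" "ps~=[]"
 shows "cochain b' ps' = cochain b ps"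
proof -
 interpret G: group "OG dd" by (rule group_orthogonal_group)
 have cl: "cluster (set ps)" "cluster (set ps')" using assms by (auto simp: lift_def)
 hence pts: "set ps\<subseteq>points dd N" "set ps'\<subseteq>points dd N" by (auto simp: cluster_def)
 have eq: "map (%p. Some (orbit dd p)) ps' = map (%p. Some (orbit dd p)) ps" using assms by (simp add: lift_def)
 hence len: "length ps' = length ps" using map_eq_imp_length_eq by blast
 have ex: "\<exists>g\<in>OC dd. ps' ! k = act_point dd g (ps ! k)" if "k < length ps" for k
 proof (rule orbit_eqD)
  show "orbit dd (ps' ! k) = orbit dd (ps ! k)"
   using arg_cong[OF eq, of "%l. l ! k"] that len by simp
  show "ps' ! k\<in>points dd N" using pts that len by auto
 qed
 obtain g where g: "g\<in>OC dd" "ps' ! 0 = act_point dd g (ps ! 0)"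
  using ex[of 0] assms(3) by auto
 have "ps' = map (act_point dd g) ps"
 proof (rule nth_equalityI)
  fix k assume "k < length ps'"
  hence k: "k < length ps" using len by simp
  hence m: "ps ! 0\<in>set ps" "ps ! k\<in>set ps" "ps' ! 0\<in>set ps'" "ps' ! k\<in>set ps'" using len by (auto intro!: nth_mem)
  obtain h where h: "h\<in>OC dd" "ps' ! k = act_point dd h (ps ! k)" using ex[OF k] by blast
  let ?e = "fst (ps ! 0)" and ?e' = "fst (ps ! k)"
  have e: "?e\<in>EG_points dd" "?e'\<in>EG_points dd" using pts(1) m by (auto simp: points_def)
  let ?i = "inv\<^bsub>OG dd\<^esub> g"
  have i: "?i\<in>OC dd" using g(1) by simp
  have "1/2 < overlap (EG_act (OG dd) g ?e) (EG_act (OG dd) h ?e')"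
   using cluster_near[OF cl(2) m(3,4)] by (simp add: near_def g(2) h(2) act_point_fst_snd)
  hence "1/2 < overlap (EG_act (OG dd) ?i (EG_act (OG dd) g ?e)) (EG_act (OG dd) ?i (EG_act (OG dd) h ?e'))"
   using overlap_EG_act[OF EG_act_points[OF e(1) g(1)] EG_act_points[OF e(2) h(1)] i] by simp
  moreover have "EG_act (OG dd) ?i (EG_act (OG dd) g ?e) = ?e"
   using EG_act_act[OF e(1) i g(1)] EG_act_one[OF e(1)] g(1) by simp
  moreover have "EG_act (OG dd) ?i (EG_act (OG dd) h ?e') = EG_act (OG dd) (?i \<otimes>\<^bsub>OG dd\<^esub> h) ?e'"
   by (rule EG_act_act[OF e(2) i h(1)])
  moreover have "1/2 < overlap ?e ?e'" using cluster_near[OF cl(1) m(1,2)] by (simp add: near_def)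
  ultimately have "?i \<otimes>\<^bsub>OG dd\<^esub> h = \<one>\<^bsub>OG dd\<^esub>"
   using EG_act_free[OF e G.m_closed[OF i h(1)]] by simp
  hence "h = g" using g(1) h(1) by (metis G.inv_solve_left G.one_closed G.r_one)
  thus "ps' ! k = map (act_point dd g) ps ! k" using h(2) k by simp
 qed (use len in simp)
 moreover have "cochain b' (map (act_point dd g) ps) = cochain (%k. g (b k)) (map (act_point dd g) ps)"
 proof (rule cochain_frame_independent)
  show "set (map (act_point dd g) ps)\<subseteq>points dd N" using pts(1) act_point_points g(1) by auto
  show "map (act_point dd g) ps~=[]" using assms(3) by simp
  show "adapted b' p" if "p\<in>set (map (act_point dd g) ps)" for p
   using that assms(2) calculation by (auto simp: lift_def)
  show "adapted (%k. g (b k)) p" if p: "p\<in>set (map (act_point dd g) ps)" for p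
  proof -
   obtain q where q: "q\<in>set ps" "p = act_point dd g q" using p by auto
   hence "adapted b q" "snd (snd q)\<in>ST_points dd" using assms(1) pts(1) by (auto simp: lift_def points_def)
   thus ?thesis unfolding q(2) adapted_def act_point_fst_snd
    using frame_act g(1) flag_weight_act by auto
  qed
 qed
 moreover have "cochain (%k. g (b k)) (map (act_point dd g) ps) = cochain b ps"
 proof (rule cochain_act[OF _ g(1) pts(1)])
  show "frame dd b" using assms(1,3) by (cases ps) (auto simp: lift_def adapted_def)
 qed
 ultimately show ?thesis by simp
qed

lemma orbit_cochain_eq:
 assumes "lift ys ps b" "ps~=[]"
 shows "orbit_cochain ys = cochain b ps"
proof -
 let ?z = "SOME z. lift ys (fst z) (snd z)"
 have ex: "\<exists>z. lift ys (fst z) (snd z)" using assms(1) by (intro exI[of _ "(ps, b)"]) simp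
 hence "lift ys (fst ?z) (snd ?z)" by (rule someI_ex)
 from lift_unique[OF assms(1) this assms(2)] show ?thesis using ex by (simp add: orbit_cochain_def)
qed

text \<open>Being remote is invariant under the group. An entry of a lift is remote because its
  complement vector is long or because the adapted flag has a member lighter than
  \<open>tau\<close>: the cases of \<open>cochain_far\<close> and
  \<open>cochain_degenerate\<close>.\<close>

lemma orbit_cochain_bad:
 assumes len: "2*n + dd < length ys" and y: "y\<in>set ys" "y\<in>bad"
 shows "orbit_cochain ys = 0"
proof (cases "\<exists>ps b. lift ys ps b")
 case True
 then obtain ps b where l: "lift ys ps b" by blast
 hence P: "cluster (set ps)" and ad: "!!p. p\<in>set ps ==> adapted b p" and ys: "ys = map (%p. Some (orbit dd p)) ps"
  by (auto simp: lift_def)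
 obtain p where p: "p\<in>set ps" "y = Some (orbit dd p)" using y(1) ys by auto
 have pp: "p\<in>points dd N" using P p(1) by (auto simp: cluster_def)
 obtain q where q: "q\<in>K_points dd N" "remote q" "orbit dd p = orbit dd q"
  using y(2) p(2) by (auto simp: bad_def)
 obtain g where "g\<in>OC dd" "p = act_point dd g q" using orbit_eqD[OF q(3) pp] by blast
 hence rem: "remote p" using q(1,2) remote_act[of q g] by (simp add: K_points_def)
 have fr: "frame dd b" using ad[OF p(1)] by (simp add: adapted_def)
 have len': "2*n + dd < length ps" using len ys by simp
 have "cochain b ps = 0"
 proof (cases "1 < dot N (snd (fst (snd p))) (snd (fst (snd p)))")
  case True
  thus ?thesis using cochain_far[OF P fr len' p(1)] by simp
 next
  case False
  then obtain i where "i<=r" "snd (snd p) (flag b i) < tau"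
   using rem fr by (auto simp: remote_def flagged_def not_le)
  thus ?thesis using cochain_degenerate[OF P ad len' p(1)] by blast
 qed
 thus ?thesis using orbit_cochain_eq[OF l] len' by fastforce
next
 case False
 thus ?thesis by (auto simp: orbit_cochain_def)
qed

lemma coboundary_orbit_cochain:
 assumes "lift ys ps b" "length ys = 2*n + N + 2"
 shows "coboundary orbit_cochain ys = 0"
proof -
 let ?o = "%p. Some (orbit dd p)"
 have l: "ys = map ?o ps" "cluster (set ps)" "!!p. p\<in>set ps ==> adapted b p" using assms(1) by (auto simp: lift_def)
 have "coboundary orbit_cochain ys = coboundary (%qs. orbit_cochain (map ?o qs)) ps"
  unfolding l(1) by (rule coboundary_map[symmetric])
 also have "... = coboundary (cochain b) ps"
 proof (rule coboundary_cong)
  fix qs assume qs: "set qs\<subseteq>set ps" "Suc (length qs) = length ps"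
  have "lift (map ?o qs) qs b" using cluster_subset[OF l(2) qs(1)] qs(1) l(3) by (auto simp: lift_def)
  thus "orbit_cochain (map ?o qs) = cochain b qs" using orbit_cochain_eq qs(2) assms(2) l(1) by fastforce
 qed
 also have "... = 0"
 proof (rule coboundary_cochain[OF l(2)])
  show len: "length ps = 2*n + N + 2" using assms(2) l(1) by simp
  show "frame dd b" using l(3)[of "hd ps"] len by (cases ps) (auto simp: adapted_def)
 qed
 finally show ?thesis .
qed

end

lemma openin_finite_ball:
 assumes "finite S" "!!s. s\<in>S ==> openin X {x\<in>topspace X. P s x}"
 shows "openin X {x\<in>topspace X. \<forall>s\<in>S. P s x}"
 using assms
proof (induction S)
 case (insert s S)
 hence "openin X ({x\<in>topspace X. P s x}\<inter>{x\<in>topspace X. \<forall>s\<in>S. P s x})" by (intro openin_Int) auto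
 moreover have "{x\<in>topspace X. P s x}\<inter>{x\<in>topspace X. \<forall>s\<in>S. P s x} = {x\<in>topspace X. \<forall>s\<in>insert s S. P s x}" by auto
 ultimately show ?case by simp
qed simp

lemma openin_abs_diff:
 assumes "continuous_map X euclideanreal f"
 shows "openin X {x\<in>topspace X. \<bar>f x - c\<bar> < ep}"
proof -
 have "openin X {x\<in>topspace X. f x\<in>{c - ep<..<c + ep}}"
  by (rule openin_continuous_map_preimage[OF assms]) simp
 moreover have "{x\<in>topspace X. f x\<in>{c - ep<..<c + ep}} = {x\<in>topspace X. \<bar>f x - c\<bar> < ep}"
  by (auto simp: abs_less_iff)
 ultimately show ?thesis by simp
qed

section \<open>Product neighbourhoods of points with a heavy flag\<close>

context flag_cochain
begin

text \<open>A unit vector has \<open>2*r\<close> frame coefficients of size at most 1, and two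
  points of a neighbourhood differ by less than \<open>2*radius\<close> at each frame vector; the
  product of these bounds is \<open>ka\<close>.\<close>

definition radius::real
 where "radius = ka/(4*real r)"

lemma radius_pos: "0 < radius"
 using ka_pos r_pos by (simp add: radius_def)

text \<open>Overlap above 3/4 with the centre gives mutual overlap above 1/2 by the triangle
  inequality.\<close>

definition nbhd_EG :: "point => ((vec => vec)\<times>nat => real) set"
 where "nbhd_EG p = {e\<in>EG_points dd. 3/4 < overlap (fst p) e}"

definition nbhd_bundle :: "(nat => vec) => point => ((vec => vec)\<times>vec) set"
 where "nbhd_bundle b p = {x\<in>bundle_points dd N. \<forall>j<N. \<bar>snd x j - snd (fst (snd p)) j\<bar> < radius &
  (\<forall>l<dd. \<bar>fst x (b l) j - fst (fst (snd p)) (b l) j\<bar> < radius)}"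

definition nbhd_ST :: "point => (vec set => real) set"
 where "nbhd_ST p = {t\<in>ST_points dd. 1 - tau/2 < overlap (snd (snd p)) t}"

definition nbhd :: "(nat => vec) => point => point set"
 where "nbhd b p = nbhd_EG p\<times>(nbhd_bundle b p\<times>nbhd_ST p)"

definition core :: "(nat => vec) => point => bool"
 where "core b p \<longleftrightarrow> p\<in>points dd N & frame dd b & (\<forall>i\<le>r. tau<=snd (snd p) (flag b i))"

lemma coreD:
 assumes "core b p"
 shows "p\<in>points dd N" "frame dd b" "i<=r ==> tau<=snd (snd p) (flag b i)"
  "fst p\<in>EG_points dd" "fst (snd p)\<in>bundle_points dd N" "snd (snd p)\<in>ST_points dd"
 using assms by (auto simp: core_def points_def)

lemma core_act:
 assumes "core b p" and g: "g\<in>OC dd"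
 shows "core (%k. g (b k)) (act_point dd g p)"
 using act_point_points[OF coreD(1)[OF assms(1)] g] frame_act[OF coreD(2)[OF assms(1)] g]
  flag_weight_act[OF coreD(6)[OF assms(1)] g coreD(2)[OF assms(1)]] coreD(3)[OF assms(1)]
 by (simp add: core_def act_point_fst_snd)

lemma nbhd_self: "core b p ==> p\<in>nbhd b p"
 using overlap_self[OF weights_EG] overlap_self[OF weights_ST] radius_pos tau_pos coreD(4-6)[of b p]
 by (cases p) (simp add: nbhd_def nbhd_EG_def nbhd_bundle_def nbhd_ST_def)

lemma nbhd_ST_flag:
 assumes "core b p" "t\<in>nbhd_ST p" "i<=r"
 shows "0 < t (flag b i)"
proof -
 have "t\<in>ST_points dd" "1 - tau/2 < overlap (snd (snd p)) t" using assms(2) by (auto simp: nbhd_ST_def)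
 hence "\<bar>snd (snd p) (flag b i) - t (flag b i)\<bar> < tau/2"
  using weight_abs_diff[OF weights_ST[OF coreD(6)[OF assms(1)]] weights_ST, of t "dd" "flag b i"] by linarith
 thus ?thesis using coreD(3)[OF assms(1,3)] tau_pos by linarith
qed

lemma nbhd_act_subset:
 assumes p: "core b p" and g: "g\<in>OC dd"
 shows "act_point dd g ` nbhd b p\<subseteq>nbhd (%k. g (b k)) (act_point dd g p)"
proof
 fix x assume "x\<in>act_point dd g ` nbhd b p"
 then obtain q where q: "q\<in>nbhd b p" "x = act_point dd g q" by blast
 have m: "fst q\<in>EG_points dd" "fst (snd q)\<in>bundle_points dd N" "snd (snd q)\<in>ST_points dd"
  using q(1) by (auto simp: nbhd_def nbhd_EG_def nbhd_bundle_def nbhd_ST_def)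
 have e: "EG_act (OG dd) g (fst q)\<in>nbhd_EG (act_point dd g p)"
  using q(1) EG_act_points[OF m(1) g] overlap_EG_act[OF coreD(4)[OF p] m(1) g]
  by (auto simp: nbhd_def nbhd_EG_def act_point_fst_snd)
 have ov: "overlap (realization_map (image g) (snd (snd p))) (realization_map (image g) (snd (snd q))) = overlap (snd (snd p)) (snd (snd q))"
  by (rule overlap_realization_map[OF inj_on_image_subspaces[OF g] ST_support[OF coreD(6)[OF p]] ST_support[OF m(3)]])
 have t: "realization_map (image g) (snd (snd q))\<in>nbhd_ST (act_point dd g p)"
  using q(1) ST_act_points[OF m(3) g] ov by (auto simp: nbhd_def nbhd_ST_def act_point_fst_snd)
 have f: "fst (neg_sphere_act dd g y) (g (b l)) = fst y (b l)" if "l < dd" for y :: "(vec => vec)\<times>vec" and l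
  using OG_Rn[OF g frameD(1)[OF coreD(2)[OF p] that]] OG_inv(1)[OF g frameD(1)[OF coreD(2)[OF p] that]]
  by (simp add: neg_sphere_act_def compose_def split: prod.splits)
 have a: "neg_sphere_act dd g (fst (snd q))\<in>nbhd_bundle (%k. g (b k)) (act_point dd g p)"
  using q(1) neg_sphere_act_points[OF m(2) g] f by (auto simp: nbhd_def nbhd_bundle_def act_point_fst_snd)
 show "x\<in>nbhd (%k. g (b k)) (act_point dd g p)"
  using e a t unfolding q(2) nbhd_def by (simp add: mem_Times_iff act_point_fst_snd)
qed

lemma nbhd_bundle_cong:
 assumes "!!l. l < dd ==> b l = b' l"
 shows "nbhd_bundle b p = nbhd_bundle b' p"
 using assms by (simp add: nbhd_bundle_def)

lemma nbhd_act:
 assumes p: "core b p" and g: "g\<in>OC dd"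
 shows "act_point dd g ` nbhd b p = nbhd (%k. g (b k)) (act_point dd g p)"
proof
 interpret G: group "OG dd" by (rule group_orthogonal_group)
 let ?i = "inv\<^bsub>OG dd\<^esub> g"
 have i: "?i\<in>OC dd" using g by simp
 show "nbhd (%k. g (b k)) (act_point dd g p)\<subseteq>act_point dd g ` nbhd b p"
 proof
  fix x assume x: "x\<in>nbhd (%k. g (b k)) (act_point dd g p)"
  hence xp: "x\<in>points dd N"
   by (auto simp: nbhd_def nbhd_EG_def nbhd_bundle_def nbhd_ST_def points_def)
  have "act_point dd ?i x\<in>nbhd (%k. ?i (g (b k))) (act_point dd ?i (act_point dd g p))"
   using nbhd_act_subset[OF core_act[OF p g] i] x by blast
  also have "act_point dd ?i (act_point dd g p) = p"
   using act_point_act[OF coreD(1)[OF p] i g] act_point_one[OF coreD(1)[OF p]] g by simp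
  also have "nbhd (%k. ?i (g (b k))) p = nbhd b p"
   unfolding nbhd_def
   using nbhd_bundle_cong[of "%k. ?i (g (b k))" b p] OG_inv(1)[OF g frameD(1)[OF coreD(2)[OF p]]] by simp
  finally have "act_point dd ?i x\<in>nbhd b p" .
  moreover have "x = act_point dd g (act_point dd ?i x)"
   using act_point_act[OF xp g i] act_point_one[OF xp] g by simp
  ultimately show "x\<in>act_point dd g ` nbhd b p" by blast
 qed
qed (rule nbhd_act_subset[OF assms])

lemma openin_nbhd_bundle:
 assumes b: "frame dd b"
 shows "openin (complement_bundle dd N) (nbhd_bundle b p)"
proof -
 let ?X = "complement_bundle dd N"
 let ?T = "{x\<in>topspace ?X. \<forall>j\<in>{..<N}. \<bar>snd x j - snd (fst (snd p)) j\<bar> < radius}"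
 let ?S = "{x\<in>topspace ?X. \<forall>s\<in>{..<N}\<times>{..<dd}. \<bar>fst x (b (snd s)) (fst s) - fst (fst (snd p)) (b (snd s)) (fst s)\<bar> < radius}"
 have "openin ?X ?T"
  by (rule openin_finite_ball) (auto intro!: openin_abs_diff continuous_map_complement_bundle)
 moreover have "openin ?X ?S"
  by (rule openin_finite_ball) (use frameD(1)[OF b] in \<open>auto intro!: openin_abs_diff continuous_map_complement_bundle\<close>)
 ultimately have "openin ?X (?T
 \<inter>?S)"
  by (rule openin_Int)
 moreover have "(?T
 \<inter>?S)
  = nbhd_bundle b p"
  by (auto simp: nbhd_bundle_def topspace_complement_bundle)
 ultimately show ?thesis by simp
qed

lemma openin_nbhd_orbits:
 assumes p: "core b p"
 shows "openin (K_level dd N) (Some ` orbit dd ` nbhd b p)"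
proof (rule openin_K_level_orbits)
 have nb: "t\<notin>ST_boundary dd" if "core b' p'" "t\<in>nbhd_ST p'" for b' p' t
  using nbhd_ST_flag[OF that, of 0] nbhd_ST_flag[OF that, of r] flag_top[OF coreD(2)[OF that(1)]]
  by (auto simp: ST_boundary_def)
 show "nbhd b p\<subseteq>K_points dd N"
  using nb[OF p] by (auto simp: nbhd_def nbhd_EG_def nbhd_bundle_def nbhd_ST_def K_points_def points_def)
 fix g assume g: "g\<in>OC dd"
 let ?p = "act_point dd g p"
 note c = core_act[OF p g]
 have 1: "openin (EG (OG dd)) (nbhd_EG ?p)"
  unfolding EG_def nbhd_EG_def EG_points_def
  by (rule openin_overlap) (rule coreD(4)[OF c, unfolded EG_points_def])
 have 2: "openin (flag_realization dd) (nbhd_ST ?p)"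
  unfolding flag_realization_def nbhd_ST_def ST_points_def
  by (rule openin_overlap) (rule coreD(6)[OF c, unfolded ST_points_def])
 show "\<exists>E A T. openin (EG (OG dd)) E & openin (complement_bundle dd N) A &
   openin (flag_realization dd) T & T\<inter>ST_boundary dd = {} & act_point dd g ` nbhd b p = E\<times>(A\<times>T)"
  using 1 2 openin_nbhd_bundle[OF coreD(2)[OF c], of ?p] nb[OF c] nbhd_act[OF p g]
  unfolding nbhd_def
  by (intro exI[of _ "nbhd_EG ?p"] exI[of _ "nbhd_bundle (%k. g (b k)) ?p"] exI[of _ "nbhd_ST ?p"]) auto
qed

lemma cluster_nbhd:
 assumes p: "core b p"
 shows "cluster (nbhd b p)"
 unfolding cluster_def
proof (intro conjI ballI)
 show "nbhd b p\<subseteq>points dd N"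
  by (auto simp: nbhd_def nbhd_EG_def nbhd_bundle_def nbhd_ST_def points_def)
 fix q q' assume q: "q\<in>nbhd b p" and q': "q'\<in>nbhd b p"
 have m: "fst q\<in>EG_points dd" "snd (snd q)\<in>ST_points dd"
  "fst q'\<in>EG_points dd" "snd (snd q')\<in>ST_points dd"
  and e: "3/4 < overlap (fst p) (fst q)" "3/4 < overlap (fst p) (fst q')"
  and t: "1 - tau/2 < overlap (snd (snd p)) (snd (snd q))" "1 - tau/2 < overlap (snd (snd p)) (snd (snd q'))"
  and x: "fst (snd q)\<in>nbhd_bundle b p" "fst (snd q')\<in>nbhd_bundle b p"
  using q q' by (auto simp: nbhd_def nbhd_EG_def nbhd_ST_def)
 have "1/2 < overlap (fst q) (fst q')"
  using overlap_triangle[OF weights_EG[OF coreD(4)[OF p]] weights_EG[OF m(1)] weights_EG[OF m(3)]] e by linarith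
 moreover have "1 - tau<=overlap (snd (snd q)) (snd (snd q'))"
  using overlap_triangle[OF weights_ST[OF coreD(6)[OF p]] weights_ST[OF m(2)] weights_ST[OF m(4)]] t by linarith
 moreover have "\<bar>snd (fst (snd q)) j - snd (fst (snd q')) j\<bar><=ka" if "j < N" for j
 proof -
  have "\<bar>snd (fst (snd q)) j - snd (fst (snd p)) j\<bar> < radius" "\<bar>snd (fst (snd q')) j - snd (fst (snd p)) j\<bar> < radius"
   using x that by (auto simp: nbhd_bundle_def)
  moreover have "2*radius<=ka" using ka_pos r_pos by (simp add: radius_def field_simps)
  ultimately show ?thesis by linarith
 qed
 moreover have "\<bar>fst (fst (snd q)) v j - fst (fst (snd q')) v j\<bar><=ka"
  if j: "j < N" and v: "v\<in>Rn dd" "dot dd v v = 1" for v j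
 proof -
  note b = coreD(2)[OF p]
  have ev: "v = (%j. \<Sum>k<dd. dot dd v (b k)*b k j)"
   using flag_expansion[OF b, of r v] flag_top[OF b] v(1) by simp
  have ex: "ph v j = (\<Sum>k<dd. dot dd v (b k)*ph (b k) j)" if ph: "ph\<in>linear_isometries dd N" for ph
  proof -
   have "ph (%j. \<Sum>k<dd. dot dd v (b k)*b k j) = (%j. \<Sum>k<dd. dot dd v (b k)*ph (b k) j)"
    by (rule linear_isometries_comb[OF ph]) (use frameD(1)[OF b] in auto)
   thus ?thesis using ev by simp
  qed
  let ?f = "fst (fst (snd q))" and ?f' = "fst (fst (snd q'))"
  have "?f\<in>linear_isometries dd N" "?f'\<in>linear_isometries dd N"
   using x by (auto simp: nbhd_bundle_def bundle_points_def)
  hence "\<bar>?f v j - ?f' v j\<bar> = \<bar>\<Sum>k<dd. dot dd v (b k)*(?f (b k) j - ?f' (b k) j)\<bar>"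
   by (simp add: ex sum_subtractf algebra_simps)
  also have "...<=(\<Sum>k<dd. 1*(2*radius))"
  proof (rule order_trans[OF sum_abs sum_mono])
   fix k assume k: "k\<in>{..<dd}"
   have "\<bar>?f (b k) j - fst (fst (snd p)) (b k) j\<bar> < radius" "\<bar>?f' (b k) j - fst (fst (snd p)) (b k) j\<bar> < radius"
    using x j k by (auto simp: nbhd_bundle_def)
   hence "\<bar>?f (b k) j - ?f' (b k) j\<bar><=2*radius" by linarith
   moreover have "\<bar>dot dd v (b k)\<bar><=1"
    by (rule unit_dot_le_1[OF v(2)]) (use frameD(2)[OF b] k in simp)
   ultimately show "\<bar>dot dd v (b k)*(?f (b k) j - ?f' (b k) j)\<bar><=1*(2*radius)"
    unfolding abs_mult by (intro mult_mono) auto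
  qed
  also have "... = ka" using r_pos by (simp add: radius_def)
  finally show ?thesis .
 qed
 ultimately show "near q q'" unfolding near_def by blast
qed

text \<open>For a bad point \<open>bad\<close> itself serves, since every face of a tuple in it has
  a bad entry. Any other point has a product neighbourhood over which all tuples lift to a cluster
  adapted to one frame.\<close>

theorem orbit_cochain_cocycle:
 assumes "y\<in>topspace (K_level dd N)"
 shows "\<exists>U. openin (K_level dd N) U & y\<in>U &
  (\<forall>ys. set ys\<subseteq>U --> length ys = 2*n + N + 2 --> coboundary orbit_cochain ys = 0)"
proof (cases "y\<in>bad")
 case True
 have "coboundary orbit_cochain ys = 0" if ys: "set ys\<subseteq>bad" "length ys = 2*n + N + 2" for ys
 proof -
  have "coboundary orbit_cochain ys = coboundary (%_. 0) ys"
  proof (rule coboundary_cong)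
   fix zs assume zs: "set zs\<subseteq>set ys" "Suc (length zs) = length ys"
   then obtain z where z: "z\<in>set zs" using ys(2) by (cases zs) auto
   show "orbit_cochain zs = 0"
   proof (rule orbit_cochain_bad[OF _ z])
    show "2*n + dd < length zs" using zs(2) ys(2) rN by simp
    show "z\<in>bad" using zs(1) ys(1) z by blast
   qed
  qed
  thus ?thesis by (simp add: coboundary_const)
 qed
 thus ?thesis using openin_bad True by blast
next
 case False
 then obtain p where p: "p\<in>K_points dd N" "y = Some (orbit dd p)" "\<not> remote p"
  using topspace_K_levelD[OF assms] unfolding bad_def by blast
 have "flagged (snd (snd p))" "p\<in>points dd N" using p by (simp_all add: remote_def K_points_def)
 then obtain b where b: "core b p" unfolding flagged_def core_def by blast
 show ?thesis
 proof (intro exI[of _ "Some ` orbit dd ` nbhd b p"] conjI allI impI)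
  show "openin (K_level dd N) (Some ` orbit dd ` nbhd b p)" by (rule openin_nbhd_orbits[OF b])
  show "y\<in>Some ` orbit dd ` nbhd b p" using nbhd_self[OF b] p(2) by blast
  fix ys assume ys: "set ys\<subseteq>Some ` orbit dd ` nbhd b p" "length ys = 2*n + N + 2"
  have "\<exists>ps. set ps\<subseteq>nbhd b p & ys = map (%p. Some (orbit dd p)) ps" using ys(1)
  proof (induction ys)
   case (Cons y ys)
   then obtain ps q where "set ps\<subseteq>nbhd b p" "ys = map (%p. Some (orbit dd p)) ps" "q\<in>nbhd b p" "y = Some (orbit dd q)"
    by auto
   thus ?case by (intro exI[of _ "q # ps"]) simp
  qed simp
  then obtain ps where ps: "set ps\<subseteq>nbhd b p" "ys = map (%p. Some (orbit dd p)) ps" by blast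
  have "lift ys ps b"
   unfolding lift_def adapted_def
  proof (intro conjI ballI allI impI)
   show "ys = map (%p. Some (orbit dd p)) ps" by (rule ps(2))
   show "cluster (set ps)" by (rule cluster_subset[OF cluster_nbhd[OF b] ps(1)])
   show "frame dd b" by (rule coreD(2)[OF b])
   fix q i assume "q\<in>set ps" "i<=r"
   hence "snd (snd q)\<in>nbhd_ST p" using ps(1) by (auto simp: nbhd_def)
   thus "snd (snd q) (flag b i)~=0" using nbhd_ST_flag[OF b _ \<open>i<=r\<close>] by force
  qed
  thus "coboundary orbit_cochain ys = 0" by (rule coboundary_orbit_cochain) (rule ys(2))
 qed
qed

end

section \<open>Evaluation on fine grids\<close>

text \<open>Up to (1/2)^k the product metric is controlled by finitely many coordinates.\<close>

lemma dist_fun_small: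
 assumes "0 < e"
 shows "\<exists>M0>0. \<forall>M\<ge>M0. \<forall>z z'::nat => real. (\<forall>l. \<bar>z l - z' l\<bar><=1/real M) --> dist z z' < e"
proof -
 obtain k where k: "(1/2)^k < e/2" using real_arch_pow_inv[of "e/2" "1/2"] assms by auto
 obtain M0::nat where M0: "4/e < real M0" using reals_Archimedean2 by blast
 have "dist z z' < e" if "M0<=M" and d: "!!l. \<bar>z l - z' l\<bar><=1/real M" for M and z z' :: "nat => real"
 proof -
  let ?S = "{dist (z (from_nat n)) (z' (from_nat n)) |n. n<=k}"
  have "finite ?S" "?S~={}" by auto
  hence "Max ?S<=1/real M" using d by (auto simp: dist_real_def)
  moreover have "1/real M < e/4"
  proof -
   have "4/e < real M" using M0 that(1) by linarith
   moreover from this assms have "0 < real M" by (meson divide_pos_pos less_trans zero_less_numeral)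
   ultimately show ?thesis using assms by (simp add: field_simps)
  qed
  ultimately show ?thesis using dist_fun_le_dist_first_terms[of z z' k] k by linarith
 qed
 moreover have "M0 > 0" using M0 assms by (cases M0) auto
 ultimately show ?thesis by blast
qed

text \<open>A Lebesgue number for the cover of \<open>K\<close> by preimages of the sets
  \<open>U\<close>.\<close>

lemma small_cells:
 fixes k :: "vec => 'a"
 assumes K: "compact K" and k: "continuous_map (top_of_set K) Y k"
  and cover: "!!y. y\<in>topspace Y ==> \<exists>U. openin Y U & y\<in>U & Ph U"
 shows "\<exists>M0>0. \<forall>M\<ge>M0. \<forall>S. S\<subseteq>K & S~={} & (\<forall>z\<in>S. \<forall>z'\<in>S. \<forall>l. \<bar>z l - z' l\<bar><=1/real M) -->
  (\<exists>U. Ph U & k ` S\<subseteq>U)"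
proof -
 let ?G = "{G. open G & (\<exists>U. Ph U & k ` (G\<inter>K)\<subseteq>U)}"
 have sub: "K\<subseteq>\<Union>?G"
 proof
  fix z assume z: "z\<in>K"
  hence "k z\<in>topspace Y" using continuous_map_funspace[OF k] by auto
  then obtain U where U: "openin Y U" "k z\<in>U" "Ph U" using cover by blast
  have "openin (top_of_set K) {x\<in>topspace (top_of_set K). k x\<in>U}"
   by (rule openin_continuous_map_preimage[OF k U(1)])
  then obtain G where G: "open G" "{x\<in>topspace (top_of_set K). k x\<in>U} = K\<inter>G" by (auto simp: openin_open)
  hence "k ` (G\<inter>K)\<subseteq>U" "z\<in>G" using z U(2) by auto
  thus "z\<in>\<Union>?G" using G(1) U(3) by blast
 qed
 obtain e where e: "0 < e" "!!x. x\<in>K ==> \<exists>G\<in>?G. ball x e\<subseteq>G"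
 proof (rule Heine_Borel_lemma[OF K sub])
  show "open G" if "G\<in>?G" for G using that by blast
 qed (rule that)
 obtain M0 where M0: "M0 > 0"
  and small: "\<forall>M\<ge>M0. \<forall>z z'::nat => real. (\<forall>l. \<bar>z l - z' l\<bar><=1/real M) --> dist z z' < e"
  using dist_fun_small[OF e(1)] by (elim exE conjE) (rule that)
 have "\<exists>U. Ph U & k ` S\<subseteq>U"
  if M: "M0<=M" and S: "S\<subseteq>K" "S~={}" "\<forall>z\<in>S. \<forall>z'\<in>S. \<forall>l. \<bar>z l - z' l\<bar><=1/real M" for M S
 proof -
  obtain z where z: "z\<in>S" using S(2) by blast
  hence "z\<in>K" using S(1) by blast
  from e(2)[OF this] obtain G U where G: "ball z e\<subseteq>G" "Ph U" "k ` (G\<inter>K)\<subseteq>U" by blast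
  have "S\<subseteq>ball z e"
  proof
   fix z' assume "z'\<in>S"
   hence "dist z z' < e" using small[rule_format, OF M, of z z'] S(3) z by blast
   thus "z'\<in>ball z e" by simp
  qed
  thus ?thesis using G S(1) by (intro exI[of _ U]) blast
 qed
 thus ?thesis using M0 by blast
qed

definition grid_point :: "nat => nat => grid => vec"
 where "grid_point M q x = (%l. if l < q then of_int (snd x l)/real M else 0)"

text \<open>Directions below \<open>q\<close> subdivide [-R, R] with mesh 1/M; direction
  \<open>q\<close> is time and subdivides [0, 1] with the same mesh.\<close>

definition grid_lo :: "nat => nat => nat => nat => int"
 where "grid_lo R M q l = (if l < q then - int (R*M) else 0)"

definition grid_hi :: "nat => nat => nat => nat => int"
 where "grid_hi R M q l = (if l < q then int (R*M) else int M)"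

lemma box_grid: "0 < R ==> 0 < M ==> box (grid_lo R M q) (grid_hi R M q)"
 by unfold_locales (auto simp: grid_lo_def grid_hi_def)

lemma compact_Rn_cylinder: "compact {z::nat => real. (\<forall>l<q. \<bar>z l\<bar><=m) & z q\<in>{0..1} & (\<forall>l>q. z l = 0)}"
 (is "compact ?K")
proof -
 let ?I = "%l. if l < q then {-m..m} else if l = q then {0..1} else {0}"
 have "compactin (powertop_real UNIV) (PiE UNIV ?I)"
  by (auto simp: compactin_PiE)
 moreover have "PiE UNIV ?I
   = ?K"
 proof (intro equalityI subsetI)
  fix z assume z: "z\<in>PiE UNIV ?I"
  have "z l\<in>?I l" for l using z by (auto simp: PiE_iff)
  hence "(l < q --> \<bar>z l\<bar><=m) & (l = q --> z l\<in>{0..1}) & (q < l --> z l = 0)" for l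
   by (metis abs_le_iff atLeastAtMost_iff less_irrefl minus_le_iff not_less_iff_gr_or_eq singletonD)
  thus "z\<in>?K" by blast
 next
  fix z assume z: "z\<in>?K"
  have "z l\<in>?I l" for l
   using z by (cases l q rule: linorder_cases) (auto simp: abs_le_iff)
  thus "z\<in>PiE UNIV ?I" by (simp add: PiE_iff)
 qed
 ultimately show ?thesis by (simp add: euclidean_product_topology)
qed

section \<open>Homotopy invariance of the evaluation\<close>

context flag_cochain
begin

definition evaluation :: "nat => nat => (vec option => point set option) => real"
 where "evaluation R M h = box.sweeps (grid_lo R M (2*n + N)) (grid_hi R M (2*n + N)) 0 (2*n + N)
  (%ys. orbit_cochain (map (%x. h (Some (grid_point M (2*n + N) x))) ys)) [((), %_. 0)]"

lemma evaluation_const: "0 < R ==> 0 < M ==> evaluation R M (%_. None) = 0"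
proof -
 assume RM: "0 < R" "0 < M"
 let ?q = "2*n + N"
 interpret box "grid_lo R M ?q" "grid_hi R M ?q" by (rule box_grid[OF RM])
 have "evaluation R M (%_. None) = sweeps 0 ?q (%_. 0) [((), %_. 0)]"
  unfolding evaluation_def
 proof (rule sweeps_cong[where P = UNIV])
  show "adm UNIV 0 [((), %_. 0)]" by (simp add: adm_def)
  fix ys :: "grid list" assume "length ys = length [((), %_. 0::int)] + ?q"
  thus "orbit_cochain (map (%x. None) ys) = 0"
   using rN by (intro orbit_cochain_bad[of _ None]) (cases ys; simp add: bad_def)+
 qed
 thus ?thesis by (simp add: sweeps_zero)
qed

text \<open>By the tube lemma the homotopy maps a neighbourhood of the base point into
  \<open>bad\<close> at all times. \<open>R\<close> has to exceed the compact complement, so that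
  the lateral faces contribute 0; for fixed \<open>R\<close>, compactness provides a mesh for which
  the cochain is closed on cells. This dictates the order of the quantifiers.\<close>

lemma evaluation_homotopic:
 assumes "homotopic_with (%h. h None = None) (sphere_space (2*n + N)) (K_level dd N) h0 h1"
 shows "\<exists>R0. \<forall>R\<ge>R0. \<exists>M0. \<forall>M\<ge>M0. evaluation R M h0 = evaluation R M h1"
proof -
 let ?q = "2*n + N" and ?Y = "K_level dd N"
 let ?Z = "prod_topology (top_of_set {0..1::real}) (sphere_space ?q)"
 obtain H where H: "continuous_map ?Z ?Y H" and H01: "!!x. H (0, x) = h0 x" "!!x. H (1, x) = h1 x"
  and HN: "!!t. t\<in>{0..1} ==> H (t, None) = None"
  using assms unfolding homotopic_with_def by blast
 let ?W = "{z\<in>topspace ?Z. H z\<in>bad}"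
 have "\<exists>T V. openin (top_of_set {0..1::real}) T & openin (sphere_space ?q) V & {0..1}\<subseteq>T & None\<in>V & T\<times>V\<subseteq>?W"
 proof (rule tube_lemma_left)
  show "openin ?Z ?W" by (rule openin_continuous_map_preimage[OF H openin_bad])
  show "{0..1::real}\<times>{None}\<subseteq>?W" using HN by (auto simp: sphere_space_def bad_def)
 qed (auto simp: compactin_subtopology sphere_space_def)
 then obtain T V where TV: "openin (top_of_set {0..1::real}) T" "openin (sphere_space ?q) V"
  "{0..1}\<subseteq>T" "None\<in>V" "T\<times>V\<subseteq>?W"
  by (elim exE conjE) (rule that)
 then obtain C where C: "compactin (Euclidean_space ?q) C" "V = insert None (Some ` (Rn ?q - C))"
  unfolding sphere_space_def openin_Alexandroff_compactification by auto
 have "\<exists>m. \<forall>x\<in>C. \<bar>x l\<bar><=m" for l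
 proof -
  have "compact ((%x. x l) ` C)"
   using image_compactin[OF C(1) continuous_map_Euclidean_coord[of ?q l]] by simp
  hence "bounded ((%x. x l) ` C)" by (rule compact_imp_bounded)
  thus ?thesis by (auto simp: bounded_iff)
 qed
 then obtain m where m: "!!l x. x\<in>C ==> \<bar>x l\<bar><=m l" by metis
 define R0 where "R0 = nat \<lceil>\<Sum>l<?q. \<bar>m l\<bar>\<rceil> + 1"
 have far: "\<not> (x\<in>C)" if "R0<=R" "l < ?q" "\<bar>x l\<bar> = real R" for R l x
 proof
  assume "x\<in>C"
  hence "\<bar>x l\<bar><=\<bar>m l\<bar>" using m[of x l] by linarith
  also have "\<bar>m l\<bar><=(\<Sum>l<?q. \<bar>m l\<bar>)" by (rule member_le_sum) (use that in auto)
  also have "... < real R0" unfolding R0_def by linarith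
  finally show False using that by simp
 qed
 have "\<exists>M0. \<forall>M\<ge>M0. evaluation R M h0 = evaluation R M h1" if R: "R0<=R" for R
 proof -
  have R1: "0 < R" using R by (simp add: R0_def)
  define K where "K = {z::nat => real. (\<forall>l<?q. \<bar>z l\<bar><=real R) & z ?q\<in>{0..1} & (\<forall>l>?q. z l = 0)}"
  define k where "k z = H (z ?q, Some (%l. if l < ?q then z l else 0))" for z
  let ?cm = "continuous_map (top_of_set K)"
  have coord: "?cm euclideanreal (%z. z l)" for l
   by (simp add: continuous_on_product_coordinates continuous_on_subset[OF continuous_on_product_coordinates])
  have "?cm (Euclidean_space ?q) (%z l. if l < ?q then z l else 0)"
   unfolding Euclidean_space_def continuous_map_in_subtopology continuous_map_componentwise_UNIV
  proof (intro conjI allI)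
   show "?cm euclideanreal (%z. if l < ?q then z l else 0)" for l
    using coord by (cases "l < ?q") auto
  qed auto
  from continuous_map_compose[OF this continuous_map_Some]
  have "?cm (sphere_space ?q) (%z. Some (%l. if l < ?q then z l else 0))"
   by (simp add: sphere_space_def comp_def)
  moreover have "?cm (top_of_set {0..1}) (%z. z ?q)"
   unfolding continuous_map_in_subtopology using coord by (auto simp: K_def)
  ultimately have "?cm ?Z (%z. (z ?q, Some (%l. if l < ?q then z l else 0)))"
   by (simp add: continuous_map_paired)
  from continuous_map_compose[OF this H] have k: "?cm ?Y k"
   by (simp add: k_def[abs_def] comp_def)
  have "compact K" unfolding K_def by (rule compact_Rn_cylinder)
  define Ph where "Ph U \<longleftrightarrow> (\<forall>ys. set ys\<subseteq>U --> length ys = 2*n + N + 2 --> coboundary orbit_cochain ys = 0)" for U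
  have cov: "!!y. y\<in>topspace ?Y ==> \<exists>U. openin ?Y U & y\<in>U & Ph U"
   unfolding Ph_def by (rule orbit_cochain_cocycle)
  have "\<exists>M0>0. \<forall>M\<ge>M0. \<forall>S. S\<subseteq>K & S~={} & (\<forall>z\<in>S. \<forall>z'\<in>S. \<forall>l. \<bar>z l - z' l\<bar><=1/real M) -->
    (\<exists>U. Ph U & k ` S\<subseteq>U)"
   by (rule small_cells[OF \<open>compact K\<close> k]) (rule cov)
  then obtain M0 where M0: "M0 > 0"
   and cells: "\<forall>M\<ge>M0. \<forall>S. S\<subseteq>K & S~={} & (\<forall>z\<in>S. \<forall>z'\<in>S. \<forall>l. \<bar>z l - z' l\<bar><=1/real M) -->
    (\<exists>U. Ph U & k ` S\<subseteq>U)"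
   by (elim exE conjE) (rule that)
  have "evaluation R M h0 = evaluation R M h1" if M: "M0<=M" for M
  proof -
   have M1: "0 < M" using M0 M by simp
   interpret box "grid_lo R M ?q" "grid_hi R M ?q" by (rule box_grid[OF R1 M1])
   define rh where "rh x = (%l. if l<=?q then of_int (snd x l)/real M else 0)" for x :: "grid"
   let ?c = "%ys. orbit_cochain (map (%x. k (rh x)) ys)"
   have rh_K: "rh ` set ys\<subseteq>K" and rh_near: "!!x y l. x\<in>set ys ==> y\<in>set ys ==> \<bar>rh x l - rh y l\<bar><=1/real M"
    if a: "adm UNIV (Suc ?q) ys" for ys
   proof -
    have cell: "\<exists>t. grid_lo R M ?q l<=t & t < grid_hi R M ?q l & (\<forall>x\<in>set ys. snd x l = t | snd x l = t + 1)" if "l<=?q" for l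
     using a that unfolding adm_def by simp
    have range: "grid_lo R M ?q l<=snd x l & snd x l<=grid_hi R M ?q l" if h: "x\<in>set ys" "l<=?q" for x l
    proof -
     obtain t where "grid_lo R M ?q l<=t" "t < grid_hi R M ?q l" "snd x l = t | snd x l = t + 1"
      using cell[OF h(2)] h(1) by blast
     thus ?thesis by linarith
    qed
    show "rh ` set ys\<subseteq>K"
    proof (intro image_subsetI)
     fix x assume x: "x\<in>set ys"
     have "\<bar>rh x l\<bar><=real R" if "l < ?q" for l
     proof -
      have "\<bar>snd x l\<bar><=int (R*M)" using range[OF x, of l] that by (auto simp: grid_lo_def grid_hi_def)
      hence "\<bar>real_of_int (snd x l)\<bar><=real R*real M"
       by (metis of_int_abs of_int_le_iff of_int_of_nat_eq of_nat_mult)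
      thus ?thesis using M1 that by (simp add: rh_def field_simps)
     qed
     moreover have "rh x ?q\<in>{0..1}"
      using range[OF x, of ?q] M1 by (auto simp: rh_def grid_lo_def grid_hi_def field_simps)
     ultimately show "rh x\<in>K" by (simp add: K_def rh_def)
    qed
    show "\<bar>rh x l - rh y l\<bar><=1/real M" if h: "x\<in>set ys" "y\<in>set ys" for x y l
    proof (cases "l<=?q")
     case True
     obtain t where "snd x l = t | snd x l = t + 1" "snd y l = t | snd y l = t + 1"
      using cell[OF True] h by blast
     hence "\<bar>snd x l - snd y l\<bar><=1" by linarith
     hence "\<bar>real_of_int (snd x l) - real_of_int (snd y l)\<bar><=1" by linarith
     thus ?thesis using True M1 by (simp add: rh_def diff_divide_distrib[symmetric] divide_right_mono)
    qed (simp add: rh_def)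
   qed
   have ends: "sweeps 0 ?q (%ys. ?c (map (put ?q t) ys)) [((), %_. 0)]
     = sweeps 0 ?q (%ys. orbit_cochain (map (%x. H (of_int t/real M, Some (grid_point M ?q x))) ys)) [((), %_. 0)]" for t
   proof -
    have "k (rh (put ?q t x)) = H (of_int t/real M, Some (grid_point M ?q x))" for x :: "grid"
    proof -
     have "(%l. if l < ?q then rh (put ?q t x) l else 0) = grid_point M ?q x"
      by (auto simp: rh_def grid_point_def)
     moreover have "rh (put ?q t x) ?q = of_int t/real M" by (simp add: rh_def)
     ultimately show ?thesis by (simp add: k_def)
    qed
    thus ?thesis by (simp add: comp_def)
   qed
   have "sweeps 0 ?q (%ys. ?c (map (put ?q (grid_hi R M ?q ?q)) ys)) [((), %_. 0)]
     = sweeps 0 ?q (%ys. ?c (map (put ?q (grid_lo R M ?q ?q)) ys)) [((), %_. 0)]"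
   proof (rule sweeps_homotopy[where P = UNIV])
    fix ys :: "grid list" assume a: "adm UNIV (Suc ?q) ys" and len: "length ys = ?q + 2"
    have "rh ` set ys\<subseteq>K & rh ` set ys~={} & (\<forall>z\<in>rh ` set ys. \<forall>z'\<in>rh ` set ys. \<forall>l. \<bar>z l - z' l\<bar><=1/real M)"
     using rh_K[OF a] rh_near[OF a] len by auto
    from cells[THEN spec, THEN mp, OF M, THEN spec, THEN mp, OF this]
    obtain U where U: "Ph U" "k ` rh ` set ys\<subseteq>U" by (elim exE conjE) (rule that)
    have "coboundary ?c ys = coboundary orbit_cochain (map (%x. k (rh x)) ys)" by (rule coboundary_map)
    also have "... = 0" using U len unfolding Ph_def by (auto simp: image_image)
    finally show "coboundary ?c ys = 0" .
   next
    fix ys :: "grid list" assume a: "adm UNIV (Suc ?q) ys" and len: "length ys = ?q + 1" and fa: "face 0 ?q ys"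
    obtain x where x: "x\<in>set ys" using len by (cases ys) auto
    obtain l where l: "l < ?q" "snd x l = grid_lo R M ?q l | snd x l = grid_hi R M ?q l"
     using fa x unfolding face_def by auto
    have abs: "\<bar>rh x l\<bar> = real R" using l M1 by (auto simp: rh_def grid_lo_def grid_hi_def)
    have xK: "rh x\<in>K" using rh_K[OF a] x by blast
    have "(%l. if l < ?q then rh x l else 0)\<notin>C" by (rule far[OF R l(1)]) (use abs l(1) in simp)
    hence "Some (%l. if l < ?q then rh x l else 0)\<in>V" using C(2) by (auto simp: Rn_iff)
    moreover have "rh x ?q\<in>T" using xK TV(3) by (auto simp: K_def)
    ultimately have "k (rh x)\<in>bad" using TV(5) by (auto simp: k_def)
    thus "?c ys = 0"
     by (intro orbit_cochain_bad[of _ "k (rh x)"]) (use x len rN in auto)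
   qed auto
   thus ?thesis
    unfolding ends evaluation_def using M1 by (simp add: grid_lo_def grid_hi_def H01)
  qed
  thus ?thesis by blast
 qed
 thus ?thesis by blast
qed

end

section \<open>Rotations and coordinate subspaces\<close>

definition plane_part :: "vec => nat => complex"
 where "plane_part v i = Complex (v (2*i)) (v (2*i + 1))"

lemma plane_part_simps [simp]: "plane_part (x + y) i = plane_part x i + plane_part y i"
 "plane_part (%i. c*x i) i = of_real c*plane_part x i"
 by (simp_all add: plane_part_def complex_eq_iff)

text \<open>Restricted to \<real>^(2 r), because group elements are extensional functions.\<close>

definition rot :: "nat => vec => vec => vec"
 where "rot r tt = (\<lambda>v\<in>Rn (2*r). %j. if j < 2*r then (if even j then Re else Im) (cis (tt (j div 2))*plane_part v (j div 2)) else 0)"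

definition cspace :: "nat => nat set => vec set"
 where "cspace r S = {v\<in>Rn (2*r). \<forall>i<r. i\<notin>S --> plane_part v i = 0}"

lemma plane_part_rot: "v\<in>Rn (2*r) ==> i < r ==> plane_part (rot r tt v) i = cis (tt i)*plane_part v i"
 by (simp add: plane_part_def rot_def complex_eq_iff)

lemma rot_Rn: "v\<in>Rn (2*r) ==> rot r tt v\<in>Rn (2*r)"
 unfolding rot_def by (subst restrict_apply', assumption) (simp add: Rn_iff)

lemma Rn_eqI:
 assumes "v\<in>Rn (2*r)" "w\<in>Rn (2*r)" "!!i. i < r ==> plane_part v i = plane_part w i"
 shows "v = w"
proof
 fix j show "v j = w j"
 proof (cases "j < 2*r")
  case True
  hence "plane_part v (j div 2) = plane_part w (j div 2)" by (intro assms(3)) auto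
  thus ?thesis by (cases "even j") (auto simp: plane_part_def elim!: evenE oddE)
 qed (use assms in \<open>simp add: Rn_iff\<close>)
qed

lemma rot_add: "v\<in>Rn (2*r) ==> rot r tt (rot r tt' v) = rot r (%i. tt i + tt' i) v"
 by (intro Rn_eqI[of _ r]) (simp_all add: rot_Rn plane_part_rot cis_mult[symmetric] mult.assoc)

lemma rot_0: "v\<in>Rn (2*r) ==> rot r (%_. 0) v = v"
 by (intro Rn_eqI[of _ r]) (simp_all add: rot_Rn plane_part_rot)

lemma dot_plane_part: "dot (2*r) v w = (\<Sum>i<r. Re (plane_part v i*cnj (plane_part w i)))"
proof (induction r)
 case (Suc r)
 have "dot (2*Suc r) v w = dot (2*r) v w + (v (2*r)*w (2*r) + v (2*r + 1)*w (2*r + 1))"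
  by (simp add: dot_def)
 thus ?case using Suc by (simp add: plane_part_def)
qed (simp add: dot_def)

lemma rot_linear_isometries: "rot r tt\<in>linear_isometries (2*r) (2*r)"
proof -
 have add: "x + y\<in>Rn (2*r)" "(%i. c*x i)\<in>Rn (2*r)" if "x\<in>Rn (2*r)" "y\<in>Rn (2*r)" for x y c
  using that by (auto simp: Rn_iff)
 have "rot r tt (x + y) = rot r tt x + rot r tt y" if "x\<in>Rn (2*r)" "y\<in>Rn (2*r)" for x y
  by (rule Rn_eqI[of _ r]) (use that in \<open>simp_all add: plane_part_rot rot_Rn add distrib_left\<close>)
 moreover have "rot r tt (%i. c*x i) = (%i. c*rot r tt x i)" if "x\<in>Rn (2*r)" for x c
  by (rule Rn_eqI[of _ r]) (use that in \<open>simp_all add: plane_part_rot rot_Rn add distrib_left\<close>)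
 moreover have "dot (2*r) (rot r tt x) (rot r tt y) = dot (2*r) x y" if "x\<in>Rn (2*r)" "y\<in>Rn (2*r)" for x y
 proof -
  have "cis t*z*cnj (cis t*w) = (cis t*cnj (cis t))*(z*cnj w)" for t and z w::complex
   by (simp only: complex_cnj_mult mult_ac)
  hence "cis t*z*cnj (cis t*w) = z*cnj w" for t and z w::complex
   by (simp only: cis_cnj cis_mult) simp
  thus ?thesis unfolding dot_plane_part using that by (intro sum.cong) (simp_all only: plane_part_rot lessThan_iff)
 qed
 moreover have "rot r tt\<in>Rn (2*r) \<rightarrow>\<^sub>E Rn (2*r)" using rot_Rn by (auto simp: rot_def)
 ultimately show ?thesis unfolding linear_isometries_def by blast
qed

lemma rot_carrier: "rot r tt\<in>OC (2*r)"
proof -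
 have "bij_betw (rot r tt) (Rn (2*r)) (Rn (2*r))"
  by (rule bij_betw_byWitness[where f' = "rot r (%i. - tt i)"])
   (use rot_Rn in \<open>auto simp: rot_add rot_0\<close>)
 thus ?thesis using rot_linear_isometries by (simp add: orthogonal_group_def)
qed

lemma rot_compose: "compose (Rn (2*r)) (rot r tt) (rot r tt') = rot r (%i. tt i + tt' i)"
proof
 fix v show "compose (Rn (2*r)) (rot r tt) (rot r tt') v = rot r (%i. tt i + tt' i) v"
 proof (cases "v\<in>Rn (2*r)")
  case True
  thus ?thesis by (simp add: compose_def rot_add)
 next
  case False
  thus ?thesis by (simp add: compose_def rot_def)
 qed
qed

lemma rot_mult: "rot r tt \<otimes>\<^bsub>OG (2*r)\<^esub> rot r tt' = rot r (%i. tt i + tt' i)"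
 using rot_compose by (simp add: orthogonal_group_def)

lemma rot_one: "\<one>\<^bsub>OG (2*r)\<^esub> = rot r (%_. 0)"
proof
 fix v show "\<one>\<^bsub>OG (2*r)\<^esub> v = rot r (%_. 0) v"
  by (cases "v\<in>Rn (2*r)") (simp_all add: orthogonal_group_def rot_0 del: topspace_Euclidean_space, simp add: rot_def)
qed

lemma rot_inv: "inv\<^bsub>OG (2*r)\<^esub> rot r tt = rot r (%i. - tt i)"
proof -
 interpret G: group "OG (2*r)" by (rule group_orthogonal_group)
 show ?thesis by (rule G.inv_equality) (simp_all add: rot_mult rot_one rot_carrier)
qed

lemma subspace_cspace: "real_fun.subspace (cspace r S)"
 by (auto simp: real_fun.subspace_def cspace_def Rn_iff plane_part_def complex_eq_iff)

lemma cspace_Rn: "cspace r S\<subseteq>Rn (2*r)"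
 by (auto simp: cspace_def)

lemma plane_part_stdf: "plane_part (stdf k) i = (if k div 2 = i then (if even k then 1 else \<i>) else 0)"
 by (auto simp: plane_part_def stdf_def complex_eq_iff elim: evenE oddE)

lemma stdf_cspace: "k < 2*r ==> stdf k\<in>cspace r S \<longleftrightarrow> k div 2\<in>S"
 unfolding cspace_def mem_Collect_eq plane_part_stdf using stdf_Rn[of k "2*r"] by auto

lemma cspace_subset_iff: "S\<subseteq>{..<r} ==> cspace r S\<subseteq>cspace r T \<longleftrightarrow> S\<subseteq>T"
proof
 assume S: "S\<subseteq>{..<r}" and sub: "cspace r S\<subseteq>cspace r T"
 show "S\<subseteq>T"
 proof
  fix i assume i: "i\<in>S"
  hence "2*i < 2*r" using S by auto
  thus "i\<in>T" using stdf_cspace[of "2*i" r S] stdf_cspace[of "2*i" r T] i sub by auto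
 qed
qed (auto simp: cspace_def)

lemma cspace_eq_iff: "S\<subseteq>{..<r} ==> T\<subseteq>{..<r} ==> cspace r S = cspace r T \<longleftrightarrow> S = T"
 using cspace_subset_iff[of S r T] cspace_subset_iff[of T r S] by blast

lemma cspace_full: "cspace r {..<r} = Rn (2*r)" and cspace_empty: "cspace r {} = {0}"
proof -
 have "v = 0" if "v\<in>cspace r {}" for v
  by (rule Rn_eqI[of _ r]) (use that in \<open>auto simp: cspace_def Rn_iff plane_part_def complex_eq_iff\<close>)
 thus "cspace r {} = {0}" using real_fun.subspace_0[OF subspace_cspace, of r "{}"] by blast
qed (auto simp: cspace_def)

lemma rot_cspace: "rot r tt ` cspace r S = cspace r S"
proof -
 have sub: "rot r tt ` cspace r S\<subseteq>cspace r S" for tt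
  by (auto simp: cspace_def rot_Rn plane_part_rot simp del: topspace_Euclidean_space)
 have "v\<in>rot r tt ` cspace r S" if "v\<in>cspace r S" for v
 proof
  show "v = rot r tt (rot r (%i. - tt i) v)" using that cspace_Rn[of r S] rot_0[of v r] by (subst rot_add) auto
  show "rot r (%i. - tt i) v\<in>cspace r S" using sub that by blast
 qed
 thus ?thesis using sub by blast
qed

definition perm_frame :: "(nat => nat) => nat => vec"
 where "perm_frame sg k = stdf (2 * sg (k div 2) + k mod 2)"

lemma frame_perm_frame:
 assumes "sg ` {..<r}\<subseteq>{..<r}" "inj_on sg {..<r}"
 shows "frame (2*r) (perm_frame sg)"
 unfolding frame_def
proof (intro conjI allI impI)
 have b: "2 * sg (k div 2) + k mod 2 < 2*r" if "k < 2*r" for k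
 proof -
  have "k div 2\<in>{..<r}" using that by auto
  hence "sg (k div 2) < r" using assms(1) by blast
  thus ?thesis by presburger
 qed
 fix k assume k: "k < 2*r"
 thus "perm_frame sg k\<in>Rn (2*r)" unfolding perm_frame_def by (intro stdf_Rn b)
 fix l assume l: "l < 2*r"
 have "k = l" if "2 * sg (k div 2) + k mod 2 = 2 * sg (l div 2) + l mod 2"
 proof -
  have "sg (k div 2) = sg (l div 2)" "k mod 2 = l mod 2" using that by presburger+
  moreover have "k div 2\<in>{..<r}" "l div 2\<in>{..<r}" using k l by auto
  ultimately have "k div 2 = l div 2" using assms(2) by (auto dest: inj_onD)
  hence "k div 2*2 + k mod 2 = l div 2*2 + l mod 2" using \<open>k mod 2 = l mod 2\<close> by (simp only:)
  thus ?thesis by (simp only: div_mult_mod_eq)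
 qed
 thus "dot (2*r) (perm_frame sg k) (perm_frame sg l) = of_bool (k = l)"
  unfolding perm_frame_def frameD(2)[OF frame_stdf b[OF k] b[OF l]] by auto
qed

lemma perm_frame_id: "perm_frame (%i. i) = stdf"
 by (simp add: perm_frame_def fun_eq_iff)

lemma pcoord_perm_frame:
 "sg i < r ==> pcoord (2*r) (perm_frame sg) i u = plane_part u (sg i)"
 by (simp add: pcoord_def perm_frame_def dot_stdf plane_part_def)

lemma flag_perm_frame:
 assumes sg: "sg ` {..<r}\<subseteq>{..<r}" "inj_on sg {..<r}" and i: "i<=r"
 shows "flag (perm_frame sg) i = cspace r (sg ` {..<i})"
proof
 show "flag (perm_frame sg) i\<subseteq>cspace r (sg ` {..<i})"
 proof (rule flag_subset_subspace[OF subspace_cspace])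
  fix k assume k: "k < 2*i"
  hence "k div 2\<in>{..<r}" using i by auto
  hence "sg (k div 2) < r" using sg(1) by blast
  hence "2 * sg (k div 2) + k mod 2 < 2*r" by presburger
  thus "perm_frame sg k\<in>cspace r (sg ` {..<i})"
   using k unfolding perm_frame_def by (subst stdf_cspace) auto
 qed
 show "cspace r (sg ` {..<i})\<subseteq>flag (perm_frame sg) i"
 proof
  fix v assume v: "v\<in>cspace r (sg ` {..<i})"
  let ?b = "perm_frame sg"
  note fr = frame_perm_frame[OF sg]
  have "v\<in>flag ?b r" using v cspace_Rn flag_top[OF fr] by blast
  hence "v = (%j. \<Sum>k<2*r. dot (2*r) v (?b k)*?b k j)" by (rule flag_expansion[OF fr order_refl])
  also have "... = (%j. \<Sum>k<2*i. dot (2*r) v (?b k)*?b k j)"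
  proof
   fix j
   have "dot (2*r) v (?b k) = 0" if "k < 2*r" "\<not> k < 2*i" for k
   proof -
    have k0: "k div 2\<in>{..<r}" using that by auto
    hence k: "k div 2\<in>{..<r}" "sg (k div 2) < r" using sg(1) by blast+
    hence "2 * sg (k div 2) + k mod 2 < 2*r" by presburger
    hence "dot (2*r) v (?b k) = v (2 * sg (k div 2) + k mod 2)"
     unfolding perm_frame_def by (rule dot_stdf)
    moreover have "sg (k div 2)\<notin>sg ` {..<i}"
     using inj_on_image_mem_iff[OF sg(2) k(1), of "{..<i}"] i that by auto
    hence "plane_part v (sg (k div 2)) = 0" using v k by (simp add: cspace_def)
    ultimately show ?thesis by (cases "even k") (auto simp: plane_part_def complex_eq_iff elim!: evenE oddE)
   qed
   thus "(\<Sum>k<2*r. dot (2*r) v (?b k)*?b k j) = (\<Sum>k<2*i. dot (2*r) v (?b k)*?b k j)"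
    using i by (intro sum.mono_neutral_right) auto
  qed
  finally have "v = (%j. \<Sum>k<2*i. dot (2*r) v (?b k)*?b k j)" .
  thus "v\<in>flag ?b i"
   using subspace_comb[OF subspace_flag, of "{..<2*i}" ?b ?b i "%k. dot (2*r) v (?b k)"] mem_flag by fastforce
 qed
qed

text \<open>A full flag of coordinate subspaces adds one coordinate plane at a time; the order of
  these planes is the permutation.\<close>

lemma adapted_perm_frame:
 assumes b: "frame (2*r) b" and S: "!!i. i<=r ==> \<exists>S. S\<subseteq>{..<r} & flag b i = cspace r S"
 shows "\<exists>sg. sg ` {..<r}\<subseteq>{..<r} & inj_on sg {..<r} & (\<forall>i\<le>r. flag b i = flag (perm_frame sg) i)"
proof -
 from S obtain T where T: "!!i. i<=r ==> T i\<subseteq>{..<r}" "!!i. i<=r ==> flag b i = cspace r (T i)" by metis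
 have fin: "finite (T i)" if "i<=r" for i using finite_subset[OF T(1)[OF that]] by simp
 have T0: "T 0 = {}"
  using T(1)[of 0] T(2)[of 0, unfolded flag_0] cspace_eq_iff[of "T 0" r "{}"] cspace_empty[of r] by simp
 have Tr: "T r = {..<r}"
  using cspace_eq_iff[OF T(1)[OF order_refl] order_refl] T(2)[OF order_refl] cspace_full[of r] flag_top[OF b] by metis
 have strict: "T i \<subset> T (Suc i)" if "i < r" for i
 proof -
  have "cspace r (T i) \<subset> cspace r (T (Suc i))" using flag_strict[OF b, of i] T(2) that by simp
  thus ?thesis using cspace_subset_iff[OF T(1), of i "T (Suc i)"] that by auto
 qed
 \<comment> \<open>Bounds from both ends: \<open>r\<close> strict steps from no plane to
   \<open>r\<close> planes leave exactly one plane per step.\<close>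
 have low: "i<=card (T i)" if "i<=r" for i
  using that by (induction i) (use psubset_card_mono[OF fin strict] in fastforce)+
 have up: "card (T (r - j))<=r - j" if "j<=r" for j
  using that
 proof (induction j)
  case 0 thus ?case using Tr by simp
 next
  case (Suc j)
  hence "card (T (r - Suc j)) < card (T (Suc (r - Suc j)))" by (intro psubset_card_mono[OF fin strict]) auto
  thus ?case using Suc by (simp add: Suc_diff_Suc)
 qed
 have card: "card (T i) = i" if "i<=r" for i using low[OF that] up[of "r - i"] that by simp
 have "\<exists>x. T (Suc i) = insert x (T i) & x\<notin>T i" if i: "i < r" for i
 proof -
  obtain x where x: "x\<in>T (Suc i)" "x\<notin>T i" using strict[OF i] by blast
  have "insert x (T i) = T (Suc i)"
   by (rule card_subset_eq) (use x strict[OF i] fin[of "Suc i"] fin[of i] card[of i] card[of "Suc i"] i in auto)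
  thus ?thesis using x by blast
 qed
 then obtain sg where sg: "!!i. i < r ==> T (Suc i) = insert (sg i) (T i)" "!!i. i < r ==> sg i\<notin>T i" by metis
 have im: "T i = sg ` {..<i}" if "i<=r" for i
  using that by (induction i) (simp_all add: T0 sg(1) lessThan_Suc)
 have 1: "sg ` {..<r}\<subseteq>{..<r}" using im[of r] Tr by simp
 have 2: "inj_on sg {..<r}" by (rule eq_card_imp_inj_on) (use im[of r] card[of r] in simp_all)
 have "flag b i = flag (perm_frame sg) i" if "i<=r" for i
  using T(2)[OF that] im[OF that] flag_perm_frame[OF 1 2 that] by simp
 thus ?thesis using 1 2 by blast
qed

section \<open>Weights on finitely many vertices\<close>

definition pushed :: "'k set => ('k => 'p) => ('k => real) => 'p => real"
 where "pushed V ver w p = (\<Sum>k | k\<in>V & ver k = p. w k)"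

lemma pushed_nonzeroD: "pushed V ver w p~=0 ==> \<exists>k\<in>V. w k~=0 & ver k = p"
 unfolding pushed_def by (metis (mono_tags, lifting) mem_Collect_eq sum.neutral)

lemma pushed_sum:
 assumes "finite V"
 shows "(\<Sum>p | pushed V ver w p~=0 & p\<in>A. pushed V ver w p) = (\<Sum>k | k\<in>V & ver k\<in>A. w k)"
proof -
 have "(\<Sum>p | pushed V ver w p~=0 & p\<in>A. pushed V ver w p) = (\<Sum>p\<in>ver ` V\<inter>A. pushed V ver w p)"
  by (rule sum.mono_neutral_left) (use assms in \<open>auto dest: pushed_nonzeroD\<close>)
 also have "... = (\<Sum>p\<in>ver ` V\<inter>A. \<Sum>k\<in>{k\<in>{k\<in>V. ver k\<in>A}. ver k = p}. w k)"
  unfolding pushed_def by (intro sum.cong) auto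
 also have "... = (\<Sum>k | k\<in>V & ver k\<in>A. w k)" by (rule sum.group) (use assms in auto)
 finally show ?thesis .
qed

lemma pushed_mass: "finite V ==> mass (pushed V ver w) A = (\<Sum>k | k\<in>V & ver k\<in>A. w k)"
 unfolding mass_def by (rule pushed_sum)

lemma pushed_points:
 assumes "finite V" "ver ` V\<subseteq>P" "!!k. k\<in>V ==> 0<=w k" "(\<Sum>k\<in>V. w k) = 1"
  and "!!k k'. k\<in>V ==> k'\<in>V ==> w k~=0 ==> w k'~=0 ==> prec (ver k) (ver k') | prec (ver k') (ver k)"
 shows "pushed V ver w\<in>realization_points P prec"
proof (rule realization_pointsI)
 have sub: "{p. pushed V ver w p~=0}\<subseteq>ver ` V" by (auto dest: pushed_nonzeroD)
 thus "finite {p. pushed V ver w p~=0}" "{p. pushed V ver w p~=0}\<subseteq>P"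
  using assms(1,2) by (auto intro: finite_subset)
 show "0<=pushed V ver w p" for p unfolding pushed_def using assms(3) by (intro sum_nonneg) auto
 show "(\<Sum>p | pushed V ver w p~=0. pushed V ver w p) = 1"
  using pushed_sum[OF assms(1), of ver w UNIV] assms(4) by simp
 fix p q assume "pushed V ver w p~=0" "pushed V ver w q~=0"
 then obtain k k' where "k\<in>V" "w k~=0" "ver k = p" "k'\<in>V" "w k'~=0" "ver k' = q"
  by (elim pushed_nonzeroD[elim_format] bexE conjE)
 thus "prec p q | prec q p" using assms(5)[of k k'] by simp
qed

text \<open>All images lie in the finitely many simplices on a finite vertex set. On each of them
  closed sets are cut out by pointwise conditions, and a finite union of closed preimages is
  closed.\<close>

lemma continuous_map_pushed:
 assumes "finite V" "ver ` V\<subseteq>P" and w: "!!k. k\<in>V ==> continuous_map X euclideanreal (%x. w x k)"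
  and pts: "!!x. x\<in>topspace X ==> pushed V ver (w x)\<in>realization_points P prec"
 shows "continuous_map X (realization P prec) (%x. pushed V ver (w x))"
proof (subst continuous_map_closedin, intro conjI allI impI)
 let ?p = "%x. pushed V ver (w x)"
 let ?P = "%S. {x\<in>topspace X. ?p x\<in>S}"
 show "?p\<in>topspace X \<rightarrow> topspace (realization P prec)"
  using pts by (auto simp: topspace_realization)
 fix C assume C: "closedin (realization P prec) C"
 have co: "continuous_map X euclideanreal (%x. ?p x p)" for p
  unfolding pushed_def using w assms(1) by (intro continuous_map_sum) auto
 hence cp: "continuous_map X (powertop_real UNIV) ?p"
  by (simp add: continuous_map_componentwise_UNIV)
 let ?D = "{D\<in>order_simplices P prec. D\<subseteq>ver ` V}"
 have cl: "closedin X (?P (closed_simplex D\<inter>C))" if "D\<in>?D" for D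
 proof -
  have D: "D\<in>order_simplices P prec" using that by simp
  have "closedin X {x\<in>topspace X. ?p x p\<in>{0..}}" for p
   by (rule closedin_continuous_map_preimage[OF co]) simp
  moreover have "closedin X {x\<in>topspace X. ?p x p\<in>{0}}" for p
   by (rule closedin_continuous_map_preimage[OF co]) simp
  moreover have "closedin X {x\<in>topspace X. (\<Sum>p\<in>D. ?p x p)\<in>{1}}"
   by (rule closedin_continuous_map_preimage[OF continuous_map_sum[OF _ co]])
    (use D in \<open>auto simp: order_simplices_def\<close>)
  ultimately have "closedin X ((\<Inter>p. {x\<in>topspace X. ?p x p\<in>{0..}})
   \<inter>(topspace X\<inter>(\<Inter>p\<in>-D. {x\<in>topspace X. ?p x p\<in>{0}}))
   \<inter>{x\<in>topspace X. (\<Sum>p\<in>D. ?p x p)\<in>{1}})"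
   by (cases "- D = {}") (auto intro!: closedin_Int closedin_INT)
  moreover have "((\<Inter>p. {x\<in>topspace X. ?p x p\<in>{0..}})
   \<inter>(topspace X\<inter>(\<Inter>p\<in>-D. {x\<in>topspace X. ?p x p\<in>{0}}))
   \<inter>{x\<in>topspace X. (\<Sum>p\<in>D. ?p x p)\<in>{1}}) = (?P (closed_simplex D))" (is "_ = ?E")
   by (auto simp: closed_simplex_def)
  ultimately have E: "closedin X ?E" by simp
  have "openin (subtopology (powertop_real UNIV) (closed_simplex D)) (closed_simplex D\<inter>(realization_points P prec - C))"
   using C D unfolding closedin_def topspace_realization openin_realization by blast
  then obtain G where G: "openin (powertop_real UNIV) G" "closed_simplex D\<inter>(realization_points P prec - C) = G\<inter>closed_simplex D"
   by (auto simp: openin_subtopology)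
  have "closedin X {x\<in>topspace X. ?p x\<in>topspace (powertop_real UNIV) - G}"
   by (rule closedin_continuous_map_preimage[OF cp]) (use G(1) in blast)
  from closedin_Int[OF E this] show ?thesis
   by (rule back_subst[of "closedin X"]) (use G(2) D in \<open>auto simp: realization_points_def\<close>)
 qed
 have "closedin X (\<Union>D\<in>?D. (?P (closed_simplex D\<inter>C)))"
  by (rule closedin_Union) (use assms(1) cl in \<open>auto intro: finite_subset[of _ "Pow (ver ` V)"]\<close>)
 moreover have "(\<Union>D\<in>?D. (?P (closed_simplex D\<inter>C))) = (?P C)"
 proof (intro equalityI subsetI)
  fix x assume x: "x\<in>(?P C)"
  let ?t = "?p x" and ?S = "{p. ?p x p~=0}"
  note R = realization_pointsD[OF pts]
  have xt: "x\<in>topspace X" using x by simp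
  have "?S~={}" using R(4)[OF xt] by fastforce
  moreover have "?S\<subseteq>ver ` V" by (auto dest: pushed_nonzeroD)
  ultimately have "?S\<in>?D" "?t\<in>closed_simplex ?S"
   using R[OF xt] by (auto simp: order_simplices_def closed_simplex_def Complete_Partial_Order.chain_def)
  thus "x\<in>(\<Union>D\<in>?D. (?P (closed_simplex D\<inter>C)))" using x by blast
 qed auto
 ultimately show "closedin X (?P C)" by simp
qed

text \<open>For s in the unit cube, the length of the set of u in [0, 1) such that \<open>S\<close>
  is exactly the set of l with u < s l. This is the standard triangulation of the cube by chains of
  subsets.\<close>

definition cube_weight :: "nat => vec => nat set => real"
 where "cube_weight r s S = max 0 (Min (insert 1 (s ` S)) - Max (insert 0 (s ` ({..<r} - S))))"

definition cube :: "nat => vec => vec set => real"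
 where "cube r s = pushed (Pow {..<r}) (cspace r) (cube_weight r s)"

text \<open>The intervals behind the weights are disjoint, and those of the sets \<open>S\<close>
  containing \<open>A\<close> fill the interval from 0 to the minimum.\<close>

lemma cube_weight_sum:
 assumes s: "!!l. l < r ==> 0<=s l & s l<=1" and A: "A\<subseteq>{..<r}"
 shows "(\<Sum>S | S\<in>Pow {..<r} & A\<subseteq>S. cube_weight r s S) = Min (insert 1 (s ` A))"
proof -
 let ?P = "{S\<in>Pow {..<r}. A\<subseteq>S}"
 define B where "B S = {Max (insert 0 (s ` ({..<r} - S)))..<Min (insert 1 (s ` S))}" for S
 have B: "u\<in>B S \<longleftrightarrow> u\<in>{0..<1} & (\<forall>l<r. u < s l \<longleftrightarrow> l\<in>S)" if S: "S\<subseteq>{..<r}" for S u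
 proof -
  have fin: "finite S" using finite_subset[OF S] by simp
  have "u\<in>B S \<longleftrightarrow> 0<=u & (\<forall>l\<in>{..<r} - S. s l<=u) & u < 1 & (\<forall>l\<in>S. u < s l)"
   unfolding B_def using fin by auto
  moreover have "(\<forall>l\<in>{..<r} - S. s l<=u) & (\<forall>l\<in>S. u < s l) \<longleftrightarrow> (\<forall>l<r. u < s l \<longleftrightarrow> l\<in>S)"
   using S not_le[of _ u] by (metis Diff_iff lessThan_iff subsetD)
  ultimately show ?thesis by auto
 qed
 have "measure lborel {a..<b} = max 0 (b - a)" for a b::real by (cases "a<=b") auto
 hence m: "measure lborel (B S) = cube_weight r s S" for S by (simp only: B_def cube_weight_def)
 have "(\<Sum>S | S\<in>Pow {..<r} & A\<subseteq>S. cube_weight r s S) = measure lborel (\<Union>S\<in>?P. B S)"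
  unfolding m[symmetric]
 proof (rule measure_finite_Union[symmetric])
  show "disjoint_family_on B ?P"
   unfolding disjoint_family_on_def
  proof (intro ballI impI)
   fix S T assume ST: "S\<in>?P" "T\<in>?P" "S~=T"
   show "B S\<inter>B T = {}"
   proof (rule ccontr)
    assume "B S\<inter>B T~={}"
    then obtain u where "u\<in>B S" "u\<in>B T" by blast
    hence "\<forall>l<r. l\<in>S \<longleftrightarrow> l\<in>T" using B[of S u] B[of T u] ST by auto
    thus False using ST by blast
   qed
  qed
  have "emeasure lborel {a..<b}~=\<infinity>" for a b::real by (cases "a<=b") auto
  thus "emeasure lborel (B S)~=\<infinity>" for S unfolding B_def .
 qed (auto simp: B_def)
 also have "(\<Union>S\<in>?P. B S) = {0..<Min (insert 1 (s ` A))}"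
 proof (intro equalityI subsetI)
  fix u assume "u\<in>(\<Union>S\<in>?P. B S)"
  then obtain S where "S\<subseteq>{..<r}" "A\<subseteq>S" "u\<in>B S" by auto
  thus "u\<in>{0..<Min (insert 1 (s ` A))}"
   using B[of S u] finite_subset[OF A] A by auto
 next
  fix u assume u: "u\<in>{0..<Min (insert 1 (s ` A))}"
  let ?S = "{l. l < r & u < s l}"
  have "?S\<subseteq>{..<r}" by auto
  hence "u\<in>B ?S" "A\<subseteq>?S" using B[of ?S u] u finite_subset[OF A] A by auto
  thus "u\<in>(\<Union>S\<in>?P. B S)" using \<open>?S\<subseteq>{..<r}\<close> by blast
 qed
 also have "measure lborel {0..<Min (insert 1 (s ` A))} = Min (insert 1 (s ` A))"
  using finite_subset[OF A] A s by (subst measure_lborel_Ico) (auto simp: subset_iff)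
 finally show ?thesis .
qed

lemma cube_weight_chain:
 assumes "S\<subseteq>{..<r}" "T\<subseteq>{..<r}" "cube_weight r s S~=0" "cube_weight r s T~=0"
 shows "S\<subseteq>T | T\<subseteq>S"
proof (rule ccontr)
 assume "\<not> ?thesis"
 then obtain i j where ij: "i\<in>S" "i\<notin>T" "j\<in>T" "j\<notin>S" by blast
 have *: "s j < s i" if S: "S\<subseteq>{..<r}" "cube_weight r s S~=0" "i\<in>S" "j\<notin>S" "j < r" for i j S
 proof -
  have fin: "finite S" using finite_subset[OF S(1)] by simp
  have "s j<=Max (insert 0 (s ` ({..<r} - S)))" by (rule Max_ge) (use S in auto)
  also have "... < Min (insert 1 (s ` S))" using S(2) unfolding cube_weight_def max_def by (smt (verit))
  also have "...<=s i" by (rule Min_le) (use S fin in auto)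
  finally show ?thesis .
 qed
 have "s j < s i" "s i < s j"
  using *[OF assms(1,3) ij(1,4)] *[OF assms(2,4) ij(3,2)] ij assms(1,2) by auto
 thus False by simp
qed

lemma cube_points:
 assumes "!!l. l < r ==> 0<=s l & s l<=1"
 shows "cube r s\<in>ST_points (2*r)"
 unfolding cube_def ST_points_def
proof (rule pushed_points)
 show "cspace r ` Pow {..<r}\<subseteq>{U. real_fun.subspace U & U\<subseteq>Rn (2*r)}"
  using subspace_cspace cspace_Rn by blast
 show "sum (cube_weight r s) (Pow {..<r}) = 1" using cube_weight_sum[of r s "{}"] assms by (simp add: Pow_def)
 fix S T assume "S\<in>Pow {..<r}" "T\<in>Pow {..<r}" "cube_weight r s S~=0" "cube_weight r s T~=0"
 thus "cspace r S\<subseteq>cspace r T | cspace r T\<subseteq>cspace r S"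
  using cube_weight_chain[of S r T s] by (auto simp: cspace_subset_iff)
qed (simp_all add: cube_weight_def)

lemma cube_apply: "S\<subseteq>{..<r} ==> cube r s (cspace r S) = cube_weight r s S"
proof -
 assume S: "S\<subseteq>{..<r}"
 hence "{T\<in>Pow {..<r}. cspace r T = cspace r S} = {S}" by (auto simp: cspace_eq_iff)
 thus ?thesis by (simp add: cube_def pushed_def)
qed

lemma cube_nonzeroD: "cube r s U~=0 ==> \<exists>S. S\<subseteq>{..<r} & U = cspace r S & cube_weight r s S~=0"
 unfolding cube_def by (drule pushed_nonzeroD) blast

lemma cube_mass:
 assumes "!!l. l < r ==> 0<=s l & s l<=1" "A\<subseteq>{..<r}"
 shows "mass (cube r s) {U. cspace r A\<subseteq>U} = Min (insert 1 (s ` A))"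
proof -
 have "{S\<in>Pow {..<r}. cspace r S\<in>{U. cspace r A\<subseteq>U}} = {S\<in>Pow {..<r}. A\<subseteq>S}"
  using cspace_subset_iff[OF assms(2)] by auto
 thus ?thesis unfolding cube_def by (simp add: pushed_mass cube_weight_sum[OF assms, simplified])
qed

lemma cube_rot:
 assumes "!!l. l < r ==> 0<=s l & s l<=1"
 shows "realization_map (image (rot r tt)) (cube r s) = cube r s"
proof -
 have "realization_map (image (rot r tt)) (cube r s) = realization_map (%U. U) (cube r s)"
 proof (rule realization_map_cong)
  fix U assume "cube r s U~=0"
  then obtain S where "U = cspace r S" using cube_nonzeroD by blast
  thus "rot r tt ` U = U" by (simp add: rot_cspace)
 qed
 thus ?thesis by (simp add: realization_map_id)
qed

lemma cube_boundary:
 assumes "!!l. l < r ==> 0<=s l & s l<=1" "0 < r"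
 shows "cube r s\<in>ST_boundary (2*r) \<longleftrightarrow> (\<exists>l<r. s l = 0 | s l = 1)"
proof -
 have m: "max 0 m = 0 \<longleftrightarrow> m<=0" for m::real by auto
 have z: "l < r ==> s l<=0 \<longleftrightarrow> s l = 0" "l < r ==> 1<=s l \<longleftrightarrow> s l = 1" for l using assms(1)[of l] by auto
 have "cube r s (Rn (2*r)) = 0 \<longleftrightarrow> Min (insert 1 (s ` {..<r}))<=0"
  unfolding cspace_full[symmetric] cube_apply[OF order_refl] cube_weight_def by (simp add: m)
 also have "... \<longleftrightarrow> (\<exists>l<r. s l = 0)" by (auto simp: Min_le_iff z)
 finally have 1: "cube r s (Rn (2*r)) = 0 \<longleftrightarrow> (\<exists>l<r. s l = 0)" .
 have "cube r s {0} = 0 \<longleftrightarrow> 1<=Max (insert 0 (s ` {..<r}))"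
  unfolding cspace_empty[of r, symmetric] cube_apply[OF empty_subsetI] cube_weight_def by (simp add: m)
 also have "... \<longleftrightarrow> (\<exists>l<r. s l = 1)" by (auto simp: Max_ge_iff z)
 finally show ?thesis using 1 cube_points[OF assms(1)] by (auto simp: ST_boundary_def)
qed

section \<open>The classifying map of a torus of rotations\<close>

definition hat :: "real => real"
 where "hat u = max 0 (1 - \<bar>u\<bar>)"

lemma hat_sum: "\<bar>x\<bar><=1 ==> (\<Sum>l\<in>{-1, 0, 1}. hat (x - of_int l)) = 1"
 by (cases "x = 1"; cases "x = -1"; cases "0<=x") (auto simp: hat_def max_def abs_if)

lemma hat_nonzero: "hat u~=0 \<longleftrightarrow> \<bar>u\<bar> < 1"
 by (auto simp: hat_def max_def)

lemma rot_stdf: "i < r ==> plane_part (rot r tt (stdf k)) i = (if k div 2 = i then cis (tt i)*(if even k then 1 else \<i>) else 0)"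
 if "k < 2*r"
 using stdf_Rn[OF that] by (simp add: plane_part_rot plane_part_stdf del: topspace_Euclidean_space)

lemma rot_eqD:
 assumes "rot r tt = rot r tt'" "i < r"
 shows "cis (tt i) = cis (tt' i)"
 using rot_stdf[of "2*i" r i tt] rot_stdf[of "2*i" r i tt'] assms by simp

lemma label_dir_perm_frame:
 assumes sg: "sg i < r"
 shows "label_dir (2*r) (perm_frame sg) i (rot r tt) = cis (tt (sg i))"
proof -
 have p: "pcoord (2*r) (perm_frame sg) i (rot r tt (stdf k)) = plane_part (rot r tt (stdf k)) (sg i)" for k
  by (rule pcoord_perm_frame[where sg = sg and i = i, OF sg])
 have "(LEAST k. k < 2*r & pcoord (2*r) (perm_frame sg) i (rot r tt (stdf k))~=0) = 2 * sg i"
 proof (rule Least_equality)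
  show "2 * sg i < 2*r & pcoord (2*r) (perm_frame sg) i (rot r tt (stdf (2 * sg i)))~=0"
   using sg by (simp add: p rot_stdf)
  fix k assume "k < 2*r & pcoord (2*r) (perm_frame sg) i (rot r tt (stdf k))~=0"
  hence "k div 2 = sg i" unfolding p using rot_stdf[of k r "sg i" tt] sg by (auto split: if_splits)
  thus "2 * sg i<=k" by auto
 qed
 thus ?thesis unfolding label_dir_def using sg by (simp add: p rot_stdf)
qed

locale torus_class = flag_cochain r N L ka n f for r N L ka n f +
 fixes be :: "nat => real"
 assumes dual: "i < 2*n + r ==> j < 2*n + r ==> f i (be j) = of_bool (i = j)"
begin

abbreviation a::nat
 where "a \<equiv> 2*n + r"

text \<open>The rotation angle of plane \<open>i\<close> at the parameter \<open>x\<close>. At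
  integer points, functional \<open>j\<close> recovers coordinate \<open>j\<close> from the angle of
  its plane.\<close>

definition theta :: "vec => nat => real"
 where "theta x i = (\<Sum>j<a. if plane j = i then x j*be j else 0)"

lemma theta_add: "theta (%j. x j + y j) = (%i. theta x i + theta y i)"
 by (auto simp: theta_def fun_eq_iff sum.distrib[symmetric] algebra_simps intro!: sum.cong)

lemma f_int: "f j (of_int k * t) = of_int k*f j t"
proof -
 have nat: "f j (of_nat m * t) = of_nat m*f j t" for m
  by (induction m) (simp_all add: angle_functionalD[OF f] algebra_simps)
 show ?thesis
 proof (cases k rule: int_cases2)
  case (nonneg m)
  thus ?thesis using nat[of m] by simp
 next
  case (nonpos m)
  thus ?thesis using nat[of m] angle_functionalD(4)[OF f, of j "of_nat m * t"] by simp
 qed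
qed

lemma f_theta:
 assumes j: "j < a"
 shows "f j (theta (%j. of_int (k j)) i) = (if plane j = i then of_int (k j) else 0)"
proof -
 have "f j (sum g {..<m}) = (\<Sum>l<m. f j (g l))" for g and m::nat
  by (induction m) (simp_all add: angle_functionalD[OF f])
 hence "f j (theta (%j. of_int (k j)) i) = (\<Sum>l<a. f j (if plane l = i then of_int (k l)*be l else 0))"
  by (simp only: theta_def)
 also have "... = (\<Sum>l<a. if l = j then (if plane j = i then of_int (k j) else 0) else 0)"
  using j by (intro sum.cong) (auto simp: f_int dual angle_functionalD[OF f])
 finally show ?thesis using j by simp
qed

lemma f_cis: "cis t = cis t' ==> f j t = f j t'"
 using angle_functional_Arg_cis[OF f, of j] by metis

definition cells :: "ivec set"
 where "cells = PiE {..<a} (%_. {-1, 0, 1})"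

text \<open>The second component encodes parities. It separates the corners around any given
  parameter, so they have distinct indices and span a simplex of Milnor's model.\<close>

definition vertex :: "ivec => (vec => vec)\<times>nat"
 where "vertex k = (rot r (theta (%j. of_int (k j))), set_encode {j. j < a & even (k j)})"

text \<open>Products of tent functions: a partition of unity on [-1, 1]^a indexed by
  \<open>cells\<close>.\<close>

definition cell_weight :: "vec => ivec => real"
 where "cell_weight x k = (\<Prod>j<a. hat (x j - of_int (k j)))"

definition torus_pt :: "vec => (vec => vec)\<times>nat => real"
 where "torus_pt x = pushed cells vertex (cell_weight x)"

lemma finite_cells [simp]: "finite cells"
 by (simp add: cells_def finite_PiE)

lemma cell_weight_nonneg: "0<=cell_weight x k"
 by (simp add: cell_weight_def prod_nonneg hat_def)

lemma cell_weight_nonzeroD: "cell_weight x k~=0 ==> j < a ==> \<bar>x j - of_int (k j)\<bar> < 1"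
 by (simp add: cell_weight_def hat_nonzero)

lemma cell_weight_sum:
 assumes x: "!!j. j < a ==> \<bar>x j\<bar><=1"
 shows "(\<Sum>k\<in>cells. cell_weight x k) = 1"
  and "i < a ==> l\<in>{-1, 0, 1} ==> (\<Sum>k | k\<in>cells & k i = l. cell_weight x k) = hat (x i - of_int l)"
proof -
 have "(\<Sum>k\<in>cells. cell_weight x k) = (\<Prod>j<a. \<Sum>l\<in>{-1, 0, 1}. hat (x j - of_int l))"
  unfolding cells_def cell_weight_def by (rule prod_sum_PiE[symmetric]) auto
 also have "... = 1" by (rule prod.neutral) (use hat_sum x in blast)
 finally show "(\<Sum>k\<in>cells. cell_weight x k) = 1" .
 assume i: "i < a" and l: "l\<in>{-1, 0, 1}"
 let ?B = "%j. if j = i then {l} else {-1, 0, 1}"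
 have "{k\<in>cells. k i = l} = PiE {..<a} ?B"
 proof (intro equalityI subsetI)
  fix k assume "k\<in>{k\<in>cells. k i = l}"
  thus "k\<in>PiE {..<a} ?B" unfolding cells_def by (simp add: PiE_iff)
 next
  fix k assume k: "k\<in>PiE {..<a} ?B"
  hence b: "k j\<in>?B j" if "j < a" for j using that by (simp add: PiE_iff)
  have "k j\<in>{-1, 0, 1}" if "j < a" for j using b[OF that] l by (cases "j = i") auto
  moreover have "k i = l" using b[OF i] by simp
  ultimately have "k i = l" "\<forall>j<a. k j\<in>{-1, 0, 1}" by blast+
  thus "k\<in>{k\<in>cells. k i = l}" using k unfolding cells_def by (simp add: PiE_iff)
 qed
 hence "(\<Sum>k | k\<in>cells & k i = l. cell_weight x k) = (\<Sum>k\<in>PiE {..<a} ?B. \<Prod>j<a. hat (x j - of_int (k j)))"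
  by (simp add: cell_weight_def)
 also have "... = (\<Prod>j<a. \<Sum>l\<in>?B j. hat (x j - of_int l))" by (rule prod_sum_PiE[symmetric]) auto
 also have "... = (\<Prod>j<a. if j = i then hat (x i - of_int l) else 1)"
  by (rule prod.cong) (use hat_sum x in auto)
 finally show "(\<Sum>k | k\<in>cells & k i = l. cell_weight x k) = hat (x i - of_int l)" using i by simp
qed

lemma cells_ext: "k\<in>cells ==> k'\<in>cells ==> (!!j. j < a ==> k j = k' j) ==> k = k'"
 unfolding cells_def by (rule PiE_ext) auto

lemma vertex_colour: "snd (vertex k) = snd (vertex k') \<longleftrightarrow> (\<forall>j<a. even (k j) \<longleftrightarrow> even (k' j))"
 unfolding vertex_def snd_conv by (subst set_encode_eq) auto

lemma vertex_colour_inj: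
 assumes "k\<in>cells" "k'\<in>cells" "cell_weight x k~=0" "cell_weight x k'~=0" "snd (vertex k) = snd (vertex k')"
 shows "k = k'"
proof (rule cells_ext[OF assms(1,2)])
 fix j assume j: "j < a"
 have "\<bar>real_of_int (k j) - real_of_int (k' j)\<bar> < 2"
  using cell_weight_nonzeroD[OF assms(3) j] cell_weight_nonzeroD[OF assms(4) j] by linarith
 hence "\<bar>k j - k' j\<bar> < 2" by linarith
 moreover have "even (k j) \<longleftrightarrow> even (k' j)" using assms(5) j by (simp add: vertex_colour)
 ultimately show "k j = k' j" by presburger
qed

lemma torus_pt_points:
 assumes x: "!!j. j < a ==> \<bar>x j\<bar><=1"
 shows "torus_pt x\<in>EG_points dd"
 unfolding torus_pt_def EG_points_def
proof (rule pushed_points)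
 show "vertex ` cells\<subseteq>OC dd\<times>UNIV" by (auto simp: vertex_def rot_carrier)
 show "(\<Sum>k\<in>cells. cell_weight x k) = 1" by (rule cell_weight_sum(1)[OF x])
 fix k k' assume k: "k\<in>cells" "k'\<in>cells" "cell_weight x k~=0" "cell_weight x k'~=0"
 show "milnor_le (vertex k) (vertex k') | milnor_le (vertex k') (vertex k)"
  using vertex_colour_inj[OF k] unfolding milnor_le_def by (metis linorder_neqE_nat)
qed (simp_all add: cell_weight_nonneg)

lemma torus_pt_nonzeroD:
 assumes "torus_pt x p~=0"
 shows "\<exists>k\<in>cells. cell_weight x k~=0 & vertex k = p"
 using pushed_nonzeroD[OF assms[unfolded torus_pt_def]] by blast

lemma torus_pt_vertex:
 assumes "k\<in>cells" "cell_weight x k~=0"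
 shows "torus_pt x (vertex k) = cell_weight x k"
proof -
 have "{k'\<in>cells. vertex k' = vertex k}\<inter>{k'. cell_weight x k'~=0} = {k}"
  using assms vertex_colour_inj[of _ k x] by auto
 moreover have "torus_pt x (vertex k) = (\<Sum>k'\<in>{k'\<in>cells. vertex k' = vertex k}\<inter>{k'. cell_weight x k'~=0}. cell_weight x k')"
  unfolding torus_pt_def pushed_def by (rule sum.mono_neutral_right) auto
 ultimately show ?thesis by simp
qed

text \<open>The odd integer next to \<open>x j\<close>: odd vertices have smaller colours.\<close>
definition nearest_odd :: "vec => nat => int"
 where "nearest_odd x j = (if x j = 0 then 0 else if 0 < x j then 1 else -1)"

text \<open>If the corner given by \<open>nearest_odd\<close> has an even coordinate, x vanishes
  there, and every corner of nonzero weight has coordinate 0 as well. So its set of even coordinates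
  is least, and \<open>set_encode\<close> is monotone.\<close>

lemma label_torus_pt:
 assumes x: "!!j. j < a ==> \<bar>x j\<bar><=1"
 shows "label (torus_pt x) = rot r (theta (%j. of_int (nearest_odd x j)))"
proof -
 define k where "k = restrict (nearest_odd x) {..<a}"
 have k: "k\<in>cells" by (auto simp: k_def cells_def nearest_odd_def)
 have "\<bar>x j - of_int (nearest_odd x j)\<bar> < 1" if "j < a" for j
  using x[OF that] by (auto simp: nearest_odd_def abs_less_iff abs_le_iff)
 hence "cell_weight x k~=0" by (simp add: cell_weight_def hat_nonzero k_def)
 hence nz: "torus_pt x (vertex k)~=0" using torus_pt_vertex[OF k] by simp
 have "label (torus_pt x) = fst (vertex k)"
 proof (rule label_eqI[OF torus_pt_points[OF x]])
  show "torus_pt x (fst (vertex k), snd (vertex k))~=0" using nz by simp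
  fix h c assume "torus_pt x (h, c)~=0"
  then obtain k' where k': "k'\<in>cells" "cell_weight x k'~=0" "vertex k' = (h, c)" using torus_pt_nonzeroD by blast
  have "{j. j < a & even (k j)}\<subseteq>{j. j < a & even (k' j)}"
  proof safe
   fix j assume j: "j < a" "even (k j)"
   hence "x j = 0" by (auto simp: k_def nearest_odd_def split: if_splits)
   hence "k' j = 0" using cell_weight_nonzeroD[OF k'(2) j(1)] by linarith
   thus "even (k' j)" by simp
  qed
  hence "snd (vertex k)<=snd (vertex k')"
   unfolding vertex_def snd_conv set_encode_def by (auto intro!: sum_mono2)
  thus "snd (vertex k)<=c" using k'(3) by simp
 qed simp
 also have "fst (vertex k) = rot r (theta (%j. of_int (nearest_odd x j)))"
  unfolding vertex_def fst_conv theta_def by (rule arg_cong[of _ _ "rot r"]) (auto simp: k_def fun_eq_iff intro!: sum.cong)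
 finally show ?thesis .
qed

text \<open>Translation by even integers preserves parities and weights and multiplies the rotations
  of all corners by one group element. Thus opposite faces of [-1, 1]^a are glued by the group, and
  the orbits form a torus.\<close>

lemma torus_pt_shift:
 assumes x: "!!j. j < a ==> \<bar>x j\<bar><=1" and y: "!!j. j < a ==> \<bar>x j + 2 * of_int (m j)\<bar><=1"
 shows "torus_pt (%j. x j + 2 * of_int (m j)) = EG_act (OG dd) (rot r (theta (%j. 2 * of_int (m j)))) (torus_pt x)"
  (is "torus_pt ?y = EG_act _ ?g _")
proof
 fix p :: "(vec => vec)\<times>nat"
 interpret G: group "OG dd" by (rule group_orthogonal_group)
 let ?s = "%k. \<lambda>j\<in>{..<a}. k j + 2*m j"
 have w: "cell_weight ?y (?s k) = cell_weight x k" for k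
  unfolding cell_weight_def by (rule prod.cong) auto
 have s_cells: "?s k\<in>cells" if "cell_weight x k~=0" for k
 proof -
  have "k j + 2*m j\<in>{-1, 0, 1}" if j: "j < a" for j
  proof -
   have "\<bar>x j - of_int (k j)\<bar> < 1" by (rule cell_weight_nonzeroD[OF \<open>cell_weight x k~=0\<close> j])
   hence "\<bar>real_of_int (k j + 2*m j)\<bar> < 2" using y[OF j] by simp
   hence "\<bar>k j + 2*m j\<bar> < 2" by linarith
   thus ?thesis by auto
  qed
  thus ?thesis by (simp add: cells_def PiE_iff)
 qed
 have v: "fst (vertex (?s k)) = ?g \<otimes>\<^bsub>OG dd\<^esub> fst (vertex k)" "snd (vertex (?s k)) = snd (vertex k)" for k
 proof -
  have "theta (%j. of_int (?s k j)) = theta (%j. 2 * of_int (m j) + of_int (k j))"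
   unfolding theta_def by (intro ext sum.cong) auto
  thus "fst (vertex (?s k)) = ?g \<otimes>\<^bsub>OG dd\<^esub> fst (vertex k)"
   unfolding vertex_def fst_conv rot_mult by (simp only: theta_add)
  show "snd (vertex (?s k)) = snd (vertex k)" by (simp add: vertex_colour)
 qed
 have c: "rot r (theta u)\<in>OC dd" for u by (rule rot_carrier)
 have e: "torus_pt x\<in>EG_points dd" "torus_pt ?y\<in>EG_points dd"
  by (rule torus_pt_points, erule x, rule torus_pt_points, erule y)
 have sub: "torus_pt ?y (?g \<otimes>\<^bsub>OG dd\<^esub> h, i) = torus_pt x (h, i)" if nz: "torus_pt x (h, i)~=0" for h i
 proof -
  obtain k where k: "k\<in>cells" "cell_weight x k~=0" "vertex k = (h, i)" using torus_pt_nonzeroD[OF nz] by blast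
  have "vertex (?s k) = (?g \<otimes>\<^bsub>OG dd\<^esub> h, i)" using v[of k] k(3) by (simp add: prod_eq_iff)
  thus ?thesis
   using torus_pt_vertex[OF s_cells[OF k(2)], of ?y] torus_pt_vertex[OF k(1,2)] k w[of k] by simp
 qed
 let ?e = "EG_act (OG dd) ?g (torus_pt x)"
 have eq: "?e (?g \<otimes>\<^bsub>OG dd\<^esub> h, i) = torus_pt x (h, i)" if "h\<in>OC dd" for h i
  by (rule EG_act_apply[OF e(1) c that])
 \<comment> \<open>One inequality suffices, because both sides are weights with total 1.\<close>
 have le: "?e q<=torus_pt ?y q" for q
 proof (cases "?e q = 0")
  case True
  thus ?thesis using realization_pointsD(3)[OF e(2)[unfolded EG_points_def]] by simp
 next
  case False
  hence "?e (fst q, snd q)~=0" by simp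
  from EG_points_carrier[OF EG_act_points[OF e(1) c] this] have q: "fst q\<in>OC dd" .
  let ?h = "inv\<^bsub>OG dd\<^esub> ?g \<otimes>\<^bsub>OG dd\<^esub> fst q"
  have h: "?h\<in>OC dd" "?g \<otimes>\<^bsub>OG dd\<^esub> ?h = fst q" using q c by (simp_all add: G.m_assoc[symmetric])
  have "?e q = torus_pt x (?h, snd q)" using eq[OF h(1), of "snd q"] h(2) by simp
  thus ?thesis using sub[of ?h "snd q"] False h(2) by simp
 qed
 have W: "weights ?e" "weights (torus_pt ?y)" by (rule weights_EG[OF EG_act_points[OF e(1) c]], rule weights_EG[OF e(2)])
 have fin: "finite {q. torus_pt ?y q~=0}" "(\<Sum>q | torus_pt ?y q~=0. torus_pt ?y q) = 1" using weightsD[OF W(2)] by auto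
 have supp: "{q. ?e q~=0}\<subseteq>{q. torus_pt ?y q~=0}"
 proof (intro Collect_mono impI notI)
  fix q assume "?e q~=0" "torus_pt ?y q = 0"
  thus False using le[of q] weightsD(2)[OF W(1), of q] by linarith
 qed
 have z: "(\<Sum>q | torus_pt ?y q~=0. torus_pt ?y q - ?e q) = 0"
  using weights_sum_superset[OF W(1) fin(1) supp] fin(2) by (simp add: sum_subtractf)
 have "\<forall>q\<in>{q. torus_pt ?y q~=0}. torus_pt ?y q - ?e q = 0"
  by (rule iffD1[OF sum_nonneg_eq_0_iff[OF fin(1)] z]) (use le in \<open>simp only: diff_ge_0_iff_ge\<close>)
 hence "torus_pt ?y p~=0 --> torus_pt ?y p - ?e p = 0" by blast
 moreover have "torus_pt ?y p = 0 --> ?e p = 0" using supp by blast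
 ultimately show "torus_pt ?y p = ?e p" by linarith
qed

end

lemma continuous_map_coinduced:
 "f ` topspace X\<subseteq>S ==> continuous_map X (coinduced_topology S X f) f"
 unfolding continuous_map_def by (auto simp: topspace_coinduced_topology openin_coinduced_topology)

lemma continuous_map_Alexandroff:
 assumes f: "continuous_map X Y (%x. g (Some x))" and B: "compactin X B"
  and out: "!!x. x\<in>topspace X - B ==> g (Some x) = g None" and N: "g None\<in>topspace Y"
 shows "continuous_map (Alexandroff_compactification X) Y g"
 unfolding continuous_map_def
proof (intro conjI allI impI)
 let ?X = "Alexandroff_compactification X"
 have fY: "g (Some x)\<in>topspace Y" if "x\<in>topspace X" for x
  using continuous_map_funspace[OF f] that by auto
 thus "g\<in>topspace ?X \<rightarrow> topspace Y" using N by auto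
 fix U assume U: "openin Y U"
 let ?A = "{x\<in>topspace X. g (Some x)\<in>U}" and ?C = "{x\<in>topspace X. g (Some x)\<in>topspace Y - U}"
 have A: "openin X ?A" by (rule openin_continuous_map_preimage[OF f U])
 have C: "closedin X ?C" by (rule closedin_continuous_map_preimage[OF f]) (use U in blast)
 show "openin ?X {x\<in>topspace ?X. g x\<in>U}"
 proof (cases "g None\<in>U")
  case True
  have "?C\<subseteq>B" using out True by force
  hence "compactin X ?C" using closed_compactin[OF B _ C] by blast
  moreover have "{x\<in>topspace ?X. g x\<in>U} = insert None (Some ` (topspace X - ?C))"
   using True fY by auto
  ultimately show ?thesis unfolding openin_Alexandroff_compactification using C by blast
 next
  case False
  hence "{x\<in>topspace ?X. g x\<in>U} = Some ` ?A" by auto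
  thus ?thesis unfolding openin_Alexandroff_compactification using A by blast
 qed
qed

text \<open>Projection along a compact space is closed. The lemma stands in for a continuous
  selection of \<open>k\<close>, which does not exist when \<open>k\<close> contains an argument
  with its cut.\<close>

lemma closed_relation_continuous_map:
 assumes K: "compact_space K" and q: "continuous_map K Y q" and R: "closedin (prod_topology X K) R"
  and ex: "!!x. x\<in>topspace X ==> \<exists>k. (x, k)\<in>R" and eq: "!!x k. (x, k)\<in>R ==> f x = q k"
 shows "continuous_map X Y f"
proof (subst continuous_map_closedin, intro conjI allI impI)
 note sub = closedin_subset[OF R]
 show "f\<in>topspace X \<rightarrow> topspace Y"
 proof
  fix x assume "x\<in>topspace X"
  then obtain k where k: "(x, k)\<in>R" using ex by blast
  hence "k\<in>topspace K" using sub by auto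
  thus "f x\<in>topspace Y" using eq[OF k] continuous_map_funspace[OF q] by auto
 qed
 fix C assume C: "closedin Y C"
 let ?Q = "R\<inter>{z\<in>topspace (prod_topology X K). q (snd z)\<in>C}"
 have "closedin (prod_topology X K) ?Q"
  using C by (intro closedin_Int R closedin_continuous_map_preimage[OF continuous_map_compose[OF continuous_map_snd q, unfolded comp_def]])
 hence "closedin X (fst ` ?Q)"
  using closed_map_fst[OF K, of X] unfolding closed_map_def by blast
 moreover have "fst ` ?Q = {x\<in>topspace X. f x\<in>C}"
 proof (intro equalityI subsetI)
  fix x assume "x\<in>fst ` ?Q"
  thus "x\<in>{x\<in>topspace X. f x\<in>C}" using eq by fastforce
 next
  fix x assume x: "x\<in>{x\<in>topspace X. f x\<in>C}"
  then obtain k where k: "(x, k)\<in>R" using ex by blast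
  hence "(x, k)\<in>?Q" using sub eq[OF k] x by auto
  thus "x\<in>fst ` ?Q" by force
 qed
 ultimately show "closedin X {x\<in>topspace X. f x\<in>C}" by simp
qed

lemma continuous_map_Min_insert:
 assumes "finite S" "!!l. l\<in>S ==> continuous_map X euclideanreal (%x. g x l)"
 shows "continuous_map X euclideanreal (%x. Min (insert c (g x ` S)))"
  and "continuous_map X euclideanreal (%x. Max (insert c (g x ` S)))"
proof -
 let ?c = "continuous_map X euclideanreal"
 have *: "?c (%x. Min (insert c (g x ` S))) & ?c (%x. Max (insert c (g x ` S)))"
  using assms
 proof (induction S)
  case (insert l S)
  have "Min (insert c (g x ` insert l S)) = min (g x l) (Min (insert c (g x ` S)))"
   "Max (insert c (g x ` insert l S)) = max (g x l) (Max (insert c (g x ` S)))" for x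
   using insert.hyps(1) by (simp_all add: insert_commute[of c] del: Min_insert Max_insert) simp_all
  thus ?case using insert by (simp add: continuous_map_real_min continuous_map_real_max)
 qed simp
 thus "?c (%x. Min (insert c (g x ` S)))"
  and "?c (%x. Max (insert c (g x ` S)))" by blast+
qed

section \<open>The family of points over the torus and the cube\<close>

context torus_class
begin

text \<open>The isometry turns backwards because the group acts on isometries by composition with
  the inverse. So a translation of \<open>x\<close> by even integers is the action of one group
  element on all components; the rotations fix \<open>cube r s\<close>.\<close>

definition canonical_pt :: "vec => vec => vec => point"
 where "canonical_pt x s w = (torus_pt x, ((rot r (%i. - theta x i), w), cube r s))"

definition cell_map :: "vec\<times>vec => point set option"
 where "cell_map z = (if \<exists>l<r. snd z l = 0 | snd z l = 1 then None
  else Some (orbit dd (canonical_pt (fst z) (snd z) 0)))"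

definition cell_domain :: "(vec\<times>vec) set"
 where "cell_domain = PiE UNIV (%j. if j < a then {-1..1} else {0})\<times>PiE UNIV (%l. if l < r then {0..1} else {0})"

lemma cell_domainD:
 assumes "z\<in>cell_domain"
 shows "j < a ==> \<bar>fst z j\<bar><=1" "l < r ==> 0<=snd z l & snd z l<=1"
proof -
 have "fst z\<in>PiE UNIV (%j. if j < a then {-1..1} else {0})" "snd z\<in>PiE UNIV (%l. if l < r then {0..1} else {0})"
  using assms unfolding cell_domain_def by (simp_all only: mem_Times_iff)
 hence "fst z j\<in>(if j < a then {-1..1} else {0})" "snd z l\<in>(if l < r then {0..1} else {0})"
  by (simp_all only: PiE_iff) blast+
 thus "j < a ==> \<bar>fst z j\<bar><=1" "l < r ==> 0<=snd z l & snd z l<=1" by (auto simp: abs_le_iff)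
qed

lemma canonical_pt_shift:
 assumes x: "!!j. j < a ==> \<bar>x j\<bar><=1" and y: "!!j. j < a ==> \<bar>x j + 2 * of_int (m j)\<bar><=1"
  and s: "!!l. l < r ==> 0<=s l & s l<=1"
 shows "canonical_pt (%j. x j + 2 * of_int (m j)) s w
  = act_point dd (rot r (theta (%j. 2 * of_int (m j)))) (canonical_pt x s w)"
 unfolding canonical_pt_def act_point_def act_fibre_def neg_sphere_act_def fst_conv snd_conv map_prod_simp prod.case
 using torus_pt_shift[of x m] x y cube_rot[of r s] s
 by (simp add: rot_inv rot_compose theta_add)

lemma canonical_pt_points:
 assumes x: "!!j. j < a ==> \<bar>x j\<bar><=1" and s: "!!l. l < r ==> 0<=s l & s l<=1"
  and w: "w\<in>Rn N'" "!!l. l < dd ==> w l = 0" and N': "dd<=N'"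
 shows "canonical_pt x s w\<in>points dd N'"
proof -
 have dot: "dot N' v v' = dot dd v v'" if "v'\<in>Rn dd" for v v'
  unfolding dot_def using N' that by (intro sum.mono_neutral_right) (auto simp: Rn_iff)
 note lin = linear_isometriesD[OF rot_linear_isometries[of r "%i. - theta x i"]]
 have sub: "Rn dd\<subseteq>Rn N'" by (rule Rn_mono[OF N'])
 have "rot r (%i. - theta x i)\<in>Rn dd \<rightarrow>\<^sub>E Rn N'" 
 proof (rule PiE_I)
  show "rot r (%i. - theta x i) v\<in>Rn N'" if "v\<in>Rn dd" for v using lin(1)[OF that] sub by blast
 qed (simp add: rot_def)
 hence "rot r (%i. - theta x i)\<in>linear_isometries dd N'"
  unfolding linear_isometries_def using lin(2-4) dot[OF lin(1)] by simp
 moreover have "dot N' w (rot r (%i. - theta x i) v) = 0" if "v\<in>Rn dd" for v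
  using dot[OF lin(1)[OF that], of w] w(2) by (simp add: dot_def)
 ultimately show ?thesis
  unfolding canonical_pt_def points_def bundle_points_def
  using torus_pt_points[OF x] cube_points[of r s] s w(1) by auto
qed

lemma continuous_cell_map: "continuous_map (top_of_set cell_domain) (K_level dd dd) cell_map"
proof -
 let ?S = "Sigma_ST (Rn dd)"
 let ?R = "%z. rot r (%i. - theta (fst z) i)"
 let ?Z = "top_of_set cell_domain"
 let ?A = "Alexandroff_compactification (complement_bundle dd dd)"
 let ?c = "continuous_map ?Z euclideanreal"
 have x: "?c (%z. fst z j)" and s: "?c (%z. snd z j)" for j
  using continuous_on_compose2[OF continuous_on_product_coordinates[of j] continuous_on_fst[OF continuous_on_id]]
   continuous_on_compose2[OF continuous_on_product_coordinates[of j] continuous_on_snd[OF continuous_on_id]] by auto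
 have "compact (PiE UNIV (%j. if j < a then {-1..1} else {0::real}))" "compact (PiE UNIV (%l. if l < r then {0..1} else {0::real}))"
  unfolding compactin_euclidean_iff[symmetric] euclidean_product_topology[symmetric] compactin_PiE by auto
 hence cpt: "compact cell_domain" unfolding cell_domain_def by (rule compact_Times)
 \<comment> \<open>Since the compact domain is a k-space, continuity into a kified product can be
   tested in the plain product.\<close>
 have k: "k_space ?Z" by (rule compact_imp_k_space) (use cpt in \<open>simp add: compact_space_subtopology\<close>)
 have 1: "continuous_map ?Z (EG (OG dd)) (%z. torus_pt (fst z))"
  unfolding EG_def torus_pt_def
 proof (rule continuous_map_pushed)
  show "vertex ` cells\<subseteq>OC dd\<times>UNIV" by (auto simp: vertex_def rot_carrier)
  show "?c (%z. cell_weight (fst z) k)" for k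
   unfolding cell_weight_def hat_def
   by (intro continuous_map_prod continuous_map_real_max continuous_map_diff continuous_map_real_abs x) auto
  show "pushed cells vertex (cell_weight (fst z))\<in>realization_points (OC dd\<times>UNIV) milnor_le"
   if "z\<in>topspace ?Z" for z
   using torus_pt_points[of "fst z"] cell_domainD(1)[of z] that by (auto simp: torus_pt_def EG_points_def)
 qed simp
 have th: "?c (%z. theta (fst z) i)" for i
 proof -
  have "?c (%z. if plane j = i then fst z j*be j else 0)" for j
   using x[of j] by (cases "plane j = i") (auto intro: continuous_on_mult_right)
  thus ?thesis unfolding theta_def by (intro continuous_map_sum) auto
 qed
 have 2: "continuous_map ?Z ?A (%z. Some (?R z, 0))"
 proof (rule continuous_map_compose[OF _ continuous_map_Some, unfolded comp_def])
  have "continuous_map ?Z (Euclidean_space dd) (%z. ?R z v)" if v: "v\<in>Rn dd" for v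
   unfolding Euclidean_space_def continuous_map_in_subtopology continuous_map_componentwise_UNIV
  proof (intro conjI allI)
   fix j
   have c: "continuous_on cell_domain (%z. theta (fst z) i)" for i using th[of i] by simp
   show "?c (%z. ?R z v j)"
    using v by (cases "j < dd"; cases "even j")
     (auto simp: rot_def simp del: topspace_Euclidean_space intro!: continuous_intros c)
   show "(%z. ?R z v)\<in>topspace ?Z \<rightarrow> {y. \<forall>i\<ge>dd. y i = 0}"
    using rot_Rn[OF v] by (auto simp: Rn_iff)
  qed
  hence "continuous_map ?Z (product_topology (%_. Euclidean_space dd) (Rn dd)) ?R"
   unfolding continuous_map_componentwise by (auto simp: rot_def)
  moreover have "continuous_map ?Z (Euclidean_space dd) (%z. 0)" by (simp add: topspace_Euclidean_space)
  ultimately show "continuous_map ?Z (complement_bundle dd dd) (%z. (?R z, 0))"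
   unfolding complement_bundle_def continuous_map_in_subtopology
   using rot_linear_isometries by (auto simp: continuous_map_paired)
 qed
 let ?q = "%t. if t\<in>ST_boundary dd then None else Some t"
 have 3: "continuous_map ?Z ?S (%z. ?q (cube r (snd z)))"
 proof (rule continuous_map_compose[where g = ?q and f = "%z. cube r (snd z)", unfolded comp_def])
  show "continuous_map (flag_realization dd) ?S ?q"
   unfolding Sigma_ST_Rn quotient_space_def by (rule continuous_map_coinduced) auto
  show "continuous_map ?Z (flag_realization dd) (%z. cube r (snd z))"
   unfolding flag_realization_def cube_def
  proof (rule continuous_map_pushed)
   show "cspace r ` Pow {..<r}\<subseteq>{U. real_fun.subspace U & U\<subseteq>Rn dd}"
    using subspace_cspace cspace_Rn by blast
   show "?c (%z. cube_weight r (snd z) S)" if "S\<in>Pow {..<r}" for S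
    unfolding cube_weight_def using finite_subset[of S "{..<r}"] that
    by (intro continuous_map_real_max continuous_map_diff continuous_map_Min_insert s) auto
   show "pushed (Pow {..<r}) (cspace r) (cube_weight r (snd z))\<in>realization_points {U. real_fun.subspace U & U\<subseteq>Rn dd} (\<subseteq>)"
    if "z\<in>topspace ?Z" for z
    using cube_points[of r "snd z"] cell_domainD(2)[of z] that by (auto simp: cube_def ST_points_def)
  qed simp
 qed
 have "continuous_map ?Z (kification (prod_topology ?A ?S))
   (%z. (Some (?R z, 0), ?q (cube r (snd z))))"
  using 2 3 by (simp add: continuous_map_into_kification[OF k] continuous_map_paired)
 moreover have "continuous_map (kification (prod_topology ?A ?S)) (smash ?A ?S) (%(a, b). smash_pt a b)"
  unfolding smash_def by (rule continuous_map_coinduced) simp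
 ultimately have "continuous_map ?Z (smash ?A ?S)
   (%z. smash_pt (Some (?R z, 0)) (?q (cube r (snd z))))"
  by (auto dest: continuous_map_compose simp: comp_def)
 with 1 have "continuous_map ?Z (kification (prod_topology (EG (OG dd)) (smash ?A ?S)))
   (%z. (torus_pt (fst z), smash_pt (Some (?R z, 0)) (?q (cube r (snd z)))))"
  by (simp add: continuous_map_into_kification[OF k] continuous_map_paired)
 moreover have "continuous_map (kification (prod_topology (EG (OG dd)) (smash ?A ?S)))
   (K_level dd dd) (%(e, z). orbit_pt (OG dd) (act_fibre dd) e z)"
  unfolding K_level_def homotopy_orbit_space_def by (rule continuous_map_coinduced) simp
 ultimately have "continuous_map ?Z (K_level dd dd) (%z. orbit_pt (OG dd) (act_fibre dd) (torus_pt (fst z))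
   (smash_pt (Some (?R z, 0)) (?q (cube r (snd z)))))"
  by (auto dest: continuous_map_compose simp: comp_def)
 thus ?thesis
 proof (rule continuous_map_eq)
  fix z assume "z\<in>topspace ?Z"
  hence "cube r (snd z)\<in>ST_boundary dd \<longleftrightarrow> (\<exists>l<r. snd z l = 0 | snd z l = 1)"
   using cube_boundary[of r "snd z"] cell_domainD(2)[of z] r_pos by auto
  thus "orbit_pt (OG dd) (act_fibre dd) (torus_pt (fst z))
    (smash_pt (Some (?R z, 0)) (?q (cube r (snd z)))) = cell_map z"
   by (simp add: cell_map_def orbit_pt_eq smash_pt_def canonical_pt_def)
 qed
qed

end

section \<open>The map from the sphere\<close>

definition clamp01 :: "real => real"
 where "clamp01 t = max 0 (min 1 t)"

lemma clamp01_bounds: "0<=clamp01 t" "clamp01 t<=1"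
 by (auto simp: clamp01_def)

lemma clamp01_extreme: "t<=0 ==> clamp01 t = 0" "1<=t ==> clamp01 t = 1"
 by (auto simp: clamp01_def)

lemma max_expanding: "3<=x | 3<=y ==> 3<=\<bar>2*max x y - 3::real\<bar>"
 by (auto simp: max_def)

lemma sigma_reduced_spherical_K_spectrum:
 assumes "(SOME p. p\<in>C) = (e, ((ph, w), t))"
 shows "sigma (reduced_spherical_K_spectrum d) N (Some C) (Some y) = Some (orbit d (e, ((ph, w(N := y)), t)))"
 using assms by (simp add: reduced_spherical_K_spectrum_def homotopy_orbits_def smash_spectrum_def neg_sphere_def
   smash_pt_def orbit_pt_def orbit_def act_point_def act_fibre_def)

text \<open>Grid points have rational coordinates, so an irrational \<open>c\<close> keeps them off
  the walls \<open>v j = c\<close>, where \<open>nearest_odd\<close> can take the value 0.\<close>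

locale torus_map = torus_class r N L ka n f be for r N L ka n f be +
 fixes c::real
 assumes c: "0 < c" "c < 1" "c\<notin>\<rat>"
begin

text \<open>Iterated polar coordinates: the pair of \<open>depth v j\<close> and
  \<open>v j - c\<close> has a radius in maximum norm, and x \<mapsto> 2 x - 3 turns radii between 0
  and 3 into the next coordinate between -3 and 3. Absolute values of at least 3 persist and lead to
  the base point.\<close>

primrec depth :: "vec => nat => real"
 where
  "depth v 0 = v a"
 | "depth v (Suc j) = 2*max \<bar>depth v j\<bar> \<bar>v j - c\<bar> - 3"

text \<open>The minus sign puts angle 0 on negative depths, in particular on -1, the fixed point of
  d \<mapsto> - 2 d - 3 around which the evaluation is localised.\<close>

definition polar :: "vec => nat => complex"
 where "polar v j = Complex (- depth v j) (v j - c)"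

definition angle :: "vec => nat => real"
 where "angle v j = (if j < a then Arg (polar v j)/pi else 0)"

definition height :: "vec => nat => real"
 where "height v l = (if l < r then clamp01 (((if l = 0 then depth v a else v (a + l)) + 1)/2) else 0)"

definition sphere_map :: "vec option => point set option"
 where "sphere_map z = (case z of None => None | Some v => cell_map (angle v, height v))"

lemma angle_bound: "\<bar>angle v j\<bar><=1"
 using Arg_bounded[of "polar v j"] by (simp add: angle_def abs_le_iff field_simps)

lemma height_bounds: "0<=height v l" "height v l<=1"
 by (auto simp: height_def clamp01_bounds)

lemma angle_height_domain: "(angle v, height v)\<in>cell_domain"
proof -
 have "angle v j\<in>(if j < a then {-1..1} else {0})" for j
  using angle_bound[of v j] by (cases "j < a") (simp_all add: abs_le_iff, simp add: angle_def)
 moreover have "height v l\<in>(if l < r then {0..1} else {0})" for l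
  using height_bounds[of v l] by (cases "l < r") (simp_all, simp add: height_def)
 ultimately show ?thesis by (simp add: cell_domain_def PiE_iff)
qed

lemma depth_large:
 assumes "3<=\<bar>depth v j\<bar>" "j<=i"
 shows "3<=\<bar>depth v i\<bar>"
 using assms(2,1) by (induction i rule: dec_induct) (use max_expanding in auto)

lemma cell_map_large: "3<=\<bar>depth v j\<bar> ==> j<=a ==> cell_map (angle v, height v) = None"
proof -
 assume "3<=\<bar>depth v j\<bar>" "j<=a"
 hence "3<=\<bar>depth v a\<bar>" by (rule depth_large)
 hence "height v 0 = 0 | height v 0 = 1" 
  using r_pos clamp01_extreme[of "(depth v a + 1)/2"] by (cases "0<=depth v a") (auto simp: height_def)
 thus ?thesis using r_pos by (auto simp: cell_map_def)
qed

lemma sphere_map_far: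
 assumes v: "v\<in>Rn (2*n + dd)" and l: "l < 2*n + dd" "4 < \<bar>v l\<bar>"
 shows "cell_map (angle v, height v) = None"
proof -
 consider "l < a" | "l = a" | i where "l = a + i" "0 < i" "i < r"
  using l(1) by (metis add.assoc le_add_diff_inverse less_diff_conv2 linorder_neqE_nat mult_2 nat_add_left_cancel_less order_less_imp_le zero_less_diff)
 thus ?thesis
 proof cases
  case 1
  have "4<=\<bar>v l - c\<bar> + 1" using l(2) c by linarith
  hence "3<=\<bar>depth v (Suc l)\<bar>" using max_expanding[of "\<bar>depth v l\<bar>" "\<bar>v l - c\<bar>"] by simp
  thus ?thesis by (rule cell_map_large) (use 1 in simp)
 next
  case 2
  thus ?thesis using cell_map_large[of v 0] l(2) by simp
 next
  case 3
  hence "height v i = 0 | height v i = 1" 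
   using l(2) clamp01_extreme[of "(v (a + i) + 1)/2"] by (cases "0<=v l") (auto simp: height_def)
  thus ?thesis using 3 by (auto simp: cell_map_def)
 qed
qed

definition polar_relation :: "(vec\<times>vec\<times>vec) set"
 where "polar_relation = {(v, x, s). v\<in>Rn (2*n + dd) & (x, s)\<in>cell_domain & (\<forall>l<r. s l = height v l) &
  (\<forall>j<a. polar v j = of_real (cmod (polar v j))*cis (pi*x j))}"

text \<open>A vanishing polar coordinate gives depth -3 and hence the base point. Otherwise
  admissible angles differ by even integers, and these act through the group.\<close>

lemma cell_map_polar_relation:
 assumes R: "(v, x, s)\<in>polar_relation"
 shows "cell_map (x, s) = cell_map (angle v, height v)"
proof -
 have x: "!!j. j < a ==> \<bar>x j\<bar><=1" and s: "!!l. l < r ==> s l = height v l"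
  and p: "!!j. j < a ==> polar v j = of_real (cmod (polar v j))*cis (pi*x j)"
  and dom: "(x, s)\<in>cell_domain"
  using R cell_domainD(1)[of "(x, s)"] by (auto simp: polar_relation_def)
 have cube_eq: "cube r s = cube r (height v)"
 proof -
  have "cube_weight r s S = cube_weight r (height v) S" if "S\<in>Pow {..<r}" for S
  proof -
   have "s ` S = height v ` S" "s ` ({..<r} - S) = height v ` ({..<r} - S)" using s that by (auto intro!: image_cong)
   thus ?thesis by (simp only: cube_weight_def)
  qed
  thus ?thesis unfolding cube_def pushed_def by (intro ext sum.cong) auto
 qed
 show ?thesis
 proof (cases "\<exists>j<a. polar v j = 0")
  case True
  then obtain j where j: "j < a" "polar v j = 0" by blast
  hence "depth v (Suc j) = -3" by (simp add: polar_def complex_eq_iff)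
  hence none: "cell_map (angle v, height v) = None" using cell_map_large[of v "Suc j"] j(1) by simp
  hence "\<exists>l<r. height v l = 0 | height v l = 1" by (auto simp: cell_map_def split: if_splits)
  hence "\<exists>l<r. s l = 0 | s l = 1" using s by auto
  thus ?thesis using none by (simp add: cell_map_def)
 next
  case False
  have "\<exists>m. x j = angle v j + 2 * of_int m" if j: "j < a" for j
  proof -
   have "polar v j = of_real (cmod (polar v j))*cis (Arg (polar v j))"
    using rcis_cmod_Arg[of "polar v j"] by (simp add: rcis_def)
   hence "of_real (cmod (polar v j))*cis (pi*x j) = of_real (cmod (polar v j))*cis (Arg (polar v j))"
    using p[OF j] by simp
   hence "cis (pi*x j) = cis (Arg (polar v j))" using False j by simp
   then obtain m::int where "pi*x j = Arg (polar v j) + 2*pi * of_int m"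
    unfolding cis_conv_exp exp_eq by (auto simp: complex_eq_iff)
   thus ?thesis using j by (intro exI[of _ m]) (simp add: angle_def field_simps)
  qed
  then obtain m where m: "!!j. j < a ==> x j = angle v j + 2 * of_int (m j)" by metis
  let ?y = "%j. angle v j + 2 * of_int (m j)"
  have cw: "cell_weight x k = cell_weight ?y k" for k unfolding cell_weight_def by (rule prod.cong) (use m in auto)
  have th: "theta x = theta ?y" unfolding theta_def by (intro ext sum.cong) (use m in auto)
  have "canonical_pt x s 0 = canonical_pt ?y (height v) 0"
   unfolding canonical_pt_def torus_pt_def cube_eq th by (rule arg_cong[of _ _ "%w. (pushed cells vertex w, _)"]) (auto simp: cw)
  also have "... = act_point dd (rot r (theta (%j. 2 * of_int (m j)))) (canonical_pt (angle v) (height v) 0)"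
   by (rule canonical_pt_shift) (use angle_bound height_bounds x m in fastforce)+
  finally have "orbit dd (canonical_pt x s 0) = orbit dd (canonical_pt (angle v) (height v) 0)"
   using orbit_act[OF canonical_pt_points[of "angle v" "height v" 0 "dd"] rot_carrier] angle_bound height_bounds
   by (simp add: Rn_iff)
  moreover have "(\<exists>l<r. s l = 0 | s l = 1) \<longleftrightarrow> (\<exists>l<r. height v l = 0 | height v l = 1)" using s by metis
  ultimately show ?thesis by (simp only: cell_map_def fst_conv snd_conv)
 qed
qed

lemma continuous_sphere_map: "continuous_map (sphere_space (2*n + dd)) (K_level dd dd) sphere_map"
 unfolding sphere_space_def
proof (rule continuous_map_Alexandroff)
 let ?E = "Euclidean_space (2*n + dd)"
 let ?X = "prod_topology ?E (top_of_set cell_domain)"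
 let ?c = "continuous_map ?X euclideanreal"
 show "compactin ?E {v\<in>Rn (2*n + dd). \<forall>l<2*n + dd. \<bar>v l\<bar><=4}" by (rule compactin_Rn_box)
 show "sphere_map (Some v) = sphere_map None" if "v\<in>topspace ?E - {v\<in>Rn (2*n + dd). \<forall>l<2*n + dd. \<bar>v l\<bar><=4}" for v
  using that sphere_map_far by (auto simp: sphere_map_def not_le)
 show "sphere_map None\<in>topspace (K_level dd dd)" by (simp add: sphere_map_def topspace_K_level)
 have "compact (PiE UNIV (%j. if j < a then {-1..1} else {0::real}))" "compact (PiE UNIV (%l. if l < r then {0..1} else {0::real}))"
  unfolding compactin_euclidean_iff[symmetric] euclidean_product_topology[symmetric] compactin_PiE by auto
 hence "compact cell_domain" unfolding cell_domain_def by (rule compact_Times)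
 hence K: "compact_space (top_of_set cell_domain)" by (simp add: compact_space_subtopology)
 have z: "continuous_map (top_of_set cell_domain) euclideanreal (%z. fst z j)"
  "continuous_map (top_of_set cell_domain) euclideanreal (%z. snd z j)" for j
  using continuous_on_compose2[OF continuous_on_product_coordinates[of j] continuous_on_fst[OF continuous_on_id]]
   continuous_on_compose2[OF continuous_on_product_coordinates[of j] continuous_on_snd[OF continuous_on_id]] by auto
 have v: "?c (%u. fst u j)"
  and x: "?c (%u. fst (snd u) j)"
  and s: "?c (%u. snd (snd u) j)" for j
  using continuous_map_compose[OF continuous_map_fst continuous_map_Euclidean_coord]
   continuous_map_compose[OF continuous_map_snd z(1)] continuous_map_compose[OF continuous_map_snd z(2)]
  by (simp_all add: comp_def)
 have depth: "?c (%u. depth (fst u) j)" for j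
 proof (induction j)
  case (Suc j)
  have "?c (%u. 2*max \<bar>depth (fst u) j\<bar> \<bar>fst u j - c\<bar> - 3)"
   by (intro continuous_map_diff continuous_map_real_mult_left continuous_map_real_max continuous_map_real_abs Suc v) auto
  thus ?case by simp
 qed (simp add: v)
 have norm: "?c (%u. cmod (polar (fst u) j))" for j
  unfolding polar_def complex_norm
  by (intro continuous_map_sqrt continuous_map_add continuous_map_real_pow continuous_map_minus continuous_map_diff depth v) auto
 have trig: "?c (%u. cos (pi*fst (snd u) j))" "?c (%u. sin (pi*fst (snd u) j))" for j
  using continuous_map_compose[OF continuous_map_real_mult_left[OF x, of pi j], of euclideanreal cos]
   continuous_map_compose[OF continuous_map_real_mult_left[OF x, of pi j], of euclideanreal sin]
  by (simp_all add: comp_def continuous_on_cos continuous_on_sin)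
 have half: "?c (%u. height (fst u) l)" for l
 proof -
  have cl: "?c (%u. clamp01 ((g u + 1)/2))" if "?c g" for g
   unfolding clamp01_def
   by (intro continuous_map_real_max continuous_map_real_min continuous_map_real_divide continuous_map_add that) auto
  show ?thesis using cl[OF depth, of a] cl[OF v, of "a + l"] by (cases "l < r"; cases "l = 0") (use r_pos in \<open>simp_all add: height_def\<close>)
 qed
 have ball: "closedin ?X {u\<in>topspace ?X. \<forall>j<m. P j u}" if "!!j. closedin ?X {u\<in>topspace ?X. P j u}" for m::nat and P
 proof (induction m)
  case (Suc m)
  have "{u\<in>topspace ?X. \<forall>j<Suc m. P j u} = {u\<in>topspace ?X. \<forall>j<m. P j u}\<inter>{u\<in>topspace ?X. P m u}"
   by (auto simp: less_Suc_eq)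
  thus ?case using closedin_Int[OF Suc that] by simp
 qed (use closedin_topspace[of ?X] in simp)
 let ?P = "%l u. snd (snd u) l = height (fst u) l"
 let ?Q = "%j u. Re (polar (fst u) j) = cmod (polar (fst u) j)*cos (pi*fst (snd u) j) &
   Im (polar (fst u) j) = cmod (polar (fst u) j) * sin (pi*fst (snd u) j)"
 have P: "closedin ?X {u\<in>topspace ?X. ?P l u}" for l by (rule closedin_eq_real[OF s half])
 have Q: "closedin ?X {u\<in>topspace ?X. ?Q j u}" for j
 proof -
  have "closedin ?X ({u\<in>topspace ?X. Re (polar (fst u) j) = cmod (polar (fst u) j)*cos (pi*fst (snd u) j)}
   \<inter>{u\<in>topspace ?X. Im (polar (fst u) j) = cmod (polar (fst u) j) * sin (pi*fst (snd u) j)})"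
   by (intro closedin_Int closedin_eq_real continuous_map_real_mult norm trig)
    (auto simp: polar_def simp del: topspace_prod_topology intro!: continuous_map_minus continuous_map_diff depth v)
  thus ?thesis by (rule back_subst[of "closedin ?X"]) auto
 qed
 have "polar_relation = {u\<in>topspace ?X. \<forall>l<r. ?P l u}\<inter>{u\<in>topspace ?X. \<forall>j<a. ?Q j u}"
  by (auto simp: polar_relation_def complex_eq_iff)
 hence R: "closedin ?X polar_relation" using closedin_Int[OF ball[OF P] ball[OF Q]] by simp
 show "continuous_map ?E (K_level dd dd) (%v. sphere_map (Some v))"
 proof (rule closed_relation_continuous_map[OF K continuous_cell_map R])
  fix v assume v: "v\<in>topspace ?E"
  have "polar v j = of_real (cmod (polar v j))*cis (pi*angle v j)" if "j < a" for j
   using rcis_cmod_Arg[of "polar v j"] that by (simp add: rcis_def angle_def)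
  hence "(v, angle v, height v)\<in>polar_relation"
   using v angle_height_domain by (simp add: polar_relation_def)
  thus "\<exists>z. (v, z)\<in>polar_relation" by blast
 next
  fix v z assume "(v, z)\<in>polar_relation"
  thus "sphere_map (Some v) = cell_map z"
   using cell_map_polar_relation[of v "fst z" "snd z"] by (simp add: sphere_map_def)
 qed
qed

text \<open>The coordinates added by suspension; the first 2 n + 2 r coordinates are consumed by
  \<open>angle\<close> and \<open>height\<close>.\<close>

definition tail :: "nat => vec => vec"
 where "tail N' v = (%l. if dd<=l & l < N' then v (2*n + l) else 0)"

definition lift_pt :: "nat => vec => point"
 where "lift_pt N' v = canonical_pt (angle v) (height v) (tail N' v)"

lemma lift_pt_points: "dd<=N' ==> lift_pt N' v\<in>points dd N'"
 unfolding lift_pt_def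
 by (rule canonical_pt_points) (auto simp: angle_bound height_bounds tail_def Rn_iff)

lemma depth_cong: "(!!l. l<=a ==> v l = v' l) ==> j<=a ==> depth v j = depth v' j"
 by (induction j) auto

text \<open>The structure map works on a representative chosen by \<open>SOME\<close>. It is some
  translate of \<open>lift_pt\<close>, and the group leaves the complement vector, to which the new
  coordinate is appended, alone.\<close>

lemma stabilize_sphere_map:
 "stabilize (reduced_spherical_K_spectrum dd) (2*n) dd sphere_map i (Some v)
  = (if \<exists>l<r. height v l = 0 | height v l = 1 then None else Some (orbit dd (lift_pt (dd + i) v)))"
proof (induction i arbitrary: v)
 case 0
 have "tail dd v = 0" by (auto simp: tail_def)
 thus ?case by (simp add: sphere_map_def cell_map_def lift_pt_def)
next
 case (Suc i)
 let ?X = "reduced_spherical_K_spectrum dd" and ?q = "2*n + dd + i"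
 let ?u = "v(?q := 0)"
 have d: "depth ?u j = depth v j" if "j<=a" for j by (rule depth_cong[OF _ that]) (use r_pos in auto)
 have h: "height ?u = height v" using d[of a] r_pos by (auto simp: height_def fun_eq_iff)
 have an: "angle ?u = angle v" using d r_pos by (auto simp: angle_def polar_def fun_eq_iff)
 have st: "stabilize ?X (2*n) dd sphere_map (Suc i) (Some v)
   = sigma ?X (dd + i) (if \<exists>l<r. height v l = 0 | height v l = 1 then None else Some (orbit dd (lift_pt (dd + i) ?u))) (Some (v ?q))"
  by (simp only: stabilize.simps suspend_def option.case Suc.IH h)
 show ?case
 proof (cases "\<exists>l<r. height v l = 0 | height v l = 1")
  case True
  thus ?thesis unfolding st by (simp add: reduced_spherical_K_spectrum_def homotopy_orbits_def)
 next
  case False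
  let ?p = "lift_pt (dd + i) ?u"
  have "?p\<in>orbit dd ?p" by (rule mem_orbit[OF lift_pt_points]) simp
  hence "(SOME p. p\<in>orbit dd ?p)\<in>orbit dd ?p" by (rule someI)
  then obtain g where g: "g\<in>OC dd" "(SOME p. p\<in>orbit dd ?p) = act_point dd g ?p"
   unfolding orbit_def by auto
  have w: "(tail (dd + i) ?u)(dd + i := v ?q) = tail (dd + Suc i) v"
   by (auto simp: tail_def fun_eq_iff add.assoc)
  let ?g = "%w. ((compose (Rn dd) (rot r (%i. - theta (angle v) i)) (inv\<^bsub>OG dd\<^esub> g), w), realization_map (image g) (cube r (height v)))"
  have "(SOME p. p\<in>orbit dd ?p) = (EG_act (OG dd) g (torus_pt (angle v)), ?g (tail (dd + i) ?u))"
   unfolding g(2) by (simp add: lift_pt_def canonical_pt_def act_point_def act_fibre_def neg_sphere_act_def an h)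
  from sigma_reduced_spherical_K_spectrum[OF this, of "dd" "dd + i" "v ?q"]
  have "sigma ?X (dd + i) (Some (orbit dd ?p)) (Some (v ?q)) = Some (orbit dd (act_point dd g (lift_pt (dd + Suc i) v)))"
   unfolding w by (simp add: lift_pt_def canonical_pt_def act_point_def act_fibre_def neg_sphere_act_def)
  moreover have "orbit dd (act_point dd g (lift_pt (dd + Suc i) v)) = orbit dd (lift_pt (dd + Suc i) v)"
   by (rule orbit_act[OF lift_pt_points g(1)]) simp
  ultimately show ?thesis unfolding st by (simp only: False if_False)
 qed
qed

end

section \<open>Lifts of tuples of the sphere with nonzero cochain\<close>

context torus_map
begin

text \<open>A common support vertex exhibits \<open>h\<close> as a rotation, with \<open>m\<close>
  half the difference of two corners of equal parity. When x j and y j lie on opposite sides, both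
  beyond 1/2, the case \<open>m j = 0\<close> is excluded: all common vertices would have coordinate
  0, of total weight \<open>hat (x j) < 1/2\<close>.\<close>

lemma torus_pt_overlap:
 assumes x: "!!j. j < a ==> \<bar>x j\<bar><=1" and y: "!!j. j < a ==> \<bar>y j\<bar><=1" and h: "h\<in>OC dd"
  and ov: "1/2 < overlap (torus_pt x) (EG_act (OG dd) h (torus_pt y))"
 shows "\<exists>m. h = rot r (theta (%j. 2 * of_int (m j))) &
  (\<forall>j<a. 0 < x j & 0 < y j | x j < 0 & y j < 0 | 1/2 < \<bar>x j\<bar> & 1/2 < \<bar>y j\<bar> --> nearest_odd y j + 2*m j = nearest_odd x j)"
proof -
 interpret G: group "OG dd" by (rule group_orthogonal_group)
 let ?e = "torus_pt x" and ?e' = "EG_act (OG dd) h (torus_pt y)"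
 have e: "?e\<in>EG_points dd" "torus_pt y\<in>EG_points dd" by (rule torus_pt_points, erule x, rule torus_pt_points, erule y)
 have e': "?e'\<in>EG_points dd" by (rule EG_act_points[OF e(2) h])
 have common: "\<exists>k k'. k\<in>cells & cell_weight x k~=0 & vertex k = p & cell_weight y k'~=0 &
   fst p = h \<otimes>\<^bsub>OG dd\<^esub> fst (vertex k') & snd (vertex k') = snd p" if p: "?e p~=0" "?e' p~=0" for p
 proof -
  obtain k where k: "k\<in>cells" "cell_weight x k~=0" "vertex k = p" using torus_pt_nonzeroD[OF p(1)] by blast
  obtain q where q: "torus_pt y q~=0" "(case q of (h', i) => (h \<otimes>\<^bsub>OG dd\<^esub> h', i)) = p"
   using realization_map_nonzeroD[OF p(2)[unfolded EG_act_def]] by blast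
  obtain k' where k': "k'\<in>cells" "cell_weight y k'~=0" "vertex k' = q" using torus_pt_nonzeroD[OF q(1)] by blast
  have "fst p = h \<otimes>\<^bsub>OG dd\<^esub> fst (vertex k')" "snd (vertex k') = snd p" using q(2) k'(3) by (auto simp: case_prod_beta)
  thus ?thesis using k k' by blast
 qed
 have "\<exists>p. ?e p~=0 & ?e' p~=0"
 proof (rule ccontr)
  assume "\<nexists>p. ?e p~=0 & ?e' p~=0"
  hence "overlap ?e ?e' = 0"
   unfolding overlap_def using weightsD(2)[OF weights_EG[OF e(1)]] by (intro sum.neutral ballI) (metis (mono_tags, lifting) mem_Collect_eq min.absorb2)
  thus False using ov by simp
 qed
 then obtain p where p: "?e p~=0" "?e' p~=0" by blast
 obtain k k' where k: "cell_weight x k~=0" "vertex k = p" and k': "cell_weight y k'~=0"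
  and eq: "fst p = h \<otimes>\<^bsub>OG dd\<^esub> fst (vertex k')" "snd (vertex k') = snd p" using common[OF p] by blast
 define m where "m j = (k j - k' j) div 2" for j
 let ?r = "rot r (theta (%j. 2 * of_int (m j)))"
 have m: "k j = k' j + 2*m j" if "j < a" for j
 proof -
  have "even (k j) \<longleftrightarrow> even (k' j)" using eq(2) k(2) vertex_colour[of k' k] that by simp
  hence "2 dvd k j - k' j" by presburger
  thus ?thesis by (simp add: m_def)
 qed
 let ?tt = "%k. theta (%j. of_int (k j))"
 have hk: "fst (vertex k) = h \<otimes>\<^bsub>OG dd\<^esub> fst (vertex k')" using eq(1) k(2) by simp
 have "?tt k = theta (%j. 2 * of_int (m j) + of_int (k' j))"
  unfolding theta_def by (intro ext sum.cong) (auto simp: m)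
 hence "rot r (?tt k) = ?r \<otimes>\<^bsub>OG dd\<^esub> rot r (?tt k')"
  by (simp only: rot_mult theta_add)
 hence h_eq: "h = ?r"
  using hk h rot_carrier G.right_cancel[of "rot r (?tt k')" h "?r"] by (simp add: vertex_def)
 have "nearest_odd y j + 2*m j = nearest_odd x j"
  if j: "j < a" and c: "0 < x j & 0 < y j | x j < 0 & y j < 0 | 1/2 < \<bar>x j\<bar> & 1/2 < \<bar>y j\<bar>" for j
 proof -
  have kb: "\<bar>x j - of_int (k j)\<bar> < 1" "\<bar>y j - of_int (k' j)\<bar> < 1"
   using cell_weight_nonzeroD[OF k(1) j] cell_weight_nonzeroD[OF k' j] by auto
  consider "0 < x j" "0 < y j" | "x j < 0" "y j < 0" | "1/2 < \<bar>x j\<bar>" "1/2 < \<bar>y j\<bar>" "0 < x j \<longleftrightarrow> y j < 0"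
   using c by fastforce
  thus ?thesis
  proof cases
   case 1
   hence "k j\<in>{0, 1}" "k' j\<in>{0, 1}" using kb x[OF j] y[OF j] by auto
   hence "m j = 0" using m[OF j] by auto
   thus ?thesis using 1 by (simp add: nearest_odd_def)
  next
   case 2
   hence "k j\<in>{0, -1}" "k' j\<in>{0, -1}" using kb x[OF j] y[OF j] by auto
   hence "m j = 0" using m[OF j] by auto
   thus ?thesis using 2 by (simp add: nearest_odd_def)
  next
   case opp: 3
   define s where "s = (if 0 < x j then 1 else - 1::int)"
   have nx: "u\<in>{0, s}" if "\<bar>x j - of_int u\<bar> < 1" for u using that opp x[OF j] by (auto simp: s_def)
   have ny: "u\<in>{0, - s}" if "\<bar>y j - of_int u\<bar> < 1" for u using that opp y[OF j] by (auto simp: s_def)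
   have "m j = 0 | m j = s" using nx[OF kb(1)] ny[OF kb(2)] m[OF j] by (auto simp: s_def split: if_splits)
   moreover have "m j~=0"
   proof
    assume m0: "m j = 0"
    have z: "l j = 0" if l: "l\<in>cells" "cell_weight x l~=0" "?e' (vertex l)~=0" for l
    proof -
     have "?e (vertex l)~=0" using torus_pt_vertex[OF l(1,2)] l(2) by simp
     from common[OF this l(3)] obtain l0 l' where l0: "l0\<in>cells" "cell_weight x l0~=0" "vertex l0 = vertex l"
      and l': "cell_weight y l'~=0" "fst (vertex l) = h \<otimes>\<^bsub>OG dd\<^esub> fst (vertex l')" by blast
     have "rot r (?tt l) = rot r (%i. theta (%j. of_int (2*m j)) i + ?tt l' i)"
      using l'(2) unfolding h_eq vertex_def fst_conv rot_mult by simp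
     also have "... = rot r (?tt (%j. 2*m j + l' j))" by (simp only: theta_add[symmetric] of_int_add)
     finally have "cis (?tt l (plane j)) = cis (?tt (%j. 2*m j + l' j) (plane j))"
      by (rule rot_eqD) (rule plane_less[OF j])
     hence "f j (?tt l (plane j)) = f j (?tt (%j. 2*m j + l' j) (plane j))" by (rule f_cis)
     hence "l j = l' j" unfolding f_theta[OF j] using m0 by simp
     moreover have "l j\<in>{0, s}" "l' j\<in>{0, - s}"
      using nx[OF cell_weight_nonzeroD[OF l(2) j]] ny[OF cell_weight_nonzeroD[OF l'(1) j]] .
     ultimately show ?thesis by (auto simp: s_def split: if_splits)
    qed
    have "overlap ?e ?e'<=mass ?e {p. ?e' p~=0}"
    proof -
     have fin: "finite {p. ?e p~=0}" by (rule weightsD(1)[OF weights_EG[OF e(1)]])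
     have "overlap ?e ?e'<=(\<Sum>p | ?e p~=0. if ?e' p~=0 then ?e p else 0)"
      unfolding overlap_def
     proof (rule sum_mono)
      fix p show "min (?e p) (?e' p)<=(if ?e' p~=0 then ?e p else 0)" by (cases "?e' p = 0") (simp only: if_False not_True_eq_False min.cobounded2 simp_thms, simp only: if_True min.cobounded1 simp_thms if_False not_False_eq_True)
     qed
     also have "... = mass ?e {p. ?e' p~=0}"
      unfolding mass_def using fin by (subst sum.inter_filter[symmetric]) (auto intro: sum.cong)
     finally show ?thesis .
    qed
    also have "mass ?e {p. ?e' p~=0} = (\<Sum>l | l\<in>cells & vertex l\<in>{p. ?e' p~=0}. cell_weight x l)"
     unfolding torus_pt_def by (rule pushed_mass) simp
    also have "...<=(\<Sum>l | l\<in>cells & l j = 0. cell_weight x l)"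
    proof -
     have "(\<Sum>l | l\<in>cells & vertex l\<in>{p. ?e' p~=0}. cell_weight x l)
       = (\<Sum>l | l\<in>cells & vertex l\<in>{p. ?e' p~=0} & cell_weight x l~=0. cell_weight x l)"
      by (rule sum.mono_neutral_right) auto
     also have "...<=(\<Sum>l | l\<in>cells & l j = 0. cell_weight x l)"
      by (rule sum_mono2) (use z cell_weight_nonneg in auto)
     finally show ?thesis .
    qed
    also have "... = hat (x j)" using cell_weight_sum(2)[of x j 0] x j by simp
    also have "... < 1/2" using opp by (auto simp: hat_def max_def)
    finally show False using ov by simp
   qed
   ultimately show ?thesis using opp by (auto simp: nearest_odd_def s_def)
  qed
 qed
 thus ?thesis using h_eq by blast
qed

definition sphere_value :: "vec => point set option"
 where "sphere_value v = (if \<exists>l<r. height v l = 0 | height v l = 1 then None else Some (orbit dd (lift_pt N v)))"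

lemma stabilize_sphere_value:
 "stabilize (reduced_spherical_K_spectrum dd) (2*n) dd sphere_map (N - dd) (Some v) = sphere_value v"
 using stabilize_sphere_map[of "N - dd" v] rN by (simp add: sphere_value_def)

lemma angle_sign:
 assumes "j < a"
 shows "c < v j ==> 0 < angle v j" "v j < c ==> angle v j < 0" "0 < depth v j ==> 1/2 < \<bar>angle v j\<bar>"
proof -
 show "c < v j ==> 0 < angle v j" using assms by (simp add: angle_def Arg_pos_iff polar_def)
 show "v j < c ==> angle v j < 0" using assms by (simp add: angle_def Arg_neg_iff polar_def divide_neg_pos)
 assume "0 < depth v j"
 hence "\<not> \<bar>Arg (polar v j)\<bar><=pi/2" unfolding Arg_Re_nonneg by (simp add: polar_def)
 thus "1/2 < \<bar>angle v j\<bar>" using assms by (simp add: angle_def abs_divide field_simps)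
qed

text \<open>The support of \<open>cube r s\<close> consists of coordinate subspaces, which grow by
  whole planes, so none is strictly between consecutive members of the flag. Directions are then
  read from the label.\<close>

lemma cube_dir_set: "perm_frame sg = b ==> sg ` {..<r}\<subseteq>{..<r} ==> inj_on sg {..<r} ==> i < r ==> 0 < de ==>
  dir_set dd de b i (cube r s) = {}"
proof (rule ccontr)
 assume b: "perm_frame sg = b" and sg: "sg ` {..<r}\<subseteq>{..<r}" "inj_on sg {..<r}" and i: "i < r" and de: "0 < de"
 assume "dir_set dd de b i (cube r s)~={}"
 then obtain U where U: "de<=cube r s U" "flag b i \<subset> U" "U \<subset> flag b (Suc i)" unfolding dir_set_def by blast
 have "cube r s U~=0" using U(1) de by simp
 then obtain S where S: "S\<subseteq>{..<r}" "U = cspace r S" using cube_nonzeroD by blast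
 have fl: "flag b l = cspace r (sg ` {..<l})" "sg ` {..<l}\<subseteq>{..<r}" if "l<=r" for l
  using flag_perm_frame[OF sg that] b subset_trans[OF image_mono sg(1), of "{..<l}"] that by simp_all
 have "sg ` {..<i} \<subset> S" "S \<subset> sg ` {..<Suc i}"
  using U S i fl[of i] fl[of "Suc i"] cspace_subset_iff[of _ r] by (simp_all add: psubset_eq cspace_eq_iff)
 thus False by (auto simp: lessThan_Suc)
qed

text \<open>The label rotates by an integral combination of the dual angles, so the functional
  returns an integer. If the permutation moves the plane, only angles dual to other functionals are
  seen and the value is 0.\<close>

lemma dir_fun_canonical:
 assumes sg: "sg ` {..<r}\<subseteq>{..<r}" "inj_on sg {..<r}" and j: "j < a"
  and p: "fst p = EG_act (OG dd) (rot r (theta (%j. 2 * of_int (m j)))) (torus_pt (angle v))" "snd (snd p) = cube r s"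
 shows "dir_fun (perm_frame sg) j p = (if plane j = sg (plane j) then of_int (2*m j + nearest_odd (angle v) j) else 0)"
proof -
 note i = plane_less[OF j]
 have e: "torus_pt (angle v)\<in>EG_points dd" by (rule torus_pt_points) (rule angle_bound)
 have "label (fst p) = rot r (theta (%j. of_int (2*m j + nearest_odd (angle v) j)))"
  unfolding p(1) label_EG_act[OF e rot_carrier] label_torus_pt[of "angle v", OF angle_bound] rot_mult theta_add[symmetric] by simp
 moreover have "dir_set dd (2 * tau) (perm_frame sg) (plane j) (snd (snd p)) = {}"
  unfolding p(2) by (rule cube_dir_set[OF refl sg i]) (simp add: tau_pos)
 ultimately have "direction dd (2 * tau) (perm_frame sg) (plane j) p
   = cis (theta (%j. of_int (2*m j + nearest_odd (angle v) j)) (sg (plane j)))"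
  using label_dir_perm_frame[of sg "plane j" r] sg(1) i unfolding direction_def by auto
 thus ?thesis
  unfolding dir_fun_def by (simp only: angle_functional_Arg_cis[OF f] f_theta[OF j])
qed

text \<open>The lift is translated so that it starts with \<open>lift_pt N (vs ! 0)\<close>; by
  \<open>torus_pt_overlap\<close> the other entries then differ from theirs by integral data. If the
  j-th angles of all entries were compatible with the first, those integers would cancel and
  direction function \<open>j\<close> would be constant. So the walls are crossed, and the
  permutation of the planes is the identity.\<close>

lemma lift_nonzeroD:
 assumes lift: "lift (map sphere_value vs) ps b" and nz: "cochain b ps~=0" and len: "2*n + dd < length vs"
 shows "v\<in>set vs ==> l < r ==> height v l~=0 & height v l~=1"
  and "j < a ==> \<exists>v\<in>set vs. v j<=c" "j < a ==> \<exists>v\<in>set vs. c<=v j" "j < a ==> \<exists>v\<in>set vs. depth v j<=0"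
  and "1<=i ==> i<=r ==> \<exists>v\<in>set vs. \<exists>v'\<in>set vs.
   threshold i < Min (insert 1 (height v ` {..<i})) & \<not> threshold i < Min (insert 1 (height v' ` {..<i}))"
proof -
 interpret G: group "OG dd" by (rule group_orthogonal_group)
 have eq: "map sphere_value vs = map (%p. Some (orbit dd p)) ps" and cl: "cluster (set ps)"
  and ad: "!!p. p\<in>set ps ==> adapted b p" using lift by (auto simp: lift_def)
 have pts: "set ps\<subseteq>points dd N" using cl by (simp add: cluster_def)
 have lps: "length ps = length vs" using map_eq_imp_length_eq[OF eq] by simp
 have val: "sphere_value (vs ! k) = Some (orbit dd (ps ! k))" if "k < length vs" for k
  using arg_cong[OF eq, of "%l. l ! k"] that lps by simp
 have int: "height v l~=0 & height v l~=1" if "v\<in>set vs" "l < r" for v l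
 proof -
  obtain k where "k < length vs" "vs ! k = v" using \<open>v\<in>set vs\<close> by (auto simp: in_set_conv_nth)
  hence "sphere_value v~=None" using val by fastforce
  thus ?thesis using \<open>l < r\<close> unfolding sphere_value_def by meson
 qed
 thus "v\<in>set vs ==> l < r ==> height v l~=0 & height v l~=1" .
 have "\<exists>g\<in>OC dd. ps ! k = act_point dd g (lift_pt N (vs ! k))" if k: "k < length vs" for k
 proof (rule orbit_eqD)
  show "orbit dd (ps ! k) = orbit dd (lift_pt N (vs ! k))"
   using val[OF k] int[OF nth_mem[OF k]] by (auto simp: sphere_value_def split: if_splits)
  show "ps ! k\<in>points dd N" using pts k lps by auto
 qed
 then obtain g where g: "!!k. k < length vs ==> g k\<in>OC dd"
  "!!k. k < length vs ==> ps ! k = act_point dd (g k) (lift_pt N (vs ! k))" by metis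
 have v0: "0 < length vs" using len by linarith
 let ?i = "inv\<^bsub>OG dd\<^esub> g 0"
 have i: "?i\<in>OC dd" using g(1)[OF v0] by simp
 define h where "h k = ?i \<otimes>\<^bsub>OG dd\<^esub> g k" for k
 have h: "h k\<in>OC dd" if "k < length vs" for k using i g(1)[OF that] by (simp add: h_def)
 define qs where "qs = map (act_point dd ?i) ps"
 have lqs: "length qs = length vs" using lps by (simp add: qs_def)
 have lp: "lift_pt N v\<in>points dd N" for v by (rule lift_pt_points[OF rN])
 have qs: "qs ! k = act_point dd (h k) (lift_pt N (vs ! k))" if "k < length vs" for k
  using act_point_act[OF lp i g(1)[OF that]] g(2)[OF that] that lps by (simp add: qs_def h_def)
 have e: "torus_pt (angle v)\<in>EG_points dd" for v by (rule torus_pt_points) (rule angle_bound)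
 have ov: "1/2 < overlap (torus_pt (angle (vs ! 0))) (EG_act (OG dd) (h k) (torus_pt (angle (vs ! k))))" if k: "k < length vs" for k
 proof -
  have "1/2 < overlap (fst (ps ! 0)) (fst (ps ! k))"
   using cluster_near[OF cl, of "ps ! 0" "ps ! k"] v0 k lps by (simp add: near_def)
  also have "overlap (fst (ps ! 0)) (fst (ps ! k)) = overlap (fst (qs ! 0)) (fst (qs ! k))"
  proof -
   have "ps ! 0\<in>points dd N" "ps ! k\<in>points dd N" 
    using subsetD[OF pts, OF nth_mem[of 0 ps]] subsetD[OF pts, OF nth_mem[of k ps]] v0 k lps by simp_all
   thus ?thesis
    using overlap_EG_act[OF _ _ i, of "fst (ps ! 0)" "fst (ps ! k)"] v0 k lps by (auto simp: qs_def act_point_fst_snd points_def)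
  qed
  also have "fst (qs ! 0) = torus_pt (angle (vs ! 0))"
   using qs[OF v0] EG_act_one[OF e] g(1)[OF v0] by (simp add: h_def act_point_fst_snd lift_pt_def canonical_pt_def)
  finally show ?thesis using qs[OF k] by (simp add: act_point_fst_snd lift_pt_def canonical_pt_def)
 qed
 let ?C = "%x y::real. 0 < x & 0 < y | x < 0 & y < 0 | 1/2 < \<bar>x\<bar> & 1/2 < \<bar>y\<bar>"
 have "\<exists>m. k < length vs --> h k = rot r (theta (%j. 2 * of_int (m j))) &
   (\<forall>j<a. ?C (angle (vs ! 0) j) (angle (vs ! k) j) --> nearest_odd (angle (vs ! k)) j + 2*m j = nearest_odd (angle (vs ! 0)) j)" for k
 proof (cases "k < length vs")
  case True
  from torus_pt_overlap[OF angle_bound angle_bound h[OF True] ov[OF True]] show ?thesis using True by blast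
 qed simp
 then obtain m where m: "!!k. k < length vs ==> h k = rot r (theta (%j. 2 * of_int (m k j)))"
  "!!k j. k < length vs ==> j < a ==> ?C (angle (vs ! 0) j) (angle (vs ! k) j) ==>
   nearest_odd (angle (vs ! k)) j + 2*m k j = nearest_odd (angle (vs ! 0)) j" by metis
 have cub: "snd (snd (qs ! k)) = cube r (height (vs ! k))" if k: "k < length vs" for k
  using cube_rot[of r "height (vs ! k)"] height_bounds by (simp add: qs[OF k] m(1)[OF k] act_point_fst_snd lift_pt_def canonical_pt_def)
 have tor: "fst (qs ! k) = EG_act (OG dd) (rot r (theta (%j. 2 * of_int (m k j)))) (torus_pt (angle (vs ! k)))" if k: "k < length vs" for k
  by (simp add: qs[OF k] m(1)[OF k] act_point_fst_snd lift_pt_def canonical_pt_def)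
 let ?b = "%l. ?i (b l)"
 have fr: "frame dd b" using ad[of "ps ! 0"] v0 lps by (simp add: adapted_def)
 have ad': "adapted ?b q" if q: "q\<in>set qs" for q
 proof -
  obtain p where p: "p\<in>set ps" "q = act_point dd ?i p" using q by (auto simp: qs_def)
  have t: "snd (snd p)\<in>ST_points dd" using pts p(1) by (auto simp: points_def)
  show ?thesis using ad[OF p(1)] frame_act[OF fr i] flag_weight_act[OF t i fr]
   unfolding p(2) adapted_def act_point_fst_snd by simp
 qed
 \<comment> \<open>Each member of the translated flag carries weight of a cube point, hence is a
   coordinate subspace.\<close>
 have "\<exists>S\<subseteq>{..<r}. flag ?b l = cspace r S" if "l<=r" for l
  using ad'[of "qs ! 0"] cub[OF v0] that lqs v0 nth_mem[of 0 qs] unfolding adapted_def by (metis cube_nonzeroD)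
 from adapted_perm_frame[OF frame_act[OF fr i] this] obtain sg where sg: "sg ` {..<r}\<subseteq>{..<r}" "inj_on sg {..<r}"
  and fl: "!!l. l<=r ==> flag ?b l = flag (perm_frame sg) l" by blast
 have qpts: "set qs\<subseteq>points dd N" using pts act_point_points[OF _ i] by (auto simp: qs_def)
 have "cochain (perm_frame sg) qs = cochain ?b qs"
  by (rule cochain_frame_independent[OF qpts]) (use lqs v0 ad' fl frame_perm_frame[OF sg] in \<open>auto simp: adapted_def\<close>)
 also have "... = cochain b ps" unfolding qs_def by (rule cochain_act[OF fr i pts])
 finally have nz': "cochain (perm_frame sg) qs~=0" using nz by simp
 have len': "2*n + dd < length qs" using len lqs by simp
 have dir: "dir_fun (perm_frame sg) j (qs ! k)
   = (if plane j = sg (plane j) then of_int (2*m k j + nearest_odd (angle (vs ! k)) j) else 0)" if "j < a" "k < length vs" for j k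
  by (rule dir_fun_canonical[OF sg that(1) tor[OF that(2)] cub[OF that(2)]])
 have jump: "plane j = sg (plane j) & (\<exists>k<length vs. \<not> ?C (angle (vs ! 0) j) (angle (vs ! k) j))" if j: "j < a" for j
 proof (rule ccontr)
  assume n: "\<not> ?thesis"
  have "dir_fun (perm_frame sg) j q = (if plane j = sg (plane j) then of_int (nearest_odd (angle (vs ! 0)) j) else 0)" if hq: "q\<in>set qs" for q
  proof -
   obtain k where k: "k < length vs" "q = qs ! k" using hq lqs by (auto simp: in_set_conv_nth)
   show ?thesis unfolding k(2) dir[OF j k(1)] using m(2)[OF k(1) j] n k(1) by (auto simp: add.commute)
  qed
  thus False using cochain_nonzeroD(1)[OF nz' len' j] by auto
 qed
 have vset: "vs ! k\<in>set vs" if "k < length vs" for k using that by simp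
 show "j < a ==> \<exists>v\<in>set vs. v j<=c" using jump[of j] angle_sign(1)[of j] vset[OF v0] vset by (meson not_le)
 show "j < a ==> \<exists>v\<in>set vs. c<=v j" using jump[of j] angle_sign(2)[of j] vset[OF v0] vset by (meson not_le)
 show "j < a ==> \<exists>v\<in>set vs. depth v j<=0" using jump[of j] angle_sign(3)[of j] vset[OF v0] vset by (meson not_le)
 have id: "sg i = i" if "i < r" for i using plane_surj[OF that] jump by metis
 assume il: "1<=i" "i<=r"
 have "flag (perm_frame sg) i = cspace r {..<i}"
  using flag_perm_frame[OF sg il(2)] image_cong[OF refl, of "{..<i}" sg "%i. i"] id il(2) by simp
 hence lev: "level_fun (perm_frame sg) i (qs ! k) = of_bool (threshold i < Min (insert 1 (height (vs ! k) ` {..<i})))" if "k < length vs" for k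
  using cube_mass[of r "height (vs ! k)" "{..<i}"] height_bounds il(2) cub[OF that] by (simp add: level_fun_def)
 obtain x y where "x\<in>set qs" "y\<in>set qs" "level_fun (perm_frame sg) i x~=level_fun (perm_frame sg) i y"
  using cochain_nonzeroD(2)[OF nz' len' il] by blast
 then obtain k k' where "k < length vs" "k' < length vs" "level_fun (perm_frame sg) i (qs ! k)~=level_fun (perm_frame sg) i (qs ! k')"
  using lqs by (auto simp: in_set_conv_nth)
 thus "\<exists>v\<in>set vs. \<exists>v'\<in>set vs.
   threshold i < Min (insert 1 (height v ` {..<i})) & \<not> threshold i < Min (insert 1 (height v' ` {..<i}))"
  using lev vset by (metis of_bool_eq_iff)
qed

end

section \<open>Localisation of the support\<close>

context torus_map
begin

lemma half_shift: "(d + 1)/2 = h ==> 0<=h ==> \<bar>d + 1\<bar> = 2*h & - 1<=d" for d h::real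
 by (auto simp: abs_if field_simps)

lemma clamp01_lipschitz: "\<bar>clamp01 x - clamp01 y\<bar><=\<bar>x - y\<bar>"
 by (auto simp: clamp01_def max_def min_def)

lemma half_close: "\<bar>d - e\<bar><=ep ==> \<bar>clamp01 ((d + 1)/2) - clamp01 ((e + 1)/2)\<bar><=ep"
proof -
 assume "\<bar>d - e\<bar><=ep"
 hence "\<bar>(d + 1)/2 - (e + 1)/2\<bar><=ep" by (simp add: diff_divide_distrib[symmetric])
 thus ?thesis using order_trans[OF clamp01_lipschitz] by blast
qed

lemma threshold_eq: "threshold i = 1 - 8 * tau*real i"
 by (simp add: threshold_def tau_def field_simps)

lemma threshold_bounds: "i<=r ==> 8 * tau<=threshold i" "1<=i ==> threshold i<=1 - 8 * tau" "i < i' ==> threshold i' + 8 * tau<=threshold i"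
proof -
 have "8 * tau*(real r + 1) = 1" by (simp add: tau_def)
 hence "8 * tau*real r + 8 * tau = 1" by (simp add: distrib_left)
 moreover have "8 * tau*real i<=8 * tau*real r" if "i<=r" using that tau_pos by (intro mult_left_mono) auto
 ultimately show "i<=r ==> 8 * tau<=threshold i" unfolding threshold_eq by linarith
 show "1<=i ==> threshold i<=1 - 8 * tau"
  using mult_left_mono[of 1 "real i" "8 * tau"] tau_pos by (simp add: threshold_eq)
 assume "i < i'"
 thus "threshold i' + 8 * tau<=threshold i"
  using mult_left_mono[of "real i + 1" "real i'" "8 * tau"] tau_pos by (simp add: threshold_eq algebra_simps)
qed

lemma depth_lipschitz:
 assumes "!!l. l<=a ==> \<bar>v l - v' l\<bar><=de" "0<=de" "j<=a"
 shows "\<bar>depth v j - depth v' j\<bar><=2^j*de"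
 using assms(3)
proof (induction j)
 case (Suc j)
 have m: "\<bar>max x y - max x' y'\<bar><=e" if "\<bar>x - x'\<bar><=e" "\<bar>y - y'\<bar><=e" for x y x' y' e::real
  using that by (auto simp: max_def)
 have "de<=2^j*de" using assms(2) mult_right_mono[of 1 "2^j" de] by simp
 hence "\<bar>v j - v' j\<bar><=2^j*de" using assms(1)[of j] Suc.prems by linarith
 hence "\<bar>\<bar>v j - c\<bar> - \<bar>v' j - c\<bar>\<bar><=2^j*de" by linarith
 moreover have "\<bar>\<bar>depth v j\<bar> - \<bar>depth v' j\<bar>\<bar><=2^j*de" using Suc by linarith
 ultimately have "\<bar>max \<bar>depth v j\<bar> \<bar>v j - c\<bar> - max \<bar>depth v' j\<bar> \<bar>v' j - c\<bar>\<bar><=2^j*de" by (intro m)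
 hence "2*\<bar>max \<bar>depth v j\<bar> \<bar>v j - c\<bar> - max \<bar>depth v' j\<bar> \<bar>v' j - c\<bar>\<bar><=2^Suc j*de"
  unfolding power_Suc mult.assoc by (rule mult_left_mono) simp
 also have "2*\<bar>x - y\<bar> = \<bar>(2*x - 3) - (2*y - 3)\<bar>" for x y::real by (simp add: abs_if)
 finally show ?case by (simp only: depth.simps)
qed (use assms in simp)

lemma height_lipschitz:
 assumes v: "!!l. l < 2*n + dd ==> \<bar>v l - v' l\<bar><=de" and de: "0<=de"
 shows "\<bar>height v l - height v' l\<bar><=2^a*de"
proof (cases "l < r")
 case True
 have p: "de<=2^a*de" using de mult_right_mono[of 1 "2^a" de] by simp
 have "\<bar>depth v a - depth v' a\<bar><=2^a*de"
  by (rule depth_lipschitz[OF _ de order_refl]) (use v r_pos in simp)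
 moreover have "\<bar>v (a + l) - v' (a + l)\<bar><=2^a*de" using v[of "a + l"] True p by auto
 ultimately show ?thesis using True half_close by (cases "l = 0") (simp_all add: height_def)
qed (use de in \<open>simp add: height_def\<close>)

text \<open>Where the pulled back cochain can be nonzero: near all walls, on the branch where the
  negative depth dominates the maximum, with heights near their thresholds.\<close>

definition locus :: "real => vec => bool"
 where "locus de v \<longleftrightarrow> (\<forall>j<a. \<bar>v j - c\<bar><=de) & (\<forall>j<a. depth v (Suc j) = - 2*depth v j - 3) &
  (\<forall>l<r. \<bar>height v l - threshold (Suc l)\<bar><=2^a*de)"

text \<open>The crossings supplied by \<open>lift_nonzeroD\<close> happen at some entries; Lipschitz
  bounds for depth and height carry them to every entry of the small tuple.\<close>

lemma lift_nonzero_locus: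
 assumes lift: "lift (map sphere_value vs) ps b" and nz: "cochain b ps~=0" and len: "2*n + dd < length vs"
  and close: "!!v v' l. v\<in>set vs ==> v'\<in>set vs ==> l < 2*n + dd ==> \<bar>v l - v' l\<bar><=de"
  and de: "0 < de" "2^a*de<=tau" and v: "v\<in>set vs"
 shows "locus de v"
proof -
 note D = lift_nonzeroD[OF lift nz len]
 have close_a: "\<bar>x l - y l\<bar><=de" if "x\<in>set vs" "y\<in>set vs" "l<=a" for x y l
  using close[OF that(1,2), of l] that(3) r_pos by simp
 have p: "de<=2^a*de" using de mult_right_mono[of 1 "2^a" de] by simp
 have t16: "tau<=1/16" using r_pos by (simp add: tau_def field_simps)
 have L1: "\<bar>x j - c\<bar><=de" if x: "x\<in>set vs" and j: "j < a" for x j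
 proof -
  obtain y y' where "y\<in>set vs" "y j<=c" "y'\<in>set vs" "c<=y' j" using D(2,3)[OF j] by blast
  thus ?thesis using close_a[OF x, of y j] close_a[OF x, of y' j] j by (simp add: abs_le_iff)
 qed
 have hl: "\<bar>height x l - height y l\<bar><=2^a*de" if "x\<in>set vs" "y\<in>set vs" for x y l
  by (rule height_lipschitz) (use close that de in auto)
 \<comment> \<open>Strong induction: heights of smaller index are already near larger thresholds, so
   only height \<open>l\<close> can bring the minimum below
   \<open>threshold (Suc l)\<close>.\<close>
 have L3: "\<bar>height x l - threshold (Suc l)\<bar><=2^a*de" if "x\<in>set vs" "l < r" for x l
  using that
 proof (induction l arbitrary: x rule: less_induct)
  case (less l)
  obtain y y' where y: "y\<in>set vs" "y'\<in>set vs" "threshold (Suc l) < Min (insert 1 (height y ` {..<Suc l}))"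
   "\<not> threshold (Suc l) < Min (insert 1 (height y' ` {..<Suc l}))"
   using D(5)[of "Suc l"] less.prems by auto
  have "threshold (Suc l) < height y l" using y(3) by simp
  moreover have "height y' l<=threshold (Suc l)"
  proof -
   have "threshold (Suc l) < 1" using threshold_bounds(2)[of "Suc l"] tau_pos by simp
   then obtain i where i: "i<=l" "height y' i<=threshold (Suc l)" using y(4) by (auto simp: not_less less_Suc_eq_le)
   have "i = l"
   proof (rule ccontr)
    assume "i~=l"
    hence "i < l" using i(1) by simp
    hence "\<bar>height y' i - threshold (Suc i)\<bar><=2^a*de" "threshold (Suc l) + 8 * tau<=threshold (Suc i)"
     using less.IH[of i y'] y(2) less.prems(2) threshold_bounds(3)[of "Suc i" "Suc l"] by auto
    thus False using i(2) de(2) tau_pos by linarith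
   qed
   thus ?thesis using i(2) by simp
  qed
  ultimately show ?case using hl[OF less.prems(1) y(1), of l] hl[OF less.prems(1) y(2), of l] by linarith
 qed
 have dep: "(depth x a + 1)/2 = height x 0" if x: "x\<in>set vs" for x
  using D(1)[OF x r_pos] r_pos by (auto simp: height_def clamp01_def max_def min_def split: if_splits)
 \<comment> \<open>Downward induction from \<open>a\<close>. As -1 is fixed by d \<mapsto> - 2 d -
   3, each step back halves the distance to -1; an entry with depth at most 0 rules out the other
   branch d \<mapsto> 2 d - 3.\<close>
 have "\<forall>x\<in>set vs. \<bar>depth x j + 1\<bar><=(if j = a then 2 else 1)*height x 0 & (j = a --> -1<=depth x j) &
   (\<forall>i. j<=i --> i < a --> depth x (Suc i) = - 2*depth x i - 3)" if "j<=a" for j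
  using that
 proof (induction rule: inc_induct)
  case base
  have "\<bar>depth x a + 1\<bar><=2*height x 0 & - 1<=depth x a" if "x\<in>set vs" for x
   using half_shift[OF dep[OF that] height_bounds(1)] by simp
  thus ?case by simp
 next
  case (step j)
  have big: "1/2<=\<bar>depth x j\<bar> & depth x (Suc j) = 2*\<bar>depth x j\<bar> - 3" if x: "x\<in>set vs" for x
  proof -
   let ?m = "max \<bar>depth x j\<bar> \<bar>x j - c\<bar>"
   have "- 1<=depth x (Suc j) + 1"
    using bspec[OF step.IH x] height_bounds(2)[of x 0] by (cases "Suc j = a") (auto simp: abs_le_iff)
   also have "... = 2*?m - 2" by simp
   finally have *: "- 1<=2*?m - 2" .
   have "1/2<=m" if "- 1<=2*m - 2" for m::real using that by linarith
   from this[OF *] have "1/2<=?m" .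
   moreover have "\<bar>x j - c\<bar> < 1/2" using L1[OF x step.hyps(2)] p de t16 by linarith
   ultimately show ?thesis by (auto simp: max_def split: if_splits)
  qed
  obtain y where y: "y\<in>set vs" "depth y j<=0" using D(4)[OF step.hyps(2)] by blast
  show ?case
  proof
   fix x assume x: "x\<in>set vs"
   have "\<bar>depth x j - depth y j\<bar><=2^j*de"
    by (rule depth_lipschitz) (use close_a[OF x y(1)] de step.hyps in auto)
   also have "...<=2^a*de" using de(1) step.hyps(2) by (intro mult_right_mono power_increasing) auto
   finally have "depth x j < 0" using big[OF x] big[OF y(1)] y(2) de(2) t16 by linarith
   hence s: "depth x (Suc j) = - 2*depth x j - 3" using big[OF x] by linarith
   moreover have "\<bar>depth x (Suc j) + 1\<bar><=2*height x 0"
    using bspec[OF step.IH x] height_bounds(1)[of x 0] by (auto split: if_splits)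
   ultimately have "\<bar>depth x j + 1\<bar><=height x 0" by linarith
   thus "\<bar>depth x j + 1\<bar><=(if j = a then 2 else 1)*height x 0 & (j = a --> -1<=depth x j) &
     (\<forall>i. j<=i --> i < a --> depth x (Suc i) = - 2*depth x i - 3)"
   proof (intro conjI allI impI)
    show "\<bar>depth x j + 1\<bar><=(if j = a then 2 else 1)*height x 0"
     using \<open>\<bar>depth x j + 1\<bar><=height x 0\<close> step.hyps(2) by simp
    show "j = a ==> -1<=depth x j" using step.hyps(2) by simp
    fix i assume "j<=i" "i < a"
    then consider "i = j" | "Suc j<=i" "i < a" by linarith
    thus "depth x (Suc i) = - 2*depth x i - 3" by cases (use s bspec[OF step.IH x] in blast)+
   qed
  qed
 qed
 from this[of 0] show ?thesis unfolding locus_def using v L1 L3 by auto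
qed

text \<open>On the locus \<open>depth v a + 1\<close> is (-2)^a (v a + 1), so height 0 has slope
  (-2)^a/2 in \<open>v a\<close>; the other heights have slope 1/2. The matching
  \<open>boundary i\<close> is the place where factor \<open>i\<close> jumps.\<close>

definition slope :: "nat => real"
 where "slope i = (if i < a then 1 else if i = a then (- 2)^a/2 else 1/2)"

definition boundary :: "nat => real"
 where "boundary i = (if i < a then c else if i = a then 2 * threshold 1/(- 2)^a - 1 else 2 * threshold (Suc (i - a)) - 1)"

lemma slope_bound: "\<bar>slope i\<bar><=2^a" and slope_nonzero: "slope i~=0"
proof -
 have "1<=(2::real)^a" by simp
 moreover from this have "1/2<=(2::real)^a" by linarith
 ultimately show "\<bar>slope i\<bar><=2^a" by (auto simp: slope_def power_abs abs_divide)
qed (simp add: slope_def)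

lemma slope_first: "slope a*(v - boundary a) = (- 2)^a*(v + 1)/2 - threshold 1"
 by (simp add: slope_def boundary_def field_simps)

text \<open>The bound on \<open>u\<close> keeps all depths up to index a - 1 below
  \<open>- 7 * tau\<close>, so they dominate |v j - c| and the recursion stays on its linear
  branch.\<close>

lemma separating_locus:
 assumes s: "!!i. i < a + r ==> \<bar>v i - boundary i\<bar><=de" and de: "0 < de" "2^a*de<=tau"
 shows "locus de v"
proof -
 have p: "de<=2^a*de" using de mult_right_mono[of 1 "2^a" de] by simp
 have L1: "\<bar>v j - c\<bar><=de" if "j < a" for j using s[of j] that by (simp add: boundary_def)
 define u where "u = (- 2)^a*(v a + 1)/2"
 have "\<bar>u - threshold 1\<bar> = \<bar>slope a\<bar>*\<bar>v a - boundary a\<bar>" unfolding u_def slope_first[symmetric] by (rule abs_mult)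
 also have "...<=2^a*de" using slope_bound[of a] s[of a] r_pos by (intro mult_mono) auto
 finally have u: "\<bar>u - threshold 1\<bar><=2^a*de" .
 have th: "8 * tau<=threshold 1" "threshold 1<=1 - 8 * tau" using threshold_bounds(1,2)[of 1] r_pos by auto
 have "depth v j + 1 = (- 2)^j*(v a + 1) & (\<forall>i<j. depth v (Suc i) = - 2*depth v i - 3)" if "j<=a" for j
  using that
 proof (induction j)
  case (Suc j)
  hence IH: "depth v j + 1 = (- 2)^j*(v a + 1)" by simp
  have "\<bar>(- 2)^j*(v a + 1)\<bar><=\<bar>u\<bar>"
  proof -
   have "(2::real)^Suc j<=2^a" using Suc.prems by (intro power_increasing) auto
   hence "2^Suc j*\<bar>v a + 1\<bar><=2^a*\<bar>v a + 1\<bar>" by (intro mult_right_mono) auto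
   thus ?thesis by (simp add: u_def abs_mult power_abs)
  qed
  hence "depth v j<=- (7 * tau)" unfolding IH[symmetric] using u th de tau_pos by linarith
  moreover have "\<bar>v j - c\<bar><=tau" using L1[OF Suc_le_lessD[OF Suc.prems]] p de(2) by linarith
  ultimately have "max \<bar>depth v j\<bar> \<bar>v j - c\<bar> = - depth v j" using tau_pos by (simp add: max_def)
  hence "depth v (Suc j) = - 2*depth v j - 3" by simp
  thus ?case using Suc IH by (auto simp: less_Suc_eq)
 qed simp
 from this[of a] have d: "depth v a + 1 = (- 2)^a*(v a + 1)" and L2: "!!i. i < a ==> depth v (Suc i) = - 2*depth v i - 3" by auto
 have "\<bar>height v l - threshold (Suc l)\<bar><=2^a*de" if l: "l < r" for l
 proof -
  have "clamp01 (((2 * threshold (Suc l) - 1) + 1)/2) = threshold (Suc l)"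
   using threshold_bounds(1,2)[of "Suc l"] l tau_pos by (simp add: clamp01_def)
  moreover have "\<bar>clamp01 (((if l = 0 then depth v a else v (a + l)) + 1)/2) - clamp01 (((2 * threshold (Suc l) - 1) + 1)/2)\<bar><=2^a*de"
  proof (cases "l = 0")
   case True
   have "\<bar>(depth v a + 1)/2 - threshold 1\<bar><=2^a*de" using u d by (simp add: u_def)
   thus ?thesis using True order_trans[OF clamp01_lipschitz] by simp
  next
   case False
   have "\<bar>v (a + l) - (2 * threshold (Suc l) - 1)\<bar><=2^a*de" using order_trans[OF s p, of "a + l"] l False by (simp add: boundary_def)
   from half_close[OF this] show ?thesis using False by simp
  qed
  ultimately show ?thesis using l by (simp add: height_def)
 qed
 thus ?thesis unfolding locus_def using L1 L2 by simp
qed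

lemma locusD:
 assumes v: "locus de v" and de: "0 < de" "2^a*de<=tau"
 shows "l < r ==> 0 < height v l & height v l < 1"
  and "(depth v a + 1)/2 = height v 0" "depth v a + 1 = (- 2)^a*(v a + 1)"
  and "j < a ==> \<bar>angle v j\<bar><=de/tau"
  and "l < r ==> threshold (Suc l) < Min (insert 1 (height v ` {..<Suc l})) \<longleftrightarrow> 0 < slope (a + l)*(v (a + l) - boundary (a + l))"
proof -
 have L1: "!!j. j < a ==> \<bar>v j - c\<bar><=de" and L2: "!!j. j < a ==> depth v (Suc j) = - 2*depth v j - 3"
  and L3: "!!l. l < r ==> \<bar>height v l - threshold (Suc l)\<bar><=2^a*de" using v by (auto simp: locus_def)
 have hb: "7 * tau<=height v l & height v l<=1 - 7 * tau" if "l < r" for l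
  using L3[OF that] threshold_bounds(1,2)[of "Suc l"] that de by auto
 thus int: "l < r ==> 0 < height v l & height v l < 1" for l using tau_pos by fastforce
 show h0: "(depth v a + 1)/2 = height v 0"
  using int[OF r_pos] r_pos by (auto simp: height_def clamp01_def max_def min_def split: if_splits)
 have dj: "depth v j + 1 = (- 2)^j*(v a + 1)" if "j<=a" for j
  using that by (induction j) (simp, simp add: L2 algebra_simps del: depth.simps(2))
 show da: "depth v a + 1 = (- 2)^a*(v a + 1)" by (rule dj) simp
 show "\<bar>angle v j\<bar><=de/tau" if j: "j < a"
 proof -
  have "(2::real)^Suc j<=2^a" using j by (intro power_increasing) auto
  hence "2^Suc j*\<bar>v a + 1\<bar><=2^a*\<bar>v a + 1\<bar>" by (intro mult_right_mono) auto
  hence "2*\<bar>depth v j + 1\<bar><=\<bar>depth v a + 1\<bar>" using dj[of j] da j by (simp add: abs_mult power_abs)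
  hence "\<bar>depth v j + 1\<bar><=height v 0" using half_shift[OF h0 height_bounds(1)] by simp
  hence R: "tau<=- depth v j" using conjunct2[OF hb[OF r_pos]] tau_pos by linarith
  have "Arg (polar v j) = arctan ((v j - c)/(- depth v j))"
   using arg_conv_arctan[of "polar v j"] R tau_pos by (simp add: polar_def)
  hence "\<bar>Arg (polar v j)\<bar><=\<bar>(v j - c)/(- depth v j)\<bar>" by (simp only: abs_arctan_le)
  also have "...<=de/tau" unfolding abs_divide using L1[OF j] R tau_pos de by (intro frac_le) auto
  finally have A: "\<bar>Arg (polar v j)\<bar><=de/tau" .
  have "\<bar>Arg (polar v j)\<bar>/pi<=\<bar>Arg (polar v j)\<bar>" using pi_ge_two by (simp add: divide_le_eq mult_le_cancel_left1)
  thus ?thesis using A j by (simp add: angle_def abs_divide)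
 qed
 assume l: "l < r"
 have t1: "threshold (Suc l) < 1" "0 < threshold (Suc l)" using threshold_bounds(1,2)[of "Suc l"] l tau_pos by auto
 have "threshold (Suc l) < height v i" if "i < l" for i
  using L3[of i] threshold_bounds(3)[of "Suc i" "Suc l"] that l de tau_pos by auto
 hence "threshold (Suc l) < Min (insert 1 (height v ` {..<Suc l})) \<longleftrightarrow> threshold (Suc l) < height v l"
  using t1 by (auto simp: less_Suc_eq)
 also have "... \<longleftrightarrow> 0 < slope (a + l)*(v (a + l) - boundary (a + l))"
 proof (cases "l = 0")
  case True
  thus ?thesis using slope_first[of "v a"] h0 da by simp
 next
  case False
  have "threshold (Suc l) < clamp01 x \<longleftrightarrow> threshold (Suc l) < x" for x using t1 by (auto simp: clamp01_def)
  thus ?thesis using False l by (simp add: height_def slope_def boundary_def field_simps)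
 qed
 finally show "threshold (Suc l) < Min (insert 1 (height v ` {..<Suc l})) \<longleftrightarrow> 0 < slope (a + l)*(v (a + l) - boundary (a + l))" .
qed

end

lemma prod_ge_1_minus_sum:
 assumes "!!j::nat. j < m ==> 0<=u j & u j<=(1::real)"
 shows "1 - (\<Sum>j<m. u j)<=(\<Prod>j<m. 1 - u j)"
 using assms
proof (induction m)
 case (Suc m)
 have "0<=(\<Prod>j<m. 1 - u j)" "(\<Prod>j<m. 1 - u j)<=1" using Suc.prems by (auto intro!: prod_nonneg prod_le_1)
 hence "(\<Prod>j<m. 1 - u j) - u m<=(\<Prod>j<m. 1 - u j)*(1 - u m)"
  using mult_right_mono[of "\<Prod>j<m. 1 - u j" 1 "u m"] Suc.prems[of m] by (simp add: algebra_simps)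
 thus ?case using Suc by force
qed simp

lemma overlap_ge:
 assumes "weights t" "weights t'" "t p~=0"
 shows "min (t p) (t' p)<=overlap t t'"
 unfolding overlap_def
 by (rule member_le_sum[of p _ "%p. min (t p) (t' p)"]) (use assms weightsD in auto)

lemma Min_insert_lipschitz:
 assumes S: "finite S" and s: "!!l. l\<in>S ==> \<bar>s l - s' l\<bar><=et" and et: "0<=(et::real)"
 shows "\<bar>Min (insert k (s ` S)) - Min (insert k (s' ` S))\<bar><=et" "\<bar>Max (insert k (s ` S)) - Max (insert k (s' ` S))\<bar><=et"
proof -
 let ?A = "%s. insert k (s ` S)"
 have "Min (?A s) - et<=Min (?A s') & Max (?A s) - et<=Max (?A s')"
  if s: "!!l. l\<in>S ==> \<bar>s l - s' l\<bar><=et" for s s'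
 proof
  have *: "Min (?A s) - et<=y" if hy: "y\<in>?A s'" for y
  proof (cases "y = k")
   case True
   have "Min (?A s)<=k" by (rule Min_le) (use S in auto)
   thus ?thesis using True et by linarith
  next
   case False
   then obtain l where l: "l\<in>S" "y = s' l" using hy by blast
   have "Min (?A s)<=s l" by (rule Min_le) (use S l in auto)
   thus ?thesis using s[OF l(1)] l(2) by linarith
  qed
  show "Min (?A s) - et<=Min (?A s')" by (rule Min.boundedI) (use S*in auto)
  have "y<=Max (?A s') + et" if hy: "y\<in>insert k (s ` S)" for y
  proof (cases "y = k")
   case True
   have "k<=Max (?A s')" by (rule Max_ge) (use S in auto)
   thus ?thesis using True et by linarith
  next
   case False
   then obtain l where l: "l\<in>S" "y = s l" using hy by blast
   have "s' l<=Max (?A s')" by (rule Max_ge) (use S l in auto)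
   thus ?thesis using s[OF l(1)] l(2) by linarith
  qed
  hence "Max (?A s)<=Max (?A s') + et" by (intro Max.boundedI) (use S in auto)
  thus "Max (?A s) - et<=Max (?A s')" by linarith
 qed
 note half = this
 have "Min (?A s) - et<=Min (?A s') & Max (?A s) - et<=Max (?A s')"
  by (rule half) (rule s)
 moreover have "Min (?A s') - et<=Min (?A s) & Max (?A s') - et<=Max (?A s)"
  by (rule half) (use s in \<open>simp add: abs_minus_commute\<close>)
 ultimately show "\<bar>Min (?A s) - Min (?A s')\<bar><=et" "\<bar>Max (?A s) - Max (?A s')\<bar><=et"
  unfolding abs_le_iff by (elim conjE, intro conjI, linarith, linarith)+
qed

text \<open>There are at most 2^r weights, and each is built from a minimum and a maximum, so it
  drops by at most \<open>2*et\<close>.\<close>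

lemma cube_overlap:
 assumes s: "!!l. l < r ==> 0<=s l & s l<=1" and s': "!!l. l < r ==> 0<=s' l & s' l<=1"
  and close: "!!l. l < r ==> \<bar>s l - s' l\<bar><=et" and et: "0<=et"
 shows "1 - 2^Suc r*et<=overlap (cube r s) (cube r s')"
proof -
 have pts: "cube r s\<in>ST_points (2*r)" by (rule cube_points) (erule s)
 note W = weightsD[OF weights_ST[OF pts]]
 have diff: "cube r s U - 2*et<=cube r s' U" if "cube r s U~=0" for U
 proof -
  obtain S where S: "S\<subseteq>{..<r}" "U = cspace r S" using cube_nonzeroD[OF \<open>cube r s U~=0\<close>] by blast
  have f: "finite S" "finite ({..<r} - S)" using finite_subset[OF S(1)] by auto
  have *: "max 0 (x - y) - 2*et<=max 0 (x' - y')" if "\<bar>x - x'\<bar><=et" "\<bar>y - y'\<bar><=et" for x y x' y'::real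
   using that by (simp add: max_def abs_le_iff)
  show ?thesis unfolding S(2) cube_apply[OF S(1)] cube_weight_def
   by (rule *; rule Min_insert_lipschitz[OF _ _ et]) (use f close S(1) in auto)
 qed
 have "{U. cube r s U~=0}\<subseteq>cspace r ` Pow {..<r}" using cube_nonzeroD by blast
 hence "card {U. cube r s U~=0}<=card (cspace r ` Pow {..<r})" by (intro card_mono) auto
 also have "...<=card (Pow {..<r})" by (rule card_image_le) simp
 finally have "real (card {U. cube r s U~=0})<=real (2^r)" unfolding of_nat_le_iff by (simp add: card_Pow)
 hence card: "real (card {U. cube r s U~=0})<=2^r" by simp
 have "1 - 2^Suc r*et<=1 - real (card {U. cube r s U~=0})*(2*et)"
  using mult_right_mono[OF card, of "2*et"] et by simp
 also have "... = (\<Sum>U | cube r s U~=0. cube r s U - 2*et)" using W(3) by (simp add: sum_subtractf)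
 also have "...<=overlap (cube r s) (cube r s')"
  unfolding overlap_def by (rule sum_mono) (use diff et in auto)
 finally show ?thesis .
qed

lemma rot_close:
 assumes v: "v\<in>Rn (2*r)" "dot (2*r) v v = 1" and tt: "!!i. i < r ==> \<bar>tt i - tt' i\<bar><=e" and e: "0<=e"
 shows "\<bar>rot r tt v j - rot r tt' v j\<bar><=4*e"
proof (cases "j < 2*r")
 case True
 let ?i = "j div 2" and ?z = "plane_part v (j div 2)"
 have i: "?i < r" "2*?i < 2*r" "2*?i + 1 < 2*r" using True by presburger+
 have "\<bar>v l\<bar><=1" if "l < 2*r" for l by (rule coord_le_dot[of "2*r"]) (use v that in auto)
 from this[OF i(2)] this[OF i(3)] have z: "cmod ?z<=2"
  using cmod_le[of ?z] unfolding plane_part_def complex.sel by linarith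
 have "\<bar>cos a - cos b\<bar><=\<bar>a - b\<bar> & \<bar>sin a - sin b\<bar><=\<bar>a - b\<bar>" for a b::real
 proof
  have "\<bar>sin ((b - a)/2)\<bar><=\<bar>b - a\<bar>/2" "\<bar>sin ((a - b)/2)\<bar><=\<bar>a - b\<bar>/2"
   using abs_sin_x_le_abs_x[of "(b - a)/2"] abs_sin_x_le_abs_x[of "(a - b)/2"] by simp_all
  moreover have "\<bar>sin ((a + b)/2)\<bar><=1" "\<bar>cos ((a + b)/2)\<bar><=1" by simp_all
  ultimately have "\<bar>sin ((a + b)/2)\<bar>*\<bar>sin ((b - a)/2)\<bar><=1*(\<bar>b - a\<bar>/2)" "\<bar>sin ((a - b)/2)\<bar>*\<bar>cos ((a + b)/2)\<bar><=\<bar>a - b\<bar>/2*1"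
   by (intro mult_mono; simp)+
  thus "\<bar>cos a - cos b\<bar><=\<bar>a - b\<bar>" "\<bar>sin a - sin b\<bar><=\<bar>a - b\<bar>"
   unfolding cos_diff_cos sin_diff_sin abs_mult by (simp_all add: abs_minus_commute)
 qed
 hence "\<bar>cos (tt ?i) - cos (tt' ?i)\<bar><=e" "\<bar>sin (tt ?i) - sin (tt' ?i)\<bar><=e" using tt[OF i(1)] order_trans by blast+
 hence c: "cmod (cis (tt ?i) - cis (tt' ?i))<=2*e" using cmod_le[of "cis (tt ?i) - cis (tt' ?i)"] by simp
 have "\<bar>rot r tt v j - rot r tt' v j\<bar><=cmod ((cis (tt ?i) - cis (tt' ?i))*?z)"
  using abs_Re_le_cmod[of "(cis (tt ?i) - cis (tt' ?i))*?z"] abs_Im_le_cmod[of "(cis (tt ?i) - cis (tt' ?i))*?z"] v(1) True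
  by (auto simp: rot_def algebra_simps simp del: topspace_Euclidean_space)
 also have "...<=2*e*2" unfolding norm_mult using c z e by (intro mult_mono) auto
 finally show ?thesis by simp
qed (use v e in \<open>simp add: rot_def\<close>)

section \<open>Nearby points of the locus have near lifts\<close>

context torus_map
begin

lemma locus_near:
 "\<exists>de0>0. \<forall>de. 0 < de & de<=de0 --> 2^a*de<=tau &
  (\<forall>v v'. locus de v --> locus de v' --> (\<forall>l. \<bar>v l - v' l\<bar><=de) --> near (lift_pt N v) (lift_pt N v'))"
proof -
 let ?B = "1 + (\<Sum>j<a. \<bar>be j\<bar>)"
 have B: "0 < ?B" by (simp add: add_pos_nonneg sum_nonneg)
 \<comment> \<open>In order: the loss of overlap of the cubes; weight at least 3/4 on the central
   corner 0; the suspended coordinates; the rotations, whose angles err by at most 2 de/tau times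
   the dual angles and enter \<open>rot_close\<close> with the factor 4.\<close>
 define de0 where "de0 = Min {tau/2^(a + r + 1), tau/(4*real a + 4), ka, ka * tau/(8*?B)}"
 have "0 < de0" using tau_pos ka_pos B by (simp add: de0_def)
 moreover have "2^a*de<=tau & (\<forall>v v'. locus de v --> locus de v' --> (\<forall>l. \<bar>v l - v' l\<bar><=de) --> near (lift_pt N v) (lift_pt N v'))"
  if de: "0 < de" "de<=de0" for de
 proof -
  have d: "de<=tau/2^(a + r + 1)" "de<=tau/(4*real a + 4)" "de<=ka" "de<=ka * tau/(8*?B)"
   using de(2) by (auto simp: de0_def)
  have d1: "2^Suc r*(2^a*de)<=tau" 
  proof -
   have "2^Suc r*(2^a*de) = 2^(a + r + 1)*de" unfolding power_add by simp
   also have "...<=tau" using d(1) by (simp only: pos_le_divide_eq zero_less_power zero_less_numeral mult.commute)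
   finally show ?thesis .
  qed
  have d2: "2^a*de<=tau"
  proof -
   have "1*(2^a*de)<=2^Suc r*(2^a*de)" using de(1) by (intro mult_right_mono one_le_power) auto
   thus ?thesis using d1 by linarith
  qed
  have d3: "real a*(de/tau)<=1/4" using d(2) tau_pos de(1) by (simp add: field_simps)
  have "near (lift_pt N v) (lift_pt N v')" if v: "locus de v" and v': "locus de v'" and c: "!!l. \<bar>v l - v' l\<bar><=de" for v v'
  proof -
   have w: "weights (torus_pt (angle v))" for v by (rule weights_EG, rule torus_pt_points) (rule angle_bound)
   have centre: "3/4<=torus_pt (angle v) (vertex (\<lambda>j\<in>{..<a}. 0))" if v: "locus de v" for v
   proof -
    let ?k = "\<lambda>j\<in>{..<a}. 0::int"
    have "(\<Sum>j<a. \<bar>angle v j\<bar>)<=(\<Sum>j<a. de/tau)" by (rule sum_mono) (use locusD(4)[OF v de(1) d2] in auto)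
    also have "... = real a*(de/tau)" by (simp only: sum_constant card_lessThan)
    finally have "(\<Sum>j<a. \<bar>angle v j\<bar>)<=1/4" using d3 by (rule order_trans)
    hence "3/4<=1 - (\<Sum>j<a. \<bar>angle v j\<bar>)" by linarith
    also have "...<=(\<Prod>j<a. 1 - \<bar>angle v j\<bar>)" by (rule prod_ge_1_minus_sum) (simp add: angle_bound)
    also have "... = cell_weight (angle v) ?k"
     unfolding cell_weight_def by (rule prod.cong) (use angle_bound in \<open>auto simp: hat_def\<close>)
    finally have "3/4<=cell_weight (angle v) ?k" .
    thus ?thesis using torus_pt_vertex[of ?k "angle v"] by (simp add: cells_def)
   qed
   have 1: "1/2 < overlap (torus_pt (angle v)) (torus_pt (angle v'))"
    using overlap_ge[OF w w, of v "vertex (\<lambda>j\<in>{..<a}. 0)" v'] centre[OF v] centre[OF v'] by linarith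
   have "1 - 2^Suc r*(2^a*de)<=overlap (cube r (height v)) (cube r (height v'))"
    by (rule cube_overlap) (use height_bounds height_lipschitz c de(1) in auto)
   hence 2: "1 - tau<=overlap (cube r (height v)) (cube r (height v'))" using d1 by linarith
   have 3: "\<bar>tail N v j - tail N v' j\<bar><=ka" for j using c[of "2*n + j"] d(3) de(1) by (auto simp: tail_def)
   have th: "\<bar>- theta (angle v) i - - theta (angle v') i\<bar><=ka/4" for i
   proof -
    have "\<bar>- theta (angle v) i - - theta (angle v') i\<bar> = \<bar>\<Sum>j<a. if plane j = i then (angle v j - angle v' j)*be j else 0\<bar>"
     unfolding theta_def by (subst abs_minus_commute) (auto simp: sum_subtractf[symmetric] algebra_simps intro!: arg_cong[of _ _ abs] sum.cong)
    also have "...<=(\<Sum>j<a. (2*de/tau)*\<bar>be j\<bar>)"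
    proof (rule order_trans[OF sum_abs sum_mono])
     fix j assume j: "j\<in>{..<a}"
     have "\<bar>angle v j - angle v' j\<bar><=2*de/tau"
      using locusD(4)[OF v de(1) d2, of j] locusD(4)[OF v' de(1) d2, of j] j by simp
     hence "\<bar>(angle v j - angle v' j)*be j\<bar><=2*de/tau*\<bar>be j\<bar>" unfolding abs_mult by (intro mult_right_mono) auto
     thus "\<bar>if plane j = i then (angle v j - angle v' j)*be j else 0\<bar><=(2*de/tau)*\<bar>be j\<bar>"
      using de(1) tau_pos by auto
    qed
    also have "...<=2*de/tau*?B"
     unfolding sum_distrib_left[symmetric] using de(1) tau_pos by (intro mult_left_mono) auto
    also have "...<=ka/4" using d(4) B tau_pos by (simp add: field_simps)
    finally show ?thesis .
   qed
   have 4: "\<bar>rot r (%i. - theta (angle v) i) u j - rot r (%i. - theta (angle v') i) u j\<bar><=ka"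
    if "u\<in>Rn dd" "dot dd u u = 1" for u j
    using rot_close[OF that, of "%i. - theta (angle v) i" "%i. - theta (angle v') i" "ka/4" j] th ka_pos by simp
   show ?thesis unfolding near_def lift_pt_def canonical_pt_def using 1 2 3 4 by simp
  qed
  thus ?thesis using d2 by blast
 qed
 ultimately show ?thesis by blast
qed

end

context box
begin

lemma sweeps_cong_fixed:
 assumes "!!x. x\<in>set xs ==> \<forall>l<k. snd x l = u l"
  and "!!ys. (!!x. x\<in>set ys ==> \<forall>l<k. snd x l = u l) ==> c ys = c' ys" "k<=m"
 shows "sweeps m n c xs = sweeps m n c' xs"
 using assms(1,3)
proof (induction n arbitrary: m xs)
 case 0
 thus ?case using assms(2) by simp
next
 case (Suc n)
 have "prism (put m t) (put m (t + 1)) (sweeps (Suc m) n c) xs = prism (put m t) (put m (t + 1)) (sweeps (Suc m) n c') xs" for t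
 proof (rule prism_cong)
  fix ys assume ys: "set ys\<subseteq>put m t ` set xs\<union>put m (t + 1) ` set xs"
  have "\<forall>l<k. snd y l = u l" if "y\<in>set ys" for y
   using subsetD[OF ys that] Suc.prems by auto
  thus "sweeps (Suc m) n c ys = sweeps (Suc m) n c' ys" using Suc.IH[of ys "Suc m"] Suc.prems(2) by simp
 qed
 thus ?case by (simp add: sweep_def)
qed

end

lemma rot_stdf_turn: "l < 2*r ==> rot r tt (stdf l) = turn tt {} stdf l"
proof
 fix j assume l: "l < 2*r"
 show "rot r tt (stdf l) j = turn tt {} stdf l j"
 proof (cases "j < 2*r")
  case True
  have "rot r tt (stdf l) j = (if even j then Re else Im) (cis (tt (j div 2))*plane_part (stdf l) (j div 2))"
   using stdf_Rn[OF l] True by (simp add: rot_def del: topspace_Euclidean_space)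
  moreover have "j = 2*(l div 2) \<longleftrightarrow> j div 2 = l div 2" if "even j" using that by presburger
  moreover have "j = Suc (2*(l div 2)) \<longleftrightarrow> j div 2 = l div 2" if "odd j" using that by presburger
  moreover have "Suc (2*(l div 2))~=j" if "even j" using that by presburger
  moreover have "j~=2*(l div 2)" if "odd j" using that by presburger
  moreover have "l = 2*(l div 2)" if "even l" using that by presburger
  moreover have "l = Suc (2*(l div 2))" if "odd l" using that by presburger
  ultimately show ?thesis
   by (cases "even l"; cases "even j") (auto simp: plane_part_stdf turn_def turn_cos_def turn_sin_def stdf_def)
 next
  case False
  hence "j~=2*(l div 2)" "j~=2*(l div 2) + 1" using l by presburger+
  thus ?thesis using stdf_Rn[OF l] False by (simp add: rot_def turn_def stdf_def del: topspace_Euclidean_space)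
 qed
qed

section \<open>The pulled back cochain and its evaluation\<close>

context torus_map
begin

text \<open>A direction function takes the values -1 and 1 on the two sides of its wall, whence the
  factor 2 for i < a.\<close>

definition separator :: "nat => vec => real"
 where "separator i v = (if i < a then 2 * of_bool (0 < slope i*(v i - boundary i)) - 1 else of_bool (0 < slope i*(v i - boundary i)))"

text \<open>Inside the locus the tuple has the evident lift adapted to the standard frame, and every
  factor can be computed. If an entry leaves the locus, both sides vanish, by
  \<open>lift_nonzero_locus\<close> and \<open>separating_locus\<close>.\<close>

lemma orbit_cochain_sphere:
 "\<exists>de0>0. \<forall>de vs. 0 < de & de<=de0 & 2*n + dd < length vs & (\<forall>v\<in>set vs. \<forall>j<a. v j~=c) &
   (\<forall>v\<in>set vs. \<forall>v'\<in>set vs. \<forall>l. \<bar>v l - v' l\<bar><=de) -->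
  orbit_cochain (map sphere_value vs)
   = cups (map separator [0..<a + r]) (%us. thom (map (%v. bundle_pt stdf (lift_pt N v)) us)) vs"
proof -
 obtain de0 where de0: "0 < de0" and near: "!!de. 0 < de ==> de<=de0 ==> 2^a*de<=tau &
  (\<forall>v v'. locus de v --> locus de v' --> (\<forall>l. \<bar>v l - v' l\<bar><=de) --> near (lift_pt N v) (lift_pt N v'))"
  using locus_near by blast
 have "orbit_cochain (map sphere_value vs)
   = cups (map separator [0..<a + r]) (%us. thom (map (%v. bundle_pt stdf (lift_pt N v)) us)) vs" (is "_ = cups ?G ?T vs")
  if de: "0 < de" "de<=de0" and len: "2*n + dd < length vs" and vc: "!!v j. v\<in>set vs ==> j < a ==> v j~=c"
   and close: "!!v v' l. v\<in>set vs ==> v'\<in>set vs ==> \<bar>v l - v' l\<bar><=de" for de vs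
 proof (cases "\<forall>v\<in>set vs. locus de v")
  case True
  have d: "2^a*de<=tau" using near[OF de] by blast
  let ?ps = "map (lift_pt N) vs"
  let ?cs = "map (%g v. g (lift_pt N v)) (coords stdf)"
  have ne: "vs~=[]" using len by auto
  have tau1: "8 * tau<=1" using r_pos by (simp add: tau_def)
  have w: "0 < cube_weight r (height v) {..<i}" if v: "v\<in>set vs" and i: "i<=r" for v i
  proof -
   have h: "\<bar>height v l - threshold (Suc l)\<bar><=tau" if "l < r" for l
   proof -
    have "\<bar>height v l - threshold (Suc l)\<bar><=2^a*de" using bspec[OF True v] that unfolding locus_def by blast
    thus ?thesis using d by (rule order_trans)
   qed
   have "threshold i - 2 * tau < Min (insert 1 (height v ` {..<i}))"
   proof -
    have "threshold i - 2 * tau < 1" using tau_pos by (simp add: threshold_eq) (smt (verit) mult_nonneg_nonneg of_nat_0_le_iff)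
    moreover have "threshold i - 2 * tau < height v l" if l: "l < i" for l
     using h[of l] threshold_bounds(3)[of "Suc l" i] that i tau_pos by (cases "Suc l = i") auto
    ultimately show ?thesis by auto
   qed
   moreover have "Max (insert 0 (height v ` ({..<r} - {..<i}))) < threshold i - 2 * tau"
   proof -
    have "0 < threshold i - 2 * tau" using threshold_bounds(1)[OF i] tau_pos by linarith
    moreover have "height v l < threshold i - 2 * tau" if "l < r" "i<=l" for l
     using h[OF that(1)] threshold_bounds(3)[of i "Suc l"] that tau_pos by auto
    ultimately show ?thesis by (auto simp: not_less)
   qed
   ultimately show ?thesis unfolding cube_weight_def by (simp only: less_max_iff_disj diff_gt_0_iff_gt) linarith
  qed
  have fl: "flag stdf i = cspace r {..<i}" if "i<=r" for i
   using flag_perm_frame[of "%i. i" r i] that by (simp add: perm_frame_id inj_on_def)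
  have lift: "lift (map sphere_value vs) ?ps stdf"
   unfolding lift_def
  proof (intro conjI ballI)
   have "sphere_value v = Some (orbit dd (lift_pt N v))" if v: "v\<in>set vs" for v
   proof -
    have "0 < height v l & height v l < 1" if "l < r" for l
     by (rule locusD(1)[OF bspec[OF True v] de(1) d that])
    hence "\<not> (\<exists>l<r. height v l = 0 | height v l = 1)" by (metis less_irrefl)
    thus ?thesis by (simp only: sphere_value_def if_False)
   qed
   thus "map sphere_value vs = map (%p. Some (orbit dd p)) ?ps" by simp
   show "cluster (set ?ps)"
    unfolding cluster_def using lift_pt_points[OF rN] near[OF de] True close by (auto simp del: topspace_Euclidean_space)
   fix p assume "p\<in>set ?ps"
   then obtain v where v: "v\<in>set vs" "p = lift_pt N v" by auto
   show "adapted stdf p"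
    unfolding adapted_def v(2) lift_pt_def canonical_pt_def snd_conv
    using frame_stdf fl w[OF v(1)] by (simp add: cube_apply less_imp_neq[symmetric])
  qed
  have c1: "orbit_cochain (map sphere_value vs) = cochain stdf ?ps" by (rule orbit_cochain_eq[OF lift]) (use ne in simp)
  also have "... = cups ?cs (%us. thom (map (bundle_pt stdf) (map (lift_pt N) us))) vs"
   unfolding cochain_def by (rule cups_map)
  also have "... = cups ?G (%us. thom (map (bundle_pt stdf) (map (lift_pt N) us))) vs"
  proof (rule cups_cong_funs)
   show "length ?cs = length ?G" by simp
   fix i v assume i: "i < length ?cs" and v: "v\<in>set vs"
   have i': "i < a + r" using i by simp
   show "(?cs ! i) v = (?G ! i) v"
   proof (cases "i < a")
    case ia: True
    have e: "torus_pt (angle v)\<in>EG_points dd" by (rule torus_pt_points) (rule angle_bound)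
    have "theta (%j. 2 * of_int 0) = (%_. 0)" by (auto simp: theta_def fun_eq_iff intro!: sum.neutral)
    hence "fst (lift_pt N v) = EG_act (OG dd) (rot r (theta (%j. 2 * of_int 0))) (torus_pt (angle v))"
     using EG_act_one[OF e] by (simp add: rot_one lift_pt_def canonical_pt_def)
    hence "dir_fun (perm_frame (%i. i)) i (lift_pt N v) = of_int (2*0 + nearest_odd (angle v) i)"
     by (subst dir_fun_canonical[of "%i. i" i _ "%_. 0" v "height v"]) (auto simp: ia lift_pt_def canonical_pt_def)
    also have "nearest_odd (angle v) i = (if c < v i then 1 else -1)"
     using angle_sign(1,2)[OF ia, of v] vc[OF v ia] by (cases "v i < c") (simp_all add: nearest_odd_def)
    finally show ?thesis using ia i' by (simp add: coords_def nth_append perm_frame_id separator_def slope_def boundary_def del: upt_Suc)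
   next
    case False
    define l where "l = i - a"
    have l: "l < r" "i = a + l" using False i' by (auto simp: l_def)
    have "level_fun stdf (Suc l) (lift_pt N v) = of_bool (threshold (Suc l) < Min (insert 1 (height v ` {..<Suc l})))"
     using cube_mass[of r "height v" "{..<Suc l}"] height_bounds l(1) fl[of "Suc l"]
     by (simp add: level_fun_def lift_pt_def canonical_pt_def subset_eq del: Min_insert lessThan_Suc)
    also have "... = of_bool (0 < slope (a + l)*(v (a + l) - boundary (a + l)))"
     using locusD(5)[OF bspec[OF True v] de(1) d l(1)] by simp
    finally show ?thesis using l by (simp add: coords_def nth_append separator_def del: upt_Suc)
   qed
  qed
  finally show ?thesis by (simp add: comp_def)
 next
  case nl: False
  have "orbit_cochain (map sphere_value vs) = 0"
  proof (rule ccontr)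
   assume nz: "orbit_cochain (map sphere_value vs)~=0"
   then obtain z where z: "lift (map sphere_value vs) (fst z) (snd z)" by (auto simp: orbit_cochain_def split: if_splits)
   have "length (fst z) = length vs" using arg_cong[where f = length, OF z[unfolded lift_def, THEN conjunct1]] by simp
   hence "cochain (snd z) (fst z)~=0" using orbit_cochain_eq[OF z] nz len by fastforce
   hence "locus de v" if "v\<in>set vs" for v
    using lift_nonzero_locus[where de = de, OF z] len close de(1) near[OF de] that by simp
   thus False using nl by blast
  qed
  moreover have "cups ?G ?T vs = 0"
  proof (rule ccontr)
   assume nz: "cups ?G ?T vs~=0"
   have "locus de v" if v: "v\<in>set vs" for v
   proof (rule separating_locus)
    fix i assume i: "i < a + r"
    hence "separator i\<in>set ?G" by simp
    then obtain x y where "x\<in>set vs" "y\<in>set vs" "separator i x~=separator i y" using cups_nonzeroD(1)[OF nz] by blast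
    moreover have "separator i x = separator i y" if "(0 < slope i*(x i - boundary i)) = (0 < slope i*(y i - boundary i))"
     by (simp only: separator_def that)
    ultimately obtain x y where xy: "x\<in>set vs" "y\<in>set vs" "0 < slope i*(x i - boundary i)" "\<not> 0 < slope i*(y i - boundary i)"
     by blast
    hence "x i < boundary i & boundary i<=y i | boundary i < x i & y i<=boundary i"
     using slope_nonzero[of i] by (auto simp: zero_less_mult_iff not_less)
    thus "\<bar>v i - boundary i\<bar><=de" using close[OF v xy(1), of i] close[OF v xy(2), of i] by (auto simp: abs_le_iff)
   qed (use de near[OF de] in auto)
   thus False using nl by blast
  qed
  ultimately show ?thesis by simp
 qed
 note main = this
 show ?thesis
 proof (intro exI[of _ de0] conjI allI impI de0; elim conjE)
  fix de and vs :: "vec list"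
  assume h: "0 < de" "de<=de0" "2*n + dd < length vs" "\<forall>v\<in>set vs. \<forall>j<a. v j~=c"
   "\<forall>v\<in>set vs. \<forall>v'\<in>set vs. \<forall>l. \<bar>v l - v' l\<bar><=de"
  show "orbit_cochain (map sphere_value vs) = cups (map separator [0..<a + r]) (%us. thom (map (%v. bundle_pt stdf (lift_pt N v)) us)) vs"
   by (rule main[OF h(1,2,3)]) (use h(4,5) in auto)
 qed
qed

text \<open>The first 2 n + 2 r factors are steps in single coordinates and yield signs and powers
  of 2; the remaining directions yield \<open>thom_const\<close>. All walls lie in [-2, 2], so they
  are interior to the cube once R is at least 3.\<close>

theorem evaluation_sphere_map:
 assumes R: "3<=R"
 shows "\<exists>M0. \<forall>M\<ge>M0. evaluation R M (stabilize (reduced_spherical_K_spectrum dd) (2*n) dd sphere_map (N - dd))~=0"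
proof -
 let ?q = "2*n + N" and ?F = "stabilize (reduced_spherical_K_spectrum dd) (2*n) dd sphere_map (N - dd)"
 let ?T = "%us. thom (map (%v. bundle_pt stdf (lift_pt N v)) us)"
 obtain de0 where de0: "0 < de0" and eq: "!!de vs. 0 < de ==> de<=de0 ==> 2*n + dd < length vs ==> (\<forall>v\<in>set vs. \<forall>j<a. v j~=c) ==>
   (\<forall>v\<in>set vs. \<forall>v'\<in>set vs. \<forall>l. \<bar>v l - v' l\<bar><=de) ==>
   orbit_cochain (map sphere_value vs) = cups (map separator [0..<a + r]) ?T vs"
  using orbit_cochain_sphere by blast
 obtain M0::nat where M0: "1/de0 < real M0" using reals_Archimedean2 by blast
 have "evaluation R M ?F~=0" if M: "M0<=M" for M
 proof -
  have M1: "1/de0 < real M" using M0 M by linarith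
  hence Mp: "0 < real M" using de0 by (meson divide_pos_pos less_trans zero_less_one)
  hence Mn: "0 < M" by simp
  have d: "0 < 1/real M" "1/real M<=de0" using M1 Mp de0 by (auto simp: field_simps)
  interpret B: box "grid_lo R M ?q" "grid_hi R M ?q" by (rule box_grid) (use R Mn in auto)
  let ?V = "grid_point M ?q" and ?x0 = "((), %_. 0)::grid"
  let ?b = "%i. boundary i*real M"
  let ?G = "map (%i x. separator i (?V x)) [0..<a + r]"
  let ?H = "%ys. ?T (map ?V ys)"
  have q: "?q = length ?G + (N - dd)" using rN by simp
  have Vl: "?V x l = of_int (snd x l)/real M" if "l < ?q" for x l using that by (simp add: grid_point_def)
  have "evaluation R M ?F = B.sweeps 0 ?q (%ys. orbit_cochain (map (%x. sphere_value (?V x)) ys)) [?x0]"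
   unfolding evaluation_def by (simp only: stabilize_sphere_value)
  also have "... = B.sweeps 0 ?q (cups ?G ?H) [?x0]"
  proof (rule B.sweeps_cong[where P = UNIV])
   show "B.adm UNIV 0 [?x0]" by (simp add: B.adm_def)
   fix ys :: "grid list" assume ys: "B.adm UNIV (0 + ?q) ys" "length ys = length [?x0] + ?q"
   have "orbit_cochain (map sphere_value (map ?V ys)) = cups (map separator [0..<a + r]) ?T (map ?V ys)"
   proof (rule eq[OF d])
    show "2*n + dd < length (map ?V ys)" using ys(2) rN by simp
    have "of_int k/real M~=c" for k using c(3) by (metis Rats_divide Rats_of_int Rats_of_nat)
    thus "\<forall>v\<in>set (map ?V ys). \<forall>j<a. v j~=c" using rN by (auto simp: Vl)
    have "\<bar>?V x l - ?V y l\<bar><=1/real M" if xy: "x\<in>set ys" "y\<in>set ys" for x y l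
    proof (cases "l < ?q")
     case True
     then obtain t where "snd x l = t | snd x l = t + 1" "snd y l = t | snd y l = t + 1"
      using ys(1) xy unfolding B.adm_def by (metis add_0)
     hence "\<bar>real_of_int (snd x l) - real_of_int (snd y l)\<bar><=1" by auto
     thus ?thesis using True Mp by (simp add: Vl diff_divide_distrib[symmetric] divide_right_mono)
    qed (simp add: grid_point_def)
    thus "\<forall>v\<in>set (map ?V ys). \<forall>v'\<in>set (map ?V ys). \<forall>l. \<bar>v l - v' l\<bar><=1/real M" by auto
   qed
   also have "... = cups ?G ?H ys" by (subst cups_map) (simp add: comp_def)
   finally show "orbit_cochain (map (%x. sphere_value (?V x)) ys) = cups ?G ?H ys" by (simp add: comp_def)
  qed
  also have "...~=0"
  proof -
   \<comment> \<open>The last integer before the step. For negative slope the strict inequality puts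
     it at the ceiling minus 1, which matters as a wall with i \<ge> a may pass through grid
     points.\<close>
   let ?tt = "%i. if 0 < slope i then \<lfloor>?b i\<rfloor> else \<lceil>?b i\<rceil> - 1"
   let ?s = "%i. (if i < a then 2 else 1)*(if 0 < slope i then 1 else -1::real)"
   have pos: "0 < slope i*(?V x i - boundary i) \<longleftrightarrow> (if 0 < slope i then ?tt i < snd x i else \<not> ?tt i < snd x i)" if "i < a + r" for x i
   proof -
    have V: "?V x i = of_int (snd x i)/real M" using that rN by (simp add: Vl)
    show ?thesis
    proof (cases "0 < slope i")
     case True
     hence "0 < slope i*(?V x i - boundary i) \<longleftrightarrow> ?b i < of_int (snd x i)"
      using Mp by (simp add: V zero_less_mult_iff pos_less_divide_eq)
     thus ?thesis using True by (simp add: floor_less_iff)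
    next
     case False
     hence "slope i < 0" using slope_nonzero[of i] by linarith
     hence "0 < slope i*(?V x i - boundary i) \<longleftrightarrow> of_int (snd x i) < ?b i"
      using Mp by (simp add: V zero_less_mult_iff pos_divide_less_eq)
     also have "... \<longleftrightarrow> snd x i < \<lceil>?b i\<rceil>" by (rule less_ceiling_iff[symmetric])
     finally show ?thesis using False by auto
    qed
   qed
   have bd: "\<bar>boundary i\<bar><=2" if "i < a + r" for i
   proof -
    have th: "0<=threshold l & threshold l<=1" if "1<=l" "l<=r" for l
     using threshold_bounds(1,2)[of l] that tau_pos by auto
    have "\<bar>2 * threshold 1/(- 2)^a\<bar><=1"
    proof -
     have "(2::real)^1<=2^a" using r_pos by (intro power_increasing) auto
     thus ?thesis using th[of 1] r_pos by (simp add: abs_divide power_abs abs_mult divide_le_eq)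
    qed
    hence "\<bar>2 * threshold 1/(- 2)^a - 1\<bar><=2" by linarith
    moreover have "0<=threshold (Suc (i - a)) & threshold (Suc (i - a))<=1" if "\<not> i < a"
     by (rule th) (use that \<open>i < a + r\<close> in auto)
    ultimately show ?thesis using c by (auto simp: boundary_def abs_le_iff)
   qed
   have "B.sweeps 0 (length ?G + (N - dd)) (cups ?G ?H) [?x0]
    = B.aligned_sign (length ?G) (N - dd)*(\<Prod>i<length ?G. ?s i) *
     B.sweeps (0 + length ?G) (N - dd) ?H
      [(fst ?x0, %l. if 0<=l & l < 0 + length ?G then ?tt l + 1 else snd ?x0 l)]"
   proof (rule B.sweeps_cups_aligned)
    fix i::nat and x y :: "grid" assume "i < length ?G"
    hence i: "i < a + r" by simp
    have "(?G ! i) x - (?G ! i) y = separator i (?V x) - separator i (?V y)" using i by simp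
    also have "... = ?s i*(of_bool (?tt i < snd x i) - of_bool (?tt i < snd y i))"
     unfolding separator_def pos[OF i] by (cases "0 < slope i") auto
    finally show "(?G ! i) x - (?G ! i) y = ?s i*(of_bool (?tt (0 + i) < snd x (0 + i)) - of_bool (?tt (0 + i) < snd y (0 + i)))" by simp
   next
    fix i assume "i < length ?G"
    hence i: "i < a + r" "i < ?q" using rN by auto
    have "\<bar>?b i\<bar><=2*real M" using bd[OF i(1)] Mp by (simp add: abs_mult)
    moreover have "3*real M<=real (R*M)" "1<=real M" using R Mn by (simp_all add: mult_right_mono)
    ultimately have "- real (R*M)<=?b i - 1" "?b i < real (R*M)" by linarith+
    hence "of_int (- int (R*M))<=?b i" "of_int (- int (R*M)) < ?b i"
      "?b i < of_int (int (R*M))" by auto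
    hence "- int (R*M)<=\<lfloor>?b i\<rfloor>" "\<lfloor>?b i\<rfloor> < int (R*M)"
      "- int (R*M) < \<lceil>?b i\<rceil>" "\<lceil>?b i\<rceil><=int (R*M)"
     unfolding le_floor_iff floor_less_iff less_ceiling_iff ceiling_le_iff by simp_all
    hence "- int (R*M)<=?tt i" "?tt i < int (R*M)" by auto
    thus "grid_lo R M ?q (0 + i)<=?tt (0 + i) & ?tt (0 + i) < grid_hi R M ?q (0 + i)"
     by (simp only: grid_lo_def grid_hi_def add_0 i(2) if_True)
   qed
   moreover have "B.sweeps (0 + length ?G) (N - dd) ?H
     [(fst ?x0, %l. if 0<=l & l < 0 + length ?G then ?tt l + 1 else snd ?x0 l)] = thom_const" (is "B.sweeps ?k ?m _ [?x1] = _")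
   proof -
    \<comment> \<open>The angles depend only on coordinates up to \<open>a\<close>, which are frozen
      by now, so all entries carry the same rotated frame.\<close>
    define aa where "aa = (%i. - theta (angle (?V ?x1)) i)"
    have "B.sweeps ?k ?m ?H [?x1]
      = B.sweeps ?k ?m (%vs. thom (map (%x. (turn aa {} stdf, tail N (?V x))) vs)) [?x1]"
    proof (rule B.sweeps_cong_fixed[where k = "a + r" and u = "snd ?x1"])
     fix ys :: "grid list" assume ys: "!!x. x\<in>set ys ==> \<forall>l<a + r. snd x l = snd ?x1 l"
     have an: "angle (?V x) = angle (?V ?x1)" if "x\<in>set ys" for x
     proof -
      have V: "?V x l = ?V ?x1 l" if "l<=a" for l
       using ys[OF \<open>x\<in>set ys\<close>, THEN spec, of l] that r_pos unfolding grid_point_def by simp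
      have "depth (?V x) j = depth (?V ?x1) j" if "j<=a" for j by (rule depth_cong[OF V that])
      thus ?thesis using V by (auto simp: angle_def polar_def fun_eq_iff)
     qed
     have "?T (map ?V ys) = thom (map (%x. bundle_pt stdf (lift_pt N (?V x))) ys)" by (simp add: comp_def)
     also have "... = thom (map (%x. (turn aa {} stdf, tail N (?V x))) ys)"
     proof (rule thom_map_cong)
      fix x assume x: "x\<in>set ys"
      show "snd (bundle_pt stdf (lift_pt N (?V x))) = snd (turn aa {} stdf, tail N (?V x))"
       by (simp add: bundle_pt_def lift_pt_def canonical_pt_def)
      fix l assume "l < dd"
      thus "fst (bundle_pt stdf (lift_pt N (?V x))) l = fst (turn aa {} stdf, tail N (?V x)) l"
       unfolding bundle_pt_def lift_pt_def canonical_pt_def fst_conv snd_conv an[OF x] aa_def by (rule rot_stdf_turn)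
     qed
     finally show "?T (map ?V ys) = thom (map (%x. (turn aa {} stdf, tail N (?V x))) ys)" .
    qed simp_all
    also have "... = (-1)^card ({}::nat set) * thom_const"
    proof (rule sweeps_thom)
     show "box (grid_lo R M ?q) (grid_hi R M ?q)" by (rule box_grid) (use R Mn in auto)
     fix i x assume i: "i < N - dd"
     have "tail N (?V x) (dd + i) = of_int (snd x (?k + i))/real M" for x :: "grid"
      using i Vl[of "2*n + (dd + i)" x] by (simp add: tail_def mult_2 add.assoc add.left_commute)
     thus "0 < tail N (?V x) (dd + i) \<longleftrightarrow> 0 < snd x (?k + i)" for x :: "grid"
      using Mp by (simp add: zero_less_divide_iff)
     show "grid_lo R M ?q (?k + i)<=0 & 0 < grid_hi R M ?q (?k + i)"
      using R Mn by (auto simp: grid_lo_def grid_hi_def)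
    qed (simp_all add: tail_def)
    finally show ?thesis by simp
   qed
   ultimately have "B.sweeps 0 (length ?G + (N - dd)) (cups ?G ?H) [?x0]
     = B.aligned_sign (length ?G) (N - dd)*(\<Prod>i<length ?G. ?s i) * thom_const" by (simp only:)
   moreover have "(\<Prod>i<length ?G. ?s i)~=0" by (simp add: prod_zero_iff)
   ultimately show ?thesis
    unfolding q[symmetric] by (simp only: mult_eq_0_iff B.aligned_sign_nonzero thom_const_nonzero not_False_eq_True simp_thms)
  qed
  finally show ?thesis .
 qed
 thus ?thesis by blast
qed

end

section \<open>Choice of constants and conclusion\<close>

lemma stabilize_None: "stabilize (reduced_spherical_K_spectrum d) m 0 (%_. None) i = (%_. None)"
 by (induction i) (auto simp: suspend_def fun_eq_iff reduced_spherical_K_spectrum_def homotopy_orbits_def split: option.splits)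

text \<open>Both summands of the bracket \<open>x\<close> in \<open>fine\<close> are at most 1/(4 (N
  + 1)), so N x^2 is at most N/(4 (N + 1)^2), which is below 1/4.\<close>

lemma ex_thom_data:
 assumes "2*r<=N"
 shows "\<exists>L ka. thom_data r N L ka"
proof -
 let ?n = "real N + 1" and ?L = "8*(r + 1)*(N + 1)"
 define x where "x = 2*(1/(8*?n*(1 + 2*real r)))*(1 + 2*real r) + 2*real r/real ?L"
 have "2*(1/(8*?n*(1 + 2*real r)))*(1 + 2*real r) = 1/(4*?n)" by (simp add: divide_simps) (simp add: algebra_simps)
 moreover have "2*real r/real ?L = (real r/(real r + 1))*(1/(4*?n))" 
  using mult_divide_mult_cancel_left[of 2 "real r" "(real r + 1)*(4*?n)"] by (simp add: algebra_simps)
 moreover have "(real r/(real r + 1))*(1/(4*?n))<=1*(1/(4*?n))" by (intro mult_right_mono) auto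
 ultimately have "x<=1/(4*?n) + 1*(1/(4*?n))" unfolding x_def by linarith
 hence "x<=1/(2*?n)" by (simp add: field_simps)
 moreover have "0<=x" by (simp add: x_def)
 ultimately have "x\<^sup>2<=(1/(2*?n))\<^sup>2" by (rule power_mono)
 hence "real N*x\<^sup>2<=real N*(1/(2*?n))\<^sup>2" by (rule mult_left_mono) simp
 also have "... < 1/4"
  by (simp add: power_divide power_mult_distrib divide_simps) (simp add: power2_eq_square algebra_simps add_pos_nonneg)
 finally have "thom_data r N ?L (1/(8*?n*(1 + 2*real r)))"
  using assms unfolding x_def by unfold_locales (simp_all add: mult.assoc)
 thus ?thesis by blast
qed

theorem mainTheorem4:
  fixes n k :: nat
  shows "\<exists>x \<in> carrier (reduced_spherical_K (2 * k + 2) (2 * n)).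
           x \<noteq> \<one>\<^bsub>reduced_spherical_K (2 * k + 2) (2 * n)\<^esub>"
proof -
 define r where "r = k + 1"
 let ?X = "reduced_spherical_K_spectrum (2*r)"
 have d: "2 * k + 2 = 2*r" by (simp add: r_def)
 obtain be La where La: "!!j. angle_functional (La j::real => real)"
  and dual: "!!i j. i < 2*n + r ==> j < 2*n + r ==> La i (be j) = of_bool (i = j)"
  using ex_dual_angles[of "2*n + r"] by blast
 have "\<not> {0<..<1}\<subseteq>(\<rat>::real set)"
  using countable_subset[OF _ countable_rat] uncountable_open_interval[of 0 "1::real"] by auto
 then obtain c where "c\<in>{0<..<1}" and c3: "c\<notin>(\<rat>::real set)" by blast
 hence c: "0 < c" "c < 1" "c\<notin>\<rat>" by auto
 define s where "s = torus_map.sphere_map r n be c"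
 have loc: "\<exists>L ka. torus_map r N L ka n La be c" if N: "2*r<=N" for N
 proof -
  obtain L ka where "thom_data r N L ka" using ex_thom_data[OF N] by blast
  hence "torus_map r N L ka n La be c"
   using La dual c by (simp add: torus_map_def torus_map_axioms_def torus_class_def torus_class_axioms_def
     flag_cochain_def flag_cochain_axioms_def r_def)
  thus ?thesis by blast
 qed
 have s: "(2*r, s)\<in>stable_maps ?X (2*n)"
 proof -
  obtain L ka where "torus_map r (2*r) L ka n La be c" using loc[of "2*r"] by auto
  then interpret T: torus_map r "2*r" L ka n La be c .
  show ?thesis using T.continuous_sphere_map
   by (simp add: stable_maps_def level_reduced_spherical_K_spectrum s_def T.sphere_map_def)
 qed
 have refl: "((2*r, s), (2*r, s))\<in>stable_homotopic ?X (2*n)"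
  using s by (auto simp: stable_homotopic_def stable_maps_def intro!: exI[of _ 0])
 have ne: "((0, %_. None), (2*r, s))\<notin>stable_homotopic ?X (2*n)"
 proof
  assume "((0, %_. None), (2*r, s))\<in>stable_homotopic ?X (2*n)"
  then obtain i j where ij: "i = 2*r + j"
   and h: "homotopic_with (%h. h None = None) (sphere_space (2*n + i)) (K_level (2*r) i)
    (%_. None) (stabilize ?X (2*n) (2*r) s j)"
   by (auto simp: stable_homotopic_def level_reduced_spherical_K_spectrum stabilize_None)
  \<comment> \<open>The Thom data are chosen only now, for the level \<open>i\<close> at which the
    homotopy lives; this is possible because \<open>s\<close> does not depend on them.\<close>
  obtain L ka where "torus_map r i L ka n La be c" using loc[of i] ij by auto
  then interpret T: torus_map r i L ka n La be c .
  obtain R0 where R0: "!!R. R0<=R ==> \<exists>M0. \<forall>M\<ge>M0. T.evaluation R M (%_. None)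
    = T.evaluation R M (stabilize ?X (2*n) (2*r) s j)"
   using T.evaluation_homotopic[OF h] by blast
  define R where "R = max R0 3"
  obtain M0 where M0: "!!M. M0<=M ==> T.evaluation R M (%_. None) = T.evaluation R M (stabilize ?X (2*n) (2*r) s j)"
   using R0[of R] by (auto simp: R_def)
  obtain M1 where M1: "!!M. M1<=M ==> T.evaluation R M (stabilize ?X (2*n) (2*r) s j)~=0"
   using T.evaluation_sphere_map[of R] ij by (auto simp: R_def s_def)
  define M where "M = Suc (M0 + M1)"
  have "T.evaluation R M (%_. None) = 0" by (rule T.evaluation_const) (simp_all add: R_def M_def)
  thus False using M0[of M] M1[of M] by (simp add: M_def)
 qed
 show ?thesis
 proof (rule bexI)
  show "stable_homotopic ?X (2*n) `` {(2*r, s)}\<in>carrier (reduced_spherical_K (2 * k + 2) (2*n))"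
   unfolding d reduced_spherical_K_def stable_homotopy_group_def using s by (simp add: quotientI)
  show "stable_homotopic ?X (2*n) `` {(2*r, s)}~=\<one>\<^bsub>reduced_spherical_K (2 * k + 2) (2*n)\<^esub>"
   unfolding d reduced_spherical_K_def stable_homotopy_group_def using refl ne by auto
 qed
qed

end
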